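(* Let $l\ge 2$ be an integer and let $q,y_1,\dots,y_l$ be formal variables. Then, as formal power series in $y_1,\dots,y_l$ whose coefficients are formal series in $q$, $$\prod_{m>0}\ \left(\prod_{1\le i\le j\le l}\frac{1}{1-q^m y_iy_{i+1}\cdots y_j}\right)\left(\prod_{1\le i<j\le l}\frac{1}{1-q^m\, y_i\cdots y_{j-1}\,y_j^2y_{j+1}^2\cdots y_l^2}\right)$$ $$=\sum_{(r_1,\dots,r_l)\in\mathcal P^l}\ \frac{q^{E(r_1,\dots,r_l)}}{\prod_{i=1}^{l}\prod_{t\ge1}(q)_{r_i^{(t)}-r_i^{(t+1)}}}\ \prod_{i=1}^l y_i^{|r_i|},$$ where $$E(r_1,\dots,r_l)=\sum_{i=1}^{l}\sum_{t\ge1}\bigl(r_i^{(t)}\bigr)^2-\sum_{i=2}^{l-1}\sum_{t\ge1}r_{i-1}^{(t)}r_i^{(t)}-\sum_{t\ge1}r_{l-1}^{(t)}\bigl(r_l^{(2t-1)}+r_l^{(2t)}\bigr).$$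
   Context: $\mathcal P$ is the set of all partitions, i.e. weakly decreasing sequences $r=(r^{(1)}\ge r^{(2)}\ge\cdots)$ of nonnegative integers with only finitely many nonzero terms; $|r|=\sum_{t\ge1}r^{(t)}$. For $(r_1,\dots,r_l)\in\mathcal P^l$ the parts of $r_i$ are denoted $r_i^{(t)}$. For an integer $n\ge0$, $(q)_n=(1-q)(1-q^2)\cdots(1-q^n)$, with $(q)_0=1$; $1/(q)_n$ is expanded as a power series in $q$, and each factor $1/(1-q^m y^{\beta})$ is expanded as a geometric series. *)

theory Defs
  imports
    "HOL-Analysis.Analysis"
    "HOL-Computational_Algebra.Formal_Power_Series"
    "HOL-Library.Poly_Mapping"
begin

section \<open>Formal power series in several variables\<close>

text \<open>
  A series in variables indexed by \<open>'v\<close> with coefficients in \<open>'a\<close> assigns a coefficient to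
  each monomial, that is, to each finitely supported exponent vector. The type \<open>'v\<close> may be
  infinite, since every monomial still has only finitely many divisors.
\<close>

typedef ('v, 'a) mfps = "UNIV :: (('v \<Rightarrow>\<^sub>0 nat) \<Rightarrow> 'a) set"
  morphisms mcoeff Abs_mfps by simp

lemma mcoeff_Abs_mfps [simp]: "mcoeff (Abs_mfps f) = f"
  by (simp add: Abs_mfps_inverse)

lemma mfps_eqI: "(\<And>n. mcoeff f n = mcoeff g n) \<Longrightarrow> f = g"
  by (metis ext mcoeff_inject)

definition splits :: "('v \<Rightarrow>\<^sub>0 nat) \<Rightarrow> (('v \<Rightarrow>\<^sub>0 nat) \<times> ('v \<Rightarrow>\<^sub>0 nat)) set" where
  "splits n = {(a, b). a + b = n}"

lemma finite_splits [simp]: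
  fixes n :: "'v \<Rightarrow>\<^sub>0 nat"
  shows "finite (splits n)"
proof -
  have outside: "Poly_Mapping.lookup a k = 0"
    if "a + b = n" "k \<notin> Poly_Mapping.keys n" for a b :: "'v \<Rightarrow>\<^sub>0 nat" and k
    using that by (metis add_is_0 in_keys_iff lookup_add)
  let ?L = "\<lambda>a :: 'v \<Rightarrow>\<^sub>0 nat. restrict (Poly_Mapping.lookup a) (Poly_Mapping.keys n)"
  have inj: "inj_on (\<lambda>(a, b). ?L a) (splits n)"
  proof (rule inj_onI)
    fix p p'
    assume p: "p \<in> splits n" "p' \<in> splits n"
      and eq: "(case p of (a, b) \<Rightarrow> ?L a) = (case p' of (a, b) \<Rightarrow> ?L a)"
    have sum: "fst p + snd p = n" "fst p' + snd p' = n"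
      using p by (auto simp: splits_def)
    have eq: "?L (fst p) = ?L (fst p')"
      using eq by (simp add: case_prod_unfold)
    have "Poly_Mapping.lookup (fst p) k = Poly_Mapping.lookup (fst p') k" for k
      using outside[OF sum(1), of k] outside[OF sum(2), of k] fun_cong[OF eq, of k]
      by (cases "k \<in> Poly_Mapping.keys n") auto
    then have "fst p = fst p'" by (simp add: poly_mapping_eqI)
    then show "p = p'" using sum by (metis add_left_cancel prod.collapse)
  qed
  have sub: "(\<lambda>(a, b). ?L a) ` splits n \<subseteq> (\<Pi>\<^sub>E k\<in>Poly_Mapping.keys n. {..Poly_Mapping.lookup n k})"
    by (auto simp: splits_def lookup_add)
  have "finite (\<Pi>\<^sub>E k\<in>Poly_Mapping.keys n. {..Poly_Mapping.lookup n k})"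
    by (intro finite_PiE) auto
  then show ?thesis
    by (rule inj_on_finite[OF inj sub])
qed

instantiation mfps :: (type, comm_ring_1) comm_ring_1
begin

definition "0 = Abs_mfps (\<lambda>_. 0)"
definition "1 = Abs_mfps (\<lambda>n. if n = 0 then 1 else 0)"
definition "f + g = Abs_mfps (\<lambda>n. mcoeff f n + mcoeff g n)"
definition "f - g = Abs_mfps (\<lambda>n. mcoeff f n - mcoeff g n)"
definition "- f = Abs_mfps (\<lambda>n. - mcoeff f n)"
definition "f * g = Abs_mfps (\<lambda>n. \<Sum>(a, b)\<in>splits n. mcoeff f a * mcoeff g b)"

lemmas mfps_ring_defs =
  zero_mfps_def one_mfps_def plus_mfps_def minus_mfps_def uminus_mfps_def times_mfps_def

instance
proof
  fix f g h :: "('a, 'b) mfps"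
  show "f * g * h = f * (g * h)"
  proof (rule mfps_eqI)
    fix n
    have "mcoeff (f * g * h) n =
        (\<Sum>(u, c)\<in>splits n. \<Sum>(a, b)\<in>splits u. mcoeff f a * mcoeff g b * mcoeff h c)"
      by (simp add: times_mfps_def sum_distrib_right case_prod_unfold)
    also have "\<dots> = (\<Sum>((u, c), (a, b))\<in>Sigma (splits n) (\<lambda>(u, c). splits u).
        mcoeff f a * mcoeff g b * mcoeff h c)"
      by (subst sum.Sigma[symmetric]) (auto simp: case_prod_unfold)
    also have "\<dots> = (\<Sum>((a, v), (b, c))\<in>Sigma (splits n) (\<lambda>(a, v). splits v).
        mcoeff f a * mcoeff g b * mcoeff h c)"
      by (rule sum.reindex_bij_witness
          [where i = "\<lambda>((a, v), (b, c)). ((a + b, c), (a, b))"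
             and j = "\<lambda>((u, c), (a, b)). ((a, b + c), (b, c))"])
        (auto simp: splits_def add.assoc)
    also have "\<dots> = (\<Sum>(a, v)\<in>splits n. \<Sum>(b, c)\<in>splits v. mcoeff f a * mcoeff g b * mcoeff h c)"
      by (subst sum.Sigma[symmetric]) (auto simp: case_prod_unfold)
    also have "\<dots> = mcoeff (f * (g * h)) n"
      by (simp add: times_mfps_def sum_distrib_left case_prod_unfold mult.assoc)
    finally show "mcoeff (f * g * h) n = mcoeff (f * (g * h)) n" .
  qed
  show "f * g = g * f"
  proof (rule mfps_eqI)
    fix n
    show "mcoeff (f * g) n = mcoeff (g * f) n"
      unfolding times_mfps_def mcoeff_Abs_mfps
      by (rule sum.reindex_bij_witness[where i = prod.swap and j = prod.swap])
        (auto simp: splits_def add.commute mult.commute)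
  qed
  show "1 * f = f"
  proof (rule mfps_eqI)
    fix n
    have "mcoeff (1 * f) n = (\<Sum>(a, b)\<in>{(0 :: 'a \<Rightarrow>\<^sub>0 nat, n)}. (if a = 0 then 1 else 0) * mcoeff f b)"
      unfolding times_mfps_def one_mfps_def mcoeff_Abs_mfps
      by (rule sum.mono_neutral_right, rule finite_splits)
        (auto simp: splits_def split: if_splits)
    then show "mcoeff (1 * f) n = mcoeff f n" by simp
  qed
  show "(f + g) * h = f * h + g * h"
    by (rule mfps_eqI)
      (simp add: times_mfps_def plus_mfps_def sum.distrib case_prod_unfold distrib_right)
  show "(0 :: ('a, 'b) mfps) \<noteq> 1"
  proof
    assume "(0 :: ('a, 'b) mfps) = 1"
    then have "mcoeff (0 :: ('a, 'b) mfps) 0 = mcoeff 1 0" by simp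
    then show False by (simp add: zero_mfps_def one_mfps_def)
  qed
qed (rule mfps_eqI, simp add: mfps_ring_defs algebra_simps)+

end

lemma mcoeff_0 [simp]: "mcoeff 0 n = 0"
  and mcoeff_1: "mcoeff 1 n = (if n = 0 then 1 else 0)"
  and mcoeff_add [simp]: "mcoeff (f + g) n = mcoeff f n + mcoeff g n"
  and mcoeff_diff [simp]: "mcoeff (f - g) n = mcoeff f n - mcoeff g n"
  and mcoeff_uminus [simp]: "mcoeff (- f) n = - mcoeff f n"
  and mcoeff_mult: "mcoeff (f * g) n = (\<Sum>(a, b)\<in>splits n. mcoeff f a * mcoeff g b)"
  by (simp_all add: mfps_ring_defs)

lemma mcoeff_sum [simp]: "mcoeff (sum f A) n = (\<Sum>x\<in>A. mcoeff (f x) n)"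
  by (induction A rule: infinite_finite_induct) auto

definition mconst :: "'a \<Rightarrow> ('v, 'a::zero) mfps" where
  "mconst c = Abs_mfps (\<lambda>n. if n = 0 then c else 0)"

definition mvar :: "'v \<Rightarrow> ('v, 'a::zero_neq_one) mfps" where
  "mvar v = Abs_mfps (\<lambda>n. if n = Poly_Mapping.single v 1 then 1 else 0)"


subsection \<open>Coefficientwise convergence\<close>

text \<open>
  The product topology on the coefficient functions. When the coefficients are themselves
  univariate series of type \<open>'b fps\<close>, they carry the adic metric of that type, so that
  convergence means that for every monomial in all variables involved the coefficient is
  eventually constant.
\<close>

instantiation mfps :: (type, topological_space) topological_space
begin

definition open_mfps_def: "open U \<longleftrightarrow> open (mcoeff ` U)" for U :: "('a, 'b) mfps set"

instance
proof
  have bij: "bij (mcoeff :: ('a, 'b) mfps \<Rightarrow> _)"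
    by (metis bijI' mcoeff_Abs_mfps mcoeff_inject)
  have inj: "inj (mcoeff :: ('a, 'b) mfps \<Rightarrow> _)"
    using bij by (rule bij_is_inj)
  show "open (UNIV :: ('a, 'b) mfps set)"
    using bij by (simp add: open_mfps_def bij_is_surj)
  show "open (S \<inter> T)" if "open S" "open T" for S T :: "('a, 'b) mfps set"
    using that by (simp add: open_mfps_def image_Int[OF inj] open_Int)
  show "open (\<Union> K)" if "\<forall>S\<in>K. open S" for K :: "('a, 'b) mfps set set"
    using that by (auto simp: open_mfps_def image_Union)
qed

end

lemma open_vimage_mcoeff: "open U \<Longrightarrow> open (mcoeff -` U)"
proof -
  have "surj (mcoeff :: ('a, 'b::topological_space) mfps \<Rightarrow> _)"
    by (metis mcoeff_Abs_mfps surjI)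
  then show "open U \<Longrightarrow> open (mcoeff -` U :: ('a, 'b) mfps set)"
    by (simp add: open_mfps_def surj_image_vimage_eq)
qed

instance mfps :: (type, t2_space) t2_space
proof
  fix f g :: "('a, 'b) mfps"
  assume "f \<noteq> g"
  then obtain n where "mcoeff f n \<noteq> mcoeff g n"
    by (metis mfps_eqI)
  then obtain U V where UV: "open U" "open V" "mcoeff f n \<in> U" "mcoeff g n \<in> V" "U \<inter> V = {}"
    by (meson hausdorff)
  have *: "open ((\<lambda>h. h n) -` W :: (_ \<Rightarrow> 'b) set)" if "open W" for W
    using that by (intro open_vimage continuous_on_product_coordinates)
  show "\<exists>U V. open U \<and> open V \<and> f \<in> U \<and> g \<in> V \<and> U \<inter> V = {}"
    using UV
    by (intro exI[of _ "mcoeff -` ((\<lambda>h. h n) -` U)"] exI[of _ "mcoeff -` ((\<lambda>h. h n) -` V)"])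
      (auto intro!: open_vimage_mcoeff *)
qed

lemma tendsto_mfps_iff:
  fixes F :: "'c \<Rightarrow> ('a, 'b::topological_space) mfps"
  shows "(F \<longlongrightarrow> L) A \<longleftrightarrow> (\<forall>n. ((\<lambda>x. mcoeff (F x) n) \<longlongrightarrow> mcoeff L n) A)"
proof -
  have inj: "inj (mcoeff :: ('a, 'b) mfps \<Rightarrow> _)" and surj: "surj (mcoeff :: ('a, 'b) mfps \<Rightarrow> _)"
    by (metis injI mcoeff_inject, metis mcoeff_Abs_mfps surjI)
  have "(F \<longlongrightarrow> L) A \<longleftrightarrow> ((\<lambda>x. mcoeff (F x)) \<longlongrightarrow> mcoeff L) A"
  proof
    assume L: "(F \<longlongrightarrow> L) A"
    show "((\<lambda>x. mcoeff (F x)) \<longlongrightarrow> mcoeff L) A"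
    proof (rule topological_tendstoI)
      fix S assume "open S" "mcoeff L \<in> S"
      then show "\<forall>\<^sub>F x in A. mcoeff (F x) \<in> S"
        using topological_tendstoD[OF L open_vimage_mcoeff[of S]] by simp
    qed
  next
    assume L: "((\<lambda>x. mcoeff (F x)) \<longlongrightarrow> mcoeff L) A"
    show "(F \<longlongrightarrow> L) A"
    proof (rule topological_tendstoI)
      fix S assume "open S" "L \<in> S"
      then show "\<forall>\<^sub>F x in A. F x \<in> S"
        using topological_tendstoD[OF L, of "mcoeff ` S"]
        by (simp add: open_mfps_def inj_image_mem_iff[OF inj])
    qed
  qed
  also have "\<dots> \<longleftrightarrow> (\<forall>n. ((\<lambda>x. mcoeff (F x) n) \<longlongrightarrow> mcoeff L n) A)"
    using limitin_componentwise[of "\<lambda>_. euclidean" UNIV "\<lambda>x. mcoeff (F x)" "mcoeff L" A]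
    by (simp add: euclidean_product_topology limitin_canonical_iff)
  finally show ?thesis .
qed


subsection \<open>Geometric series\<close>

definition geom :: "('v, 'a::{comm_ring_1, t2_space}) mfps \<Rightarrow> ('v, 'a) mfps" where
  "geom x = suminf (\<lambda>k. x ^ k)"

definition mdegree :: "('v \<Rightarrow>\<^sub>0 nat) \<Rightarrow> nat" where
  "mdegree n = (\<Sum>v\<in>Poly_Mapping.keys n. Poly_Mapping.lookup n v)"

lemma mdegree_add: "mdegree (a + b) = mdegree a + mdegree b"
proof -
  define K where "K = Poly_Mapping.keys a \<union> Poly_Mapping.keys b \<union> Poly_Mapping.keys (a + b)"
  have "mdegree n = (\<Sum>v\<in>K. Poly_Mapping.lookup n v)" if "Poly_Mapping.keys n \<subseteq> K" for n
    unfolding mdegree_def using that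
    by (intro sum.mono_neutral_left) (auto simp: K_def in_keys_iff)
  then show ?thesis
    by (simp add: lookup_add sum.distrib K_def le_supI1 subset_iff)
qed

lemma mdegree_eq_0_iff: "mdegree n = 0 \<longleftrightarrow> n = 0"
proof -
  have "mdegree n = 0 \<longleftrightarrow> Poly_Mapping.keys n = {}"
    by (auto simp: mdegree_def in_keys_iff simp del: keys_eq_empty)
  then show ?thesis by simp
qed

lemma mcoeff_power_eq_0:
  fixes x :: "('v, 'a::comm_ring_1) mfps"
  assumes "mcoeff x 0 = 0" and "mdegree n < k"
  shows "mcoeff (x ^ k) n = 0"
  using assms(2)
proof (induction k arbitrary: n)
  case (Suc k)
  have "mcoeff x a * mcoeff (x ^ k) b = 0" if "a + b = n" for a b :: "'v \<Rightarrow>\<^sub>0 nat"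
  proof (cases "a = 0")
    case False
    then have "mdegree b < k"
      using Suc.prems that mdegree_add[of a b] mdegree_eq_0_iff[of a] by auto
    then show ?thesis using Suc.IH by simp
  qed (simp add: assms(1))
  then show ?case
    by (auto simp: mcoeff_mult splits_def intro!: sum.neutral)
qed simp

text \<open>
  For a series without constant term, the geometric series converges and is the reciprocal
  of \<open>1 - x\<close>.
\<close>

lemma geom:
  fixes x :: "('v, 'a::{comm_ring_1, t2_space}) mfps"
  assumes "mcoeff x 0 = 0"
  shows geom_sums: "(\<lambda>k. x ^ k) sums geom x"
    and geom_inverse: "(1 - x) * geom x = 1"
proof -
  define L where "L = Abs_mfps (\<lambda>n. \<Sum>k\<le>mdegree n. mcoeff (x ^ k) n)"
  have trunc: "(\<Sum>k<N. mcoeff (x ^ k) n) = mcoeff L n" if "mdegree n < N" for n N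
    unfolding L_def mcoeff_Abs_mfps using that
    by (intro sum.mono_neutral_right) (auto intro: mcoeff_power_eq_0[OF assms])
  have "(\<lambda>k. x ^ k) sums L"
    unfolding sums_def tendsto_mfps_iff mcoeff_sum
  proof
    fix n
    have "\<forall>\<^sub>F N in sequentially. (\<Sum>k<N. mcoeff (x ^ k) n) = mcoeff L n"
      using eventually_gt_at_top[of "mdegree n"] by eventually_elim (rule trunc)
    then show "(\<lambda>N. \<Sum>k<N. mcoeff (x ^ k) n) \<longlonglongrightarrow> mcoeff L n"
      by (rule tendsto_eventually)
  qed
  then have L: "geom x = L" "(\<lambda>k. x ^ k) sums geom x"
    by (simp_all add: geom_def sums_iff)
  then show "(\<lambda>k. x ^ k) sums geom x" by simp
  show "(1 - x) * geom x = 1"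
  proof (rule mfps_eqI)
    fix n :: "'v \<Rightarrow>\<^sub>0 nat"
    define N where "N = Suc (mdegree n)"
    have "mcoeff L b = mcoeff (\<Sum>k<N. x ^ k) b" if "a + b = n" for a b :: "'v \<Rightarrow>\<^sub>0 nat"
      using that mdegree_add[of a b] unfolding N_def mcoeff_sum by (intro trunc[symmetric]) simp
    then have "mcoeff ((1 - x) * geom x) n = mcoeff ((1 - x) * (\<Sum>k<N. x ^ k)) n"
      unfolding mcoeff_mult L(1) by (intro sum.cong) (auto simp: splits_def)
    also have "(1 - x) * (\<Sum>k<N. x ^ k) = 1 - x ^ N"
      by (simp add: one_diff_power_eq)
    also have "mcoeff \<dots> n = mcoeff 1 n"
      using mcoeff_power_eq_0[OF assms, of n N] by (simp add: N_def)
    finally show "mcoeff ((1 - x) * geom x) n = mcoeff 1 n" .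
  qed
qed


section \<open>Partitions and the two sides of the identity\<close>

text \<open>
  Parts are indexed from 0: the value at \<open>t\<close> is the \<open>(t + 1)\<close>-st part. Thus the parts with
  one-based indices \<open>2 t - 1\<close> and \<open>2 t\<close>, for \<open>t \<ge> 1\<close>, become those at \<open>2 * t\<close> and
  \<open>2 * t + 1\<close>, for \<open>t \<ge> 0\<close>.
\<close>

definition partitions :: "(nat \<Rightarrow> nat) set" where
  "partitions = {r. decseq r \<and> finite {t. r t \<noteq> 0}}"

definition psize :: "(nat \<Rightarrow> nat) \<Rightarrow> nat" where
  "psize r = Sum_any r"

definition qpoch :: "nat \<Rightarrow> rat fps" where
  "qpoch n = (\<Prod>k=1..n. 1 - fps_X ^ k)"

definition qexponent :: "nat \<Rightarrow> (nat \<Rightarrow> nat \<Rightarrow> nat) \<Rightarrow> int" where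
  "qexponent l R =
     (\<Sum>i=1..l. Sum_any (\<lambda>t. (int (R i t))\<^sup>2))
     - (\<Sum>i=2..l-1. Sum_any (\<lambda>t. int (R (i - 1) t) * int (R i t)))
     - Sum_any (\<lambda>t. int (R (l - 1) t) * (int (R l (2 * t)) + int (R l (2 * t + 1))))"

definition sum_side_term :: "nat \<Rightarrow> (nat \<Rightarrow> nat \<Rightarrow> nat) \<Rightarrow> (nat, rat fps) mfps" where
  "sum_side_term l R =
     mconst (fps_X ^ nat (qexponent l R) /
             (\<Prod>i=1..l. Prod_any (\<lambda>t. qpoch (R i t - R i (Suc t)))))
     * (\<Prod>i=1..l. mvar i ^ psize (R i))"

definition product_side_factor :: "nat \<Rightarrow> nat \<Rightarrow> (nat, rat fps) mfps" where
  "product_side_factor l m =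
     (\<Prod>i=1..l. \<Prod>j=i..l. geom (mconst (fps_X ^ m) * (\<Prod>k=i..j. mvar k)))
     * (\<Prod>i=1..l. \<Prod>j=i+1..l.
          geom (mconst (fps_X ^ m) * (\<Prod>k=i..j-1. mvar k) * (\<Prod>k=j..l. (mvar k)\<^sup>2)))"

text \<open>The exponent of \<open>q\<close> is nonnegative, so its conversion to a natural number is exact.\<close>

lemma chain_quadratic_form_nonneg:
  fixes x :: "nat \<Rightarrow> int"
  assumes "p \<ge> 1"
  shows "2 * (\<Sum>i=1..p. (x i)\<^sup>2) - 2 * (\<Sum>i=2..p. x (i - 1) * x i) \<ge> (x p)\<^sup>2"
  using assms
proof (induction p rule: nat_induct_at_least)
  case (Suc p)
  have "2 * (\<Sum>i=1..Suc p. (x i)\<^sup>2) - 2 * (\<Sum>i=2..Suc p. x (i - 1) * x i)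
      = (2 * (\<Sum>i=1..p. (x i)\<^sup>2) - 2 * (\<Sum>i=2..p. x (i - 1) * x i))
        + 2 * (x (Suc p))\<^sup>2 - 2 * x p * x (Suc p)"
    using Suc.hyps by (simp add: sum.cl_ivl_Suc algebra_simps)
  also have "\<dots> \<ge> (x p)\<^sup>2 + 2 * (x (Suc p))\<^sup>2 - 2 * x p * x (Suc p)"
    using Suc.IH by linarith
  also have "(x p)\<^sup>2 + 2 * (x (Suc p))\<^sup>2 - 2 * x p * x (Suc p)
      = (x p - x (Suc p))\<^sup>2 + (x (Suc p))\<^sup>2"
    by (simp add: power2_eq_square algebra_simps)
  finally show ?case by (smt (verit) zero_le_power2)
qed simp

lemma qexponent_nonneg:
  assumes l: "l \<ge> 2" and R: "\<forall>i\<in>{1..l}. R i \<in> partitions"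
  shows "qexponent l R \<ge> 0"
proof -
  have fin: "finite {t. R i t \<noteq> 0}" if "i \<in> {1..l}" for i
    using R that by (auto simp: partitions_def)
  then have "finite (\<Union>i\<in>{1..l}. {t. R i t \<noteq> 0})"
    by blast
  then obtain N where bound: "\<forall>t\<in>(\<Union>i\<in>{1..l}. {t. R i t \<noteq> 0}). t < N"
    unfolding finite_nat_set_iff_bounded by blast
  have N: "R i t = 0" if "i \<in> {1..l}" "t \<ge> N" for i t
  proof (rule ccontr)
    assume "R i t \<noteq> 0"
    with that(1) have "t \<in> (\<Union>i\<in>{1..l}. {t. R i t \<noteq> 0})" by blast
    with bound have "t < N" by (rule bspec)
    with that(2) show False by simp
  qed
  have any: "Sum_any f = sum f {..<M}" if "\<And>t. t \<ge> M \<Longrightarrow> f t = 0" for f :: "nat \<Rightarrow> int" and M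
    using that by (intro Sum_any.expand_superset) (auto simp: not_le[symmetric])
  have pairs: "(\<Sum>t<2 * M. f t) = (\<Sum>t<M. f (2 * t) + f (2 * t + 1))"
    for f :: "nat \<Rightarrow> int" and M
    by (induction M) simp_all
  let ?x = "\<lambda>i t. int (R i t)"
  define p where "p = l - 1"
  have p: "p \<ge> 1" "l = Suc p" using l by (auto simp: p_def)
  have 1: "Sum_any (\<lambda>t. (?x i t)\<^sup>2) = (\<Sum>t<N. (?x i t)\<^sup>2)" if "i \<in> {1..p}" for i
    using that N p by (intro any) auto
  have 2: "Sum_any (\<lambda>t. (?x l t)\<^sup>2) = (\<Sum>t<N. (?x l (2 * t))\<^sup>2 + (?x l (2 * t + 1))\<^sup>2)"
    using N p by (subst any[of "2 * N"]) (auto simp: pairs)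
  have 3: "Sum_any (\<lambda>t. ?x (i - 1) t * ?x i t) = (\<Sum>t<N. ?x (i - 1) t * ?x i t)"
    if "i \<in> {2..p}" for i
    using that N p by (intro any) auto
  have 4: "Sum_any (\<lambda>t. ?x p t * (?x l (2 * t) + ?x l (2 * t + 1)))
      = (\<Sum>t<N. ?x p t * (?x l (2 * t) + ?x l (2 * t + 1)))"
    using N p by (intro any) auto
  have "qexponent l R = (\<Sum>t<N. (\<Sum>i=1..p. (?x i t)\<^sup>2) - (\<Sum>i=2..p. ?x (i - 1) t * ?x i t)
      + (?x l (2 * t))\<^sup>2 + (?x l (2 * t + 1))\<^sup>2
      - ?x p t * (?x l (2 * t) + ?x l (2 * t + 1)))"
  proof -
    have "(\<Sum>i=1..l. Sum_any (\<lambda>t. (?x i t)\<^sup>2))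
        = (\<Sum>i=1..p. Sum_any (\<lambda>t. (?x i t)\<^sup>2)) + Sum_any (\<lambda>t. (?x l t)\<^sup>2)"
      using p by simp
    also have "(\<Sum>i=1..p. Sum_any (\<lambda>t. (?x i t)\<^sup>2)) = (\<Sum>t<N. \<Sum>i=1..p. (?x i t)\<^sup>2)"
      by (subst sum.swap) (intro sum.cong refl 1)
    finally have A: "(\<Sum>i=1..l. Sum_any (\<lambda>t. (?x i t)\<^sup>2)) = (\<Sum>t<N. \<Sum>i=1..p. (?x i t)\<^sup>2)
        + (\<Sum>t<N. (?x l (2 * t))\<^sup>2 + (?x l (2 * t + 1))\<^sup>2)"
      unfolding 2 .
    have B: "(\<Sum>i=2..l-1. Sum_any (\<lambda>t. ?x (i - 1) t * ?x i t))
        = (\<Sum>t<N. \<Sum>i=2..p. ?x (i - 1) t * ?x i t)"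
      unfolding p_def[symmetric] by (subst sum.swap) (intro sum.cong refl 3)
    show ?thesis
      unfolding qexponent_def A B using 4 p by (simp add: sum.distrib sum_subtractf)
  qed
  also have "\<dots> \<ge> 0"
  proof (rule sum_nonneg)
    have arith: "a - b + c + d - w \<ge> 0"
      if "2 * (a - b) \<ge> e" "0 \<le> 2 * (e + 2 * c + 2 * d - 2 * w)" for a b c d e w :: int
      using that by presburger
    fix t
    define u v where "u = ?x l (2 * t)" and "v = ?x l (2 * t + 1)"
    have "2 * (\<Sum>i=1..p. (?x i t)\<^sup>2) - 2 * (\<Sum>i=2..p. ?x (i - 1) t * ?x i t) \<ge> (?x p t)\<^sup>2"
      using chain_quadratic_form_nonneg[OF p(1), of "\<lambda>i. ?x i t"] by simp
    then have "2 * ((\<Sum>i=1..p. (?x i t)\<^sup>2) - (\<Sum>i=2..p. ?x (i - 1) t * ?x i t)) \<ge> (?x p t)\<^sup>2"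
      by (simp only: right_diff_distrib)
    moreover have "0 \<le> (?x p t - 2 * u)\<^sup>2 + (?x p t - 2 * v)\<^sup>2"
      by simp
    then have "0 \<le> 2 * ((?x p t)\<^sup>2 + 2 * u\<^sup>2 + 2 * v\<^sup>2 - 2 * (?x p t * (u + v)))"
      by (simp add: power2_eq_square algebra_simps)
    ultimately show "(\<Sum>i=1..p. (?x i t)\<^sup>2) - (\<Sum>i=2..p. ?x (i - 1) t * ?x i t)
        + (?x l (2 * t))\<^sup>2 + (?x l (2 * t + 1))\<^sup>2
        - ?x p t * (?x l (2 * t) + ?x l (2 * t + 1)) \<ge> 0"
      unfolding u_def[symmetric] v_def[symmetric] by (rule arith)
  qed
  finally show ?thesis .
qed

end

theory Submission
  imports Defs "HOL-Computational_Algebra.Polynomial" "HOL-Computational_Algebra.Formal_Laurent_Series"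
begin

text \<open>
  The sum over \<open>r\<^sub>1, \<dots>, r\<^sub>l\<close> is computed one partition at a time. Let operators act on functions of
  a partition: \<open>A\<^sub>w\<close> sums over a partition \<open>\<theta>\<close> with weight
  \<open>w\<^bsup>|\<theta>|\<^esup> q\<^bsup>\<Sum>\<theta>(t)(\<theta>(t) - \<mu>(t))\<^esup> / \<Prod>(q)\<^bsub>\<theta>(t) - \<theta>(t+1)\<^esub>\<close>, and \<open>C\<^sub>w\<close> does so for \<open>\<mu> = 0\<close>, evaluating the
  function at the partition with parts \<open>\<theta>(2t) + \<theta>(2t+1)\<close>. The sum side is \<open>C\<close> applied to \<open>l - 1\<close> operators
  \<open>A\<close> applied to the constant function 1.

  One constructs operators \<open>D\<^sub>x\<close> and \<open>U\<^sub>z\<close> as infinite products over \<open>x, q x, q\<^sup>2 x, \<dots>\<close> of operators that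
  remove or add a strip. With the indicator function \<open>\<delta>\<close> of the empty partition and
  \<open>H(z) = \<Prod>\<^bsub>m>0\<^esub> 1/(1 - q\<^sup>m z)\<close> they satisfy
  \<open>1 = D\<^sub>1 \<delta> = A\<^sub>w \<delta> = C\<^sub>w \<delta>\<close>, \<open>U\<^sub>z \<delta> = \<delta>\<close>, and the commutation relations
  \<open>A\<^sub>w D\<^sub>x = H(w x) D\<^bsub>w x\<^esub> A\<^sub>w\<close>, \<open>C\<^sub>w D\<^sub>x = H(w x) C\<^sub>w U\<^bsub>w\<^sup>2 x\<^esub>\<close>, \<open>U\<^sub>z D\<^sub>x = H(z x) D\<^sub>x U\<^sub>z\<close>.
  Moving \<open>D\<close> to the left through all \<open>A\<close> and then removing it by means of \<open>C\<close> and \<open>U\<close> turns the sum into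
  a product of values of \<open>H\<close>, one for each positive root. By uniqueness of solutions of q-difference
  equations, the relations reduce to relations between single strips, which are identities
  between products of 2 by 2 transfer matrices running along the parts.
\<close>

section \<open>Row-finite matrices\<close>

text \<open>The single-strip operators d, u obey \<open>(1 - q w x) A_w d_x = d_(wx) A_w\<close>,
  \<open>(1 - q z x) u_z d_x = (1 - q^2 z x) d_x u_z\<close> and
  \<open>C_w d_x = (1 + q w x) C_w u_(w^2 x)\<close>. In the infinite products the scalars of the
  second relation telescope, so \<open>u_z\<close> crosses \<open>D_x\<close> at the price of
  \<open>1/(1 - q z x)\<close>. The third relation is the delicate one: once the first strip of
  \<open>D_x\<close> has become \<open>u_(w^2 x)\<close>, it has to cross \<open>D_(qx)\<close>,
  which costs \<open>1/(1 - q^2 w^2 x^2)\<close>, and half of this denominator cancels against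
  \<open>1 + q w x\<close>. Hence the factor \<open>H(w x)\<close>, and hence the order of the
  factors in U, opposite to that in D. Two difficulties shape the proof. The entries of A and of the
  strips contain negative powers of q, so the operator identities live over a field such as Laurent
  series, although the final coefficients are power series. And D is needed at the argument 1, whose
  powers are not small; it makes sense there only because D lowers sizes, so that each row of
  \<open>D_1\<close> has finitely many entries.\<close>

typedef (overloaded) ('i, 'a::zero) rfm = "{M :: 'i \<Rightarrow> 'i \<Rightarrow> 'a. \<forall>i. finite {j. M i j \<noteq> 0}}"
  morphisms entry Abs_rfm
  by (rule exI[of _ "\<lambda>_ _. 0"]) simp

lemma finite_row [simp]: "finite {j. entry M i j \<noteq> 0}"
  using entry[of M] by simp

lemma entry_Abs_rfm: "(\<And>i. finite {j. M i j \<noteq> 0}) \<Longrightarrow> entry (Abs_rfm M) = M"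
  by (simp add: Abs_rfm_inverse)

lemma rfm_eqI: "(\<And>i j. entry M i j = entry N i j) \<Longrightarrow> M = N"
  by (metis ext entry_inject)

instantiation rfm :: (type, comm_ring_1) ring_1
begin

definition "0 = Abs_rfm (\<lambda>_ _. 0)"
definition "1 = Abs_rfm (\<lambda>i j. if i = j then 1 else 0)"
definition "M + N = Abs_rfm (\<lambda>i j. entry M i j + entry N i j)"
definition "M - N = Abs_rfm (\<lambda>i j. entry M i j - entry N i j)"
definition "- M = Abs_rfm (\<lambda>i j. - entry M i j)"
definition "M * N = Abs_rfm (\<lambda>i k. \<Sum>j | entry M i j \<noteq> 0. entry M i j * entry N j k)"

lemma entry_0 [simp]: "entry 0 i j = 0"
  by (simp add: zero_rfm_def entry_Abs_rfm)

lemma entry_1: "entry 1 i j = (if i = j then 1 else 0)"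
  by (simp add: one_rfm_def entry_Abs_rfm)

lemma entry_add [simp]: "entry (M + N) i j = entry M i j + entry N i j"
proof -
  have "finite {j. entry M i j + entry N i j \<noteq> 0}" for i
    by (rule finite_subset[of _ "{j. entry M i j \<noteq> 0} \<union> {j. entry N i j \<noteq> 0}"]) auto
  then show ?thesis by (simp add: plus_rfm_def entry_Abs_rfm)
qed

lemma entry_diff [simp]: "entry (M - N) i j = entry M i j - entry N i j"
proof -
  have "finite {j. entry M i j - entry N i j \<noteq> 0}" for i
    by (rule finite_subset[of _ "{j. entry M i j \<noteq> 0} \<union> {j. entry N i j \<noteq> 0}"]) auto
  then show ?thesis by (simp add: minus_rfm_def entry_Abs_rfm)
qed

lemma entry_uminus [simp]: "entry (- M) i j = - entry M i j"
  by (simp add: uminus_rfm_def entry_Abs_rfm)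

text \<open>A coefficient of A has infinite columns but finite rows. Row finiteness alone is stable
  under products and lets a matrix act on arbitrary functions, so no question of convergence
  arises.\<close>

lemma entry_mult: "entry (M * N) i k = (\<Sum>j | entry M i j \<noteq> 0. entry M i j * entry N j k)"
proof -
  have "finite {k. (\<Sum>j | entry M i j \<noteq> 0. entry M i j * entry N j k) \<noteq> 0}" for i
  proof (rule finite_subset)
    show "{k. (\<Sum>j | entry M i j \<noteq> 0. entry M i j * entry N j k) \<noteq> 0}
        \<subseteq> (\<Union>j\<in>{j. entry M i j \<noteq> 0}. {k. entry N j k \<noteq> 0})"
      by (auto elim!: sum.not_neutral_contains_not_neutral)
    show "finite (\<Union>j\<in>{j. entry M i j \<noteq> 0}. {k. entry N j k \<noteq> 0})"
      by (intro finite_UN_I) auto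
  qed
  then show ?thesis by (simp add: times_rfm_def entry_Abs_rfm)
qed

lemma entry_mult_superset:
  assumes "finite S" "\<And>j. entry M i j \<noteq> 0 \<Longrightarrow> j \<in> S"
  shows "entry (M * N) i k = (\<Sum>j\<in>S. entry M i j * entry N j k)"
  unfolding entry_mult using assms by (intro sum.mono_neutral_left) auto

instance
proof
  fix L M N :: "('a, 'b) rfm"
  show "L * M * N = L * (M * N)"
  proof (rule rfm_eqI)
    fix i l
    define S where "S = (\<Union>j\<in>{j. entry L i j \<noteq> 0}. {k. entry M j k \<noteq> 0})"
    have S: "finite S" unfolding S_def by (intro finite_UN_I) auto
    have "k \<in> S" if "entry (L * M) i k \<noteq> 0" for k
      using that unfolding entry_mult S_def
      by (auto elim!: sum.not_neutral_contains_not_neutral)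
    then have "entry (L * M * N) i l = (\<Sum>k\<in>S. entry (L * M) i k * entry N k l)"
      by (intro entry_mult_superset S)
    also have "\<dots> = (\<Sum>j | entry L i j \<noteq> 0. \<Sum>k\<in>S. entry L i j * entry M j k * entry N k l)"
      by (simp add: entry_mult sum_distrib_right) (rule sum.swap)
    also have "\<dots> = (\<Sum>j | entry L i j \<noteq> 0. entry L i j * entry (M * N) j l)"
    proof (rule sum.cong)
      fix j assume "j \<in> {j. entry L i j \<noteq> 0}"
      then have "entry (M * N) j l = (\<Sum>k\<in>S. entry M j k * entry N k l)"
        by (intro entry_mult_superset S) (auto simp: S_def)
      then show "(\<Sum>k\<in>S. entry L i j * entry M j k * entry N k l) = entry L i j * entry (M * N) j l"
        by (simp add: sum_distrib_left mult.assoc)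
    qed simp
    also have "\<dots> = entry (L * (M * N)) i l" by (rule entry_mult[symmetric])
    finally show "entry (L * M * N) i l = entry (L * (M * N)) i l" .
  qed
  show "1 * M = M"
  proof (rule rfm_eqI)
    fix i j
    show "entry (1 * M) i j = entry M i j"
      by (subst entry_mult_superset[of "{i}"]) (auto simp: entry_1 split: if_splits)
  qed
  show "M * 1 = M"
  proof (rule rfm_eqI)
    fix i j
    show "entry (M * 1) i j = entry M i j"
      by (subst entry_mult_superset[of "insert j {j. entry M i j \<noteq> 0}"])
        (auto simp: entry_1 if_distrib cong: if_cong)
  qed
  show "(L + M) * N = L * N + M * N"
  proof (rule rfm_eqI)
    fix i k
    define S where "S = {j. entry L i j \<noteq> 0} \<union> {j. entry M i j \<noteq> 0}"
    have S: "finite S" by (simp add: S_def)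
    show "entry ((L + M) * N) i k = entry (L * N + M * N) i k"
      unfolding entry_add
      by (subst (1 2 3) entry_mult_superset[OF S])
        (auto simp: S_def sum.distrib distrib_right)
  qed
  show "L * (M + N) = L * M + L * N"
    by (rule rfm_eqI) (simp add: entry_mult sum.distrib distrib_left)
  show "(0 :: ('a, 'b) rfm) \<noteq> 1"
  proof
    assume "(0 :: ('a, 'b) rfm) = 1"
    then have "entry (0 :: ('a, 'b) rfm) undefined undefined = entry 1 undefined undefined" by simp
    then show False by (simp add: entry_1)
  qed
qed (rule rfm_eqI, simp)+

end

lemma entry_sum [simp]: "entry (sum f A) i j = (\<Sum>x\<in>A. entry (f x) i j)"
  by (induction A rule: infinite_finite_induct) auto

text \<open>Scalars enter as central elements, so that the noncommutative q-calculus below can take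
  its parameter from the ring itself.\<close>

definition scalar_rfm :: "'a \<Rightarrow> ('i, 'a::comm_ring_1) rfm" where
  "scalar_rfm c = Abs_rfm (\<lambda>i j. if i = j then c else 0)"

lemma entry_scalar: "entry (scalar_rfm c) i j = (if i = j then c else 0)"
  by (simp add: scalar_rfm_def entry_Abs_rfm)

lemma entry_scalar_mult [simp]: "entry (scalar_rfm c * M) i j = c * entry M i j"
  by (subst entry_mult_superset[of "{i}"]) (auto simp: entry_scalar split: if_splits)

lemma entry_mult_scalar [simp]: "entry (M * scalar_rfm c) i j = c * entry M i j"
  by (subst entry_mult_superset[of "insert j {j. entry M i j \<noteq> 0}"])
    (auto simp: entry_scalar if_distrib mult.commute cong: if_cong)

lemma scalar_rfm_commute: "scalar_rfm c * M = M * scalar_rfm c"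
  by (rule rfm_eqI) simp

lemma scalar_rfm_simps:
  "scalar_rfm 0 = 0" "scalar_rfm 1 = 1"
  "scalar_rfm (a + b) = scalar_rfm a + scalar_rfm b"
  "scalar_rfm (a - b) = scalar_rfm a - scalar_rfm b"
  "scalar_rfm (a * b) = scalar_rfm a * scalar_rfm b"
  by (rule rfm_eqI, simp add: entry_scalar entry_1)+

lemma scalar_rfm_power: "scalar_rfm (a ^ n) = scalar_rfm a ^ n"
  by (induction n) (simp_all add: scalar_rfm_simps)


section \<open>Action on functions with values in a ring of power series\<close>

lemma mconst_simps:
  fixes a b :: "'a::comm_ring_1"
  shows "mconst 0 = (0 :: ('v, 'a) mfps)" "mconst 1 = (1 :: ('v, 'a) mfps)"
    "mconst (a + b) = (mconst a + mconst b :: ('v, 'a) mfps)"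
    "mconst (a - b) = (mconst a - mconst b :: ('v, 'a) mfps)"
  by (rule mfps_eqI, simp add: mconst_def mcoeff_1)+

lemma mcoeff_mconst: "mcoeff (mconst c) n = (if n = 0 then c else 0)"
  by (simp add: mconst_def)

lemma mcoeff_mconst_mult [simp]:
  fixes f :: "('v, 'a::comm_ring_1) mfps"
  shows "mcoeff (mconst c * f) n = c * mcoeff f n"
proof -
  have "mcoeff (mconst c * f) n = (\<Sum>(a, b)\<in>{(0 :: 'v \<Rightarrow>\<^sub>0 nat, n)}. mcoeff (mconst c) a * mcoeff f b)"
    unfolding mcoeff_mult
    by (rule sum.mono_neutral_right, rule finite_splits)
      (auto simp: splits_def mconst_def split: if_splits)
  then show ?thesis by (simp add: mconst_def)
qed

lemma mconst_mult: "mconst (a * b) = (mconst a * mconst b :: ('v, 'a::comm_ring_1) mfps)"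
  by (rule mfps_eqI) (simp add: mcoeff_mconst)

lemma mconst_power: "mconst (a ^ n) = (mconst a ^ n :: ('v, 'a::comm_ring_1) mfps)"
  by (induction n) (simp_all add: mconst_simps mconst_mult)

lemma mconst_sum: "mconst (sum f A) = (\<Sum>x\<in>A. mconst (f x) :: ('v, 'a::comm_ring_1) mfps)"
  by (induction A rule: infinite_finite_induct) (simp_all add: mconst_simps)

text \<open>Matrix entries lie in the coefficient field only; the variables stay outside as scalars
  of the function values. An operator such as \<open>A_w\<close> is therefore a family of matrices,
  one for each power of w.\<close>

definition act :: "('i, 'a::comm_ring_1) rfm \<Rightarrow> ('i \<Rightarrow> ('v, 'a) mfps) \<Rightarrow> 'i \<Rightarrow> ('v, 'a) mfps" where
  "act M f i = (\<Sum>j | entry M i j \<noteq> 0. mconst (entry M i j) * f j)"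

lemma act_superset:
  assumes "finite S" "\<And>j. entry M i j \<noteq> 0 \<Longrightarrow> j \<in> S"
  shows "act M f i = (\<Sum>j\<in>S. mconst (entry M i j) * f j)"
  unfolding act_def using assms by (intro sum.mono_neutral_left) (auto simp: mconst_simps)

lemma act_add: "act (M + N) f i = act M f i + act N f i"
proof -
  define S where "S = {j. entry M i j \<noteq> 0} \<union> {j. entry N i j \<noteq> 0}"
  have S: "finite S" by (simp add: S_def)
  show ?thesis
    by (subst (1 2 3) act_superset[OF S])
      (auto simp: S_def mconst_simps sum.distrib distrib_right)
qed

lemma act_0 [simp]: "act 0 f i = 0" and act_1 [simp]: "act 1 f i = f i"
  by (simp add: act_def, subst act_superset[of "{i}"])
    (auto simp: entry_1 mconst_simps split: if_splits)

lemma act_sum: "act (\<Sum>x\<in>A. M x) f i = (\<Sum>x\<in>A. act (M x) f i)"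
  by (induction A rule: infinite_finite_induct) (simp_all add: act_add)

lemma act_scalar_mult [simp]: "act (scalar_rfm c * M) f i = mconst c * act M f i"
  by (subst (1 2) act_superset[OF finite_row[of M i]])
    (auto simp: mconst_mult sum_distrib_left mult.assoc)

lemma act_mult: "act (M * N) f i = act M (act N f) i"
proof -
  define S where "S = (\<Union>j\<in>{j. entry M i j \<noteq> 0}. {k. entry N j k \<noteq> 0})"
  have S: "finite S" unfolding S_def by (intro finite_UN_I) auto
  have "act (M * N) f i = (\<Sum>k\<in>S. mconst (entry (M * N) i k) * f k)"
    by (intro act_superset S)
      (auto simp: entry_mult S_def elim!: sum.not_neutral_contains_not_neutral)
  also have "\<dots> = (\<Sum>j | entry M i j \<noteq> 0. \<Sum>k\<in>S. mconst (entry M i j) * (mconst (entry N j k) * f k))"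
    by (simp add: entry_mult mconst_sum mconst_mult sum_distrib_right mult.assoc) (rule sum.swap)
  also have "\<dots> = (\<Sum>j | entry M i j \<noteq> 0. mconst (entry M i j) * act N f j)"
  proof (rule sum.cong)
    fix j assume "j \<in> {j. entry M i j \<noteq> 0}"
    then have "act N f j = (\<Sum>k\<in>S. mconst (entry N j k) * f k)"
      by (intro act_superset S) (auto simp: S_def)
    then show "(\<Sum>k\<in>S. mconst (entry M i j) * (mconst (entry N j k) * f k)) =
        mconst (entry M i j) * act N f j"
      by (simp add: sum_distrib_left)
  qed simp
  finally show ?thesis by (simp add: act_def)
qed

lemma act_cmult: "act M (\<lambda>j. a * f j) i = a * act M f i"
  by (simp add: act_def sum_distrib_left mult.left_commute)


unbundle no vec_syntax
unbundle fps_syntax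

section \<open>Linear q-difference equations over a noncommutative ring\<close>

text \<open>Series over the matrix ring do not commute; only the series variables and q do. Nested
  series in two such variables keep track of two gradings at once.\<close>

definition central :: "'r::ring_1 \<Rightarrow> bool" where
  "central x \<longleftrightarrow> (\<forall>y. x * y = y * x)"

lemma centralD: "central x \<Longrightarrow> x * y = y * x"
  by (simp add: central_def)

lemma central_1 [simp]: "central 1"
  by (simp add: central_def)

lemma central_mult: "central x \<Longrightarrow> central y \<Longrightarrow> central (x * y)"
  unfolding central_def by (metis mult.assoc)

lemma central_diff: "central x \<Longrightarrow> central y \<Longrightarrow> central (x - y)"
  unfolding central_def by (simp add: left_diff_distrib right_diff_distrib)

lemma central_power: "central x \<Longrightarrow> central (x ^ n)"
  by (induction n) (auto intro: central_mult)

lemma central_fps_X [simp]: "central fps_X"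
  unfolding central_def using fps_mult_fps_X_commute by blast

lemma central_fps_const: "central c \<Longrightarrow> central (fps_const c)"
  unfolding central_def by (simp add: fps_eq_iff)

lemma central_Abs_fps: "(\<And>n. central (f n)) \<Longrightarrow> central (Abs_fps f)"
  unfolding central_def fps_eq_iff fps_mult_nth
proof (intro allI)
  fix y and n
  assume c: "\<And>n. \<forall>y. f n * y = y * f n"
  show "(\<Sum>i = 0..n. Abs_fps f $ i * y $ (n - i)) = (\<Sum>i = 0..n. y $ i * Abs_fps f $ (n - i))"
    by (rule sum.reindex_bij_witness[where i = "\<lambda>i. n - i" and j = "\<lambda>i. n - i"])
      (auto simp: c)
qed

lemma central_power_split:
  assumes "central c" and "i \<le> n"
  shows "c ^ n * (x * y) = c ^ i * x * (c ^ (n - i) * y)"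
proof -
  have "c ^ n = c ^ i * c ^ (n - i)" using assms(2) by (simp flip: power_add)
  then have "c ^ n * (x * y) = c ^ i * (c ^ (n - i) * x) * y" by (simp add: mult.assoc)
  also have "c ^ (n - i) * x = x * c ^ (n - i)" using assms(1) by (intro centralD central_power)
  finally show ?thesis by (simp add: mult.assoc)
qed

text \<open>The shift \<open>f(c z)\<close>, a ring endomorphism when c is central.\<close>

definition fps_scale :: "'r \<Rightarrow> 'r::ring_1 fps \<Rightarrow> 'r fps" where
  "fps_scale c f = Abs_fps (\<lambda>n. c ^ n * f $ n)"

lemma fps_scale_nth [simp]: "fps_scale c f $ n = c ^ n * f $ n"
  by (simp add: fps_scale_def)

lemma fps_scale_diff: "fps_scale c (f - g) = fps_scale c f - fps_scale c g"
  by (simp add: fps_eq_iff right_diff_distrib)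

lemma fps_scale_const [simp]: "fps_scale c (fps_const a) = fps_const a"
  by (simp add: fps_eq_iff)

lemma fps_scale_mult:
  assumes "central c"
  shows "fps_scale c (f * g) = fps_scale c f * fps_scale c g"
proof (rule fps_ext)
  fix n
  show "fps_scale c (f * g) $ n = (fps_scale c f * fps_scale c g) $ n"
    by (auto simp: fps_mult_nth sum_distrib_left intro!: sum.cong central_power_split assms)
qed

text \<open>Comparing coefficients of degree \<open>n\<close> gives \<open>(1 - c ^ n) * R $ n = 0\<close> by induction.\<close>

lemma q_difference_unique:
  fixes R :: "'r::ring_1 fps"
  assumes eq: "G * R = P * fps_scale c R * Q"
    and inv: "\<And>n. n > 0 \<Longrightarrow> \<exists>u. u * (1 - c ^ n) = 1"
    and one: "G $ 0 = 1" "P $ 0 = 1" "Q $ 0 = 1" and R0: "R $ 0 = 0"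
  shows "R = 0"
proof -
  have left: "(F * S) $ n = F $ 0 * S $ n" if "\<And>k. k < n \<Longrightarrow> S $ k = 0" for F S :: "'r fps" and n
  proof -
    have "F $ i * S $ (n - i) = 0" if "i \<in> {0..n} - {0}" for i
      using that \<open>\<And>k. k < n \<Longrightarrow> S $ k = 0\<close> by simp
    then have "(F * S) $ n = (\<Sum>i\<in>{0}. F $ i * S $ (n - i))"
      unfolding fps_mult_nth by (intro sum.mono_neutral_right) auto
    then show ?thesis by simp
  qed
  have right: "(S * F) $ n = S $ n * F $ 0" if "\<And>k. k < n \<Longrightarrow> S $ k = 0" for F S :: "'r fps" and n
  proof -
    have "S $ i * F $ (n - i) = 0" if "i \<in> {0..n} - {n}" for i
      using that \<open>\<And>k. k < n \<Longrightarrow> S $ k = 0\<close> by simp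
    then have "(S * F) $ n = (\<Sum>i\<in>{n}. S $ i * F $ (n - i))"
      unfolding fps_mult_nth by (intro sum.mono_neutral_right) auto
    then show ?thesis by simp
  qed
  have "R $ n = 0" for n
  proof (induction n rule: less_induct)
    case (less n)
    have vanish: "(P * fps_scale c R) $ k = P $ 0 * (c ^ k * R $ k)" if "k \<le> n" for k
      using less that by (subst left) auto
    have "R $ n = (G * R) $ n" using less one by (simp add: left)
    also have "\<dots> = (P * fps_scale c R) $ n * Q $ 0"
      unfolding eq using less vanish by (intro right) simp
    also have "\<dots> = c ^ n * R $ n" using vanish[of n] one by simp
    finally have *: "(1 - c ^ n) * R $ n = 0" by (simp add: left_diff_distrib)
    show ?case
    proof (cases "n = 0")
      case False
      then obtain u where "u * (1 - c ^ n) = 1" using inv by auto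
      then have "R $ n = u * (1 - c ^ n) * R $ n" by simp
      also have "\<dots> = u * 0" unfolding mult.assoc * ..
      finally show ?thesis by simp
    qed (simp add: R0)
  qed
  then show ?thesis by (simp add: fps_eq_iff)
qed

text \<open>The series \<open>f\<close> evaluated at \<open>t\<close> times a new variable.\<close>

definition lift :: "'r::ring_1 fps \<Rightarrow> 'r fps \<Rightarrow> 'r fps fps" where
  "lift t f = Abs_fps (\<lambda>n. t ^ n * fps_const (f $ n))"

lemma lift_nth [simp]: "lift t f $ n = t ^ n * fps_const (f $ n)"
  by (simp add: lift_def)

lemma lift_mult:
  assumes "central t"
  shows "lift t (f * g) = lift t f * lift t g"
proof (rule fps_ext)
  fix n
  have c: "fps_const (sum h A) = (\<Sum>i\<in>A. fps_const (h i))" for h :: "nat \<Rightarrow> 'a" and A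
    by (induction A rule: infinite_finite_induct) (simp_all flip: fps_const_add)
  have "t ^ n * fps_const (f $ i * g $ (n - i))
      = t ^ i * fps_const (f $ i) * (t ^ (n - i) * fps_const (g $ (n - i)))" if "i \<le> n" for i
    unfolding fps_const_mult[symmetric] using assms that by (rule central_power_split)
  then show "lift t (f * g) $ n = (lift t f * lift t g) $ n"
    by (simp add: fps_mult_nth c sum_distrib_left)
qed

lemma power_mult_central: "central c \<Longrightarrow> (c * t) ^ n = c ^ n * t ^ n"
proof (induction n)
  case (Suc n)
  then have "(c * t) ^ Suc n = c * (t * c ^ n) * t ^ n" by (simp add: mult.assoc)
  also have "t * c ^ n = c ^ n * t" using Suc.prems by (metis centralD central_power)
  finally show ?case by (simp add: mult.assoc)
qed simp

lemma fps_scale_lift: "central c \<Longrightarrow> fps_scale c (lift t f) = lift (c * t) f"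
  by (rule fps_ext) (simp add: power_mult_central mult.assoc)

lemma lift_scale: "central t \<Longrightarrow> lift t (fps_scale c f) = lift (t * fps_const c) f"
  by (rule fps_ext) (simp add: power_mult_central mult.assoc)


section \<open>Exchange relations as q-difference equations in two variables\<close>

definition gfac :: "'r::ring_1 fps \<Rightarrow> 'r fps fps" where
  "gfac t = 1 - fps_const t * fps_X"

lemma gfac_mult_nth: "(gfac t * F) $ i = F $ i - (if i = 0 then 0 else t * F $ (i - 1))"
  by (simp add: gfac_def left_diff_distrib mult.assoc)

lemma gfac_nth_0 [simp]: "gfac t $ 0 = 1"
  by (simp add: gfac_def)

lemma central_gfac: "central t \<Longrightarrow> central (gfac t)"
  unfolding gfac_def by (intro central_diff central_mult central_fps_const) simp_all

lemma fps_scale_gfac: "fps_scale c (gfac t) = gfac (c * t)"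
  by (simp add: fps_eq_iff gfac_def fps_X_def)

lemma lift_nth_0: "f $ 0 = 1 \<Longrightarrow> lift t f $ 0 = 1"
  by simp

text \<open>Division is required by the elements \<open>1 - c ^ n\<close> alone. Their inverses are
  central, so the recursions below can be solved in a noncommutative ring.\<close>

locale q_ring =
  fixes c :: "'r::ring_1" and inv :: "nat \<Rightarrow> 'r"
  assumes c_central: "central c" and inv_central: "central (inv n)"
    and inv: "n > 0 \<Longrightarrow> inv n * (1 - c ^ n) = 1"
begin

text \<open>In \<open>F(z) = P(z) F(c z)\<close> with \<open>P(0) = 1\<close>, the term k = 0 of the
  coefficient of \<open>z^n\<close> is \<open>c^n F_n\<close>. Moved to the left it gives
  \<open>(1 - c^n) F_n\<close>, and only earlier coefficients remain on the right.\<close>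

fun left_sol :: "(nat \<Rightarrow> 'r) \<Rightarrow> nat \<Rightarrow> 'r" where
  "left_sol P n = (if n = 0 then 1
     else inv n * (\<Sum>k\<in>{1..n}. P k * (c ^ (n - k) * left_sol P (n - k))))"

fun right_sol :: "(nat \<Rightarrow> 'r) \<Rightarrow> nat \<Rightarrow> 'r" where
  "right_sol P n = (if n = 0 then 1
     else inv n * (\<Sum>k\<in>{0..<n}. c ^ k * right_sol P k * P (n - k)))"

text \<open>Euler's coefficients \<open>c^n / ((1 - c) ... (1 - c^n))\<close> of
  \<open>H(z)\<close>, the product of \<open>1/(1 - c^m z)\<close> over m > 0.\<close>

fun hcoeff :: "nat \<Rightarrow> 'r" where
  "hcoeff 0 = 1"
| "hcoeff (Suc n) = inv (Suc n) * (c * hcoeff n)"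

declare left_sol.simps [simp del] right_sol.simps [simp del] hcoeff.simps [simp del]

text \<open>\<open>lsol P\<close> stands for the infinite product \<open>P(z) P(c z) P(c\<^sup>2 z) \<dots>\<close>, and \<open>rsol P\<close> for the one
  with the factors in the reverse order.\<close>

definition lsol where "lsol P = Abs_fps (left_sol (fps_nth P))"
definition rsol where "rsol P = Abs_fps (right_sol (fps_nth P))"
definition hser where "hser = Abs_fps hcoeff"

lemma sol_nth_0 [simp]: "lsol P $ 0 = 1" "rsol P $ 0 = 1" "hser $ 0 = 1"
  by (simp_all add: lsol_def rsol_def hser_def left_sol.simps right_sol.simps hcoeff.simps)

lemma central_hcoeff: "central (hcoeff n)"
  by (induction n) (auto simp: hcoeff.simps intro!: central_mult inv_central c_central)

lemma one_minus_inv: "n > 0 \<Longrightarrow> (1 - c ^ n) * inv n = 1"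
  using inv[of n] centralD[OF inv_central] by metis

lemma lsol:
  assumes "P $ 0 = 1"
  shows "lsol P = P * fps_scale c (lsol P)"
proof (rule fps_ext)
  fix n
  show "lsol P $ n = (P * fps_scale c (lsol P)) $ n"
  proof (cases "n = 0")
    case False
    define S where "S = (\<Sum>k\<in>{1..n}. P $ k * (c ^ (n - k) * left_sol (fps_nth P) (n - k)))"
    have L: "left_sol (fps_nth P) n = inv n * S"
      unfolding S_def using False by (subst left_sol.simps) simp
    then have "(1 - c ^ n) * left_sol (fps_nth P) n = S"
      using one_minus_inv False by (simp add: mult.assoc[symmetric])
    then have "left_sol (fps_nth P) n = c ^ n * left_sol (fps_nth P) n + S"
      by (simp add: algebra_simps)
    then show ?thesis
      by (simp add: lsol_def fps_mult_nth sum.atLeast_Suc_atMost assms S_def)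
  qed (simp add: assms)
qed

lemma rsol:
  assumes "P $ 0 = 1"
  shows "rsol P = fps_scale c (rsol P) * P"
proof (rule fps_ext)
  fix n
  show "rsol P $ n = (fps_scale c (rsol P) * P) $ n"
  proof (cases "n = 0")
    case False
    define S where "S = (\<Sum>k\<in>{0..<n}. c ^ k * right_sol (fps_nth P) k * P $ (n - k))"
    have L: "right_sol (fps_nth P) n = inv n * S"
      unfolding S_def using False by (subst right_sol.simps) simp
    then have "(1 - c ^ n) * right_sol (fps_nth P) n = S"
      using one_minus_inv False by (simp add: mult.assoc[symmetric])
    then have "right_sol (fps_nth P) n = S + c ^ n * right_sol (fps_nth P) n"
      by (simp add: algebra_simps)
    moreover have "{0..n} = insert n {0..<n}" by auto
    ultimately show ?thesis
      by (simp add: rsol_def fps_mult_nth assms S_def add.commute)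
  qed (simp add: assms)
qed

lemma hcoeff_eq: "n > 0 \<Longrightarrow> hcoeff n - c * hcoeff (n - 1) = c ^ n * hcoeff n"
proof -
  assume "n > 0"
  then obtain m where m: "n = Suc m" by (cases n) auto
  have "(1 - c ^ n) * hcoeff n = c * hcoeff (n - 1)"
    using one_minus_inv[of n] by (simp add: m hcoeff.simps mult.assoc[symmetric])
  then show ?thesis by (simp add: algebra_simps)
qed

abbreviation C where "C \<equiv> fps_const c"

lemma C_central: "central C"
  by (intro central_fps_const c_central)

lemma C_inv: "n > 0 \<Longrightarrow> \<exists>u. u * (1 - C ^ n) = 1"
proof (intro exI)
  assume "n > 0"
  have "1 - C ^ n = fps_const (1 - c ^ n)"
    by (simp flip: fps_const_sub)
  then show "fps_const (inv n) * (1 - C ^ n) = 1"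
    using inv[OF \<open>n > 0\<close>] by (simp only: fps_const_mult fps_const_1_eq_1)
qed

text \<open>Replacing z by \<open>c z\<close> in the product H removes its first factor
  \<open>1/(1 - c z)\<close>; on coefficients this is \<open>hcoeff_eq\<close>.\<close>

lemma gfac_hser:
  assumes "central t"
  shows "gfac (C * t) * lift t hser = fps_scale C (lift t hser)"
proof (rule fps_ext)
  fix i
  show "(gfac (C * t) * lift t hser) $ i = fps_scale C (lift t hser) $ i"
  proof (cases i)
    case (Suc n)
    have "C * t * (t ^ n * fps_const (hcoeff n)) = C * t ^ i * fps_const (hcoeff n)"
      by (simp add: Suc mult.assoc)
    also have "C * t ^ i = t ^ i * C" by (rule centralD[OF C_central])
    finally have "C * t * (t ^ n * fps_const (hcoeff n)) = t ^ i * (C * fps_const (hcoeff n))"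
      by (simp add: mult.assoc)
    then have "(gfac (C * t) * lift t hser) $ i = t ^ i * fps_const (hcoeff i - c * hcoeff n)"
      by (simp add: gfac_mult_nth hser_def Suc right_diff_distrib flip: fps_const_sub)
    also have "\<dots> = t ^ i * (C ^ i * fps_const (hcoeff i))"
      using hcoeff_eq[of i] by (simp add: Suc)
    also have "\<dots> = C ^ i * (t ^ i * fps_const (hcoeff i))"
      unfolding mult.assoc[symmetric] centralD[OF central_power[OF C_central], of i "t ^ i"] ..
    finally show ?thesis by (simp add: hser_def)
  qed (simp add: gfac_mult_nth)
qed

lemma lift_lsol: "P $ 0 = 1 \<Longrightarrow> central t \<Longrightarrow> lift t (lsol P) = lift t P * fps_scale C (lift t (lsol P))"
  by (subst lsol, assumption) (simp add: lift_mult lift_scale fps_scale_lift C_central centralD)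

lemma lift_rsol: "P $ 0 = 1 \<Longrightarrow> central t \<Longrightarrow> lift t (rsol P) = fps_scale C (lift t (rsol P)) * lift t P"
  by (subst rsol, assumption) (simp add: lift_mult lift_scale fps_scale_lift C_central centralD)

lemma central_lift_hser: "central t \<Longrightarrow> central (lift t hser)"
  unfolding lift_def hser_def
  by (intro central_Abs_fps central_mult central_power central_fps_const)
    (simp_all add: central_hcoeff)

lemma fps_X_const_mult_nth: "(C * fps_X * F) $ n = (if n = 0 then 0 else c * F $ (n - 1))"
  by (simp add: mult.assoc)

text \<open>With s the inner and z the outer variable, \<open>gfac w\<close> is
  \<open>1 - c s z\<close>. Which operator is attached to which variable changes from lemma to
  lemma.\<close>

abbreviation w where "w \<equiv> C * fps_X"

lemma w_central: "central w"
  by (intro central_mult C_central central_fps_X)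

text \<open>Multiplication of a two-variable series by the product of both variables, on
  coefficients; hence zero on the axes.\<close>

definition prv :: "(nat \<Rightarrow> nat \<Rightarrow> 'r) \<Rightarrow> nat \<Rightarrow> nat \<Rightarrow> 'r" where
  "prv f m i = (if m = 0 \<or> i = 0 then 0 else f (m - 1) (i - 1))"

text \<open>The hypothesis is \<open>(1 - c z x) U(z) E(x) = (1 - c^2 z x) E(x) U(z)\<close>. When U
  passes \<open>E(x) E(c x) E(c^2 x) ...\<close>, the numerator of each step cancels the denominator
  of the next, and only the first denominator \<open>1 - c z x\<close> is left.\<close>

lemma exchange_left:
  assumes rel: "\<And>m i. U $ m * E $ i - c * prv (\<lambda>m i. U $ m * E $ i) m i
      = E $ i * U $ m - c * (c * prv (\<lambda>m i. E $ i * U $ m) m i)"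
    and E0: "E $ 0 = 1"
  shows "U $ m * lsol E $ i - c * prv (\<lambda>m i. U $ m * lsol E $ i) m i = lsol E $ i * U $ m"
proof -
  define K D where "K = fps_const U" and "D = lift 1 (lsol E)"
  have E: "gfac w * (K * lift 1 E) = gfac (C * w) * (lift 1 E * K)"
  proof (intro fps_ext)
    fix i m
    show "(gfac w * (K * lift 1 E)) $ i $ m = (gfac (C * w) * (lift 1 E * K)) $ i $ m"
      using rel[of m i] by (auto simp: gfac_mult_nth K_def fps_X_const_mult_nth prv_def mult.assoc)
  qed
  have D: "D = lift 1 E * fps_scale C D"
    unfolding D_def using E0 by (intro lift_lsol) auto
  have Cw: "central (C * w)" by (intro central_mult C_central central_fps_X)
  note comm = centralD[OF central_gfac[OF Cw]]
  \<comment> \<open>R is the error of the claim. Both of its terms satisfy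
    \<open>R(x) = E(x) R(c x)\<close>, and its constant term is zero, so uniqueness applies.\<close>
  define R where "R = gfac w * (K * D) - D * K"
  have "gfac w * (K * D) = gfac w * (K * lift 1 E) * fps_scale C D"
    by (subst D) (simp add: mult.assoc)
  also have "\<dots> = lift 1 E * (gfac (C * w) * (K * fps_scale C D))"
    unfolding E using comm[of "lift 1 E"] by (simp add: mult.assoc[symmetric])
  finally have 1: "gfac w * (K * D) = lift 1 E * (gfac (C * w) * (K * fps_scale C D))" .
  have 2: "D * K = lift 1 E * (fps_scale C D * K)"
    by (subst D) (simp add: mult.assoc)
  have "fps_scale C R = gfac (C * w) * (K * fps_scale C D) - fps_scale C D * K"
    by (simp add: R_def fps_scale_diff fps_scale_mult C_central fps_scale_gfac K_def)
  then have "1 * R = lift 1 E * fps_scale C R * 1"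
    unfolding R_def 1 2 by (simp add: right_diff_distrib)
  then have "R = 0"
    by (rule q_difference_unique) (simp_all add: C_inv del: fps_const_power add: E0 R_def K_def D_def)
  then have "R $ i $ m = 0" by simp
  then show ?thesis
    by (auto simp: R_def gfac_mult_nth K_def D_def prv_def mult.assoc split: if_splits)
qed

text \<open>In \<open>... V(c^2 z) V(c z) V(z)\<close> the rightmost factor crosses D first. The
  k-th crossing costs \<open>1/(1 - c^k z x)\<close>, and together these are \<open>H(z x)\<close>;
  the index j below is the degree contributed by H.\<close>

lemma exchange_right:
  assumes rel: "\<And>m i. V $ m * D $ i - c * prv (\<lambda>m i. V $ m * D $ i) m i = D $ i * V $ m"
    and V0: "V $ 0 = 1"
  shows "rsol V $ m * D $ i = (\<Sum>j\<le>min m i. hcoeff j * (D $ (i - j) * rsol V $ (m - j)))"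
proof -
  define K U H where "K = fps_const D" and "U = lift 1 (rsol V)" and "H = lift fps_X hser"
  have E: "gfac w * (lift 1 V * K) = K * lift 1 V"
  proof (intro fps_ext)
    fix m i
    show "(gfac w * (lift 1 V * K)) $ m $ i = (K * lift 1 V) $ m $ i"
      using rel[of m i] by (auto simp add: gfac_mult_nth K_def fps_X_const_mult_nth prv_def mult.assoc)
  qed
  have U: "U = fps_scale C U * lift 1 V"
    unfolding U_def using V0 by (intro lift_rsol) auto
  have H: "gfac w * H = fps_scale C H"
    unfolding H_def by (rule gfac_hser) simp
  note comm = centralD[OF central_gfac[OF w_central]]
  \<comment> \<open>Now the variable of V is the outer one, and the error satisfies
    \<open>(1 - c x z) R(z) = R(c z) V(z)\<close>.\<close>
  define R where "R = U * K - H * (K * U)"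
  have "gfac w * (U * K) = fps_scale C U * (gfac w * (lift 1 V * K))"
    by (subst U) (metis comm mult.assoc)
  also have "\<dots> = fps_scale C U * K * lift 1 V"
    unfolding E by (simp add: mult.assoc)
  finally have 1: "gfac w * (U * K) = fps_scale C U * K * lift 1 V" .
  have "gfac w * (H * (K * U)) = fps_scale C H * (K * U)"
    by (simp add: H mult.assoc[symmetric])
  also have "\<dots> = fps_scale C H * (K * fps_scale C U) * lift 1 V"
    by (subst U) (simp add: mult.assoc)
  finally have 2: "gfac w * (H * (K * U)) = fps_scale C H * (K * fps_scale C U) * lift 1 V" .
  have "gfac w * R = 1 * fps_scale C R * lift 1 V"
    using 1 2 by (simp add: R_def fps_scale_diff fps_scale_mult C_central K_def
        right_diff_distrib left_diff_distrib)
  then have "R = 0"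
    by (rule q_difference_unique) (simp_all add: C_inv del: fps_const_power add: V0 R_def K_def U_def H_def)
  then have "(U * K) $ m $ i = (H * (K * U)) $ m $ i" by (simp add: R_def)
  also have "(H * (K * U)) $ m $ i = (\<Sum>j=0..m. (fps_X ^ j * (fps_const (hcoeff j) * (D * fps_const (rsol V $ (m - j))))) $ i)"
    unfolding fps_mult_nth[of H] fps_sum_nth
    by (simp add: H_def K_def U_def hser_def mult.assoc)
  also have "\<dots> = (\<Sum>j=0..m. if i < j then 0 else hcoeff j * (D $ (i - j) * rsol V $ (m - j)))"
    by (simp only: fps_X_power_mult_nth fps_mult_left_const_nth fps_mult_right_const_nth)
  also have "\<dots> = (\<Sum>j\<le>min m i. hcoeff j * (D $ (i - j) * rsol V $ (m - j)))"
    by (rule sum.mono_neutral_cong_right) auto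
  finally show ?thesis by (simp add: U_def K_def)
qed

text \<open>With s the variable of A, this passes from
  \<open>(1 - c s x) A(s) E(x) = E(s x) A(s)\<close> to
  \<open>A(s) D(x) = H(s x) D(s x) A(s)\<close>: every factor of D yields one factor of H and one of
  \<open>D(s x)\<close>. The condition \<open>i \<le> n\<close> records that \<open>E(s x)\<close>
  raises the degree in s by i.\<close>

lemma exchange_kernel:
  assumes rel: "\<And>n i. A $ n * E $ i - c * prv (\<lambda>n i. A $ n * E $ i) n i
      = (if i \<le> n then E $ i * A $ (n - i) else 0)"
    and E0: "E $ 0 = 1"
  shows "A $ n * lsol E $ i
    = (if i \<le> n then \<Sum>j\<le>i. hcoeff j * (lsol E $ (i - j) * A $ (n - i)) else 0)"
proof -
  define K D D' H where "K = fps_const A" and "D = lift 1 (lsol E)"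
    and "D' = lift fps_X (lsol E)" and "H = lift fps_X hser"
  have E: "gfac w * (K * lift 1 E) = lift fps_X E * K"
  proof (intro fps_ext)
    fix i n
    show "(gfac w * (K * lift 1 E)) $ i $ n = (lift fps_X E * K) $ i $ n"
      using rel[of n i]
      by (auto simp add: gfac_mult_nth K_def fps_X_const_mult_nth prv_def mult.assoc fps_X_power_mult_nth)
  qed
  have D: "D = lift 1 E * fps_scale C D"
    unfolding D_def using E0 by (intro lift_lsol) auto
  have D': "D' = lift fps_X E * fps_scale C D'"
    unfolding D'_def using E0 by (intro lift_lsol) auto
  have H: "gfac w * H = fps_scale C H"
    unfolding H_def by (rule gfac_hser) simp
  have Hc: "central (fps_scale C H)"
    unfolding H[symmetric] unfolding H_def
    by (intro central_mult central_gfac w_central central_lift_hser) simp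
  define R where "R = K * D - H * (D' * K)"
  have "gfac w * (K * D) = gfac w * (K * lift 1 E) * fps_scale C D"
    by (subst D) (simp add: mult.assoc)
  then have 1: "gfac w * (K * D) = lift fps_X E * (K * fps_scale C D)"
    unfolding E by (simp add: mult.assoc)
  have "gfac w * (H * (D' * K)) = fps_scale C H * (D' * K)"
    by (simp add: H mult.assoc[symmetric])
  also have "\<dots> = fps_scale C H * lift fps_X E * (fps_scale C D' * K)"
    by (subst D') (simp add: mult.assoc)
  also have "\<dots> = lift fps_X E * (fps_scale C H * (fps_scale C D' * K))"
    unfolding centralD[OF Hc] by (metis centralD[OF Hc] mult.assoc)
  finally have 2: "gfac w * (H * (D' * K)) = lift fps_X E * (fps_scale C H * (fps_scale C D' * K))" .
  have "gfac w * R = lift fps_X E * fps_scale C R * 1"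
    using 1 2 by (simp add: R_def fps_scale_diff fps_scale_mult C_central K_def right_diff_distrib)
  then have "R = 0"
    by (rule q_difference_unique) (simp_all add: C_inv del: fps_const_power add: E0 R_def K_def D_def D'_def H_def)
  then have "(K * D) $ i $ n = (H * (D' * K)) $ i $ n" by (simp add: R_def)
  also have "(H * (D' * K)) $ i $ n
      = (\<Sum>j=0..i. (fps_X ^ i * (fps_const (hcoeff j * lsol E $ (i - j)) * A)) $ n)"
    unfolding fps_mult_nth[of H] fps_sum_nth
  proof (rule sum.cong)
    fix j assume j: "j \<in> {0..i}"
    have "fps_X ^ i * (fps_const (hcoeff j) * fps_const (lsol E $ (i - j)))
        = fps_X ^ j * fps_const (hcoeff j) * (fps_X ^ (i - j) * fps_const (lsol E $ (i - j)))"
      using j by (intro central_power_split) auto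
    moreover have "H $ j * (D' * K) $ (i - j)
        = fps_X ^ j * fps_const (hcoeff j) * (fps_X ^ (i - j) * fps_const (lsol E $ (i - j))) * A"
      by (simp add: H_def D'_def K_def hser_def mult.assoc)
    ultimately have "H $ j * (D' * K) $ (i - j)
        = fps_X ^ i * (fps_const (hcoeff j) * fps_const (lsol E $ (i - j))) * A"
      by simp
    then show "(H $ j * (D' * K) $ (i - j)) $ n
        = (fps_X ^ i * (fps_const (hcoeff j * lsol E $ (i - j)) * A)) $ n"
      by (simp only: fps_const_mult mult.assoc)
  qed simp
  also have "\<dots> = (if i \<le> n then \<Sum>j\<le>i. hcoeff j * (lsol E $ (i - j) * A $ (n - i)) else 0)"
    by (simp add: fps_X_power_mult_nth atLeast0AtMost mult.assoc)
  finally show ?thesis by (simp add: K_def D_def)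
qed

lemma gfac_pair_nth:
  "(gfac (- w) * gfac w * F) $ i = F $ i - (if i < 2 then 0 else w * w * F $ (i - 2))"
proof -
  have "i - Suc (Suc 0) = i - 2" by simp
  then show ?thesis by (auto simp: gfac_mult_nth mult.assoc right_diff_distrib)
qed

text \<open>With s the variable of A, \<open>relA\<close> reads
  \<open>A(s) E(x) = (1 + c s x) A(s) V(s^2 x)\<close>. Moving \<open>V(s^2 x)\<close> past
  \<open>D(c x)\<close> divides by \<open>(1 - c s x)(1 + c s x)\<close>, so one step is
  \<open>(1 - c s x) A(s) D(x) = A(s) D(c x) V(s^2 x)\<close>, and iteration gives
  \<open>H(s x) A(s) U(s^2 x)\<close>. The degree in s taken by H and U together is
  \<open>j + 2 (i - j)\<close>, whence \<open>2 * i - j\<close>.\<close>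

lemma exchange_double:
  assumes rel: "\<And>m i. V $ m * lsol E $ i - c * prv (\<lambda>m i. V $ m * lsol E $ i) m i
      = lsol E $ i * V $ m"
    and relA: "\<And>n i. A $ n * E $ i = (if 2 * i \<le> n then A $ (n - 2 * i) * V $ i else 0)
      + (if i > 0 \<and> 2 * i - 1 \<le> n then c * (A $ (n - (2 * i - 1)) * V $ (i - 1)) else 0)"
    and E0: "E $ 0 = 1" and V0: "V $ 0 = 1"
  shows "A $ n * lsol E $ i
    = (\<Sum>j\<le>i. if 2 * i - j \<le> n then hcoeff j * (A $ (n - (2 * i - j)) * rsol V $ (i - j)) else 0)"
proof -
  define K D V' U H where "K = fps_const A" and "D = lift 1 (lsol E)"
    and "V' = lift (fps_X ^ 2) V" and "U = lift (fps_X ^ 2) (rsol V)" and "H = lift fps_X hser"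
  define D' where "D' = fps_scale C D"
  have X2: "central (fps_X ^ k :: 'r fps)" for k by (intro central_power) simp
  have E: "K * lift 1 E = gfac (- w) * (K * V')"
  proof (intro fps_ext)
    fix i n
    have X: "(fps_X * (fps_X ^ 2) ^ j * F) $ n = (if n < 2 * j + 1 then 0 else F $ (n - (2 * j + 1)))"
      for j F and n :: nat
      using fps_X_power_mult_nth[of "2 * j + 1" F n] by (simp add: power_mult)
    have Xn: "((fps_X ^ 2) ^ j * F) $ n = (if n < 2 * j then 0 else F $ (n - 2 * j))"
      for j F and n :: nat
      using fps_X_power_mult_nth[of "2 * j" F n] by (simp add: power_mult)
    have XA: "A * (fps_X ^ 2) ^ j = (fps_X ^ 2) ^ j * A" for j
      by (intro centralD[symmetric] central_power) simp
    have 1: "(K * V') $ i $ n = (if 2 * i \<le> n then A $ (n - 2 * i) * V $ i else 0)" for i n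
      by (simp add: K_def V'_def mult.assoc[symmetric] XA) (simp add: mult.assoc Xn)
    have 2: "(w * (K * V') $ j) $ n = (if 2 * j + 1 \<le> n then c * (A $ (n - (2 * j + 1)) * V $ j) else 0)" for j
      by (simp add: 1 mult.assoc) (auto simp: 1)
    show "(K * lift 1 E) $ i $ n = (gfac (- w) * (K * V')) $ i $ n"
    proof (cases i)
      case (Suc j)
      have "2 * i - 1 = 2 * j + 1" by (simp add: Suc)
      then show ?thesis
        using relA[of n "Suc j"] unfolding Suc by (simp add: gfac_mult_nth 1 2) (simp add: K_def)
    next
      case 0
      then show ?thesis using relA[of n i] by (simp add: gfac_mult_nth V'_def) (simp add: K_def)
    qed
  qed
  \<comment> \<open>This is \<open>rel\<close> at \<open>z = s^2 x\<close> with x replaced by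
    \<open>c x\<close>: the scalar becomes \<open>1 - c^2 s^2 x^2\<close>, the product of the two
    linear factors.\<close>
  have F: "gfac (- w) * gfac w * (V' * D') = D' * V'"
  proof (rule fps_ext)
    fix i
    define d where "d = lsol E"
    have CX: "central (C ^ a * (fps_X ^ 2) ^ b)" for a b
      by (intro central_mult central_power C_central) simp
    have VD: "(V' * D') $ i = (\<Sum>m\<le>i. C ^ (i - m) * (fps_X ^ 2) ^ m * fps_const (V $ m * d $ (i - m)))" for i
      unfolding fps_mult_nth atLeast0AtMost
    proof (rule sum.cong)
      fix m
      show "V' $ m * D' $ (i - m) = C ^ (i - m) * (fps_X ^ 2) ^ m * fps_const (V $ m * d $ (i - m))"
      proof -
        have "V' $ m * D' $ (i - m)
            = (fps_X ^ 2) ^ m * (fps_const (V $ m) * C ^ (i - m)) * fps_const (d $ (i - m))"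
          by (simp only: V'_def D'_def D_def lift_nth fps_scale_nth mult.assoc power_one mult_1 d_def)
        also have "fps_const (V $ m) * C ^ (i - m) = C ^ (i - m) * fps_const (V $ m)"
          by (intro centralD[symmetric] central_power C_central)
        also have "(fps_X ^ 2) ^ m * (C ^ (i - m) * fps_const (V $ m))
            = C ^ (i - m) * (fps_X ^ 2) ^ m * fps_const (V $ m)"
          unfolding mult.assoc[symmetric] using centralD[OF central_power[OF C_central], of "i - m" "(fps_X ^ 2) ^ m"]
          by (simp only:)
        finally show ?thesis by (simp only: mult.assoc fps_const_mult)
      qed
    qed simp
    have DV: "(D' * V') $ i = (\<Sum>m\<le>i. C ^ (i - m) * (fps_X ^ 2) ^ m * fps_const (d $ (i - m) * V $ m))"
    proof -
      have "(D' * V') $ i = (\<Sum>m\<le>i. D' $ (i - m) * V' $ m)"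
        unfolding fps_mult_nth atLeast0AtMost
        by (rule sum.reindex_bij_witness[where i = "\<lambda>m. i - m" and j = "\<lambda>m. i - m"]) auto
      also have "\<dots> = (\<Sum>m\<le>i. C ^ (i - m) * (fps_X ^ 2) ^ m * fps_const (d $ (i - m) * V $ m))"
      proof (rule sum.cong)
        fix m
        have "D' $ (i - m) * V' $ m
            = C ^ (i - m) * (fps_const (d $ (i - m)) * (fps_X ^ 2) ^ m) * fps_const (V $ m)"
          by (simp only: V'_def D'_def D_def lift_nth fps_scale_nth mult.assoc power_one mult_1 d_def)
        also have "fps_const (d $ (i - m)) * (fps_X ^ 2) ^ m = (fps_X ^ 2) ^ m * fps_const (d $ (i - m))"
          by (intro centralD[symmetric] central_power) simp
        finally show "D' $ (i - m) * V' $ m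
            = C ^ (i - m) * (fps_X ^ 2) ^ m * fps_const (d $ (i - m) * V $ m)"
          by (simp only: mult.assoc fps_const_mult)
      qed simp
      finally show ?thesis .
    qed
    \<comment> \<open>Only \<open>0 < m < i\<close> contributes. Lowering both indices of
      \<open>prv\<close> by one replaces i by \<open>i - 2\<close>, which is the origin of the
      factor \<open>w * w\<close>.\<close>
    define T where "T m = C ^ (i - m) * (fps_X ^ 2) ^ m
        * fps_const (c * prv (\<lambda>m i. V $ m * d $ i) m (i - m))" for m
    have "(V' * D') $ i - (D' * V') $ i = (\<Sum>m\<le>i. T m)"
      unfolding VD DV sum_subtractf[symmetric]
    proof (rule sum.cong)
      fix m
      have "V $ m * d $ (i - m) - d $ (i - m) * V $ m = c * prv (\<lambda>m i. V $ m * d $ i) m (i - m)"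
        using rel[of m "i - m"] by (simp add: d_def algebra_simps)
      then show "C ^ (i - m) * (fps_X ^ 2) ^ m * fps_const (V $ m * d $ (i - m))
          - C ^ (i - m) * (fps_X ^ 2) ^ m * fps_const (d $ (i - m) * V $ m) = T m"
        by (simp only: T_def right_diff_distrib[symmetric] fps_const_sub)
    qed simp
    also have "\<dots> = (if i < 2 then 0 else w * w * (V' * D') $ (i - 2))"
    proof (cases "i < 2")
      case True
      then have "T m = 0" if "m \<le> i" for m using that by (auto simp: T_def prv_def)
      then show ?thesis using True by simp
    next
      case False
      then obtain k where k: "i = k + 2" by (metis add.commute le_Suc_ex not_less)
      have "(\<Sum>m\<le>i. T m) = (\<Sum>m\<in>{1..k+1}. T m)"
        by (rule sum.mono_neutral_right) (auto simp: T_def prv_def k)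
      also have "\<dots> = (\<Sum>m\<le>k. w * w * (C ^ (k - m) * (fps_X ^ 2) ^ m * fps_const (V $ m * d $ (k - m))))"
      proof (rule sum.reindex_bij_witness[where i = Suc and j = "\<lambda>m. m - 1"])
        fix m assume "m \<in> {1..k+1}"
        then obtain n where n: "m = Suc n" "n \<le> k" by (cases m) auto
        have ww: "w * w = C ^ 2 * fps_X ^ 2"
          using centralD[OF C_central, of fps_X] by (metis mult.assoc power2_eq_square)
        define Z where "Z = fps_const (V $ n * d $ (k - n))"
        have "w * w * (C ^ (k - n) * (fps_X ^ 2) ^ n * Z)
            = C ^ 2 * (fps_X ^ 2 * C ^ (k - n)) * (fps_X ^ 2) ^ n * Z"
          unfolding ww by (simp only: mult.assoc)
        also have "fps_X ^ 2 * C ^ (k - n) = C ^ (k - n) * fps_X ^ 2"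
          by (intro centralD central_power) simp
        also have "C ^ 2 * (C ^ (k - n) * fps_X ^ 2) * (fps_X ^ 2) ^ n * Z
            = C ^ (k - n + 1) * C * (fps_X ^ 2) ^ m * Z"
          by (simp only: n power_add power2_eq_square power_one_right power_Suc mult.assoc power_commutes)
        also have "\<dots> = C ^ (k - n + 1) * (fps_X ^ 2) ^ m * (C * Z)"
          by (simp only: mult.assoc centralD[OF C_central, of "(fps_X ^ 2) ^ m * Z"] centralD[OF C_central, of Z])
        also have "\<dots> = T m"
        proof -
          have "i - m = k - n + 1" using n k by simp
          moreover have "k - n + 1 - 1 = k - n" by simp
          ultimately show ?thesis using n by (simp add: T_def prv_def Z_def)
        qed
        finally show "w * w * (C ^ (k - (m - 1)) * (fps_X ^ 2) ^ (m - 1) * fps_const (V $ (m - 1) * d $ (k - (m - 1)))) = T m"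
          by (simp only: n Z_def diff_Suc_1)
      qed auto
      finally show ?thesis by (simp add: k VD sum_distrib_left)
    qed
    finally show "(gfac (- w) * gfac w * (V' * D')) $ i = (D' * V') $ i"
      unfolding gfac_pair_nth by (simp add: algebra_simps)
  qed
  have D: "D = lift 1 E * D'"
    unfolding D_def D'_def using E0 by (intro lift_lsol) auto
  have U: "U = fps_scale C U * V'"
    unfolding U_def V'_def using V0 by (intro lift_rsol) (auto intro: X2)
  have H: "gfac w * H = fps_scale C H"
    unfolding H_def by (rule gfac_hser) simp
  have "central (- w)"
    using w_central by (simp add: central_def)
  then have gw: "central (gfac w)" and gm: "central (gfac (- w))"
    using w_central by (auto intro: central_gfac)
  define R where "R = K * D - H * (K * U)"
  have "gfac w * (K * D) = gfac w * (gfac (- w) * (K * V')) * D'"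
    unfolding E[symmetric] by (subst D) (simp only: mult.assoc)
  also have "\<dots> = gfac w * gfac (- w) * K * (V' * D')"
    by (simp only: mult.assoc)
  also have "\<dots> = K * (gfac (- w) * gfac w * (V' * D'))"
    using centralD[OF central_mult[OF gw gm], of K] centralD[OF gw, of "gfac (- w)"]
    by (simp only: mult.assoc[symmetric])
  also have "\<dots> = K * D' * V'"
    unfolding F by (simp only: mult.assoc)
  finally have 1: "gfac w * (K * D) = K * D' * V'" .
  have "gfac w * (H * (K * U)) = fps_scale C H * (K * U)"
    by (simp add: H mult.assoc[symmetric])
  also have "\<dots> = fps_scale C H * (K * fps_scale C U) * V'"
    by (subst U) (simp only: mult.assoc)
  finally have 2: "gfac w * (H * (K * U)) = fps_scale C H * (K * fps_scale C U) * V'" .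
  have "fps_scale C R = K * D' - fps_scale C H * (K * fps_scale C U)"
    by (simp add: R_def fps_scale_diff fps_scale_mult C_central K_def D'_def)
  then have "gfac w * R = 1 * fps_scale C R * V'"
    unfolding R_def right_diff_distrib 1 2 by (simp add: left_diff_distrib)
  then have "R = 0"
    by (rule q_difference_unique)
      (simp_all add: C_inv del: fps_const_power add: E0 V0 R_def K_def D_def U_def V'_def H_def)
  then have "(K * D) $ i $ n = (H * (K * U)) $ i $ n" by (simp add: R_def)
  also have "(H * (K * U)) $ i $ n
      = (\<Sum>j=0..i. (fps_X ^ (2 * i - j) * (fps_const (hcoeff j) * (A * fps_const (rsol V $ (i - j))))) $ n)"
    unfolding fps_mult_nth[of H] fps_sum_nth
  proof (rule sum.cong)
    fix j assume j: "j \<in> {0..i}"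
    define Z where "Z = A * fps_const (rsol V $ (i - j))"
    have "(K * U) $ (i - j) = A * (fps_X ^ 2) ^ (i - j) * fps_const (rsol V $ (i - j))"
      by (simp add: K_def U_def mult.assoc)
    also have "A * (fps_X ^ 2) ^ (i - j) = (fps_X ^ 2) ^ (i - j) * A"
      by (intro centralD[symmetric] central_power) simp
    finally have "H $ j * (K * U) $ (i - j)
        = fps_X ^ j * (fps_const (hcoeff j) * (fps_X ^ 2) ^ (i - j)) * Z"
      by (simp add: H_def hser_def Z_def mult.assoc)
    also have "fps_const (hcoeff j) * (fps_X ^ 2) ^ (i - j) = (fps_X ^ 2) ^ (i - j) * fps_const (hcoeff j)"
      by (intro centralD[symmetric] central_power) simp
    also have "fps_X ^ j * ((fps_X ^ 2) ^ (i - j) * fps_const (hcoeff j)) * Z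
        = fps_X ^ (j + 2 * (i - j)) * (fps_const (hcoeff j) * Z)"
      by (simp only: power_add power_mult mult.assoc)
    also have "j + 2 * (i - j) = 2 * i - j" using j by auto
    finally show "(H $ j * (K * U) $ (i - j)) $ n
        = (fps_X ^ (2 * i - j) * (fps_const (hcoeff j) * (A * fps_const (rsol V $ (i - j))))) $ n"
      by (simp only: Z_def)
  qed simp
  also have "\<dots> = (\<Sum>j\<le>i. if 2 * i - j \<le> n then hcoeff j * (A $ (n - (2 * i - j)) * rsol V $ (i - j)) else 0)"
    unfolding atLeast0AtMost by (rule sum.cong) (auto simp: fps_X_power_mult_nth)
  finally show ?thesis by (simp add: K_def D_def)
qed

end


section \<open>Partitions\<close>

typedef ptn = partitions
  morphisms parts Abs_ptn
  by (rule exI[of _ "\<lambda>_. 0"]) (simp add: partitions_def decseq_def)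

lemma parts_antimono: "s \<le> t \<Longrightarrow> parts \<mu> t \<le> parts \<mu> s"
  using parts[of \<mu>] by (auto simp: partitions_def decseq_def)

lemma parts_Abs_ptn:
  assumes "\<And>t. f (Suc t) \<le> f t" and "\<And>t. t \<ge> T \<Longrightarrow> f t = 0"
  shows "parts (Abs_ptn f) = f"
proof -
  have "{t. f t \<noteq> 0} \<subseteq> {..<T}" using assms(2) by (metis (mono_tags) lessThan_iff mem_Collect_eq not_le subsetI)
  then have "finite {t. f t \<noteq> 0}" by (rule finite_subset) simp
  moreover have "decseq f" using assms(1) by (rule decseq_SucI)
  ultimately show ?thesis by (intro Abs_ptn_inverse) (simp add: partitions_def)
qed

lemma ptn_eqI: "(\<And>t. parts \<mu> t = parts \<nu> t) \<Longrightarrow> \<mu> = \<nu>"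
  by (metis ext parts_inject)

definition psz :: "ptn \<Rightarrow> nat" where
  "psz \<mu> = psize (parts \<mu>)"

definition bounded_by :: "nat \<Rightarrow> ptn \<Rightarrow> bool" where
  "bounded_by T \<mu> \<longleftrightarrow> (\<forall>t\<ge>T. parts \<mu> t = 0)"

lemma bounded_byD: "bounded_by T \<mu> \<Longrightarrow> t \<ge> T \<Longrightarrow> parts \<mu> t = 0"
  by (simp add: bounded_by_def)

lemma bounded_by_mono: "bounded_by T \<mu> \<Longrightarrow> T \<le> T' \<Longrightarrow> bounded_by T' \<mu>"
  by (auto simp: bounded_by_def)

lemma psz_bounded:
  assumes "bounded_by T \<mu>"
  shows "psz \<mu> = (\<Sum>t<T. parts \<mu> t)"
  unfolding psz_def psize_def
proof (intro Sum_any.expand_superset subsetI)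
  fix t assume "t \<in> {t. parts \<mu> t \<noteq> 0}"
  then show "t \<in> {..<T}" using bounded_byD[OF assms, of t] by (cases "t < T") auto
qed simp

text \<open>A nonzero part at index t forces t + 1 nonzero parts, hence size at least t + 1. So the
  size itself serves as a bound on the support.\<close>

lemma bounded_by_psz: "bounded_by (psz \<mu>) \<mu>"
proof -
  have "finite {t. parts \<mu> t \<noteq> 0}" using parts[of \<mu>] by (simp add: partitions_def)
  then obtain T where T: "\<forall>t\<in>{t. parts \<mu> t \<noteq> 0}. t < T"
    unfolding finite_nat_set_iff_bounded by blast
  then have b: "bounded_by T \<mu>" by (auto simp: bounded_by_def not_less[symmetric])
  have "parts \<mu> t = 0" if t: "t \<ge> psz \<mu>" for t
  proof (rule ccontr)
    assume nz: "parts \<mu> t \<noteq> 0"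
    then have "t < T" using T by auto
    have "Suc t = (\<Sum>s<Suc t. 1)" by simp
    also have "\<dots> \<le> (\<Sum>s<Suc t. parts \<mu> s)"
    proof (rule sum_mono)
      fix s assume "s \<in> {..<Suc t}"
      then have "parts \<mu> t \<le> parts \<mu> s" by (intro parts_antimono) simp
      with nz show "1 \<le> parts \<mu> s" by simp
    qed
    also have "\<dots> \<le> (\<Sum>s<T. parts \<mu> s)"
      using \<open>t < T\<close> by (intro sum_mono2) auto
    finally show False using t psz_bounded[OF b] by simp
  qed
  then show ?thesis by (simp add: bounded_by_def)
qed

lemma bounded_by_size: "psz \<mu> \<le> T \<Longrightarrow> bounded_by T \<mu>"
  by (rule bounded_by_mono[OF bounded_by_psz])

lemma parts_le_psz: "parts \<mu> t \<le> psz \<mu>"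
proof (cases "parts \<mu> t = 0")
  case False
  then have "t < psz \<mu>" using bounded_byD[OF bounded_by_psz] by (metis not_le)
  then have "parts \<mu> t \<le> (\<Sum>s<psz \<mu>. parts \<mu> s)" by (intro member_le_sum) auto
  also have "\<dots> = psz \<mu>" by (rule psz_bounded[OF bounded_by_psz, symmetric])
  finally show ?thesis .
qed simp

lemma finite_psz_le: "finite {\<mu>. psz \<mu> \<le> n}"
proof (rule finite_imageD)
  have "parts ` {\<mu>. psz \<mu> \<le> n} \<subseteq> {f. \<forall>t. (t \<in> {..<n} \<longrightarrow> f t \<in> {..n}) \<and> (t \<notin> {..<n} \<longrightarrow> f t = 0)}"
    using parts_le_psz bounded_by_size by (auto simp: bounded_by_def intro: order_trans)
  then show "finite (parts ` {\<mu>. psz \<mu> \<le> n})"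
    by (rule finite_subset) (intro finite_set_of_finite_funs; simp)
  show "inj_on parts {\<mu>. psz \<mu> \<le> n}"
    by (auto simp: inj_on_def parts_inject)
qed

lemma finite_psz_eq: "finite {\<mu>. psz \<mu> = n}"
  by (rule finite_subset[OF _ finite_psz_le[of n]]) auto

definition empty_ptn :: ptn where
  "empty_ptn = Abs_ptn (\<lambda>_. 0)"

lemma parts_empty [simp]: "parts empty_ptn t = 0"
  unfolding empty_ptn_def by (subst parts_Abs_ptn[where T = 0]) auto

lemma psz_eq_0_iff [simp]: "psz \<mu> = 0 \<longleftrightarrow> \<mu> = empty_ptn"
proof
  assume "psz \<mu> = 0"
  then have "parts \<mu> t = 0" for t using parts_le_psz[of \<mu> t] by simp
  then show "\<mu> = empty_ptn" by (intro ptn_eqI) simp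
next
  assume "\<mu> = empty_ptn"
  then show "psz \<mu> = 0" using psz_bounded[of 0 empty_ptn] by (simp add: bounded_by_def)
qed

text \<open>For the conjugate partitions, \<open>\<theta>/\<nu>\<close> is a horizontal strip.\<close>

definition strip :: "ptn \<Rightarrow> ptn \<Rightarrow> bool" where
  "strip \<nu> \<theta> \<longleftrightarrow> (\<forall>t. parts \<theta> t = parts \<nu> t \<or> parts \<theta> t = Suc (parts \<nu> t))"

lemma strip_parts: "strip \<nu> \<theta> \<Longrightarrow> parts \<nu> t + of_bool (parts \<theta> t \<noteq> parts \<nu> t) = parts \<theta> t"
  unfolding strip_def by (drule spec[of _ t], elim disjE) simp_all

lemma strip_psz:
  assumes "strip \<nu> \<theta>" "bounded_by T \<theta>" "bounded_by T \<nu>"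
  shows "psz \<theta> = psz \<nu> + (\<Sum>t<T. of_bool (parts \<theta> t \<noteq> parts \<nu> t))"
proof -
  have "(\<Sum>t<T. parts \<theta> t) = (\<Sum>t<T. parts \<nu> t + of_bool (parts \<theta> t \<noteq> parts \<nu> t))"
  proof (rule sum.cong)
    fix t
    show "parts \<theta> t = parts \<nu> t + of_bool (parts \<theta> t \<noteq> parts \<nu> t)"
      by (rule strip_parts[OF assms(1), symmetric])
  qed simp
  also have "\<dots> = (\<Sum>t<T. parts \<nu> t) + (\<Sum>t<T. of_bool (parts \<theta> t \<noteq> parts \<nu> t))"
    by (rule sum.distrib)
  finally show ?thesis
    unfolding psz_bounded[OF assms(2), symmetric] psz_bounded[OF assms(3), symmetric] .
qed

lemma strip_bounded:
  assumes "strip \<nu> \<theta>" "bounded_by T \<theta>"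
  shows "bounded_by T \<nu>"
  unfolding bounded_by_def
proof (intro allI impI)
  fix t assume "t \<ge> T"
  then have "parts \<theta> t = 0" by (rule bounded_byD[OF assms(2)])
  then show "parts \<nu> t = 0" using assms(1)[unfolded strip_def, rule_format, of t] by simp
qed

lemma strip_psz_le:
  assumes "strip \<nu> \<theta>"
  shows "psz \<nu> \<le> psz \<theta>"
proof -
  have "bounded_by (psz \<theta>) \<theta>" by (rule bounded_by_psz)
  then show ?thesis
    using strip_psz[OF assms _ strip_bounded[OF assms]] by (metis le_add1)
qed


section \<open>Sums over sequences with nearest neighbour weights\<close>

text \<open>The tail d is prescribed because the weight at t also refers to the state at t + 1. In
  use it is the empty state of the rows beyond the support.\<close>

definition paths :: "nat \<Rightarrow> (nat \<Rightarrow> 's set) \<Rightarrow> (nat \<Rightarrow> 's) \<Rightarrow> (nat \<Rightarrow> 's) set" where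
  "paths T S d = {f. (\<forall>t<T. f t \<in> S t) \<and> (\<forall>t\<ge>T. f t = d t)}"

text \<open>A row vector multiplied by T transfer matrices, starting from the all-ones vector; e is
  the state that follows the last one summed over.\<close>

primrec transfer :: "(nat \<Rightarrow> 's \<Rightarrow> 's \<Rightarrow> 'a::comm_ring_1) \<Rightarrow> (nat \<Rightarrow> 's set) \<Rightarrow> nat \<Rightarrow> 's \<Rightarrow> 'a" where
  "transfer w S 0 e = 1"
| "transfer w S (Suc T) e = (\<Sum>x\<in>S T. transfer w S T x * w T x e)"

lemma paths_Suc: "paths (Suc T) S d = (\<Union>x\<in>S T. paths T S (d(T := x)))"
proof (intro equalityI subsetI)
  fix f assume "f \<in> paths (Suc T) S d"
  then show "f \<in> (\<Union>x\<in>S T. paths T S (d(T := x)))"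
    by (intro UN_I[of "f T"]) (auto simp: paths_def)
next
  fix f assume "f \<in> (\<Union>x\<in>S T. paths T S (d(T := x)))"
  then obtain x where x: "x \<in> S T" "f \<in> paths T S (d(T := x))" by blast
  have "f t \<in> S t" if "t < Suc T" for t
    using x that by (cases "t = T") (auto simp: paths_def)
  moreover have "f t = d t" if "t \<ge> Suc T" for t
    using x that by (auto simp: paths_def)
  ultimately show "f \<in> paths (Suc T) S d" by (simp add: paths_def)
qed

lemma finite_paths: "(\<And>t. finite (S t)) \<Longrightarrow> finite (paths T S d)"
proof (induction T arbitrary: d)
  case 0
  have "paths 0 S d = {d}" by (auto simp: paths_def)
  then show ?case by simp
qed (simp add: paths_Suc)

lemma transfer_eq_sum:
  assumes "\<And>t. finite (S t)"
  shows "(\<Sum>f\<in>paths T S d. \<Prod>t<T. w t (f t) (f (Suc t))) = transfer w S T (d T)"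
proof (induction T arbitrary: d)
  case 0
  have "paths 0 S d = {d}" by (auto simp: paths_def)
  then show ?case by simp
next
  case (Suc T)
  have "(\<Sum>f\<in>paths (Suc T) S d. \<Prod>t<Suc T. w t (f t) (f (Suc t)))
      = (\<Sum>x\<in>S T. \<Sum>f\<in>paths T S (d(T := x)). \<Prod>t<Suc T. w t (f t) (f (Suc t)))"
    unfolding paths_Suc
  proof (rule sum.UNION_disjoint)
    show "\<forall>i\<in>S T. \<forall>j\<in>S T. i \<noteq> j \<longrightarrow> paths T S (d(T := i)) \<inter> paths T S (d(T := j)) = {}"
      by (force simp: paths_def)
  qed (auto intro: finite_paths assms)
  also have "\<dots> = (\<Sum>x\<in>S T. transfer w S T x * w T x (d (Suc T)))"
  proof (rule sum.cong)
    fix x assume "x \<in> S T"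
    have "(\<Prod>t<Suc T. w t (f t) (f (Suc t))) = (\<Prod>t<T. w t (f t) (f (Suc t))) * w T x (d (Suc T))"
      if "f \<in> paths T S (d(T := x))" for f
      using that by (simp add: paths_def)
    then have "(\<Sum>f\<in>paths T S (d(T := x)). \<Prod>t<Suc T. w t (f t) (f (Suc t)))
        = (\<Sum>f\<in>paths T S (d(T := x)). (\<Prod>t<T. w t (f t) (f (Suc t))) * w T x (d (Suc T)))"
      by (intro sum.cong) auto
    also have "\<dots> = transfer w S T x * w T x (d (Suc T))"
      by (simp only: Suc.IH sum_distrib_right[symmetric]) simp
    finally show "(\<Sum>f\<in>paths T S (d(T := x)). \<Prod>t<Suc T. w t (f t) (f (Suc t)))
        = transfer w S T x * w T x (d (Suc T))" .
  qed simp
  finally show ?case by simp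
qed

abbreviation no_box :: "nat \<Rightarrow> bool" where "no_box \<equiv> \<lambda>_. False"

text \<open>A strip is coded by the rows e that receive a box. Such an e fails to give a partition
  only if some row without a box has the same length as the next row, which has one. There the
  weights in use carry the factor \<open>1 - q^0 = 0\<close>, so the sum may run over all paths,
  which is what a transfer matrix computes.\<close>

lemma sum_add_strip:
  fixes g :: "ptn \<Rightarrow> 'b::comm_monoid_add"
  assumes b: "bounded_by T \<nu>"
    and G: "\<And>e. e \<in> paths T S no_box \<Longrightarrow>
        \<forall>t. parts \<nu> t + of_bool (e t) \<ge> parts \<nu> (Suc t) + of_bool (e (Suc t)) \<Longrightarrow>
        G e = g (Abs_ptn (\<lambda>t. parts \<nu> t + of_bool (e t)))"
    and G0: "\<And>e. e \<in> paths T S no_box \<Longrightarrow>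
        \<exists>t. \<not> e t \<and> e (Suc t) \<and> parts \<nu> t = parts \<nu> (Suc t) \<Longrightarrow> G e = 0"
  shows "(\<Sum>e\<in>paths T S no_box. G e)
    = (\<Sum>\<theta> | strip \<nu> \<theta> \<and> bounded_by T \<theta> \<and> (\<forall>t<T. (parts \<theta> t \<noteq> parts \<nu> t) \<in> S t). g \<theta>)"
proof -
  define ok where "ok e \<longleftrightarrow> (\<forall>t. parts \<nu> t + of_bool (e t) \<ge> parts \<nu> (Suc t) + of_bool (e (Suc t)))"
    for e
  have fin: "finite (paths T S no_box)" by (intro finite_paths) simp
  have bad: "G e = 0" if path: "e \<in> paths T S no_box" and nok: "\<not> ok e" for e
  proof -
    obtain t where t: "parts \<nu> t + of_bool (e t) < parts \<nu> (Suc t) + of_bool (e (Suc t))"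
      using nok by (auto simp: ok_def not_le)
    have le: "parts \<nu> (Suc t) \<le> parts \<nu> t" by (rule parts_antimono) simp
    have "\<not> e t \<and> e (Suc t) \<and> parts \<nu> t = parts \<nu> (Suc t)"
      using t le by (cases "e t"; cases "e (Suc t)") auto
    then show ?thesis using G0 path by blast
  qed
  have "(\<Sum>e\<in>paths T S no_box. G e) = (\<Sum>e | e \<in> paths T S no_box \<and> ok e. G e)"
    using bad by (intro sum.mono_neutral_right fin) auto
  also have "\<dots> = (\<Sum>\<theta> | strip \<nu> \<theta> \<and> bounded_by T \<theta> \<and> (\<forall>t<T. (parts \<theta> t \<noteq> parts \<nu> t) \<in> S t). g \<theta>)"
  proof (rule sum.reindex_bij_witness[where j = "\<lambda>e. Abs_ptn (\<lambda>t. parts \<nu> t + of_bool (e t))"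
        and i = "\<lambda>\<theta> t. parts \<theta> t \<noteq> parts \<nu> t"])
    fix e assume e: "e \<in> {e. e \<in> paths T S no_box \<and> ok e}"
    have p: "parts (Abs_ptn (\<lambda>t. parts \<nu> t + of_bool (e t))) = (\<lambda>t. parts \<nu> t + of_bool (e t))"
      using e b by (intro parts_Abs_ptn[of _ T]) (auto simp: ok_def paths_def bounded_by_def)
    show "(\<lambda>t. parts (Abs_ptn (\<lambda>t. parts \<nu> t + of_bool (e t))) t \<noteq> parts \<nu> t) = e"
      by (simp add: p fun_eq_iff)
    show "Abs_ptn (\<lambda>t. parts \<nu> t + of_bool (e t))
        \<in> {\<theta>. strip \<nu> \<theta> \<and> bounded_by T \<theta> \<and> (\<forall>t<T. (parts \<theta> t \<noteq> parts \<nu> t) \<in> S t)}"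
      using e b by (auto simp: strip_def bounded_by_def p paths_def)
    show "g (Abs_ptn (\<lambda>t. parts \<nu> t + of_bool (e t))) = G e"
      using e G[of e] by (auto simp: ok_def)
  next
    fix \<theta> assume l: "\<theta> \<in> {\<theta>. strip \<nu> \<theta> \<and> bounded_by T \<theta> \<and> (\<forall>t<T. (parts \<theta> t \<noteq> parts \<nu> t) \<in> S t)}"
    have eq: "parts \<nu> t + of_bool (parts \<theta> t \<noteq> parts \<nu> t) = parts \<theta> t" for t
      using l by (simp only: mem_Collect_eq strip_parts)
    then show "Abs_ptn (\<lambda>t. parts \<nu> t + of_bool (parts \<theta> t \<noteq> parts \<nu> t)) = \<theta>"
      by (simp add: parts_inverse)
    show "(\<lambda>t. parts \<theta> t \<noteq> parts \<nu> t) \<in> {e. e \<in> paths T S no_box \<and> ok e}"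
      using l b by (auto simp: paths_def ok_def eq bounded_by_def intro: parts_antimono)
  qed
  finally show ?thesis .
qed

lemma run_end:
  assumes "e (t::nat)" "\<And>s. s \<ge> T \<Longrightarrow> \<not> e s"
  shows "\<exists>s\<ge>t. e s \<and> \<not> e (Suc s)"
proof -
  define M where "M = {s. s \<ge> t \<and> e s}"
  have "finite M"
  proof (rule finite_subset[of _ "{..<T}"])
    show "M \<subseteq> {..<T}"
      using assms(2) unfolding M_def
      by (metis (mono_tags, lifting) lessThan_iff mem_Collect_eq not_le subsetI)
  qed simp
  moreover have "t \<in> M" using assms(1) by (simp add: M_def)
  ultimately have m: "Max M \<in> M" and ge: "\<And>s. s \<in> M \<Longrightarrow> s \<le> Max M"
    by (auto intro: Max_in simp del: Max_in)
  have "Suc (Max M) \<notin> M" using ge[of "Suc (Max M)"] by auto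
  then show ?thesis using m by (intro exI[of _ "Max M"]) (auto simp: M_def)
qed

text \<open>Besides a wrong order of rows, a box could be taken from an empty row. This is excluded
  by the same vanishing: the run of boxes must end (\<open>run_end\<close>), and it ends between two
  equal rows of length zero.\<close>

lemma sum_remove_strip:
  fixes g :: "ptn \<Rightarrow> 'b::comm_monoid_add"
  assumes b: "bounded_by T \<mu>"
    and G: "\<And>e. e \<in> paths T S no_box \<Longrightarrow>
        \<forall>t. e t \<longrightarrow> parts \<mu> t > 0 \<Longrightarrow>
        \<forall>t. parts \<mu> t - of_bool (e t) \<ge> parts \<mu> (Suc t) - of_bool (e (Suc t)) \<Longrightarrow>
        G e = g (Abs_ptn (\<lambda>t. parts \<mu> t - of_bool (e t)))"
    and G0: "\<And>e. e \<in> paths T S no_box \<Longrightarrow>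
        \<exists>t. e t \<and> \<not> e (Suc t) \<and> parts \<mu> t = parts \<mu> (Suc t) \<Longrightarrow> G e = 0"
  shows "(\<Sum>e\<in>paths T S no_box. G e)
    = (\<Sum>\<kappa> | strip \<kappa> \<mu> \<and> (\<forall>t<T. (parts \<kappa> t \<noteq> parts \<mu> t) \<in> S t). g \<kappa>)"
proof -
  define ok where "ok e \<longleftrightarrow> (\<forall>t. e t \<longrightarrow> parts \<mu> t > 0) \<and>
      (\<forall>t. parts \<mu> t - of_bool (e t) \<ge> parts \<mu> (Suc t) - of_bool (e (Suc t)))" for e
  have fin: "finite (paths T S no_box)" by (intro finite_paths) simp
  have bad: "G e = 0" if path: "e \<in> paths T S no_box" and nok: "\<not> ok e" for e
  proof (cases "\<forall>t. e t \<longrightarrow> parts \<mu> t > 0")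
    case True
    then obtain t where t: "parts \<mu> t - of_bool (e t) < parts \<mu> (Suc t) - of_bool (e (Suc t))"
      using nok by (auto simp: ok_def not_le)
    have le: "parts \<mu> (Suc t) \<le> parts \<mu> t" by (rule parts_antimono) simp
    have "e t \<and> \<not> e (Suc t) \<and> parts \<mu> t = parts \<mu> (Suc t)"
      using t le True[rule_format, of t] by (cases "e t"; cases "e (Suc t)") auto
    then show ?thesis using G0 path by blast
  next
    case False
    then obtain t where t: "e t" "parts \<mu> t = 0" by auto
    then obtain s where s: "s \<ge> t" "e s" "\<not> e (Suc s)"
      using run_end[of e t T] path by (auto simp: paths_def)
    then have "parts \<mu> s = 0" "parts \<mu> (Suc s) = 0"
      using t parts_antimono[of t s \<mu>] parts_antimono[of t "Suc s" \<mu>] by auto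
    then have "parts \<mu> s = parts \<mu> (Suc s)" by simp
    then show ?thesis using s by (intro G0[OF path] exI[of _ s]) simp
  qed
  have "(\<Sum>e\<in>paths T S no_box. G e) = (\<Sum>e | e \<in> paths T S no_box \<and> ok e. G e)"
    using bad by (intro sum.mono_neutral_right fin) auto
  also have "\<dots> = (\<Sum>\<kappa> | strip \<kappa> \<mu> \<and> (\<forall>t<T. (parts \<kappa> t \<noteq> parts \<mu> t) \<in> S t). g \<kappa>)"
  proof (rule sum.reindex_bij_witness[where j = "\<lambda>e. Abs_ptn (\<lambda>t. parts \<mu> t - of_bool (e t))"
        and i = "\<lambda>\<kappa> t. parts \<kappa> t \<noteq> parts \<mu> t"])
    fix e assume e: "e \<in> {e. e \<in> paths T S no_box \<and> ok e}"
    have p: "parts (Abs_ptn (\<lambda>t. parts \<mu> t - of_bool (e t))) = (\<lambda>t. parts \<mu> t - of_bool (e t))"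
      using e b by (intro parts_Abs_ptn[of _ T]) (auto simp: ok_def paths_def bounded_by_def)
    have pos: "e t \<Longrightarrow> parts \<mu> t > 0" for t using e by (auto simp: ok_def)
    then have neq: "(parts \<mu> t - of_bool (e t) \<noteq> parts \<mu> t) = e t" for t
      by (cases "e t") force+
    then show "(\<lambda>t. parts (Abs_ptn (\<lambda>t. parts \<mu> t - of_bool (e t))) t \<noteq> parts \<mu> t) = e"
      by (simp add: p)
    have "parts \<mu> t = parts \<mu> t - of_bool (e t) \<or> parts \<mu> t = Suc (parts \<mu> t - of_bool (e t))" for t
      using pos[of t] by (cases "e t") auto
    then show "Abs_ptn (\<lambda>t. parts \<mu> t - of_bool (e t))
        \<in> {\<kappa>. strip \<kappa> \<mu> \<and> (\<forall>t<T. (parts \<kappa> t \<noteq> parts \<mu> t) \<in> S t)}"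
      using e by (simp add: strip_def p neq del: diff_Suc) (auto simp: paths_def)
    show "g (Abs_ptn (\<lambda>t. parts \<mu> t - of_bool (e t))) = G e"
      using e G[of e] by (auto simp: ok_def)
  next
    fix \<kappa> assume k: "\<kappa> \<in> {\<kappa>. strip \<kappa> \<mu> \<and> (\<forall>t<T. (parts \<kappa> t \<noteq> parts \<mu> t) \<in> S t)}"
    have eq: "parts \<mu> t - of_bool (parts \<kappa> t \<noteq> parts \<mu> t) = parts \<kappa> t" for t
      using k strip_parts[of \<kappa> \<mu> t] by (cases "parts \<kappa> t = parts \<mu> t") auto
    then show "Abs_ptn (\<lambda>t. parts \<mu> t - of_bool (parts \<kappa> t \<noteq> parts \<mu> t)) = \<kappa>"
      by (simp add: parts_inverse)
    have bk: "bounded_by T \<kappa>" using k b by (auto intro: strip_bounded)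
    have pos: "parts \<mu> t > 0" if "parts \<kappa> t \<noteq> parts \<mu> t" for t
    proof -
      have "parts \<mu> t = parts \<kappa> t \<or> parts \<mu> t = Suc (parts \<kappa> t)"
        using k by (simp add: strip_def)
      then show ?thesis using that by (elim disjE) simp_all
    qed
    have "ok (\<lambda>t. parts \<kappa> t \<noteq> parts \<mu> t)"
      unfolding ok_def
    proof (intro conjI allI impI)
      fix t
      show "parts \<mu> (Suc t) - of_bool (parts \<kappa> (Suc t) \<noteq> parts \<mu> (Suc t))
          \<le> parts \<mu> t - of_bool (parts \<kappa> t \<noteq> parts \<mu> t)"
        unfolding eq by (rule parts_antimono) simp
    qed (rule pos)
    then show "(\<lambda>t. parts \<kappa> t \<noteq> parts \<mu> t) \<in> {e. e \<in> paths T S no_box \<and> ok e}"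
      using k b bk by (auto simp: paths_def bounded_by_def)
  qed
  finally show ?thesis .
qed

text \<open>The transfer identities are proved for values X in the field, because their proofs
  divide by a linear polynomial in X. Equality outside a finite set of X is equality of polynomials,
  since the field is infinite; the gradings d and d' then separate strips by their number of
  boxes.\<close>

lemma coeffs_eq_of_values_eq:
  fixes c :: "'x \<Rightarrow> 'a::field_char_0" and a b :: 'a
  assumes fin: "finite A" "finite B" "finite C"
    and eq: "\<And>X. X \<notin> E \<Longrightarrow> (\<Sum>x\<in>A. c x * X ^ d x) + a * X * (\<Sum>x\<in>B. c x * X ^ d x)
        = (1 + b * X) * (\<Sum>y\<in>C. c' y * X ^ d' y)" and E: "finite E"
  shows "(\<Sum>x | x \<in> A \<and> d x = i. c x) + (if i = 0 then 0 else a * (\<Sum>x | x \<in> B \<and> d x = i - 1. c x))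
    = (\<Sum>y | y \<in> C \<and> d' y = i. c' y)
      + (if i = 0 then 0 else b * (\<Sum>y | y \<in> C \<and> d' y = i - 1. c' y))"
proof -
  define P where "P = (\<Sum>x\<in>A. monom (c x) (d x)) + monom a 1 * (\<Sum>x\<in>B. monom (c x) (d x))
      - (1 + monom b 1) * (\<Sum>y\<in>C. monom (c' y) (d' y))"
  have co: "coeff (\<Sum>x\<in>S. monom (f x) (g x)) i = (\<Sum>x | x \<in> S \<and> g x = i. f x)"
    if "finite S" for f :: "'z \<Rightarrow> 'a" and g S i
    using that by (simp add: coeff_sum sum.inter_filter)
  have "P = 0"
  proof (rule ccontr)
    assume "P \<noteq> 0"
    then have "finite {X. poly P X = 0}" by (rule poly_roots_finite)
    moreover have "- E \<subseteq> {X. poly P X = 0}"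
      using eq by (auto simp: P_def poly_sum poly_monom)
    ultimately have "finite (- E)" by (rule rev_finite_subset)
    then show False using E infinite_UNIV_char_0[where 'a = 'a] by (metis Compl_eq_Diff_UNIV finite_Diff2)
  qed
  then have "coeff P i = 0" by simp
  moreover have "coeff (monom a 1 * Q) i = (if i = 0 then 0 else a * coeff Q (i - 1))" for a and Q :: "'a poly"
    by (cases i) (simp_all add: coeff_monom_mult)
  ultimately show ?thesis
    by (auto simp: P_def co fin distrib_right)
qed


section \<open>Transfer matrix identities\<close>

declare transfer.simps(2) [simp del]

lemma sum_UNIV_bool: "(\<Sum>x\<in>UNIV. f x) = f False + f True"
  by (simp add: UNIV_bool)

text \<open>The pair of equations is the inductive invariant of the two transfer matrices.\<close>

lemma transfer_add_remove:
  fixes u \<alpha> \<beta> :: "nat \<Rightarrow> 'a::comm_ring_1"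
  assumes rel: "\<And>t. u (Suc t) * \<alpha> t = u t * \<beta> t"
  defines "wL \<equiv> \<lambda>t e e'. if e then u t else if e' then 1 - \<alpha> t else 1"
    and "wR \<equiv> \<lambda>t e e'. if e then (if e' then u t else u t * (1 - \<beta> t)) else 1"
  shows "transfer wL (\<lambda>_. UNIV) T False = transfer wR (\<lambda>_. UNIV) T True"
    and "(1 - u T) * transfer wL (\<lambda>_. UNIV) T False + u T * transfer wL (\<lambda>_. UNIV) T True
      = transfer wR (\<lambda>_. UNIV) T False"
proof (induction T)
  case (Suc T)
  define H G where "H = transfer wL (\<lambda>_. UNIV) T" and "G = transfer wR (\<lambda>_. UNIV) T"
  have IH: "H False = G True" "(1 - u T) * H False + u T * H True = G False"
    using Suc by (simp_all add: H_def G_def)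
  have H': "transfer wL (\<lambda>_. UNIV) (Suc T) False = H False + u T * H True"
    "transfer wL (\<lambda>_. UNIV) (Suc T) True = (1 - \<alpha> T) * H False + u T * H True"
    and G': "transfer wR (\<lambda>_. UNIV) (Suc T) False = G False + u T * (1 - \<beta> T) * G True"
    "transfer wR (\<lambda>_. UNIV) (Suc T) True = G False + u T * G True"
    unfolding transfer.simps(2) H_def[symmetric] G_def[symmetric]
    by (simp_all add: sum_UNIV_bool wL_def wR_def algebra_simps)
  show "transfer wL (\<lambda>_. UNIV) (Suc T) False = transfer wR (\<lambda>_. UNIV) (Suc T) True"
    unfolding H' G' using IH by (simp add: algebra_simps)
  have "(1 - u (Suc T)) * (H False + u T * H True)
      + u (Suc T) * ((1 - \<alpha> T) * H False + u T * H True)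
      = H False + u T * H True - (u (Suc T) * \<alpha> T) * H False"
    by (simp add: algebra_simps)
  also have "\<dots> = G False + u T * (1 - \<beta> T) * G True"
    unfolding rel using IH by (simp add: algebra_simps)
  finally show "(1 - u (Suc T)) * transfer wL (\<lambda>_. UNIV) (Suc T) False
      + u (Suc T) * transfer wL (\<lambda>_. UNIV) (Suc T) True = transfer wR (\<lambda>_. UNIV) (Suc T) False"
    unfolding H' G' .
qed simp_all

text \<open>For an exchange of an added and a removed strip, both intermediate partitions are
  determined where \<open>\<rho>\<close> and \<open>\<sigma>\<close> differ; where they agree, each side has two states.\<close>

lemma transfer_exchange:
  fixes q X :: "'a::field" and b :: "nat \<Rightarrow> 'a" and \<rho> \<sigma> :: "nat \<Rightarrow> nat"
  assumes near: "\<And>t. \<sigma> t = \<rho> t \<or> \<sigma> t = Suc (\<rho> t) \<or> \<rho> t = Suc (\<sigma> t)"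
    and dec: "\<And>t. \<rho> (Suc t) \<le> \<rho> t" "\<And>t. \<sigma> (Suc t) \<le> \<sigma> t"
    and X: "1 - q ^ 2 * X \<noteq> 0"
  defines "fl \<equiv> \<lambda>t e. if \<sigma> t = \<rho> t then e else \<not> e"
    and "st \<equiv> \<lambda>t e. if \<sigma> t = \<rho> t then (if e then q * X else 1) else b t"
    and "P \<equiv> \<lambda>t. 1 - q ^ (\<rho> t - \<rho> (Suc t))" and "Q \<equiv> \<lambda>t. 1 - q ^ (Suc (\<sigma> t) - \<sigma> (Suc t))"
  defines "wL \<equiv> \<lambda>t e e'. st t e * (if \<not> e \<and> e' then P t else 1)
      * (if fl t e \<and> \<not> fl (Suc t) e' then Q t else 1)"
    and "wR \<equiv> \<lambda>t h h'. st t h * (if h \<and> \<not> h' then P t else 1)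
      * (if \<not> fl t h \<and> fl (Suc t) h' then Q t else 1)"
    and "SL \<equiv> \<lambda>t. if \<sigma> t = \<rho> t then UNIV else if \<sigma> t = Suc (\<rho> t) then {True} else {False}"
    and "SR \<equiv> \<lambda>t. if \<sigma> t = \<rho> t then UNIV else if \<sigma> t = Suc (\<rho> t) then {False} else {True}"
  shows "(\<sigma> T = \<rho> T \<longrightarrow>
       (1 - q ^ 2 * X) * transfer wR SR T False
         = (1 - q * X) * transfer wL SL T False + q * X * (1 - q) * transfer wL SL T True \<and>
       (1 - q ^ 2 * X) * transfer wR SR T True
         = (1 - q) * transfer wL SL T False + q * (1 - q * X) * transfer wL SL T True) \<and>
     (\<sigma> T = Suc (\<rho> T) \<longrightarrow> transfer wR SR T False = transfer wL SL T True) \<and>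
     (\<rho> T = Suc (\<sigma> T) \<longrightarrow> transfer wR SR T True = transfer wL SL T False)"
proof (induction T)
  case 0
  then show ?case by (simp add: algebra_simps power2_eq_square)
next
  case (Suc T)
  define L R where "L = transfer wL SL T" and "R = transfer wR SR T"
  note IH = Suc.IH[folded L_def R_def]
  define p where "p = q ^ (\<rho> T - \<rho> (Suc T))"
  define Y where "Y = 1 - q ^ 2 * X"
  have Y: "Y \<noteq> 0" using X by (simp add: Y_def)
  \<comment> \<open>Where the partitions agree, the right vector is a constant 2 by 2 matrix with
    denominator Y applied to the left one. Intertwining is checked after multiplication by Y and
    then cancelled.\<close>
  have cancel: "x = y" if "Y * x = Y * y" for x y using that Y by simp
  note step = transfer.simps(2) L_def[symmetric] R_def[symmetric]
  note tr = wL_def wR_def st_def fl_def SL_def SR_def sum_UNIV_bool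
  have le: "\<rho> (Suc T) \<le> \<rho> T" "\<sigma> (Suc T) \<le> \<sigma> T" using dec by auto
  have Pp: "P T = 1 - p" by (simp add: P_def p_def)
  consider (z) "\<sigma> T = \<rho> T" | (u) "\<sigma> T = Suc (\<rho> T)" | (d) "\<rho> T = Suc (\<sigma> T)" using near by blast
  then show ?case
  proof cases
    case z
    then have I: "Y * R False = (1 - q * X) * L False + q * X * (1 - q) * L True"
      "Y * R True = (1 - q) * L False + q * (1 - q * X) * L True"
      using IH by (simp_all add: Y_def)
    consider (z') "\<sigma> (Suc T) = \<rho> (Suc T)" | (u') "\<sigma> (Suc T) = Suc (\<rho> (Suc T))"
      | (d') "\<rho> (Suc T) = Suc (\<sigma> (Suc T))" using near by blast
    then show ?thesis
    proof cases
      case z'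
      have Q: "Q T = 1 - q * p" using z z' le by (simp add: Q_def p_def Suc_diff_le)
      have L': "transfer wL SL (Suc T) False = L False + q * X * (1 - q * p) * L True"
        "transfer wL SL (Suc T) True = (1 - p) * L False + q * X * L True"
        and R': "transfer wR SR (Suc T) False = R False + q * X * (1 - p) * R True"
        "transfer wR SR (Suc T) True = (1 - q * p) * R False + q * X * R True"
        unfolding step by (simp_all add: tr z z' Q Pp algebra_simps)
      have "Y * transfer wR SR (Suc T) False = Y * R False + q * X * (1 - p) * (Y * R True)"
        "Y * transfer wR SR (Suc T) True = (1 - q * p) * (Y * R False) + q * X * (Y * R True)"
        unfolding R' by (simp_all add: algebra_simps)
      then have "Y * transfer wR SR (Suc T) False
          = (1 - q * X) * transfer wL SL (Suc T) False + q * X * (1 - q) * transfer wL SL (Suc T) True"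
        "Y * transfer wR SR (Suc T) True
          = (1 - q) * transfer wL SL (Suc T) False + q * (1 - q * X) * transfer wL SL (Suc T) True"
        unfolding L' I by (simp_all add: algebra_simps)
      then show ?thesis using z' by (simp add: Y_def)
    next
      case u'
      have Q: "Q T = 1 - p" using z u' le by (simp add: Q_def p_def)
      have L': "transfer wL SL (Suc T) True = (1 - p) * L False + q * X * (1 - p) * L True"
        and R': "transfer wR SR (Suc T) False = (1 - p) * R False + q * X * (1 - p) * R True"
        unfolding step by (simp_all add: tr z u' Q Pp algebra_simps)
      have "Y * transfer wR SR (Suc T) False = (1 - p) * (Y * R False) + q * X * (1 - p) * (Y * R True)"
        unfolding R' by (simp add: algebra_simps)
      also have "\<dots> = Y * transfer wL SL (Suc T) True"
        unfolding L' I by (simp add: Y_def algebra_simps power2_eq_square)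
      finally have "transfer wR SR (Suc T) False = transfer wL SL (Suc T) True" by (rule cancel)
      then show ?thesis using u' by simp
    next
      case d'
      have L': "transfer wL SL (Suc T) False = L False + q * X * L True"
        and R': "transfer wR SR (Suc T) True = R False + q * X * R True"
        unfolding step by (simp_all add: tr z d' Pp algebra_simps)
      have "Y * transfer wR SR (Suc T) True = Y * R False + q * X * (Y * R True)"
        unfolding R' by (simp add: algebra_simps)
      also have "\<dots> = Y * transfer wL SL (Suc T) False"
        unfolding L' I by (simp add: Y_def algebra_simps power2_eq_square)
      finally have "transfer wR SR (Suc T) True = transfer wL SL (Suc T) False" by (rule cancel)
      then show ?thesis using d' by simp
    qed
  next
    case u
    then have I: "R False = L True" using IH by simp
    consider (z') "\<sigma> (Suc T) = \<rho> (Suc T)" | (u') "\<sigma> (Suc T) = Suc (\<rho> (Suc T))"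
      | (d') "\<rho> (Suc T) = Suc (\<sigma> (Suc T))" using near by blast
    then show ?thesis
      unfolding step by cases (simp_all add: tr u I algebra_simps power2_eq_square)
  next
    case d
    then have I: "R True = L False" using IH by simp
    consider (z') "\<sigma> (Suc T) = \<rho> (Suc T)" | (u') "\<sigma> (Suc T) = Suc (\<rho> (Suc T))"
      | (d') "\<rho> (Suc T) = Suc (\<sigma> (Suc T))" using near by blast
    then show ?thesis
    proof cases
      case z'
      have Q: "Q T = 1 - p" using d z' le by (simp add: Q_def p_def)
      show ?thesis unfolding step by (simp add: tr d z' I Q Pp algebra_simps power2_eq_square)
    next
      case u'
      show ?thesis unfolding step by (simp add: tr d u' I Pp algebra_simps)
    next
      case d'
      have Q: "Q T = 1 - q * p" using d d' le by (simp add: Q_def p_def Suc_diff_le)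
      show ?thesis unfolding step by (simp add: tr d d' I Q Pp algebra_simps)
    qed
  qed
qed

section \<open>Reciprocal q-factorials and sums over pairs of consecutive parts\<close>

definition qfac :: "'a::field \<Rightarrow> nat \<Rightarrow> 'a" where
  "qfac q n = (\<Prod>k=1..n. 1 - q ^ k)"

text \<open>The value 0 at negative arguments makes sums over all integer sequences collapse to
  decreasing ones. It also makes the shift rule \<open>qfac_inv_shift\<close> valid for every
  integer: at n = 0 the factor \<open>1 - q^0\<close> vanishes.\<close>

definition qfac_inv :: "'a::field \<Rightarrow> int \<Rightarrow> 'a" where
  "qfac_inv q n = (if n < 0 then 0 else 1 / qfac q (nat n))"

lemma qfac_0 [simp]: "qfac q 0 = 1"
  by (simp add: qfac_def)

lemma qfac_Suc: "qfac q (Suc n) = (1 - q ^ Suc n) * qfac q n"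
  by (simp add: qfac_def mult.commute)

text \<open>The parameter is neither zero nor a root of unity: negative powers of q occur in the
  strip weights, and the numbers \<open>1 - q^n\<close> are denominators.\<close>

locale generic_q =
  fixes q :: "'a::field_char_0"
  assumes q_nz: "q \<noteq> 0" and q_power: "n > 0 \<Longrightarrow> q ^ n \<noteq> 1"
begin

lemma qfac_nz: "qfac q n \<noteq> 0"
  using q_power by (simp add: qfac_def)

lemma qfac_inv_shift: "qfac_inv q (n - 1) = (1 - q powi n) * qfac_inv q n"
proof -
  consider "n < 0" | "n = 0" | "n > 0" by linarith
  then show ?thesis
  proof cases
    case 3
    then have "nat n = Suc (nat (n - 1))" by simp
    moreover have "q powi n = q ^ nat n" using 3 by (simp add: power_int_def)
    moreover have "1 - q ^ nat n \<noteq> 0" using q_power[of "nat n"] 3 by simp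
    ultimately show ?thesis using 3 qfac_nz[of "nat (n - 1)"]
      by (simp add: qfac_inv_def qfac_Suc)
  qed (simp_all add: qfac_inv_def)
qed

context
  fixes X :: 'a and \<nu> :: "nat \<Rightarrow> nat"
begin

text \<open>Layers of a sum over pairs \<open>(a, b)\<close> of consecutive parts, where \<open>b = \<nu> t + e - a\<close> on the left
  and \<open>b = \<nu> t - e - a\<close> on the right for a box variable \<open>e\<close>.\<close>

definition boxL :: "nat \<Rightarrow> bool \<Rightarrow> int \<Rightarrow> bool \<Rightarrow> int \<Rightarrow> 'a" where
  "boxL t e a e' a' = (let b = int (\<nu> t) + of_bool e - a in
     (if e then X * q powi (- int (\<nu> t)) else 1) * q powi (a * a + b * b)
     * qfac_inv q (a - b) * qfac_inv q (b - a')
     * (if e \<and> \<not> e' then 1 - q powi (int (\<nu> t) - int (\<nu> (Suc t)) + 1) else 1))"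

definition boxR :: "nat \<Rightarrow> bool \<Rightarrow> int \<Rightarrow> bool \<Rightarrow> int \<Rightarrow> 'a" where
  "boxR t e a e' a' = (let b = int (\<nu> t) - of_bool e - a in
     (if e then X * q powi (int (\<nu> t)) else 1) * q powi (a * a + b * b)
     * qfac_inv q (a - b) * qfac_inv q (b - a')
     * (if \<not> e \<and> e' then 1 - q powi (int (\<nu> t) - int (\<nu> (Suc t)) + 1) else 1))"

text \<open>Transfer vectors whose state is a box variable e together with the larger part a of a
  pair; the smaller part is determined. A common range of a serves both values of e, as the surplus
  values contribute zero (\<open>box_beyond\<close>).\<close>

primrec pairL :: "nat \<Rightarrow> bool \<Rightarrow> int \<Rightarrow> 'a" where
  "pairL 0 e' a' = 1"
| "pairL (Suc t) e' a' = (\<Sum>a\<in>{0..int (\<nu> t) + 1}. \<Sum>e\<in>UNIV. pairL t e a * boxL t e a e' a')"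

primrec pairR :: "nat \<Rightarrow> bool \<Rightarrow> int \<Rightarrow> 'a" where
  "pairR 0 e' a' = 1"
| "pairR (Suc t) e' a' = (\<Sum>a\<in>{0..int (\<nu> t) + 1}. \<Sum>e\<in>UNIV. pairR t e a * boxR t e a e' a')"

text \<open>Half of the induction step of \<open>pair_invariant\<close>. The relation
  \<open>I\<close> expresses \<open>pairR\<close> in the state False through \<open>pairL\<close>,
  and \<open>II\<close> then does so in the state True, with shifts of a. Collecting the
  coefficients of each \<open>pairL t e a\<close> turns the right vector at t + 1 into a combination
  of the left vector at t, so that identities can be compared term by term.\<close>

lemma pair_expand:
  fixes t :: nat and a' :: int and e' :: bool
  assumes "a' \<ge> 0"
    and I: "\<And>a. a \<ge> 0 \<Longrightarrow> (1 + q * X) * pairR t False a = q powi (int (\<nu> t) - 2 * a) * pairL t False a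
      + (1 - q powi (int (\<nu> t) - 2 * a)) * pairL t True a + q * X * pairL t True (a + 1)"
    and II: "\<And>a. a \<ge> 0 \<Longrightarrow> pairR t False (a + 1) + X * q powi (int (\<nu> t) - 2 * a - 1) * pairR t True a
      + X * (1 - q powi (int (\<nu> t) - 2 * a - 1)) * pairR t False a = (1 + X) * pairL t True (a + 1)"
  defines "c0 \<equiv> \<lambda>a. boxR t False a e' a'"
    and "c1 \<equiv> \<lambda>a. (let b = int (\<nu> t) - 1 - a in
      q powi (2 * a + 1) * q powi (a * a + b * b) * qfac_inv q (a - b) * qfac_inv q (b - a'))"
    and "r \<equiv> \<lambda>a. q powi (int (\<nu> t) - 2 * a)"
  shows "(1 + q * X) * pairR (Suc t) e' a' = (\<Sum>a\<in>{0..int (\<nu> t) + 1}.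
      pairL t False a * (r a * c0 a - r a * c1 (a - 1) - X * (1 - r a / q) * r a * c1 a)
      + pairL t True a * ((1 - r a) * c0 a + q * X * c0 (a - 1)
        + (1 + X) * (1 + q * X) * c1 (a - 1) - (1 - r a) * c1 (a - 1) - q * X * c1 (a - 2)
        - X * (1 - r a / q) * (1 - r a) * c1 a - X * (1 - q * r a) * q * X * c1 (a - 1)))"
proof -
  define N where "N = int (\<nu> t) + 1"
  have rq: "q powi (int (\<nu> t) - 2 * a - 1) = r a / q" for a
    using q_nz by (simp add: r_def power_int_diff)
  \<comment> \<open>Splitting off \<open>X q^(nu t - 2a - 1)\<close> isolates precisely the multiple
    of \<open>pairR t True a\<close> that relation \<open>II\<close> determines.\<close>
  have c1: "boxR t True a e' a' = c1 a * (X * q powi (int (\<nu> t) - 2 * a - 1))" for a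
  proof -
    have "q powi int (\<nu> t) = q powi (2 * a + 1) * q powi (int (\<nu> t) - 2 * a - 1)"
      using q_nz by (simp flip: power_int_add)
    then show ?thesis by (simp add: boxR_def c1_def Let_def)
  qed
  have v1: "c1 a = 0" if "a < 0 \<or> a \<ge> int (\<nu> t)" for a
    using that \<open>a' \<ge> 0\<close> by (auto simp: c1_def Let_def qfac_inv_def)
  have v0: "c0 a = 0" if "a < 0 \<or> a > int (\<nu> t)" for a
    using that \<open>a' \<ge> 0\<close> by (auto simp: c0_def boxR_def Let_def qfac_inv_def)
  \<comment> \<open>Shifts of a may be undone without boundary terms, because \<open>c0\<close> and
    \<open>c1\<close> vanish wherever the shifted range leaves the support.\<close>
  have sh: "(\<Sum>a\<in>{0..N}. f (a + k)) = (\<Sum>a\<in>{0..N}. f a)"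
    if k: "k \<ge> 0" and z: "\<And>a. a < k \<or> a > N \<Longrightarrow> f a = 0" for f :: "int \<Rightarrow> 'a" and k
  proof -
    have "(\<Sum>a\<in>{0..N}. f (a + k)) = (\<Sum>a\<in>{k..N + k}. f a)"
      by (rule sum.reindex_bij_witness[where i = "\<lambda>a. a - k" and j = "\<lambda>a. a + k"]) auto
    also have "\<dots> = (\<Sum>a\<in>{k..N}. f a)"
      using k z by (intro sum.mono_neutral_right) auto
    also have "\<dots> = (\<Sum>a\<in>{0..N}. f a)"
      using k z by (intro sum.mono_neutral_left) auto
    finally show ?thesis .
  qed
  define L0 L1 where "L0 = pairL t False" and "L1 = pairL t True"
  define Z where "Z a = r a * L0 a + (1 - r a) * L1 a + q * X * L1 (a + 1)" for a
  have Z: "(1 + q * X) * pairR t False a = Z a" if "a \<ge> 0" for a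
    using I[OF that] by (simp add: Z_def L0_def L1_def r_def)
  have "(1 + q * X) * pairR (Suc t) e' a'
      = (\<Sum>a\<in>{0..N}. (1 + q * X) * pairR t False a * c0 a + (1 + q * X) * (pairR t True a * boxR t True a e' a'))"
    by (simp add: sum_UNIV_bool sum_distrib_left distrib_left c0_def N_def mult.assoc)
  also have "\<dots> = (\<Sum>a\<in>{0..N}. Z a * c0 a
      + ((1 + X) * (1 + q * X) * L1 (a + 1) - Z (a + 1) - X * (1 - r a / q) * Z a) * c1 a)"
  proof (rule sum.cong)
    fix a assume "a \<in> {0..N}"
    then have a: "a \<ge> 0" by simp
    have "(1 + q * X) * (X * q powi (int (\<nu> t) - 2 * a - 1) * pairR t True a)
        = (1 + X) * (1 + q * X) * L1 (a + 1) - Z (a + 1) - X * (1 - r a / q) * Z a"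
    proof -
      define K where "K = q powi (int (\<nu> t) - 2 * a - 1)"
      have "pairR t False (a + 1) + X * K * pairR t True a + X * (1 - K) * pairR t False a = (1 + X) * L1 (a + 1)"
        using II[OF a] by (simp only: K_def L1_def)
      then have "X * K * pairR t True a
          = (1 + X) * L1 (a + 1) - pairR t False (a + 1) - X * (1 - K) * pairR t False a"
        by (simp only: eq_diff_eq) (simp only: ac_simps)
      then have "(1 + q * X) * (X * K * pairR t True a) = (1 + X) * (1 + q * X) * L1 (a + 1)
          - (1 + q * X) * pairR t False (a + 1) - X * (1 - K) * ((1 + q * X) * pairR t False a)"
        by (simp only:) (simp only: right_diff_distrib ac_simps)
      also have "\<dots> = (1 + X) * (1 + q * X) * L1 (a + 1) - Z (a + 1) - X * (1 - K) * Z a"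
        using Z[OF a] Z[of "a + 1"] a by simp
      finally show ?thesis unfolding K_def rq .
    qed
    note eq = this
    have "(1 + q * X) * (pairR t True a * boxR t True a e' a')
        = (1 + q * X) * (X * q powi (int (\<nu> t) - 2 * a - 1) * pairR t True a) * c1 a"
      unfolding c1 by (simp only: mult_ac)
    then have "(1 + q * X) * (pairR t True a * boxR t True a e' a')
        = ((1 + X) * (1 + q * X) * L1 (a + 1) - Z (a + 1) - X * (1 - r a / q) * Z a) * c1 a"
      unfolding eq .
    then show "(1 + q * X) * pairR t False a * c0 a + (1 + q * X) * (pairR t True a * boxR t True a e' a')
        = Z a * c0 a + ((1 + X) * (1 + q * X) * L1 (a + 1) - Z (a + 1) - X * (1 - r a / q) * Z a) * c1 a"
      using Z[OF a] by simp
  qed simp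
  also have "\<dots> = (\<Sum>a\<in>{0..N}.
      L0 a * (r a * c0 a - X * (1 - r a / q) * r a * c1 a)
      + L1 a * ((1 - r a) * c0 a - X * (1 - r a / q) * (1 - r a) * c1 a))
    + (\<Sum>a\<in>{0..N}. (\<lambda>a. L1 a * (q * X * c0 (a - 1) + (1 + X) * (1 + q * X) * c1 (a - 1)
        - (1 - r a) * c1 (a - 1) - X * (1 - q * r a) * q * X * c1 (a - 1)) - L0 a * r a * c1 (a - 1)) (a + 1))
    + (\<Sum>a\<in>{0..N}. (\<lambda>a. - L1 a * (q * X * c1 (a - 2))) (a + 2))"
    unfolding sum.distrib[symmetric]
  proof (rule sum.cong)
    fix a
    have r1: "r (a + 1) = r a / q ^ 2"
      using q_nz by (simp add: r_def power_int_diff power_int_add field_simps power2_eq_square)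
    define p where "p = r a / q"
    have ra: "r a = q * p" and r1: "r (a + 1) = p / q" "q * r (a + 1) = p"
      using q_nz r1 by (simp_all add: p_def power2_eq_square)
    have Za: "Z a = q * p * L0 a + (1 - q * p) * L1 a + q * X * L1 (a + 1)"
      "Z (a + 1) = p / q * L0 (a + 1) + (1 - p / q) * L1 (a + 1) + q * X * L1 (a + 2)"
      by (simp_all add: Z_def ra r1 add.assoc)
    show "Z a * c0 a + ((1 + X) * (1 + q * X) * L1 (a + 1) - Z (a + 1) - X * (1 - r a / q) * Z a) * c1 a
      = L0 a * (r a * c0 a - X * (1 - r a / q) * r a * c1 a)
      + L1 a * ((1 - r a) * c0 a - X * (1 - r a / q) * (1 - r a) * c1 a)
      + (\<lambda>a. L1 a * (q * X * c0 (a - 1) + (1 + X) * (1 + q * X) * c1 (a - 1)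
        - (1 - r a) * c1 (a - 1) - X * (1 - q * r a) * q * X * c1 (a - 1)) - L0 a * r a * c1 (a - 1)) (a + 1)
      + (\<lambda>a. - L1 a * (q * X * c1 (a - 2))) (a + 2)"
      unfolding p_def[symmetric] Za r1 ra by (simp add: r1 algebra_simps)
  qed simp
  also have "(\<Sum>a\<in>{0..N}. (\<lambda>a. L1 a * (q * X * c0 (a - 1) + (1 + X) * (1 + q * X) * c1 (a - 1)
        - (1 - r a) * c1 (a - 1) - X * (1 - q * r a) * q * X * c1 (a - 1)) - L0 a * r a * c1 (a - 1)) (a + 1))
    = (\<Sum>a\<in>{0..N}. L1 a * (q * X * c0 (a - 1) + (1 + X) * (1 + q * X) * c1 (a - 1)
        - (1 - r a) * c1 (a - 1) - X * (1 - q * r a) * q * X * c1 (a - 1)) - L0 a * r a * c1 (a - 1))"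
    by (rule sh) (auto simp: v0 v1 N_def)
  also have "(\<Sum>a\<in>{0..N}. (\<lambda>a. - L1 a * (q * X * c1 (a - 2))) (a + 2))
    = (\<Sum>a\<in>{0..N}. - L1 a * (q * X * c1 (a - 2)))"
    by (rule sh) (auto simp: v0 v1 N_def)
  finally show ?thesis
    unfolding sum.distrib[symmetric] L0_def[symmetric] L1_def[symmetric] N_def[symmetric]
    by (simp add: algebra_simps)
qed

end

end


section \<open>The induction step for the pair sums\<close>

lemma powi_cube_shift:
  fixes q :: "'a::field"
  assumes "q \<noteq> 0" "x = y + c - m - m"
  shows "q powi x = q powi y * q powi c / (q powi m) ^ 2"
proof -
  have "q powi (y + c) = q powi y * q powi c"
    using assms(1) by (intro power_int_add) simp
  then show ?thesis
    unfolding assms(2) by (simp only: power_int_diff[OF disjI1[OF assms(1)]] power2_eq_square divide_divide_eq_left)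
qed

context generic_q
begin

text \<open>The coefficients of the left-hand pair sums in \<open>pair_expand\<close>, written with
  \<open>r = q powi (\<nu> t - 2 * a)\<close>.\<close>

definition coef0 :: "'a \<Rightarrow> 'a \<Rightarrow> 'a \<Rightarrow> 'a \<Rightarrow> 'a \<Rightarrow> 'a" where
  "coef0 X r x y y1 = r * x - r * y1 - X * (1 - r / q) * r * y"

definition coef1 :: "'a \<Rightarrow> 'a \<Rightarrow> 'a \<Rightarrow> 'a \<Rightarrow> 'a \<Rightarrow> 'a \<Rightarrow> 'a \<Rightarrow> 'a" where
  "coef1 X r x x1 y y1 y2 = (1 - r) * x + q * X * x1 + (1 + X) * (1 + q * X) * y1 - (1 - r) * y1
    - q * X * y2 - X * (1 - r / q) * (1 - r) * y - X * (1 - q * r) * q * X * y1"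

text \<open>The second invariant mixes the layers for the two values of the next box with weights d
  and 1 - d. Only the arguments x and x1 depend on that box, so the mixture can be carried out
  inside them.\<close>

lemma coef_combine:
  "coef0 X r x y y1 + X * (d * coef0 X r x' y' y1') + X * ((1 - d) * coef0 X r x'' y' y1')
    = coef0 X r x y y1 + X * coef0 X r (d * x' + (1 - d) * x'') y' y1'"
  "coef1 X r x x1 y y1 y2 + X * (d * coef1 X r x' x1' y' y1' y2')
      + X * ((1 - d) * coef1 X r x'' x1'' y' y1' y2')
    = coef1 X r x x1 y y1 y2 + X * coef1 X r (d * x' + (1 - d) * x'') (d * x1' + (1 - d) * x1'') y' y1' y2'"
  unfolding coef0_def coef1_def by algebra+

lemma coef_scale:
  "coef0 X r (c * x) (c * y) (c * y1) = c * coef0 X r x y y1"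
  "coef1 X r (c * x) (c * x1) (c * y) (c * y1) (c * y2) = c * coef1 X r x x1 y y1 y2"
  by (simp_all add: coef0_def coef1_def algebra_simps)

text \<open>Here M and N stand for \<open>q^(a - b)\<close> and \<open>q^(b - a')\<close> with
  \<open>b = nu t - a\<close>, and x, x1, y, y1, y2, z for layers divided by a common factor. With
  q, M, N and X regarded as independent, the induction step reduces to these four identities of
  rational functions, one for each invariant and each box state of the left vector.\<close>

lemma coef_identities:
  fixes M N X :: 'a
  assumes M: "M \<noteq> 0"
  defines "r \<equiv> 1 / M" and "x \<equiv> (1 - q * M) * (1 - q * N)"
    and "x1 \<equiv> q ^ 2 / M ^ 2 * (1 - M / q) * (1 - M) * (1 - q * M)"
    and "y \<equiv> q ^ 2 * M ^ 2 * (1 - N) * (1 - q * N)"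
    and "y1 \<equiv> (1 - M) * (1 - q * M) * (1 - q * N)"
    and "y2 \<equiv> q ^ 2 / M ^ 2 * (1 - M / q ^ 2) * (1 - M / q) * (1 - M) * (1 - q * M)"
    and "z \<equiv> X * (q / M) * (1 - M) * (1 - q * M)"
  shows "coef0 X r x y y1 = x + q * X * ((1 - N) * x)"
    and "coef1 X r x x1 y y1 y2 = (1 - q * M * N ^ 2) * z + q * X * ((1 - q * N) * z)"
    and "coef0 X r ((1 - N) * x) (q ^ 2 * M ^ 2 * (1 - N / q) * (1 - N) * (1 - q * N)) ((1 - N) * y1)
        + X * coef0 X r ((1 - M * N ^ 2) * x) y y1
      = (1 + X) * (1 + q * X) * ((1 - N) * x)"
    and "coef1 X r ((1 - N) * x) ((1 - q * N) * x1) (q ^ 2 * M ^ 2 * (1 - N / q) * (1 - N) * (1 - q * N))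
          ((1 - N) * y1) ((1 - q * N) * y2)
        + X * coef1 X r ((1 - M * N ^ 2) * x) ((1 - M * N ^ 2) * x1) y y1 y2
      = (1 + X) * (1 + q * X) * ((1 - q * N) * z)"
proof -
  define p where "p = 1 / M"
  have p: "M * p = 1" using M by (simp add: p_def)
  note defs = coef0_def coef1_def r_def x_def x1_def y_def y1_def y2_def z_def
  show "coef0 X r x y y1 = x + q * X * ((1 - N) * x)"
    using M q_nz unfolding defs by (simp add: divide_simps) algebra
  show "coef1 X r x x1 y y1 y2 = (1 - q * M * N ^ 2) * z + q * X * ((1 - q * N) * z)"
    using M q_nz unfolding defs by (simp add: divide_simps) algebra
  show "coef0 X r ((1 - N) * x) (q ^ 2 * M ^ 2 * (1 - N / q) * (1 - N) * (1 - q * N)) ((1 - N) * y1)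
        + X * coef0 X r ((1 - M * N ^ 2) * x) y y1
      = (1 + X) * (1 + q * X) * ((1 - N) * x)"
    using M q_nz unfolding defs by (simp add: divide_simps) algebra
  show "coef1 X r ((1 - N) * x) ((1 - q * N) * x1) (q ^ 2 * M ^ 2 * (1 - N / q) * (1 - N) * (1 - q * N))
          ((1 - N) * y1) ((1 - q * N) * y2)
        + X * coef1 X r ((1 - M * N ^ 2) * x) ((1 - M * N ^ 2) * x1) y y1 y2
      = (1 + X) * (1 + q * X) * ((1 - q * N) * z)"
    using M q_nz unfolding defs by (simp add: divide_simps) algebra
qed

lemma qfac_inv_steps:
  "qfac_inv q m = (1 - q * q powi m) * qfac_inv q (m + 1)"
  "qfac_inv q (m - 1) = (1 - q powi m) * (1 - q * q powi m) * qfac_inv q (m + 1)"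
  "qfac_inv q (m - 2) = (1 - q powi m / q) * (1 - q powi m) * (1 - q * q powi m) * qfac_inv q (m + 1)"
  "qfac_inv q (m - 3) = (1 - q powi m / q ^ 2) * (1 - q powi m / q) * (1 - q powi m) * (1 - q * q powi m)
     * qfac_inv q (m + 1)"
proof -
  have s: "q powi (m + 1) = q * q powi m" "q powi (m - 1) = q powi m / q" "q powi (m - 2) = q powi m / q ^ 2"
    using q_nz by (simp_all add: power_int_add power_int_diff)
  show 0: "qfac_inv q m = (1 - q * q powi m) * qfac_inv q (m + 1)"
    using qfac_inv_shift[of "m + 1"] by (simp add: s)
  show 1: "qfac_inv q (m - 1) = (1 - q powi m) * (1 - q * q powi m) * qfac_inv q (m + 1)"
    using qfac_inv_shift[of m] 0 by (simp add: mult.assoc)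
  show 2: "qfac_inv q (m - 2) = (1 - q powi m / q) * (1 - q powi m) * (1 - q * q powi m) * qfac_inv q (m + 1)"
    using qfac_inv_shift[of "m - 1"] 1 by (simp add: s mult.assoc)
  show "qfac_inv q (m - 3) = (1 - q powi m / q ^ 2) * (1 - q powi m / q) * (1 - q powi m) * (1 - q * q powi m)
     * qfac_inv q (m + 1)"
    using qfac_inv_shift[of "m - 2"] 2 by (simp add: s mult.assoc)
qed

context
  fixes X :: 'a and \<nu> :: "nat \<Rightarrow> nat"
begin

text \<open>The term \<open>c1\<close> of \<open>pair_expand\<close>: the layer \<open>boxR\<close>
  in the state True without the factor that the second invariant supplies. It does not depend on the
  next box.\<close>

definition boxS :: "nat \<Rightarrow> int \<Rightarrow> int \<Rightarrow> 'a" where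
  "boxS t a' a = (let b = int (\<nu> t) - 1 - a in
      q powi (2 * a + 1) * q powi (a * a + b * b) * qfac_inv q (a - b) * qfac_inv q (b - a'))"

text \<open>The factor c contains the reciprocal q-factorials at \<open>m + 1\<close> and
  \<open>n + 1\<close>, the largest arguments occurring in any of the layers; every layer is
  therefore c times an expression free of q-factorials. D is the interaction with the next
  row.\<close>

lemma box_forms:
  fixes t :: nat and a a' :: int
  defines "m \<equiv> 2 * a - int (\<nu> t)" and "n \<equiv> int (\<nu> t) - a - a'"
  defines "M \<equiv> q powi m" and "N \<equiv> q powi n"
    and "c \<equiv> q powi (a * a + (int (\<nu> t) - a) * (int (\<nu> t) - a)) * qfac_inv q (m + 1) * qfac_inv q (n + 1)"
    and "D \<equiv> \<lambda>e. if e then 1 - q powi (int (\<nu> t) - int (\<nu> (Suc t)) + 1) else 1"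
  shows "boxR X \<nu> t False a e' a' = c * (D e' * ((1 - q * M) * (1 - q * N)))"
    and "boxR X \<nu> t False (a - 1) e' a' = c * (D e' * (q ^ 2 / M ^ 2 * (1 - M / q) * (1 - M) * (1 - q * M)))"
    and "boxS t a' a = c * (q ^ 2 * M ^ 2 * (1 - N) * (1 - q * N))"
    and "boxS t a' (a - 1) = c * ((1 - M) * (1 - q * M) * (1 - q * N))"
    and "boxS t a' (a - 2) = c * (q ^ 2 / M ^ 2 * (1 - M / q ^ 2) * (1 - M / q) * (1 - M) * (1 - q * M))"
    and "boxL X \<nu> t False a e' a' = c * ((1 - q * M) * (1 - q * N))"
    and "boxL X \<nu> t True a e' a' = c * (D (\<not> e') * (X * (q / M) * (1 - M) * (1 - q * M)))"
proof -
  have M: "M \<noteq> 0" using q_nz by (simp add: M_def)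
  define B where "B = q powi (a * a + (int (\<nu> t) - a) * (int (\<nu> t) - a))"
  have B: "c = B * qfac_inv q (m + 1) * qfac_inv q (n + 1)"
    by (simp add: c_def B_def)
  note Jm = qfac_inv_steps[of m, folded M_def] and Jn = qfac_inv_steps[of n, folded N_def]
  have "boxR X \<nu> t False a e' a' = D e' * B * qfac_inv q m * qfac_inv q n"
    by (simp add: boxR_def Let_def D_def B_def m_def n_def algebra_simps)
  then show "boxR X \<nu> t False a e' a' = c * (D e' * ((1 - q * M) * (1 - q * N)))"
    unfolding B Jm(1) Jn(1) by (simp only: mult_ac)
  have "boxL X \<nu> t False a e' a' = B * qfac_inv q m * qfac_inv q n"
    by (simp add: boxL_def Let_def B_def m_def n_def algebra_simps)
  then show "boxL X \<nu> t False a e' a' = c * ((1 - q * M) * (1 - q * N))"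
    unfolding B Jm(1) Jn(1) by (simp only: mult_ac)
  have e1: "q powi ((a - 1) * (a - 1) + (int (\<nu> t) - (a - 1)) * (int (\<nu> t) - (a - 1))) = B * q powi 2 / M ^ 2"
    unfolding B_def M_def by (rule powi_cube_shift[OF q_nz]) (simp add: m_def algebra_simps)
  have e2: "a - 1 - (int (\<nu> t) - (a - 1)) = m - 2" "int (\<nu> t) - (a - 1) - a' = n + 1"
    by (simp_all add: m_def n_def)
  have b: "int (\<nu> t) - of_bool False - (a - 1) = int (\<nu> t) - (a - 1)" by simp
  have "boxR X \<nu> t False (a - 1) e' a'
      = D e' * (B * q ^ 2 / M ^ 2) * qfac_inv q (m - 2) * qfac_inv q (n + 1)"
    unfolding boxR_def Let_def b e1 e2 by (simp add: D_def)
  then show "boxR X \<nu> t False (a - 1) e' a' = c * (D e' * (q ^ 2 / M ^ 2 * (1 - M / q) * (1 - M) * (1 - q * M)))"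
    unfolding B Jm(3) by (simp add: mult_ac)
  have "boxS t a' a = B * q ^ 2 * M ^ 2 * qfac_inv q (m + 1) * qfac_inv q (n - 1)"
  proof -
    have "q powi (2 * a + 1) * q powi (a * a + (int (\<nu> t) - 1 - a) * (int (\<nu> t) - 1 - a))
        = q powi (2 * a + 1 + (a * a + (int (\<nu> t) - 1 - a) * (int (\<nu> t) - 1 - a)))"
      by (rule power_int_add[OF disjI1[OF q_nz], symmetric])
    also have "\<dots> = q powi (a * a + (int (\<nu> t) - a) * (int (\<nu> t) - a)) * q powi 2 / (q powi (- m)) ^ 2"
      by (rule powi_cube_shift[OF q_nz]) (simp add: m_def algebra_simps)
    also have "\<dots> = B * q ^ 2 * M ^ 2"
      by (simp add: B_def M_def power_int_minus power_inverse divide_simps)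
    finally have "q powi (2 * a + 1) * q powi (a * a + (int (\<nu> t) - 1 - a) * (int (\<nu> t) - 1 - a)) = B * q ^ 2 * M ^ 2" .
    moreover have "a - (int (\<nu> t) - 1 - a) = m + 1" "int (\<nu> t) - 1 - a - a' = n - 1"
      by (simp_all add: m_def n_def)
    ultimately show ?thesis unfolding boxS_def Let_def by (simp only:)
  qed
  then show "boxS t a' a = c * (q ^ 2 * M ^ 2 * (1 - N) * (1 - q * N))"
    unfolding B Jn(2) by (simp only: mult_ac)
  have "boxS t a' (a - 1) = B * qfac_inv q (m - 1) * qfac_inv q n"
  proof -
    have e: "2 * (a - 1) + 1 + ((a - 1) * (a - 1) + (int (\<nu> t) - 1 - (a - 1)) * (int (\<nu> t) - 1 - (a - 1)))
        = a * a + (int (\<nu> t) - a) * (int (\<nu> t) - a)"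
      by (simp add: algebra_simps)
    have "q powi (2 * (a - 1) + 1) * q powi ((a - 1) * (a - 1) + (int (\<nu> t) - 1 - (a - 1)) * (int (\<nu> t) - 1 - (a - 1))) = B"
      unfolding power_int_add[OF disjI1[OF q_nz], symmetric] e B_def ..
    moreover have "a - 1 - (int (\<nu> t) - 1 - (a - 1)) = m - 1" "int (\<nu> t) - 1 - (a - 1) - a' = n"
      by (simp_all add: m_def n_def)
    ultimately show ?thesis unfolding boxS_def Let_def by (simp only: power_int_numeral)
  qed
  then show "boxS t a' (a - 1) = c * ((1 - M) * (1 - q * M) * (1 - q * N))"
    unfolding B Jm(2) Jn(1) by (simp only: mult_ac)
  have "boxS t a' (a - 2) = B * q ^ 2 / M ^ 2 * qfac_inv q (m - 3) * qfac_inv q (n + 1)"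
  proof -
    have "q powi (2 * (a - 2) + 1) * q powi ((a - 2) * (a - 2) + (int (\<nu> t) - 1 - (a - 2)) * (int (\<nu> t) - 1 - (a - 2)))
        = q powi (2 * (a - 2) + 1 + ((a - 2) * (a - 2) + (int (\<nu> t) - 1 - (a - 2)) * (int (\<nu> t) - 1 - (a - 2))))"
      by (rule power_int_add[OF disjI1[OF q_nz], symmetric])
    also have "\<dots> = B * q powi 2 / M ^ 2"
      unfolding B_def M_def by (rule powi_cube_shift[OF q_nz]) (simp add: m_def algebra_simps)
    finally have "q powi (2 * (a - 2) + 1) * q powi ((a - 2) * (a - 2) + (int (\<nu> t) - 1 - (a - 2)) * (int (\<nu> t) - 1 - (a - 2)))
        = B * q powi 2 / M ^ 2" .
    moreover have "a - 2 - (int (\<nu> t) - 1 - (a - 2)) = m - 3" "int (\<nu> t) - 1 - (a - 2) - a' = n + 1"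
      by (simp_all add: m_def n_def)
    ultimately show ?thesis unfolding boxS_def Let_def by (simp only: power_int_numeral)
  qed
  then show "boxS t a' (a - 2) = c * (q ^ 2 / M ^ 2 * (1 - M / q ^ 2) * (1 - M / q) * (1 - M) * (1 - q * M))"
    unfolding B Jm(4) by (simp add: mult_ac)
  have "boxL X \<nu> t True a e' a' = D (\<not> e') * X * (B * q / M) * qfac_inv q (m - 1) * qfac_inv q (n + 1)"
  proof -
    have "q powi (- int (\<nu> t)) * q powi (a * a + (int (\<nu> t) + 1 - a) * (int (\<nu> t) + 1 - a))
        = q powi (a * a + (int (\<nu> t) - a) * (int (\<nu> t) - a) + 1 - m)"
      unfolding power_int_add[OF disjI1[OF q_nz], symmetric]
      by (rule arg_cong[of _ _ "\<lambda>x. q powi x"]) (simp add: m_def algebra_simps)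
    also have "\<dots> = B * q / M"
      unfolding B_def M_def power_int_diff[OF disjI1[OF q_nz]] power_int_add[OF disjI1[OF q_nz]] by simp
    finally have e1: "q powi (- int (\<nu> t)) * q powi (a * a + (int (\<nu> t) + 1 - a) * (int (\<nu> t) + 1 - a)) = B * q / M" .
    have e2: "a - (int (\<nu> t) + 1 - a) = m - 1" "int (\<nu> t) + 1 - a - a' = n + 1"
      by (simp_all add: m_def n_def)
    have "boxL X \<nu> t True a e' a' = D (\<not> e') * X * (q powi (- int (\<nu> t))
        * q powi (a * a + (int (\<nu> t) + 1 - a) * (int (\<nu> t) + 1 - a)))
        * qfac_inv q (a - (int (\<nu> t) + 1 - a)) * qfac_inv q (int (\<nu> t) + 1 - a - a')"
      by (simp add: boxL_def Let_def D_def)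
    then show ?thesis unfolding e1 e2 .
  qed
  then show "boxL X \<nu> t True a e' a' = c * (D (\<not> e') * (X * (q / M) * (1 - M) * (1 - q * M)))"
    unfolding B Jm(2) by (simp add: mult_ac)
qed

lemma pairL_Suc:
  "pairL X \<nu> (Suc t) e' a' = (\<Sum>a\<in>{0..int (\<nu> t) + 1}.
     pairL X \<nu> t False a * boxL X \<nu> t False a e' a' + pairL X \<nu> t True a * boxL X \<nu> t True a e' a')"
  by (simp add: sum_UNIV_bool)

text \<open>The first relation, read at a = 0 behind the last row, is what
  \<open>fold_exchange\<close> needs. It does not propagate alone: its step from t to t + 1 involves
  \<open>pairR\<close> in the state True, which the second relation determines. As the state also
  carries a part a, neighbouring values a and a + 1 are coupled.\<close>

lemma pair_invariant:
  assumes X: "1 + q * X \<noteq> 0" and "a \<ge> 0"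
  shows "(1 + q * X) * pairR X \<nu> t False a = q powi (int (\<nu> t) - 2 * a) * pairL X \<nu> t False a
      + (1 - q powi (int (\<nu> t) - 2 * a)) * pairL X \<nu> t True a + q * X * pairL X \<nu> t True (a + 1)"
    and "pairR X \<nu> t False (a + 1) + X * q powi (int (\<nu> t) - 2 * a - 1) * pairR X \<nu> t True a
      + X * (1 - q powi (int (\<nu> t) - 2 * a - 1)) * pairR X \<nu> t False a
      = (1 + X) * pairL X \<nu> t True (a + 1)"
  using \<open>a \<ge> 0\<close>
proof (induction t arbitrary: a)
  case 0
  {
    case 1
    then show ?case by (simp add: algebra_simps)
  next
    case 2
    then show ?case by (simp add: algebra_simps)
  }
next
  case (Suc t)
  define L0 L1 where "L0 = pairL X \<nu> t False" and "L1 = pairL X \<nu> t True"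
  define r where "r a = q powi (int (\<nu> t) - 2 * a)" for a
  define S where "S = {0..int (\<nu> t) + 1}"
  have R: "(1 + q * X) * pairR X \<nu> (Suc t) e' a' = (\<Sum>a\<in>S.
      L0 a * coef0 X (r a) (boxR X \<nu> t False a e' a') (boxS t a' a) (boxS t a' (a - 1))
    + L1 a * coef1 X (r a) (boxR X \<nu> t False a e' a') (boxR X \<nu> t False (a - 1) e' a')
        (boxS t a' a) (boxS t a' (a - 1)) (boxS t a' (a - 2)))" if "a' \<ge> 0" for e' a'
    using pair_expand[OF that Suc.IH, of e']
    unfolding coef0_def coef1_def L0_def L1_def r_def S_def boxS_def by (simp only:)
  have L: "pairL X \<nu> (Suc t) e' a' = (\<Sum>a\<in>S. L0 a * boxL X \<nu> t False a e' a' + L1 a * boxL X \<nu> t True a e' a')"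
    for e' a' unfolding pairL_Suc L0_def L1_def S_def ..
  {
    fix a a' :: int assume a': "a' \<ge> 0"
    define m n where "m = 2 * a - int (\<nu> t)" and "n = int (\<nu> t) - a - a'"
    define M N where "M = q powi m" and "N = q powi n"
    define c where "c = q powi (a * a + (int (\<nu> t) - a) * (int (\<nu> t) - a)) * qfac_inv q (m + 1) * qfac_inv q (n + 1)"
    define d where "d = q powi (int (\<nu> t) - int (\<nu> (Suc t)) + 1)"
    define x x1 y y1 y2 z where "x = (1 - q * M) * (1 - q * N)"
      and "x1 = q ^ 2 / M ^ 2 * (1 - M / q) * (1 - M) * (1 - q * M)"
      and "y = q ^ 2 * M ^ 2 * (1 - N) * (1 - q * N)"
      and "y1 = (1 - M) * (1 - q * M) * (1 - q * N)"
      and "y2 = q ^ 2 / M ^ 2 * (1 - M / q ^ 2) * (1 - M / q) * (1 - M) * (1 - q * M)"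
      and "z = X * (q / M) * (1 - M) * (1 - q * M)"
    note defs = x_def x1_def y_def y1_def y2_def z_def
    have M: "M \<noteq> 0" using q_nz by (simp add: M_def)
    have r: "r a = 1 / M"
      unfolding r_def M_def m_def inverse_eq_divide[symmetric] power_int_minus[symmetric] by simp
    note ids = coef_identities[OF M, where N = N and X = X, folded defs, folded r]
    \<comment> \<open>The relations also involve the layers at \<open>a' + 1\<close>; this lowers n
      by one and hence divides N by q.\<close>
    have n': "int (\<nu> t) - a - (a' + 1) = n - 1" by (simp add: n_def)
    have N': "q powi (n - 1) = N / q"
      using q_nz by (simp add: N_def power_int_diff)
    have c': "q powi (a * a + (int (\<nu> t) - a) * (int (\<nu> t) - a)) * qfac_inv q (m + 1) * qfac_inv q (n - 1 + 1)
        = (1 - q * N) * c"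
      using qfac_inv_steps(1)[of n] by (simp add: c_def N_def)
    note f = box_forms[where t = t and a = a and a' = a', folded m_def n_def, folded M_def N_def c_def d_def, folded defs]
    note g = box_forms[where t = t and a = a and a' = "a' + 1", unfolded n', folded m_def, unfolded c' N', folded M_def d_def]
    have g': "boxR X \<nu> t False a False (a' + 1) = c * ((1 - N) * x)"
      "boxR X \<nu> t False (a - 1) False (a' + 1) = c * ((1 - q * N) * x1)"
      "boxS t (a' + 1) a = c * (q ^ 2 * M ^ 2 * (1 - N / q) * (1 - N) * (1 - q * N))"
      "boxS t (a' + 1) (a - 1) = c * ((1 - N) * y1)"
      "boxS t (a' + 1) (a - 2) = c * ((1 - q * N) * y2)"
      "boxL X \<nu> t False a True (a' + 1) = c * ((1 - N) * x)"
      "boxL X \<nu> t True a True (a' + 1) = c * ((1 - q * N) * z)"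
      unfolding g defs using q_nz by (simp_all add: mult_ac)
    \<comment> \<open>The row length \<open>\<nu> (Suc t)\<close> enters through the weight of the
      invariant and through d. Their product no longer contains it, so that M and N suffice as
      variables.\<close>
    have K1: "q powi (int (\<nu> (Suc t)) - 2 * a') * d = q * M * N ^ 2"
      and K2: "q powi (int (\<nu> (Suc t)) - 2 * a' - 1) * d = M * N ^ 2"
    proof -
      have s: "q powi u * q powi v = q powi (u + v)" for u v
        by (rule power_int_add[OF disjI1[OF q_nz], symmetric])
      have h1: "M * N ^ 2 = q powi (m + n + n)"
        by (simp add: M_def N_def power2_eq_square s add_ac)
      have h2: "q * (M * N ^ 2) = q powi (1 + (m + n + n))"
        unfolding h1 s[symmetric] by simp
      show "q powi (int (\<nu> (Suc t)) - 2 * a') * d = q * M * N ^ 2"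
        unfolding d_def s mult.assoc h2
        by (rule arg_cong[of _ _ "\<lambda>x. q powi x"]) (simp add: m_def n_def)
      show "q powi (int (\<nu> (Suc t)) - 2 * a' - 1) * d = M * N ^ 2"
        unfolding d_def s h1
        by (rule arg_cong[of _ _ "\<lambda>x. q powi x"]) (simp add: m_def n_def)
    qed
    have t1: "coef0 X (r a) (boxR X \<nu> t False a False a') (boxS t a' a) (boxS t a' (a - 1))
      = q powi (int (\<nu> (Suc t)) - 2 * a') * boxL X \<nu> t False a False a'
        + (1 - q powi (int (\<nu> (Suc t)) - 2 * a')) * boxL X \<nu> t False a True a'
        + q * X * boxL X \<nu> t False a True (a' + 1)"
      unfolding f g' if_False mult_1 coef_scale ids by (simp add: algebra_simps)
    have t2: "coef1 X (r a) (boxR X \<nu> t False a False a') (boxR X \<nu> t False (a - 1) False a')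
        (boxS t a' a) (boxS t a' (a - 1)) (boxS t a' (a - 2))
      = q powi (int (\<nu> (Suc t)) - 2 * a') * boxL X \<nu> t True a False a'
        + (1 - q powi (int (\<nu> (Suc t)) - 2 * a')) * boxL X \<nu> t True a True a'
        + q * X * boxL X \<nu> t True a True (a' + 1)"
    proof -
      have w: "q powi (int (\<nu> (Suc t)) - 2 * a') * (c * ((1 - d) * z))
          + (1 - q powi (int (\<nu> (Suc t)) - 2 * a')) * (c * z) = c * ((1 - q * M * N ^ 2) * z)"
        unfolding K1[symmetric] by (simp add: algebra_simps)
      show ?thesis
        unfolding f g' if_True if_False not_True_eq_False not_False_eq_True mult_1 w coef_scale ids
        by (simp add: algebra_simps)
    qed
    have t3: "coef0 X (r a) (boxR X \<nu> t False a False (a' + 1)) (boxS t (a' + 1) a) (boxS t (a' + 1) (a - 1))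
        + X * (q powi (int (\<nu> (Suc t)) - 2 * a' - 1)
            * coef0 X (r a) (boxR X \<nu> t False a True a') (boxS t a' a) (boxS t a' (a - 1)))
        + X * ((1 - q powi (int (\<nu> (Suc t)) - 2 * a' - 1))
            * coef0 X (r a) (boxR X \<nu> t False a False a') (boxS t a' a) (boxS t a' (a - 1)))
      = (1 + X) * (1 + q * X) * boxL X \<nu> t False a True (a' + 1)"
    proof -
      have w: "q powi (int (\<nu> (Suc t)) - 2 * a' - 1) * (c * ((1 - d) * u))
          + (1 - q powi (int (\<nu> (Suc t)) - 2 * a' - 1)) * (c * u) = c * ((1 - M * N ^ 2) * u)" for u
        unfolding K2[symmetric] by (simp add: algebra_simps)
      show ?thesis
        unfolding coef_combine
        unfolding f g' if_True if_False mult_1 w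
        unfolding coef_scale
        using arg_cong[OF ids(3), of "\<lambda>u. c * u"] by (simp only: distrib_left mult_ac)
    qed
    have t4: "coef1 X (r a) (boxR X \<nu> t False a False (a' + 1)) (boxR X \<nu> t False (a - 1) False (a' + 1))
          (boxS t (a' + 1) a) (boxS t (a' + 1) (a - 1)) (boxS t (a' + 1) (a - 2))
        + X * (q powi (int (\<nu> (Suc t)) - 2 * a' - 1)
            * coef1 X (r a) (boxR X \<nu> t False a True a') (boxR X \<nu> t False (a - 1) True a')
                (boxS t a' a) (boxS t a' (a - 1)) (boxS t a' (a - 2)))
        + X * ((1 - q powi (int (\<nu> (Suc t)) - 2 * a' - 1))
            * coef1 X (r a) (boxR X \<nu> t False a False a') (boxR X \<nu> t False (a - 1) False a')
                (boxS t a' a) (boxS t a' (a - 1)) (boxS t a' (a - 2)))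
      = (1 + X) * (1 + q * X) * boxL X \<nu> t True a True (a' + 1)"
    proof -
      have w: "q powi (int (\<nu> (Suc t)) - 2 * a' - 1) * (c * ((1 - d) * u))
          + (1 - q powi (int (\<nu> (Suc t)) - 2 * a' - 1)) * (c * u) = c * ((1 - M * N ^ 2) * u)" for u
        unfolding K2[symmetric] by (simp add: algebra_simps)
      show ?thesis
        unfolding coef_combine
        unfolding f g' if_True if_False mult_1 w
        unfolding coef_scale
        using arg_cong[OF ids(4), of "\<lambda>u. c * u"] by (simp only: distrib_left mult_ac)
    qed
    note t1 t2 t3 t4
  }
  note termwise = this
  {
    case 1
    show ?case
      unfolding R[OF 1] L sum_distrib_left sum.distrib[symmetric]
      by (rule sum.cong) (simp_all add: termwise(1,2)[OF 1] algebra_simps)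
  next
    case 2
    define k where "k = q powi (int (\<nu> (Suc t)) - 2 * a - 1)"
    have "(1 + q * X) * (pairR X \<nu> (Suc t) False (a + 1) + X * k * pairR X \<nu> (Suc t) True a
        + X * (1 - k) * pairR X \<nu> (Suc t) False a)
      = (1 + q * X) * pairR X \<nu> (Suc t) False (a + 1) + X * (k * ((1 + q * X) * pairR X \<nu> (Suc t) True a))
        + X * ((1 - k) * ((1 + q * X) * pairR X \<nu> (Suc t) False a))"
      by (simp add: algebra_simps)
    also have "\<dots> = (\<Sum>u\<in>S. L0 u * ((1 + X) * (1 + q * X) * boxL X \<nu> t False u True (a + 1))
        + L1 u * ((1 + X) * (1 + q * X) * boxL X \<nu> t True u True (a + 1)))"
    proof -
      have a1: "a + 1 \<ge> 0" using 2 by simp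
      have split: "(L0 u * x + L1 u * x1) + X * (k * (L0 u * y + L1 u * y1)) + X * ((1 - k) * (L0 u * z + L1 u * z1))
        = L0 u * (x + X * (k * y) + X * ((1 - k) * z)) + L1 u * (x1 + X * (k * y1) + X * ((1 - k) * z1))"
        for u x x1 y y1 z z1 by (simp add: algebra_simps)
      show ?thesis
        unfolding R[OF 2] R[OF a1] sum_distrib_left sum.distrib[symmetric] split
        unfolding k_def termwise(3,4)[OF 2] ..
    qed
    also have "\<dots> = (1 + q * X) * ((1 + X) * pairL X \<nu> (Suc t) True (a + 1))"
      unfolding L sum_distrib_left by (rule sum.cong) (simp_all add: algebra_simps)
    \<comment> \<open>Cancelling \<open>1 + q * X\<close> is the reason for taking X as a field
      element that avoids one value.\<close>
    finally show ?case
      using X unfolding k_def by simp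
  }
qed

end

end


section \<open>Weights of strips and the kernel\<close>

lemma Prod_any_lessThan:
  fixes f :: "nat \<Rightarrow> 'b::comm_monoid_mult"
  assumes "\<And>t. t \<ge> T \<Longrightarrow> f t = 1"
  shows "Prod_any f = (\<Prod>t<T. f t)"
proof (intro Prod_any.expand_superset subsetI)
  fix t assume "t \<in> {t. f t \<noteq> 1}"
  then show "t \<in> {..<T}" using assms[of t] by (cases "t < T") auto
qed simp

section \<open>The kernel and the Hall-Littlewood weights of strips\<close>

context generic_q
begin

definition kern :: "ptn \<Rightarrow> ptn \<Rightarrow> 'a" where
  "kern \<mu> \<theta> = Prod_any (\<lambda>t. q powi (int (parts \<theta> t) * (int (parts \<theta> t) - int (parts \<mu> t)))
     * qfac_inv q (int (parts \<theta> t) - int (parts \<theta> (Suc t))))"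

text \<open>For the conjugate partitions, the factors \<open>1 - q^...\<close>, one at the end of
  each run of boxes, form the Hall-Littlewood coefficient phi of a horizontal strip at parameter q.
  In addition each box carries a negative power of q.\<close>

definition down :: "ptn \<Rightarrow> ptn \<Rightarrow> 'a" where
  "down \<theta> \<nu> = Prod_any (\<lambda>t. if parts \<theta> t = parts \<nu> t then 1
     else q powi (- int (parts \<nu> t))
       * (if parts \<theta> (Suc t) = parts \<nu> (Suc t) then 1 - q ^ (parts \<theta> t - parts \<theta> (Suc t)) else 1))"

text \<open>The factors \<open>1 - q^...\<close>, attached to rows without a box just before a run
  of boxes, form the companion Hall-Littlewood coefficient psi.\<close>

definition up :: "ptn \<Rightarrow> ptn \<Rightarrow> 'a" where
  "up \<rho> \<nu> = Prod_any (\<lambda>t. if parts \<nu> t = parts \<rho> t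
     then (if parts \<nu> (Suc t) = parts \<rho> (Suc t) then 1 else 1 - q ^ (parts \<rho> t - parts \<rho> (Suc t)))
     else q ^ Suc (parts \<rho> t))"

lemma qfac_inv_0 [simp]: "qfac_inv q 0 = 1"
  by (simp add: qfac_inv_def)

lemma kern_prod:
  assumes "bounded_by T \<theta>"
  shows "kern \<mu> \<theta> = (\<Prod>t<T. q powi (int (parts \<theta> t) * (int (parts \<theta> t) - int (parts \<mu> t)))
     * qfac_inv q (int (parts \<theta> t) - int (parts \<theta> (Suc t))))"
  unfolding kern_def by (rule Prod_any_lessThan) (simp add: bounded_byD[OF assms])

lemma down_prod:
  assumes "bounded_by T \<theta>" "bounded_by T \<nu>"
  shows "down \<theta> \<nu> = (\<Prod>t<T. if parts \<theta> t = parts \<nu> t then 1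
     else q powi (- int (parts \<nu> t))
       * (if parts \<theta> (Suc t) = parts \<nu> (Suc t) then 1 - q ^ (parts \<theta> t - parts \<theta> (Suc t)) else 1))"
  unfolding down_def
  by (rule Prod_any_lessThan) (simp add: bounded_byD[OF assms(1)] bounded_byD[OF assms(2)])

lemma up_prod:
  assumes "bounded_by T \<rho>" "bounded_by T \<nu>"
  shows "up \<rho> \<nu> = (\<Prod>t<T. if parts \<nu> t = parts \<rho> t
     then (if parts \<nu> (Suc t) = parts \<rho> (Suc t) then 1 else 1 - q ^ (parts \<rho> t - parts \<rho> (Suc t)))
     else q ^ Suc (parts \<rho> t))"
  unfolding up_def
  by (rule Prod_any_lessThan) (simp add: bounded_byD[OF assms(1)] bounded_byD[OF assms(2)])

lemma strip_power:
  fixes X :: 'a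
  assumes "strip \<nu> \<theta>" "bounded_by T \<theta>" "bounded_by T \<nu>"
  shows "X ^ (psz \<theta> - psz \<nu>) = (\<Prod>t<T. if parts \<theta> t = parts \<nu> t then 1 else X)"
proof -
  have "psz \<theta> - psz \<nu> = (\<Sum>t<T. of_bool (parts \<theta> t \<noteq> parts \<nu> t))"
    using strip_psz[OF assms] by simp
  then have "X ^ (psz \<theta> - psz \<nu>) = (\<Prod>t<T. X ^ of_bool (parts \<theta> t \<noteq> parts \<nu> t))"
    by (simp only: power_sum)
  also have "\<dots> = (\<Prod>t<T. if parts \<theta> t = parts \<nu> t then 1 else X)"
    by (intro prod.cong) auto
  finally show ?thesis .
qed

lemma qfac_inv_plus_1: "n \<ge> 0 \<Longrightarrow> qfac_inv q (n + 1) * (1 - q powi (n + 1)) = qfac_inv q n"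
  using qfac_inv_shift[of "n + 1"] by (simp add: mult.commute)

lemma one_minus_q_powi_nat: "m \<le> n \<Longrightarrow> q ^ (n - m) = q powi (int n - int m)"
  by (metis of_nat_diff power_int_of_nat)

lemma powi_add: "q powi x * q powi y = q powi (x + y)"
  by (rule power_int_add[OF disjI1[OF q_nz], symmetric])

lemma finite_strip_bounded: "finite {\<theta>. strip \<nu> \<theta> \<and> bounded_by T \<theta> \<and> P \<theta>}"
proof (rule finite_subset[OF _ finite_psz_le])
  have "psz \<theta> \<le> psz \<nu> + T" if "strip \<nu> \<theta>" "bounded_by T \<theta>" for \<theta>
  proof -
    have "(\<Sum>t<T. of_bool (parts \<theta> t \<noteq> parts \<nu> t)) \<le> (\<Sum>t<T. 1 :: nat)"
      by (intro sum_mono) simp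
    then show ?thesis using strip_psz[OF that strip_bounded[OF that]] by simp
  qed
  then show "{\<theta>. strip \<nu> \<theta> \<and> bounded_by T \<theta> \<and> P \<theta>} \<subseteq> {\<theta>. psz \<theta> \<le> psz \<nu> + T}" by auto
qed

lemma finite_strip_below: "finite {\<kappa>. strip \<kappa> \<mu> \<and> P \<kappa>}"
  by (rule finite_subset[OF _ finite_psz_le[of "psz \<mu>"]]) (auto dest: strip_psz_le)


subsection \<open>The kernel and the removal of strips\<close>

context
  fixes \<mu> \<nu> :: ptn and X :: 'a
begin

text \<open>The weight of one box in row t, the same whether the strip is added to the second
  argument of the kernel or removed from the first. The two sides differ only in the interaction of
  adjacent rows.\<close>

definition uA :: "nat \<Rightarrow> 'a" where
  "uA t = X * q powi (int (parts \<nu> t) + 1 - int (parts \<mu> t))"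

definition wA :: "nat \<Rightarrow> bool \<Rightarrow> bool \<Rightarrow> 'a" where
  "wA t e e' = (if e then uA t else if e' then 1 - q ^ (parts \<nu> t - parts \<nu> (Suc t)) else 1)"

definition wB :: "nat \<Rightarrow> bool \<Rightarrow> bool \<Rightarrow> 'a" where
  "wB t e e' = (if e then (if e' then uA t else uA t * (1 - q ^ (parts \<mu> t - parts \<mu> (Suc t)))) else 1)"

text \<open>At the last row of a run of boxes, the change of the reciprocal q-factorial in the
  kernel cancels the factor of \<open>down\<close>. Just before a run it leaves
  \<open>1 - q ^ (parts \<nu> t - parts \<nu> (Suc t))\<close>, which also suppresses the sequences
  that are not partitions.\<close>

lemma sum_kern_down:
  assumes T: "bounded_by T \<nu>"
  shows "(\<Sum>\<theta> | strip \<nu> \<theta> \<and> bounded_by T \<theta>. kern \<mu> \<theta> * down \<theta> \<nu> * X ^ (psz \<theta> - psz \<nu>))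
    = kern \<mu> \<nu> * transfer wA (\<lambda>_. UNIV) T False"
proof -
  have "(\<Sum>\<theta> | strip \<nu> \<theta> \<and> bounded_by T \<theta>. kern \<mu> \<theta> * down \<theta> \<nu> * X ^ (psz \<theta> - psz \<nu>))
    = (\<Sum>e\<in>paths T (\<lambda>_. UNIV) no_box. kern \<mu> \<nu> * (\<Prod>t<T. wA t (e t) (e (Suc t))))"
  proof (subst sum_add_strip[OF T, where g = "\<lambda>\<theta>. kern \<mu> \<theta> * down \<theta> \<nu> * X ^ (psz \<theta> - psz \<nu>)"])
    fix e assume e: "e \<in> paths T (\<lambda>_. UNIV) no_box"
      and ok: "\<forall>t. parts \<nu> t + of_bool (e t) \<ge> parts \<nu> (Suc t) + of_bool (e (Suc t))"
    define \<theta> where "\<theta> = Abs_ptn (\<lambda>t. parts \<nu> t + of_bool (e t))"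
    have p: "parts \<theta> = (\<lambda>t. parts \<nu> t + of_bool (e t))"
      unfolding \<theta>_def using e T ok by (intro parts_Abs_ptn[of _ T]) (auto simp: paths_def bounded_by_def)
    have b: "bounded_by T \<theta>" and s: "strip \<nu> \<theta>"
      using e T by (auto simp: bounded_by_def p paths_def strip_def)
    have "kern \<mu> \<theta> * down \<theta> \<nu> * X ^ (psz \<theta> - psz \<nu>) = kern \<mu> \<nu> * (\<Prod>t<T. wA t (e t) (e (Suc t)))"
      unfolding kern_prod[OF b] kern_prod[OF T] down_prod[OF b T] strip_power[OF s b T] prod.distrib[symmetric]
    proof (rule prod.cong)
      fix t
      define n n' m where "n = int (parts \<nu> t)" and "n' = int (parts \<nu> (Suc t))" and "m = int (parts \<mu> t)"
      have le: "parts \<nu> (Suc t) \<le> parts \<nu> t" by (rule parts_antimono) simp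
      have okt: "parts \<nu> t + of_bool (e t) \<ge> parts \<nu> (Suc t) + of_bool (e (Suc t))" using ok by blast
      have nn: "n' \<le> n" using le by (simp add: n_def n'_def)
      have ex: "q powi ((n + 1) * (n + 1 - m)) * q powi (- n) = q powi (n * (n - m)) * q powi (n + 1 - m)"
        unfolding powi_add by (rule arg_cong[of _ _ "\<lambda>x. q powi x"]) (simp add: algebra_simps)
      have a: "q ^ (parts \<nu> t - parts \<nu> (Suc t)) = q powi (n - n')"
        unfolding n_def n'_def using le by (rule one_minus_q_powi_nat)
      have a1: "q ^ (Suc (parts \<nu> t) - parts \<nu> (Suc t)) = q powi (n - n' + 1)"
        using one_minus_q_powi_nat[of "parts \<nu> (Suc t)" "Suc (parts \<nu> t)"] le
        by (simp add: n_def n'_def algebra_simps)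
      have J1: "qfac_inv q (n - n' + 1) * (1 - q powi (n - n' + 1)) = qfac_inv q (n - n')"
        using nn by (intro qfac_inv_plus_1) simp
      have J2: "qfac_inv q (n - n' - 1) = qfac_inv q (n - n') * (1 - q powi (n - n'))"
        using qfac_inv_shift[of "n - n'"] by simp
      have i: "int (parts \<nu> t + of_bool True) = n + 1" "int (parts \<nu> (Suc t) + of_bool True) = n' + 1"
        "int (parts \<nu> t + of_bool False) = n" "int (parts \<nu> (Suc t) + of_bool False) = n'"
        by (simp_all add: n_def n'_def)
      show "q powi (int (parts \<theta> t) * (int (parts \<theta> t) - int (parts \<mu> t)))
          * qfac_inv q (int (parts \<theta> t) - int (parts \<theta> (Suc t)))
          * (if parts \<theta> t = parts \<nu> t then 1
             else q powi (- int (parts \<nu> t))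
               * (if parts \<theta> (Suc t) = parts \<nu> (Suc t) then 1 - q ^ (parts \<theta> t - parts \<theta> (Suc t)) else 1))
          * (if parts \<theta> t = parts \<nu> t then 1 else X)
        = q powi (int (parts \<nu> t) * (int (parts \<nu> t) - int (parts \<mu> t)))
          * qfac_inv q (int (parts \<nu> t) - int (parts \<nu> (Suc t))) * wA t (e t) (e (Suc t))"
      proof (cases "e t")
        case True
        show ?thesis
        proof (cases "e (Suc t)")
          case True
          have "q powi ((n + 1) * (n + 1 - m)) * qfac_inv q (n - n') * q powi (- n) * X
              = q powi (n * (n - m)) * qfac_inv q (n - n') * (X * q powi (n + 1 - m))"
            using arg_cong[OF ex, of "\<lambda>x. x * (qfac_inv q (n - n') * X)"] by (simp only: mult_ac)
          then show ?thesis using \<open>e t\<close> True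
            unfolding p wA_def uA_def n_def[symmetric] n'_def[symmetric] m_def[symmetric]
            by (simp add: n_def n'_def m_def algebra_simps)
        next
          case False
          have "q powi ((n + 1) * (n + 1 - m)) * qfac_inv q (n - n' + 1) * (q powi (- n) * (1 - q powi (n - n' + 1))) * X
              = q powi (n * (n - m)) * qfac_inv q (n - n') * (X * q powi (n + 1 - m))"
            using arg_cong[OF ex, of "\<lambda>x. x * (qfac_inv q (n - n') * X)"]
            unfolding J1[symmetric] by (simp only: mult_ac)
          then show ?thesis using \<open>e t\<close> False a1
            unfolding p wA_def uA_def by (simp add: n_def n'_def m_def algebra_simps)
        qed
      next
        case False
        have "qfac_inv q (int (parts \<nu> t + of_bool (e t)) - int (parts \<nu> (Suc t) + of_bool (e (Suc t))))
            = qfac_inv q (n - n') * (if e (Suc t) then 1 - q powi (n - n') else 1)"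
          using False J2 by (simp add: n_def n'_def algebra_simps)
        then show ?thesis
          using False unfolding p wA_def a by (simp add: n_def n'_def)
      qed
    qed simp
    then show "kern \<mu> \<nu> * (\<Prod>t<T. wA t (e t) (e (Suc t)))
        = kern \<mu> (Abs_ptn (\<lambda>t. parts \<nu> t + of_bool (e t))) * down (Abs_ptn (\<lambda>t. parts \<nu> t + of_bool (e t))) \<nu>
          * X ^ (psz (Abs_ptn (\<lambda>t. parts \<nu> t + of_bool (e t))) - psz \<nu>)"
      unfolding \<theta>_def by simp
  next
    fix e assume e: "e \<in> paths T (\<lambda>_. UNIV) no_box"
      and ex: "\<exists>t. \<not> e t \<and> e (Suc t) \<and> parts \<nu> t = parts \<nu> (Suc t)"
    then obtain t where t: "\<not> e t" "e (Suc t)" "parts \<nu> t = parts \<nu> (Suc t)" by blast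
    have "t < T" using e t(2) by (force simp: paths_def intro: ccontr)
    moreover have "wA t (e t) (e (Suc t)) = 0" using t by (simp add: wA_def)
    ultimately show "kern \<mu> \<nu> * (\<Prod>t<T. wA t (e t) (e (Suc t))) = 0"
      by (auto intro!: prod_zero)
  qed simp
  also have "\<dots> = kern \<mu> \<nu> * transfer wA (\<lambda>_. UNIV) T False"
    by (simp add: sum_distrib_left[symmetric] transfer_eq_sum)
  finally show ?thesis .
qed

text \<open>Here the strip changes only the first argument of the kernel. No reciprocal q-factorial
  is affected, so the run-end factors of \<open>down\<close> survive in \<open>wB\<close>.\<close>

lemma sum_down_kern:
  assumes T: "bounded_by T \<mu>" "bounded_by T \<nu>"
  shows "(\<Sum>\<kappa> | strip \<kappa> \<mu>. down \<mu> \<kappa> * kern \<kappa> \<nu> * X ^ (psz \<mu> - psz \<kappa>))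
    = kern \<mu> \<nu> * transfer wB (\<lambda>_. UNIV) T False"
proof -
  have "(\<Sum>\<kappa> | strip \<kappa> \<mu>. down \<mu> \<kappa> * kern \<kappa> \<nu> * X ^ (psz \<mu> - psz \<kappa>))
    = (\<Sum>e\<in>paths T (\<lambda>_. UNIV) no_box. kern \<mu> \<nu> * (\<Prod>t<T. wB t (e t) (e (Suc t))))"
  proof (subst sum_remove_strip[OF T(1), where g = "\<lambda>\<kappa>. down \<mu> \<kappa> * kern \<kappa> \<nu> * X ^ (psz \<mu> - psz \<kappa>)"])
    fix e assume e: "e \<in> paths T (\<lambda>_. UNIV) no_box" and pos: "\<forall>t. e t \<longrightarrow> parts \<mu> t > 0"
      and ok: "\<forall>t. parts \<mu> t - of_bool (e t) \<ge> parts \<mu> (Suc t) - of_bool (e (Suc t))"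
    define \<kappa> where "\<kappa> = Abs_ptn (\<lambda>t. parts \<mu> t - of_bool (e t))"
    have p: "parts \<kappa> = (\<lambda>t. parts \<mu> t - of_bool (e t))"
      unfolding \<kappa>_def using e T ok by (intro parts_Abs_ptn[of _ T]) (auto simp: paths_def bounded_by_def)
    have eq: "parts \<mu> t = parts \<kappa> t \<longleftrightarrow> \<not> e t" for t
      using pos[rule_format, of t] by (cases "e t") (auto simp: p)
    have ik: "int (parts \<kappa> t) = int (parts \<mu> t) - of_bool (e t)" for t
      using pos[rule_format, of t] by (cases "e t") (auto simp: p)
    have s: "strip \<kappa> \<mu>"
      unfolding strip_def
    proof
      fix t
      show "parts \<mu> t = parts \<kappa> t \<or> parts \<mu> t = Suc (parts \<kappa> t)"
        using pos[rule_format, of t] by (cases "e t") (auto simp: p)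
    qed
    have b: "bounded_by T \<kappa>" using s T(1) by (rule strip_bounded)
    have "down \<mu> \<kappa> * kern \<kappa> \<nu> * X ^ (psz \<mu> - psz \<kappa>) = kern \<mu> \<nu> * (\<Prod>t<T. wB t (e t) (e (Suc t)))"
      unfolding kern_prod[OF T(2)] down_prod[OF T(1) b] strip_power[OF s T(1) b] prod.distrib[symmetric]
    proof (rule prod.cong)
      fix t
      define n m J where "n = int (parts \<nu> t)" and "m = int (parts \<mu> t)"
        and "J = qfac_inv q (int (parts \<nu> t) - int (parts \<nu> (Suc t)))"
      have ex: "q powi (- (m - 1)) * q powi (n * (n - (m - 1))) = q powi (n * (n - m)) * q powi (n + 1 - m)"
        unfolding powi_add by (rule arg_cong[of _ _ "\<lambda>x. q powi x"]) (simp add: algebra_simps)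
      show "(if parts \<mu> t = parts \<kappa> t then 1
            else q powi (- int (parts \<kappa> t))
              * (if parts \<mu> (Suc t) = parts \<kappa> (Suc t) then 1 - q ^ (parts \<mu> t - parts \<mu> (Suc t)) else 1))
          * (q powi (int (parts \<nu> t) * (int (parts \<nu> t) - int (parts \<kappa> t)))
            * qfac_inv q (int (parts \<nu> t) - int (parts \<nu> (Suc t))))
          * (if parts \<mu> t = parts \<kappa> t then 1 else X)
        = q powi (int (parts \<nu> t) * (int (parts \<nu> t) - int (parts \<mu> t)))
          * qfac_inv q (int (parts \<nu> t) - int (parts \<nu> (Suc t))) * wB t (e t) (e (Suc t))"
      proof (cases "e t")
        case True
        define w where "w = (if e (Suc t) then 1 else 1 - q ^ (parts \<mu> t - parts \<mu> (Suc t)))"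
        have "q powi (- (m - 1)) * w * (q powi (n * (n - (m - 1))) * J) * X
            = q powi (n * (n - m)) * J * (X * q powi (n + 1 - m) * w)"
          using arg_cong[OF ex, of "\<lambda>x. x * (w * J * X)"] by (simp only: mult_ac)
        then show ?thesis
          unfolding eq ik using True
          by (cases "e (Suc t)") (auto simp: wB_def uA_def w_def n_def m_def J_def mult_ac)
      next
        case False
        then show ?thesis unfolding eq ik by (simp add: wB_def)
      qed
    qed simp
    then show "kern \<mu> \<nu> * (\<Prod>t<T. wB t (e t) (e (Suc t)))
        = down \<mu> (Abs_ptn (\<lambda>t. parts \<mu> t - of_bool (e t))) * kern (Abs_ptn (\<lambda>t. parts \<mu> t - of_bool (e t))) \<nu>
          * X ^ (psz \<mu> - psz (Abs_ptn (\<lambda>t. parts \<mu> t - of_bool (e t))))"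
      unfolding \<kappa>_def by simp
  next
    fix e assume e: "e \<in> paths T (\<lambda>_. UNIV) no_box"
      and ex: "\<exists>t. e t \<and> \<not> e (Suc t) \<and> parts \<mu> t = parts \<mu> (Suc t)"
    then obtain t where t: "e t" "\<not> e (Suc t)" "parts \<mu> t = parts \<mu> (Suc t)" by blast
    have "t < T" using e t(1) by (force simp: paths_def intro: ccontr)
    moreover have "wB t (e t) (e (Suc t)) = 0" using t by (simp add: wB_def)
    ultimately show "kern \<mu> \<nu> * (\<Prod>t<T. wB t (e t) (e (Suc t))) = 0"
      by (auto intro!: prod_zero)
  qed simp
  also have "\<dots> = kern \<mu> \<nu> * transfer wB (\<lambda>_. UNIV) T False"
    by (simp add: sum_distrib_left[symmetric] transfer_eq_sum)
  finally show ?thesis .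
qed

text \<open>Boxes may be added in arbitrarily many empty rows, each further row costing
  \<open>q * X\<close>. Subtracting \<open>q * X\<close> times the sum with bound T from the sum
  with bound T + 1 is a finite substitute for multiplying the infinite sum by
  \<open>1 - q * X\<close>.\<close>

lemma kern_exchange:
  assumes T: "bounded_by T \<mu>" "bounded_by T \<nu>"
  shows "(\<Sum>\<theta> | strip \<nu> \<theta> \<and> bounded_by (Suc T) \<theta>. kern \<mu> \<theta> * down \<theta> \<nu> * X ^ (psz \<theta> - psz \<nu>))
      + - q * X * (\<Sum>\<theta> | strip \<nu> \<theta> \<and> bounded_by T \<theta>. kern \<mu> \<theta> * down \<theta> \<nu> * X ^ (psz \<theta> - psz \<nu>))
    = (\<Sum>\<kappa> | strip \<kappa> \<mu>. down \<mu> \<kappa> * kern \<kappa> \<nu> * X ^ (psz \<mu> - psz \<kappa>))"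
proof -
  have rel: "uA (Suc t) * q ^ (parts \<nu> t - parts \<nu> (Suc t)) = uA t * q ^ (parts \<mu> t - parts \<mu> (Suc t))" for t
  proof -
    have "parts \<nu> (Suc t) \<le> parts \<nu> t" "parts \<mu> (Suc t) \<le> parts \<mu> t"
      by (rule parts_antimono; simp)+
    note e = this[THEN one_minus_q_powi_nat]
    show ?thesis unfolding uA_def e mult.assoc powi_add
      by (rule arg_cong[of _ _ "\<lambda>x. X * q powi x"]) simp
  qed
  have wA: "wA = (\<lambda>t e e'. if e then uA t else if e' then 1 - q ^ (parts \<nu> t - parts \<nu> (Suc t)) else 1)"
    and wB: "wB = (\<lambda>t e e'. if e then (if e' then uA t else uA t * (1 - q ^ (parts \<mu> t - parts \<mu> (Suc t)))) else 1)"
    by (simp_all add: wA_def wB_def fun_eq_iff)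
  have G: "(1 - uA T) * transfer wA (\<lambda>_. UNIV) T False + uA T * transfer wA (\<lambda>_. UNIV) T True
      = transfer wB (\<lambda>_. UNIV) T False"
    unfolding wA wB by (rule transfer_add_remove(2)) (rule rel)
  have "uA T = X * q"
    using bounded_byD[OF T(1), of T] bounded_byD[OF T(2), of T] by (simp add: uA_def)
  moreover have "transfer wA (\<lambda>_. UNIV) (Suc T) False
      = transfer wA (\<lambda>_. UNIV) T False + uA T * transfer wA (\<lambda>_. UNIV) T True"
    by (simp add: transfer.simps(2) sum_UNIV_bool wA_def)
  ultimately have "transfer wA (\<lambda>_. UNIV) (Suc T) False + - q * X * transfer wA (\<lambda>_. UNIV) T False
      = transfer wB (\<lambda>_. UNIV) T False"
    using G by (simp add: algebra_simps)
  then have "kern \<mu> \<nu> * (transfer wA (\<lambda>_. UNIV) (Suc T) False + - q * X * transfer wA (\<lambda>_. UNIV) T False)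
      = kern \<mu> \<nu> * transfer wB (\<lambda>_. UNIV) T False"
    by (rule arg_cong)
  then show ?thesis
    unfolding sum_kern_down[OF T(2)] sum_kern_down[OF bounded_by_mono[OF T(2) le_SucI[OF order_refl]]]
      sum_down_kern[OF T]
    by (simp add: algebra_simps)
qed

end

lemma kern_exchange_graded:
  "(\<Sum>\<theta> | strip \<nu> \<theta> \<and> psz \<theta> = psz \<nu> + i. kern \<mu> \<theta> * down \<theta> \<nu>)
     - (if i = 0 then 0 else q * (\<Sum>\<theta> | strip \<nu> \<theta> \<and> psz \<theta> = psz \<nu> + (i - 1). kern \<mu> \<theta> * down \<theta> \<nu>))
   = (\<Sum>\<kappa> | strip \<kappa> \<mu> \<and> psz \<mu> = psz \<kappa> + i. down \<mu> \<kappa> * kern \<kappa> \<nu>)"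
proof -
  \<comment> \<open>Large enough that all partitions of the sizes to be compared satisfy the bound,
    so that the bound disappears from the graded statement.\<close>
  define T where "T = psz \<mu> + psz \<nu> + i"
  have T: "bounded_by T \<mu>" "bounded_by T \<nu>" by (auto simp: T_def intro: bounded_by_size)
  define A B where "A = {\<theta>. strip \<nu> \<theta> \<and> bounded_by (Suc T) \<theta>}" and "B = {\<theta>. strip \<nu> \<theta> \<and> bounded_by T \<theta>}"
  have fin: "finite A" "finite B" "finite {\<kappa>. strip \<kappa> \<mu>}"
    using finite_strip_bounded[of \<nu> _ "\<lambda>_. True"] finite_strip_below[of \<mu> "\<lambda>_. True"]
    by (simp_all add: A_def B_def)
  have d: "psz \<theta> - psz \<nu> = j \<longleftrightarrow> psz \<theta> = psz \<nu> + j" if "strip \<nu> \<theta>" for \<nu> \<theta> j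
    using strip_psz_le[OF that] by auto
  have bb: "bounded_by T' \<theta>" if "psz \<theta> = psz \<nu> + j" "j \<le> i" "T \<le> T'" for \<theta> j T'
    using that by (intro bounded_by_size) (simp add: T_def)
  have sets: "{\<theta>. \<theta> \<in> A \<and> psz \<theta> - psz \<nu> = i} = {\<theta>. strip \<nu> \<theta> \<and> psz \<theta> = psz \<nu> + i}"
    "{\<theta>. \<theta> \<in> B \<and> psz \<theta> - psz \<nu> = i - 1} = {\<theta>. strip \<nu> \<theta> \<and> psz \<theta> = psz \<nu> + (i - 1)}"
    "{\<kappa>. \<kappa> \<in> {\<kappa>. strip \<kappa> \<mu>} \<and> psz \<mu> - psz \<kappa> = i} = {\<kappa>. strip \<kappa> \<mu> \<and> psz \<mu> = psz \<kappa> + i}"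
    by (auto simp: A_def B_def d strip_psz_le intro: bb)
  have "(\<Sum>\<theta> | \<theta> \<in> A \<and> psz \<theta> - psz \<nu> = i. kern \<mu> \<theta> * down \<theta> \<nu>)
      + (if i = 0 then 0 else - q * (\<Sum>\<theta> | \<theta> \<in> B \<and> psz \<theta> - psz \<nu> = i - 1. kern \<mu> \<theta> * down \<theta> \<nu>))
    = (\<Sum>\<kappa> | \<kappa> \<in> {\<kappa>. strip \<kappa> \<mu>} \<and> psz \<mu> - psz \<kappa> = i. down \<mu> \<kappa> * kern \<kappa> \<nu>)
      + (if i = 0 then 0 else 0 * (\<Sum>\<kappa> | \<kappa> \<in> {\<kappa>. strip \<kappa> \<mu>} \<and> psz \<mu> - psz \<kappa> = i - 1. down \<mu> \<kappa> * kern \<kappa> \<nu>))"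
    using kern_exchange[OF T] by (intro coeffs_eq_of_values_eq[where E = "{}"] fin) (simp_all add: A_def B_def)
  then show ?thesis unfolding sets by (simp split: if_splits)
qed

end


context generic_q
begin

subsection \<open>Adding and removing strips\<close>

context
  fixes \<rho> \<sigma> :: ptn and X :: 'a
  assumes near: "\<And>t. parts \<sigma> t = parts \<rho> t \<or> parts \<sigma> t = Suc (parts \<rho> t) \<or> parts \<rho> t = Suc (parts \<sigma> t)"
begin

text \<open>If e tells whether the intermediate partition differs from \<rho> in a row,
  \<open>fl\<close> tells whether it differs from \<sigma> there.\<close>

definition fl :: "nat \<Rightarrow> bool \<Rightarrow> bool" where
  "fl t e = (if parts \<sigma> t = parts \<rho> t then e else \<not> e)"

text \<open>In a row where \<rho> and \<sigma> differ the intermediate part is forced, and its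
  weight is the same on both sides of the exchange. Where they agree, a box gives
  \<open>q ^ Suc (parts \<rho> t)\<close> from \<open>up\<close> and the inverse of
  \<open>q ^ parts \<rho> t\<close> from \<open>down\<close>, hence \<open>q * X\<close> in
  \<open>st\<close>.\<close>

definition base :: "nat \<Rightarrow> 'a" where
  "base t = (if parts \<sigma> t = Suc (parts \<rho> t) then X * q ^ Suc (parts \<rho> t) else q powi (- int (parts \<sigma> t)))"

definition st :: "nat \<Rightarrow> bool \<Rightarrow> 'a" where
  "st t e = (if parts \<sigma> t = parts \<rho> t then (if e then q * X else 1) else base t)"

definition facP :: "nat \<Rightarrow> 'a" where "facP t = 1 - q ^ (parts \<rho> t - parts \<rho> (Suc t))"
definition facQ :: "nat \<Rightarrow> 'a" where "facQ t = 1 - q ^ (Suc (parts \<sigma> t) - parts \<sigma> (Suc t))"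

definition wU :: "nat \<Rightarrow> bool \<Rightarrow> bool \<Rightarrow> 'a" where
  "wU t e e' = st t e * (if \<not> e \<and> e' then facP t else 1) * (if fl t e \<and> \<not> fl (Suc t) e' then facQ t else 1)"

definition wD :: "nat \<Rightarrow> bool \<Rightarrow> bool \<Rightarrow> 'a" where
  "wD t h h' = st t h * (if h \<and> \<not> h' then facP t else 1) * (if \<not> fl t h \<and> fl (Suc t) h' then facQ t else 1)"

definition sU :: "nat \<Rightarrow> bool set" where
  "sU t = (if parts \<sigma> t = parts \<rho> t then UNIV else if parts \<sigma> t = Suc (parts \<rho> t) then {True} else {False})"

definition sD :: "nat \<Rightarrow> bool set" where
  "sD t = (if parts \<sigma> t = parts \<rho> t then UNIV else if parts \<sigma> t = Suc (parts \<rho> t) then {False} else {True})"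

lemma sum_up_down:
  assumes T: "bounded_by T \<rho>" "bounded_by T \<sigma>"
  shows "(\<Sum>\<nu> | strip \<rho> \<nu> \<and> strip \<sigma> \<nu> \<and> bounded_by T \<nu>. up \<rho> \<nu> * down \<nu> \<sigma> * X ^ (psz \<nu> - psz \<rho>))
    = transfer wU sU T False"
proof -
  have set: "{\<nu>. strip \<rho> \<nu> \<and> strip \<sigma> \<nu> \<and> bounded_by T \<nu>}
      = {\<nu>. strip \<rho> \<nu> \<and> bounded_by T \<nu> \<and> (\<forall>t<T. (parts \<nu> t \<noteq> parts \<rho> t) \<in> sU t)}"
  proof (rule Collect_cong)
    fix \<nu>
    have pt: "(parts \<nu> t = parts \<sigma> t \<or> parts \<nu> t = Suc (parts \<sigma> t)) \<longleftrightarrow> (parts \<nu> t \<noteq> parts \<rho> t) \<in> sU t"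
      if "strip \<rho> \<nu>" for t
      using near[of t] that[unfolded strip_def, rule_format, of t] unfolding sU_def
      by (elim disjE) simp_all
    have z: "parts \<nu> t = parts \<sigma> t" if "bounded_by T \<nu>" "\<not> t < T" for t
      using bounded_byD[OF that(1), of t] bounded_byD[OF T(2), of t] that(2) by simp
    show "strip \<rho> \<nu> \<and> strip \<sigma> \<nu> \<and> bounded_by T \<nu>
      \<longleftrightarrow> strip \<rho> \<nu> \<and> bounded_by T \<nu> \<and> (\<forall>t<T. (parts \<nu> t \<noteq> parts \<rho> t) \<in> sU t)"
      unfolding strip_def[of \<sigma>] using pt z by blast
  qed
  have "(\<Sum>e\<in>paths T sU no_box. \<Prod>t<T. wU t (e t) (e (Suc t)))
    = (\<Sum>\<nu> | strip \<rho> \<nu> \<and> bounded_by T \<nu> \<and> (\<forall>t<T. (parts \<nu> t \<noteq> parts \<rho> t) \<in> sU t).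
        up \<rho> \<nu> * down \<nu> \<sigma> * X ^ (psz \<nu> - psz \<rho>))"
  proof (rule sum_add_strip[OF T(1)])
    fix e assume e: "e \<in> paths T sU no_box"
      and ok: "\<forall>t. parts \<rho> t + of_bool (e t) \<ge> parts \<rho> (Suc t) + of_bool (e (Suc t))"
    define \<nu> where "\<nu> = Abs_ptn (\<lambda>t. parts \<rho> t + of_bool (e t))"
    have p: "parts \<nu> = (\<lambda>t. parts \<rho> t + of_bool (e t))"
      unfolding \<nu>_def using e T ok by (intro parts_Abs_ptn[of _ T]) (auto simp: paths_def bounded_by_def)
    have b: "bounded_by T \<nu>" and s: "strip \<rho> \<nu>"
      using e T by (auto simp: bounded_by_def p paths_def strip_def)
    have eU: "e t \<in> sU t" for t
    proof (cases "t < T")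
      case False
      then show ?thesis
        using bounded_byD[OF T(1), of t] bounded_byD[OF T(2), of t] by (simp add: sU_def)
    qed (use e in \<open>simp add: paths_def\<close>)
    have eqr: "parts \<nu> t = parts \<rho> t \<longleftrightarrow> \<not> e t" for t by (simp add: p)
    have eqs: "parts \<nu> t = parts \<sigma> t \<longleftrightarrow> \<not> fl t (e t)" for t
      using eU[of t] near[of t] by (cases "e t") (auto simp: p sU_def fl_def split: if_splits)
    have sg: "parts \<nu> t = Suc (parts \<sigma> t)" if "fl t (e t)" for t
      using eU[of t] near[of t] that by (cases "e t") (auto simp: p sU_def fl_def split: if_splits)
    show "(\<Prod>t<T. wU t (e t) (e (Suc t)))
        = up \<rho> (Abs_ptn (\<lambda>t. parts \<rho> t + of_bool (e t))) * down (Abs_ptn (\<lambda>t. parts \<rho> t + of_bool (e t))) \<sigma>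
          * X ^ (psz (Abs_ptn (\<lambda>t. parts \<rho> t + of_bool (e t))) - psz \<rho>)"
      unfolding \<nu>_def[symmetric] up_prod[OF T(1) b] down_prod[OF b T(2)] strip_power[OF s b T(1)]
        prod.distrib[symmetric] eqr eqs
    proof (rule prod.cong)
      fix t
      have Q: "1 - q ^ (parts \<nu> t - parts \<nu> (Suc t)) = facQ t" if "fl t (e t)" "\<not> fl (Suc t) (e (Suc t))"
        using sg[OF that(1)] eqs[of "Suc t"] that(2) by (simp add: facQ_def)
      have site: "st t (e t) = (if e t then q ^ Suc (parts \<rho> t) else 1)
          * (if fl t (e t) then q powi (- int (parts \<sigma> t)) else 1) * (if e t then X else 1)"
        using eU[of t] near[of t] q_nz
        by (cases "e t") (auto simp: st_def base_def fl_def sU_def power_int_minus divide_simps split: if_splits)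
      show "wU t (e t) (e (Suc t)) = (if \<not> e t
            then if \<not> e (Suc t) then 1 else 1 - q ^ (parts \<rho> t - parts \<rho> (Suc t))
            else q ^ Suc (parts \<rho> t))
          * (if \<not> fl t (e t) then 1 else q powi (- int (parts \<sigma> t))
              * (if \<not> fl (Suc t) (e (Suc t)) then 1 - q ^ (parts \<nu> t - parts \<nu> (Suc t)) else 1))
          * (if \<not> e t then 1 else X)"
        unfolding wU_def site facP_def using Q by auto
    qed simp
  next
    fix e assume e: "e \<in> paths T sU no_box"
      and "\<exists>t. \<not> e t \<and> e (Suc t) \<and> parts \<rho> t = parts \<rho> (Suc t)"
    then obtain t where t: "\<not> e t" "e (Suc t)" "parts \<rho> t = parts \<rho> (Suc t)" by blast
    have "t < T" using e t(2) by (force simp: paths_def intro: ccontr)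
    moreover have "wU t (e t) (e (Suc t)) = 0" using t by (simp add: wU_def facP_def)
    ultimately show "(\<Prod>t<T. wU t (e t) (e (Suc t))) = 0"
      by (auto intro!: prod_zero)
  qed
  then show ?thesis
    unfolding set by (simp add: transfer_eq_sum)
qed

lemma sum_down_up:
  assumes T: "bounded_by T \<rho>" "bounded_by T \<sigma>"
  shows "(\<Sum>\<tau> | strip \<tau> \<rho> \<and> strip \<tau> \<sigma>. down \<rho> \<tau> * up \<tau> \<sigma> * X ^ (psz \<sigma> - psz \<tau>))
    = transfer wD sD T False"
proof -
  have set: "{\<tau>. strip \<tau> \<rho> \<and> strip \<tau> \<sigma>}
      = {\<tau>. strip \<tau> \<rho> \<and> (\<forall>t<T. (parts \<tau> t \<noteq> parts \<rho> t) \<in> sD t)}"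
  proof (rule Collect_cong)
    fix \<tau>
    have pt: "(parts \<sigma> t = parts \<tau> t \<or> parts \<sigma> t = Suc (parts \<tau> t)) \<longleftrightarrow> (parts \<tau> t \<noteq> parts \<rho> t) \<in> sD t"
      if "strip \<tau> \<rho>" for t
      using near[of t] that[unfolded strip_def, rule_format, of t] unfolding sD_def
      by (elim disjE) simp_all
    have z: "parts \<sigma> t = parts \<tau> t" if "strip \<tau> \<rho>" "\<not> t < T" for t
      using bounded_byD[OF strip_bounded[OF that(1) T(1)], of t] bounded_byD[OF T(2), of t] that(2) by simp
    show "strip \<tau> \<rho> \<and> strip \<tau> \<sigma>
      \<longleftrightarrow> strip \<tau> \<rho> \<and> (\<forall>t<T. (parts \<tau> t \<noteq> parts \<rho> t) \<in> sD t)"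
      unfolding strip_def[of _ \<sigma>] using pt z by blast
  qed
  have "(\<Sum>e\<in>paths T sD no_box. \<Prod>t<T. wD t (e t) (e (Suc t)))
    = (\<Sum>\<tau> | strip \<tau> \<rho> \<and> (\<forall>t<T. (parts \<tau> t \<noteq> parts \<rho> t) \<in> sD t).
        down \<rho> \<tau> * up \<tau> \<sigma> * X ^ (psz \<sigma> - psz \<tau>))"
  proof (rule sum_remove_strip[OF T(1)])
    fix e assume e: "e \<in> paths T sD no_box" and pos: "\<forall>t. e t \<longrightarrow> parts \<rho> t > 0"
      and ok: "\<forall>t. parts \<rho> t - of_bool (e t) \<ge> parts \<rho> (Suc t) - of_bool (e (Suc t))"
    define \<tau> where "\<tau> = Abs_ptn (\<lambda>t. parts \<rho> t - of_bool (e t))"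
    have p: "parts \<tau> = (\<lambda>t. parts \<rho> t - of_bool (e t))"
      unfolding \<tau>_def using e T ok by (intro parts_Abs_ptn[of _ T]) (auto simp: paths_def bounded_by_def)
    have rt: "parts \<rho> t = parts \<tau> t + of_bool (e t)" for t
      using pos[rule_format, of t] by (cases "e t") (auto simp: p)
    have eU: "e t \<in> sD t" for t
    proof (cases "t < T")
      case False
      then show ?thesis
        using bounded_byD[OF T(1), of t] bounded_byD[OF T(2), of t] by (simp add: sD_def)
    qed (use e in \<open>simp add: paths_def\<close>)
    have st': "parts \<sigma> t = parts \<tau> t + of_bool (fl t (e t))" for t
      using eU[of t] near[of t] rt[of t]
      by (cases "e t") (auto simp: sD_def fl_def split: if_splits)
    have s: "strip \<tau> \<rho>" "strip \<tau> \<sigma>"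
      unfolding strip_def rt st' by (auto simp: of_bool_def)
    have b: "bounded_by T \<tau>" using s(1) T(1) by (rule strip_bounded)
    have eqr: "parts \<rho> t = parts \<tau> t \<longleftrightarrow> \<not> e t" for t by (simp add: rt)
    have eqs: "parts \<sigma> t = parts \<tau> t \<longleftrightarrow> \<not> fl t (e t)" for t by (simp add: st')
    show "(\<Prod>t<T. wD t (e t) (e (Suc t)))
        = down \<rho> (Abs_ptn (\<lambda>t. parts \<rho> t - of_bool (e t))) * up (Abs_ptn (\<lambda>t. parts \<rho> t - of_bool (e t))) \<sigma>
          * X ^ (psz \<sigma> - psz (Abs_ptn (\<lambda>t. parts \<rho> t - of_bool (e t))))"
      unfolding \<tau>_def[symmetric] up_prod[OF b T(2)] down_prod[OF T(1) b] strip_power[OF s(2) T(2) b]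
        prod.distrib[symmetric] eqr eqs
    proof (rule prod.cong)
      fix t
      have Q: "1 - q ^ (parts \<tau> t - parts \<tau> (Suc t)) = facQ t" if "\<not> fl t (e t)" "fl (Suc t) (e (Suc t))"
        using st'[of t] st'[of "Suc t"] that by (simp add: facQ_def)
      have site: "st t (e t) = (if e t then q powi (- int (parts \<tau> t)) else 1)
          * (if fl t (e t) then q ^ Suc (parts \<tau> t) else 1) * (if fl t (e t) then X else 1)"
      proof -
        define a E F where "a = parts \<tau> t" and "E = e t" and "F = fl t (e t)"
        have r: "parts \<rho> t = a + of_bool E" "parts \<sigma> t = a + of_bool F"
          using rt[of t] st'[of t] by (simp_all only: a_def E_def F_def)
        show ?thesis
          unfolding st_def base_def r a_def[symmetric] F_def[symmetric]
          unfolding E_def[symmetric] using q_nz by (cases E; cases F) (simp_all add: power_int_minus)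
      qed
      show "wD t (e t) (e (Suc t)) = (if \<not> e t then 1 else q powi (- int (parts \<tau> t))
              * (if \<not> e (Suc t) then 1 - q ^ (parts \<rho> t - parts \<rho> (Suc t)) else 1))
          * (if \<not> fl t (e t)
            then if \<not> fl (Suc t) (e (Suc t)) then 1 else 1 - q ^ (parts \<tau> t - parts \<tau> (Suc t))
            else q ^ Suc (parts \<tau> t))
          * (if \<not> fl t (e t) then 1 else X)"
        unfolding wD_def site facP_def using Q by auto
    qed simp
  next
    fix e assume e: "e \<in> paths T sD no_box"
      and "\<exists>t. e t \<and> \<not> e (Suc t) \<and> parts \<rho> t = parts \<rho> (Suc t)"
    then obtain t where t: "e t" "\<not> e (Suc t)" "parts \<rho> t = parts \<rho> (Suc t)" by blast
    have "t < T" using e t(1) by (force simp: paths_def intro: ccontr)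
    moreover have "wD t (e t) (e (Suc t)) = 0" using t by (simp add: wD_def facP_def)
    ultimately show "(\<Prod>t<T. wD t (e t) (e (Suc t))) = 0"
      by (auto intro!: prod_zero)
  qed
  then show ?thesis
    unfolding set by (simp add: transfer_eq_sum)
qed

text \<open>As in \<open>kern_exchange\<close>, the left-hand side stands for
  \<open>1 - q * X\<close> times an infinite sum over common upper neighbours; the lower neighbours
  form a finite set, so no such device is required on the right.\<close>

lemma strips_exchange:
  assumes T: "bounded_by T \<rho>" "bounded_by T \<sigma>" and X: "1 - q ^ 2 * X \<noteq> 0"
  shows "(\<Sum>\<nu> | strip \<rho> \<nu> \<and> strip \<sigma> \<nu> \<and> bounded_by (Suc T) \<nu>. up \<rho> \<nu> * down \<nu> \<sigma> * X ^ (psz \<nu> - psz \<rho>))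
     + - q * X * (\<Sum>\<nu> | strip \<rho> \<nu> \<and> strip \<sigma> \<nu> \<and> bounded_by T \<nu>. up \<rho> \<nu> * down \<nu> \<sigma> * X ^ (psz \<nu> - psz \<rho>))
   = (1 + - (q ^ 2) * X) * (\<Sum>\<tau> | strip \<tau> \<rho> \<and> strip \<tau> \<sigma>. down \<rho> \<tau> * up \<tau> \<sigma> * X ^ (psz \<sigma> - psz \<tau>))"
proof -
  have dec: "parts \<rho> (Suc t) \<le> parts \<rho> t" "parts \<sigma> (Suc t) \<le> parts \<sigma> t" for t
    by (rule parts_antimono; simp)+
  note raw = transfer_exchange[where \<sigma> = "parts \<sigma>" and \<rho> = "parts \<rho>" and b = base and q = q and X = X and T = T,
      OF near dec X]
  have defs: "(\<lambda>t e e'. (if parts \<sigma> t = parts \<rho> t then if e then q * X else 1 else base t)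
        * (if \<not> e \<and> e' then 1 - q ^ (parts \<rho> t - parts \<rho> (Suc t)) else 1)
        * (if (if parts \<sigma> t = parts \<rho> t then e else \<not> e)
              \<and> \<not> (if parts \<sigma> (Suc t) = parts \<rho> (Suc t) then e' else \<not> e')
            then 1 - q ^ (Suc (parts \<sigma> t) - parts \<sigma> (Suc t)) else 1)) = wU"
    "(\<lambda>t h h'. (if parts \<sigma> t = parts \<rho> t then if h then q * X else 1 else base t)
        * (if h \<and> \<not> h' then 1 - q ^ (parts \<rho> t - parts \<rho> (Suc t)) else 1)
        * (if \<not> (if parts \<sigma> t = parts \<rho> t then h else \<not> h)
              \<and> (if parts \<sigma> (Suc t) = parts \<rho> (Suc t) then h' else \<not> h')
            then 1 - q ^ (Suc (parts \<sigma> t) - parts \<sigma> (Suc t)) else 1)) = wD"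
    "(\<lambda>t. if parts \<sigma> t = parts \<rho> t then UNIV else if parts \<sigma> t = Suc (parts \<rho> t) then {True} else {False}) = sU"
    "(\<lambda>t. if parts \<sigma> t = parts \<rho> t then UNIV else if parts \<sigma> t = Suc (parts \<rho> t) then {False} else {True}) = sD"
    by (simp_all add: fun_eq_iff wU_def wD_def st_def fl_def facP_def facQ_def sU_def sD_def)
  have z: "parts \<sigma> T = 0" "parts \<rho> T = 0" "parts \<sigma> (Suc T) = 0" "parts \<rho> (Suc T) = 0"
    using bounded_byD[OF T(1)] bounded_byD[OF T(2)] by simp_all
  have I: "(1 - q ^ 2 * X) * transfer wD sD T False
      = (1 - q * X) * transfer wU sU T False + q * X * (1 - q) * transfer wU sU T True"
    using raw unfolding defs by (simp add: z)
  have "transfer wU sU (Suc T) False = transfer wU sU T False + q * X * (1 - q) * transfer wU sU T True"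
    by (simp add: transfer.simps(2) sU_def[of T] z sum_UNIV_bool wU_def[of T] st_def fl_def facP_def facQ_def)
  then have "transfer wU sU (Suc T) False + - q * X * transfer wU sU T False
      = (1 - q * X) * transfer wU sU T False + q * X * (1 - q) * transfer wU sU T True"
    by (simp add: left_diff_distrib)
  also have "\<dots> = (1 + - (q ^ 2) * X) * transfer wD sD T False"
    unfolding I[symmetric] by simp
  finally show ?thesis
    unfolding sum_up_down[OF T] sum_down_up[OF T]
      sum_up_down[OF T[THEN bounded_by_mono[OF _ le_SucI[OF order_refl]]]] .
qed

end

lemma strips_exchange_graded:
  assumes eq: "psz \<rho> + m = psz \<sigma> + i"
  shows "(\<Sum>\<nu> | strip \<rho> \<nu> \<and> strip \<sigma> \<nu> \<and> psz \<nu> = psz \<rho> + m. up \<rho> \<nu> * down \<nu> \<sigma>)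
     - (if m = 0 then 0 else q * (\<Sum>\<nu> | strip \<rho> \<nu> \<and> strip \<sigma> \<nu> \<and> psz \<nu> = psz \<rho> + (m - 1). up \<rho> \<nu> * down \<nu> \<sigma>))
   = (\<Sum>\<tau> | strip \<tau> \<rho> \<and> strip \<tau> \<sigma> \<and> psz \<sigma> = psz \<tau> + m. down \<rho> \<tau> * up \<tau> \<sigma>)
     - (if m = 0 then 0 else q ^ 2 * (\<Sum>\<tau> | strip \<tau> \<rho> \<and> strip \<tau> \<sigma> \<and> psz \<sigma> = psz \<tau> + (m - 1). down \<rho> \<tau> * up \<tau> \<sigma>))"
proof (cases "\<forall>t. parts \<sigma> t = parts \<rho> t \<or> parts \<sigma> t = Suc (parts \<rho> t) \<or> parts \<rho> t = Suc (parts \<sigma> t)")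
  case False
  \<comment> \<open>Two partitions with a common neighbour one strip above, or one strip below,
    differ by at most one in every row; otherwise all the sums are empty.\<close>
  have 1: "\<not> (strip \<rho> \<nu> \<and> strip \<sigma> \<nu>)" "\<not> (strip \<nu> \<rho> \<and> strip \<nu> \<sigma>)" for \<nu>
    using False unfolding strip_def by (metis nat.inject)+
  have "{\<nu>. strip \<rho> \<nu> \<and> strip \<sigma> \<nu> \<and> P \<nu>} = {}" "{\<nu>. strip \<nu> \<rho> \<and> strip \<nu> \<sigma> \<and> P \<nu>} = {}" for P
    using 1 by blast+
  note none = this
  show ?thesis unfolding none by simp
next
  case True
  then have near: "\<And>t. parts \<sigma> t = parts \<rho> t \<or> parts \<sigma> t = Suc (parts \<rho> t) \<or> parts \<rho> t = Suc (parts \<sigma> t)" by blast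
  define T where "T = psz \<rho> + psz \<sigma> + m"
  have T: "bounded_by T \<rho>" "bounded_by T \<sigma>" by (auto simp: T_def intro: bounded_by_size)
  define A B C where "A = {\<nu>. strip \<rho> \<nu> \<and> strip \<sigma> \<nu> \<and> bounded_by (Suc T) \<nu>}"
    and "B = {\<nu>. strip \<rho> \<nu> \<and> strip \<sigma> \<nu> \<and> bounded_by T \<nu>}" and "C = {\<tau>. strip \<tau> \<rho> \<and> strip \<tau> \<sigma>}"
  have "A = {\<nu>. strip \<rho> \<nu> \<and> bounded_by (Suc T) \<nu> \<and> strip \<sigma> \<nu>}" "B = {\<nu>. strip \<rho> \<nu> \<and> bounded_by T \<nu> \<and> strip \<sigma> \<nu>}"
    by (auto simp: A_def B_def)
  then have fin: "finite A" "finite B" "finite C"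
    using finite_strip_bounded[of \<rho> _ "strip \<sigma>"] finite_strip_below[of \<rho> "\<lambda>\<tau>. strip \<tau> \<sigma>"]
    by (simp_all add: C_def)
  have d: "psz \<theta> - psz \<nu> = j \<longleftrightarrow> psz \<theta> = psz \<nu> + j" if "strip \<nu> \<theta>" for \<nu> \<theta> j
    using strip_psz_le[OF that] by auto
  have bb: "bounded_by T' \<theta>" if "psz \<theta> = psz \<rho> + j" "j \<le> m" "T \<le> T'" for \<theta> j T'
    using that by (intro bounded_by_size) (simp add: T_def)
  have sets: "{\<nu>. \<nu> \<in> A \<and> psz \<nu> - psz \<rho> = m} = {\<nu>. strip \<rho> \<nu> \<and> strip \<sigma> \<nu> \<and> psz \<nu> = psz \<rho> + m}"
    "{\<nu>. \<nu> \<in> B \<and> psz \<nu> - psz \<rho> = m - 1} = {\<nu>. strip \<rho> \<nu> \<and> strip \<sigma> \<nu> \<and> psz \<nu> = psz \<rho> + (m - 1)}"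
    "{\<tau>. \<tau> \<in> C \<and> psz \<sigma> - psz \<tau> = j} = {\<tau>. strip \<tau> \<rho> \<and> strip \<tau> \<sigma> \<and> psz \<sigma> = psz \<tau> + j}" for j
    by (auto simp: A_def B_def C_def d strip_psz_le intro: bb)
  have "{X. 1 - q ^ 2 * X = 0} \<subseteq> {1 / q ^ 2}"
    using q_nz by (auto simp: field_simps)
  then have E: "finite {X. 1 - q ^ 2 * X = 0}" by (rule finite_subset) simp
  have "(\<Sum>\<nu> | \<nu> \<in> A \<and> psz \<nu> - psz \<rho> = m. up \<rho> \<nu> * down \<nu> \<sigma>)
      + (if m = 0 then 0 else - q * (\<Sum>\<nu> | \<nu> \<in> B \<and> psz \<nu> - psz \<rho> = m - 1. up \<rho> \<nu> * down \<nu> \<sigma>))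
    = (\<Sum>\<tau> | \<tau> \<in> C \<and> psz \<sigma> - psz \<tau> = m. down \<rho> \<tau> * up \<tau> \<sigma>)
      + (if m = 0 then 0 else - (q ^ 2) * (\<Sum>\<tau> | \<tau> \<in> C \<and> psz \<sigma> - psz \<tau> = m - 1. down \<rho> \<tau> * up \<tau> \<sigma>))"
    using strips_exchange[OF near T] by (intro coeffs_eq_of_values_eq[OF fin _ E]) (simp add: A_def B_def C_def)
  then show ?thesis unfolding sets by (simp split: if_splits)
qed


subsection \<open>Removing strips from a power\<close>

text \<open>Since \<open>D_x = d_x D_(qx)\<close> and \<open>D_q delta\<close> should be
  \<open>q ^ psz\<close>, this is the condition for \<open>D_1 delta = 1\<close>; see
  \<open>Dm_empty\<close>. The transfer vector can be computed in closed form because the run-end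
  factors telescope.\<close>

lemma down_total:
  "(\<Sum>\<kappa> | strip \<kappa> \<mu>. q ^ psz \<kappa> * down \<mu> \<kappa>) = 1"
proof -
  define T where "T = psz \<mu>"
  have T: "bounded_by T \<mu>" by (simp add: T_def bounded_by_psz)
  define u where "u t = q powi (- int (parts \<mu> t))" for t
  define f where "f t = 1 - q ^ (parts \<mu> t - parts \<mu> (Suc t))" for t
  define w where "w t e e' = (if e then u t * (if e' then 1 else f t) else 1)" for t e e'
  define s where "s n = (\<Sum>k<n. \<Prod>t<k. u t)" for n
  \<comment> \<open>The entries are partial sums of the products \<open>u 0 ... u (k - 1)\<close>.
    The induction works since \<open>u n * f n\<close> is the difference
    \<open>u n - u (Suc n)\<close>.\<close>
  have tr: "transfer w (\<lambda>_. UNIV) n True = s (Suc n) \<and> transfer w (\<lambda>_. UNIV) n False = s (Suc n) - u n * s n" for n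
  proof (induction n)
    case (Suc n)
    have "parts \<mu> (Suc n) \<le> parts \<mu> n" by (rule parts_antimono) simp
    then have "u n * (1 - f n) = u (Suc n)"
      unfolding u_def f_def by (simp add: one_minus_q_powi_nat powi_add)
    then have uf: "u n * f n = u n - u (Suc n)" by (simp add: algebra_simps)
    have s: "s (Suc n) = s n + (\<Prod>t<n. u t)" "s (Suc (Suc n)) = s (Suc n) + u n * (\<Prod>t<n. u t)"
      by (simp_all add: s_def mult.commute)
    have "transfer w (\<lambda>_. UNIV) (Suc n) True = s (Suc n) - u n * s n + u n * s (Suc n)"
      and "transfer w (\<lambda>_. UNIV) (Suc n) False = s (Suc n) - u n * s n + u n * f n * s (Suc n)"
      using Suc.IH by (simp_all add: transfer.simps(2) sum_UNIV_bool w_def[of n] mult.commute)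
    then show ?case
      unfolding uf s by (simp add: algebra_simps)
  qed (simp add: s_def)
  have "(\<Sum>\<kappa> | strip \<kappa> \<mu>. q ^ psz \<kappa> * down \<mu> \<kappa>)
    = (\<Sum>e\<in>paths T (\<lambda>_. UNIV) no_box. q ^ psz \<mu> * (\<Prod>t<T. w t (e t) (e (Suc t))))"
  proof (subst sum_remove_strip[OF T, where g = "\<lambda>\<kappa>. q ^ psz \<kappa> * down \<mu> \<kappa>"])
    fix e assume e: "e \<in> paths T (\<lambda>_. UNIV) no_box" and pos: "\<forall>t. e t \<longrightarrow> parts \<mu> t > 0"
      and ok: "\<forall>t. parts \<mu> t - of_bool (e t) \<ge> parts \<mu> (Suc t) - of_bool (e (Suc t))"
    define \<kappa> where "\<kappa> = Abs_ptn (\<lambda>t. parts \<mu> t - of_bool (e t))"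
    have p: "parts \<kappa> = (\<lambda>t. parts \<mu> t - of_bool (e t))"
      unfolding \<kappa>_def using e T ok by (intro parts_Abs_ptn[of _ T]) (auto simp: paths_def bounded_by_def)
    have rt: "parts \<mu> t = parts \<kappa> t + of_bool (e t)" for t
      using pos[rule_format, of t] by (cases "e t") (auto simp: p)
    have st: "strip \<kappa> \<mu>" unfolding strip_def rt by (auto simp: of_bool_def)
    have b: "bounded_by T \<kappa>" using st T by (rule strip_bounded)
    have eq: "parts \<mu> t = parts \<kappa> t \<longleftrightarrow> \<not> e t" for t by (simp add: rt)
    have "psz \<mu> = psz \<kappa> + (psz \<mu> - psz \<kappa>)" using strip_psz_le[OF st] by simp
    then have "q ^ psz \<mu> = q ^ psz \<kappa> * q ^ (psz \<mu> - psz \<kappa>)" by (metis power_add)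
    then have "q ^ psz \<mu> * (\<Prod>t<T. w t (e t) (e (Suc t)))
        = q ^ psz \<kappa> * (\<Prod>t<T. (if parts \<mu> t = parts \<kappa> t then 1 else q) * w t (e t) (e (Suc t)))"
      unfolding prod.distrib strip_power[OF st T b] by (simp add: mult.assoc)
    also have "(\<Prod>t<T. (if parts \<mu> t = parts \<kappa> t then 1 else q) * w t (e t) (e (Suc t))) = down \<mu> \<kappa>"
      unfolding down_prod[OF T b]
    proof (rule prod.cong)
      fix t
      have qu: "q * u t = q powi (- int (parts \<kappa> t))" if "e t"
      proof -
        have "q * u t = q powi (1 + - int (parts \<mu> t))"
          unfolding u_def powi_add[symmetric] by simp
        also have "1 + - int (parts \<mu> t) = - int (parts \<kappa> t)"
          using rt[of t] that by simp
        finally show ?thesis .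
      qed
      show "(if parts \<mu> t = parts \<kappa> t then 1 else q) * w t (e t) (e (Suc t))
        = (if parts \<mu> t = parts \<kappa> t then 1 else q powi - int (parts \<kappa> t)
            * (if parts \<mu> (Suc t) = parts \<kappa> (Suc t) then 1 - q ^ (parts \<mu> t - parts \<mu> (Suc t)) else 1))"
        unfolding eq w_def f_def using qu by (cases "e t"; cases "e (Suc t)") simp_all
    qed simp
    finally show "q ^ psz \<mu> * (\<Prod>t<T. w t (e t) (e (Suc t)))
        = q ^ psz (Abs_ptn (\<lambda>t. parts \<mu> t - of_bool (e t))) * down \<mu> (Abs_ptn (\<lambda>t. parts \<mu> t - of_bool (e t)))"
      unfolding \<kappa>_def .
  next
    fix e assume e: "e \<in> paths T (\<lambda>_. UNIV) no_box"
      and ex: "\<exists>t. e t \<and> \<not> e (Suc t) \<and> parts \<mu> t = parts \<mu> (Suc t)"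
    then obtain t where t: "e t" "\<not> e (Suc t)" "parts \<mu> t = parts \<mu> (Suc t)" by blast
    have "t < T" using e t(1) by (force simp: paths_def intro: ccontr)
    moreover have "w t (e t) (e (Suc t)) = 0" using t by (simp add: w_def f_def)
    ultimately show "q ^ psz \<mu> * (\<Prod>t<T. w t (e t) (e (Suc t))) = 0"
      by (auto intro!: prod_zero)
  qed simp
  also have "\<dots> = q ^ psz \<mu> * transfer w (\<lambda>_. UNIV) T False"
    by (simp add: sum_distrib_left[symmetric] transfer_eq_sum)
  \<comment> \<open>Behind the last row \<open>u T = 1\<close>, so the difference of two consecutive
    partial sums is a single product.\<close>
  also have "transfer w (\<lambda>_. UNIV) T False = (\<Prod>t<T. u t)"
    using tr[of T] bounded_byD[OF T, of T] by (simp add: u_def[of T] s_def)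
  also have "(\<Prod>t<T. u t) = 1 / (\<Prod>t<T. q ^ parts \<mu> t)"
    by (simp add: u_def power_int_minus prod_inversef[symmetric] divide_inverse)
  also have "(\<Prod>t<T. q ^ parts \<mu> t) = q ^ psz \<mu>"
    unfolding psz_bounded[OF T] by (simp add: power_sum)
  finally show ?thesis using q_nz by simp
qed

end


subsection \<open>Folding pairs of consecutive parts\<close>

definition fold2 :: "ptn \<Rightarrow> ptn" where
  "fold2 \<mu> = Abs_ptn (\<lambda>t. parts \<mu> (2 * t) + parts \<mu> (2 * t + 1))"

lemma parts_fold2: "parts (fold2 \<mu>) t = parts \<mu> (2 * t) + parts \<mu> (2 * t + 1)"
proof -
  have "parts \<mu> (2 * Suc t) + parts \<mu> (2 * Suc t + 1) \<le> parts \<mu> (2 * t) + parts \<mu> (2 * t + 1)" for t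
    by (intro add_mono parts_antimono) auto
  moreover have "parts \<mu> (2 * t) + parts \<mu> (2 * t + 1) = 0" if "t \<ge> psz \<mu>" for t
    using that bounded_byD[OF bounded_by_psz, of \<mu>] by simp
  ultimately show ?thesis
    unfolding fold2_def by (subst parts_Abs_ptn[of _ "psz \<mu>"]) auto
qed

lemma bounded_by_fold2_iff: "bounded_by T (fold2 \<mu>) \<longleftrightarrow> bounded_by (2 * T) \<mu>"
proof
  assume b: "bounded_by T (fold2 \<mu>)"
  show "bounded_by (2 * T) \<mu>"
    unfolding bounded_by_def
  proof (intro allI impI)
    fix s assume "s \<ge> 2 * T"
    then have "s div 2 \<ge> T" by simp
    then have "parts \<mu> (2 * (s div 2)) = 0"
      using bounded_byD[OF b, of "s div 2"] by (simp add: parts_fold2)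
    then show "parts \<mu> s = 0"
      using parts_antimono[of "2 * (s div 2)" s \<mu>] by simp
  qed
qed (simp add: bounded_by_def parts_fold2)

lemma prod_pairs: "(\<Prod>s<2 * T. f s) = (\<Prod>t<T. f (2 * t) * f (2 * t + 1 :: nat) :: 'a::comm_monoid_mult)"
  by (induction T) (simp_all add: mult.assoc)

lemma sum_pairs: "(\<Sum>s<2 * T. f s) = (\<Sum>t<T. f (2 * t) + f (2 * t + 1 :: nat) :: 'a::comm_monoid_add)"
  by (induction T) (simp_all add: add.assoc)

lemma psz_fold2: "psz (fold2 \<mu>) = psz \<mu>"
proof -
  define T where "T = psz \<mu>"
  have b: "bounded_by (2 * T) \<mu>" by (rule bounded_by_size) (simp add: T_def)
  have "psz (fold2 \<mu>) = (\<Sum>t<T. parts (fold2 \<mu>) t)"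
    using b by (intro psz_bounded) (simp add: bounded_by_fold2_iff)
  also have "\<dots> = (\<Sum>s<2 * T. parts \<mu> s)"
    by (simp add: parts_fold2 sum_pairs)
  also have "\<dots> = psz \<mu>" by (rule psz_bounded[OF b, symmetric])
  finally show ?thesis .
qed

text \<open>The counterpart of \<open>sum_add_strip\<close> for partitions read as sequences of
  pairs of consecutive parts. Sequences that do not decrease are removed by a reciprocal q-factorial
  at a negative argument.\<close>

lemma sum_pair_paths:
  fixes g :: "ptn \<Rightarrow> 'b::comm_monoid_add" and S :: "nat \<Rightarrow> (nat \<times> nat) set"
  assumes fin: "\<And>t. finite (S t)"
    and G: "\<And>f \<mu>. f \<in> paths T S (\<lambda>_. (0, 0)) \<Longrightarrow> (\<And>t. f t = (parts \<mu> (2 * t), parts \<mu> (2 * t + 1))) \<Longrightarrow> G f = g \<mu>"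
    and G0: "\<And>f t. f \<in> paths T S (\<lambda>_. (0, 0)) \<Longrightarrow> t < T \<Longrightarrow>
        fst (f t) < snd (f t) \<or> snd (f t) < fst (f (Suc t)) \<Longrightarrow> G f = 0"
  shows "(\<Sum>f\<in>paths T S (\<lambda>_. (0, 0)). G f)
    = (\<Sum>\<mu> | bounded_by (2 * T) \<mu> \<and> (\<forall>t<T. (parts \<mu> (2 * t), parts \<mu> (2 * t + 1)) \<in> S t). g \<mu>)"
proof -
  define ok where "ok f \<longleftrightarrow> (\<forall>t<T. snd (f t) \<le> fst (f t) \<and> fst (f (Suc t)) \<le> snd (f t))"
    for f :: "nat \<Rightarrow> nat \<times> nat"
  define un where "un f s = (if even s then fst (f (s div 2)) else snd (f (s div 2)))"
    for f :: "nat \<Rightarrow> nat \<times> nat" and s :: nat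
  have "(\<Sum>f\<in>paths T S (\<lambda>_. (0, 0)). G f) = (\<Sum>f | f \<in> paths T S (\<lambda>_. (0, 0)) \<and> ok f. G f)"
  proof (rule sum.mono_neutral_right)
    show "\<forall>f\<in>paths T S (\<lambda>_. (0, 0)) - {f. f \<in> paths T S (\<lambda>_. (0, 0)) \<and> ok f}. G f = 0"
    proof
      fix f assume f: "f \<in> paths T S (\<lambda>_. (0, 0)) - {f. f \<in> paths T S (\<lambda>_. (0, 0)) \<and> ok f}"
      then obtain t where "t < T" "fst (f t) < snd (f t) \<or> snd (f t) < fst (f (Suc t))"
        unfolding ok_def by (auto simp: not_le)
      then show "G f = 0" using f by (intro G0) auto
    qed
  qed (auto intro: finite_paths fin)
  also have "\<dots> = (\<Sum>\<mu> | bounded_by (2 * T) \<mu> \<and> (\<forall>t<T. (parts \<mu> (2 * t), parts \<mu> (2 * t + 1)) \<in> S t). g \<mu>)"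
  proof (rule sum.reindex_bij_witness[where j = "\<lambda>f. Abs_ptn (un f)"
        and i = "\<lambda>\<mu> t. (parts \<mu> (2 * t), parts \<mu> (2 * t + 1))"])
    fix f assume f: "f \<in> {f. f \<in> paths T S (\<lambda>_. (0, 0)) \<and> ok f}"
    have z: "f t = (0, 0)" if "t \<ge> T" for t using f that by (simp add: paths_def)
    have o: "snd (f t) \<le> fst (f t) \<and> fst (f (Suc t)) \<le> snd (f t)" for t
    proof (cases "t < T")
      case True
      then show ?thesis using f by (simp add: ok_def)
    next
      case False
      then show ?thesis using z[of t] z[of "Suc t"] by simp
    qed
    have p: "parts (Abs_ptn (un f)) = un f"
    proof (rule parts_Abs_ptn)
      fix s
      show "un f (Suc s) \<le> un f s"
      proof (cases "even s")
        case True
        then show ?thesis using o[of "s div 2"] by (simp add: un_def)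
      next
        case False
        then have "Suc s div 2 = Suc (s div 2)" by (auto elim!: oddE)
        then show ?thesis using o[of "s div 2"] False by (simp add: un_def)
      qed
      show "un f s = 0" if "s \<ge> 2 * T"
        using z[of "s div 2"] that by (simp add: un_def)
    qed
    have ft: "(parts (Abs_ptn (un f)) (2 * t), parts (Abs_ptn (un f)) (2 * t + 1)) = f t" for t
      unfolding p by (simp add: un_def)
    then show "(\<lambda>t. (parts (Abs_ptn (un f)) (2 * t), parts (Abs_ptn (un f)) (2 * t + 1))) = f"
      by (rule ext)
    show "Abs_ptn (un f) \<in> {\<mu>. bounded_by (2 * T) \<mu> \<and> (\<forall>t<T. (parts \<mu> (2 * t), parts \<mu> (2 * t + 1)) \<in> S t)}"
      using f z unfolding mem_Collect_eq ft by (auto simp: bounded_by_def p un_def paths_def)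
    show "g (Abs_ptn (un f)) = G f"
      using f by (intro G[symmetric]) (simp_all only: ft mem_Collect_eq)
  next
    fix \<mu> assume m: "\<mu> \<in> {\<mu>. bounded_by (2 * T) \<mu> \<and> (\<forall>t<T. (parts \<mu> (2 * t), parts \<mu> (2 * t + 1)) \<in> S t)}"
    have "un (\<lambda>t. (parts \<mu> (2 * t), parts \<mu> (2 * t + 1))) = parts \<mu>"
    proof
      fix s show "un (\<lambda>t. (parts \<mu> (2 * t), parts \<mu> (2 * t + 1))) s = parts \<mu> s"
        by (cases "even s") (simp_all add: un_def)
    qed
    then show "Abs_ptn (un (\<lambda>t. (parts \<mu> (2 * t), parts \<mu> (2 * t + 1)))) = \<mu>"
      by (simp add: parts_inverse)
    show "(\<lambda>t. (parts \<mu> (2 * t), parts \<mu> (2 * t + 1))) \<in> {f. f \<in> paths T S (\<lambda>_. (0, 0)) \<and> ok f}"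
      using m by (auto simp: paths_def ok_def bounded_by_def intro: parts_antimono)
  qed
  finally show ?thesis .
qed

context generic_q
begin

context
  fixes \<nu> :: ptn and X :: 'a
begin

definition pL :: "nat \<Rightarrow> (nat \<times> nat) set" where
  "pL t = {(a, b). a + b = parts \<nu> t \<or> a + b = Suc (parts \<nu> t)}"

definition pR :: "nat \<Rightarrow> (nat \<times> nat) set" where
  "pR t = {(a, b). a + b = parts \<nu> t \<or> Suc (a + b) = parts \<nu> t}"

definition box :: "nat \<Rightarrow> nat \<times> nat \<Rightarrow> bool" where
  "box t x \<longleftrightarrow> fst x + snd x \<noteq> parts \<nu> t"

definition vL :: "nat \<Rightarrow> nat \<times> nat \<Rightarrow> nat \<times> nat \<Rightarrow> 'a" where
  "vL t x x' = boxL X (parts \<nu>) t (box t x) (int (fst x)) (box (Suc t) x') (int (fst x'))"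

definition vR :: "nat \<Rightarrow> nat \<times> nat \<Rightarrow> nat \<times> nat \<Rightarrow> 'a" where
  "vR t x x' = boxR X (parts \<nu>) t (box t x) (int (fst x)) (box (Suc t) x') (int (fst x'))"

lemma finite_pL: "finite (pL t)" and finite_pR: "finite (pR t)"
proof -
  have "pL t \<subseteq> {..Suc (parts \<nu> t)} \<times> {..Suc (parts \<nu> t)}" "pR t \<subseteq> {..parts \<nu> t} \<times> {..parts \<nu> t}"
    by (auto simp: pL_def pR_def)
  then show "finite (pL t)" "finite (pR t)" by (auto intro: finite_subset)
qed

text \<open>For such a the second part of the pair is negative, hence smaller than a', and the
  second reciprocal q-factorial is zero.\<close>

lemma box_beyond:
  assumes "a' \<ge> 0"
  shows "int (\<phi> t) + of_bool e < a \<Longrightarrow> boxL X \<phi> t e a e' a' = 0"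
    and "int (\<phi> t) - of_bool e < a \<Longrightarrow> boxR X \<phi> t e a e' a' = 0"
  using assms by (simp_all add: boxL_def boxR_def Let_def qfac_inv_def)

text \<open>The sum of a pair is \<open>parts \<nu> t\<close> or one more, so a pair is the same as
  its first part and a box variable; this is the state used in \<open>pairL\<close>.\<close>

lemma transfer_vL: "transfer vL pL T x' = pairL X (parts \<nu>) T (box T x') (int (fst x'))"
proof (induction T arbitrary: x')
  case (Suc T)
  define n where "n = int (parts \<nu> T)"
  define h where "h a e = pairL X (parts \<nu>) T e a * boxL X (parts \<nu>) T e a (box (Suc T) x') (int (fst x'))" for a e
  have "transfer vL pL (Suc T) x' = (\<Sum>x\<in>pL T. h (int (fst x)) (box T x))"
    by (simp add: transfer.simps(2) Suc.IH h_def vL_def)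
  also have "\<dots> = (\<Sum>y | y \<in> {0..n + 1} \<times> UNIV \<and> fst y \<le> n + of_bool (snd y). h (fst y) (snd y))"
    by (rule sum.reindex_bij_witness[where j = "\<lambda>x. (int (fst x), box T x)"
          and i = "\<lambda>y. (nat (fst y), nat (n + of_bool (snd y) - fst y))"])
      (auto simp: pL_def box_def n_def)
  also have "\<dots> = (\<Sum>y\<in>{0..n + 1} \<times> UNIV. h (fst y) (snd y))"
    by (rule sum.mono_neutral_left) (auto simp: h_def n_def not_le intro!: box_beyond)
  also have "\<dots> = (\<Sum>a\<in>{0..n + 1}. \<Sum>e\<in>UNIV. h a e)"
    by (simp add: sum.cartesian_product case_prod_unfold)
  finally show ?case by (simp add: h_def n_def)
qed simp

lemma transfer_vR: "transfer vR pR T x' = pairR X (parts \<nu>) T (box T x') (int (fst x'))"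
proof (induction T arbitrary: x')
  case (Suc T)
  define n where "n = int (parts \<nu> T)"
  define h where "h a e = pairR X (parts \<nu>) T e a * boxR X (parts \<nu>) T e a (box (Suc T) x') (int (fst x'))" for a e
  have "transfer vR pR (Suc T) x' = (\<Sum>x\<in>pR T. h (int (fst x)) (box T x))"
    by (simp add: transfer.simps(2) Suc.IH h_def vR_def)
  also have "\<dots> = (\<Sum>y | y \<in> {0..n + 1} \<times> UNIV \<and> fst y \<le> n - of_bool (snd y). h (fst y) (snd y))"
    by (rule sum.reindex_bij_witness[where j = "\<lambda>x. (int (fst x), box T x)"
          and i = "\<lambda>y. (nat (fst y), nat (n - of_bool (snd y) - fst y))"])
      (auto simp: pR_def box_def n_def)
  also have "\<dots> = (\<Sum>y\<in>{0..n + 1} \<times> UNIV. h (fst y) (snd y))"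
    by (rule sum.mono_neutral_left) (auto simp: h_def n_def not_le intro!: box_beyond)
  also have "\<dots> = (\<Sum>a\<in>{0..n + 1}. \<Sum>e\<in>UNIV. h a e)"
    by (simp add: sum.cartesian_product case_prod_unfold)
  finally show ?case by (simp add: h_def n_def)
qed simp

lemma kern_empty_pairs:
  assumes "bounded_by (2 * T) \<mu>"
  shows "kern empty_ptn \<mu> = (\<Prod>t<T. q powi (int (parts \<mu> (2 * t)) * int (parts \<mu> (2 * t))
      + int (parts \<mu> (2 * t + 1)) * int (parts \<mu> (2 * t + 1)))
    * qfac_inv q (int (parts \<mu> (2 * t)) - int (parts \<mu> (2 * t + 1)))
    * qfac_inv q (int (parts \<mu> (2 * t + 1)) - int (parts \<mu> (2 * Suc t))))"
  unfolding kern_prod[OF assms] prod_pairs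
  by (intro prod.cong refl) (simp add: powi_add[symmetric] mult_ac)

text \<open>The run-end factor of \<open>down\<close> refers to the larger partition, whereas the
  layer \<open>boxL\<close> knows only \<nu>; at such a row the two exponents agree.\<close>

lemma strip_fold_step:
  assumes "strip \<nu> \<theta>" "parts \<theta> t \<noteq> parts \<nu> t" "parts \<theta> (Suc t) = parts \<nu> (Suc t)"
  shows "q ^ (parts \<theta> t - parts \<theta> (Suc t)) = q powi (int (parts \<nu> t) - int (parts \<nu> (Suc t)) + 1)"
proof -
  have le: "parts \<theta> (Suc t) \<le> parts \<theta> t" by (rule parts_antimono) simp
  have "int (parts \<theta> t) = int (parts \<nu> t) + 1"
    using assms(1)[unfolded strip_def, rule_format, of t] assms(2) by auto
  then have "int (parts \<theta> t) - int (parts \<theta> (Suc t)) = int (parts \<nu> t) - int (parts \<nu> (Suc t)) + 1"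
    using assms(3) by simp
  then show ?thesis unfolding one_minus_q_powi_nat[OF le] by simp
qed

lemma strip_fold_step':
  assumes "strip \<theta> \<nu>" "parts \<theta> t = parts \<nu> t" "parts \<theta> (Suc t) \<noteq> parts \<nu> (Suc t)"
  shows "q ^ (parts \<theta> t - parts \<theta> (Suc t)) = q powi (int (parts \<nu> t) - int (parts \<nu> (Suc t)) + 1)"
proof -
  have le: "parts \<theta> (Suc t) \<le> parts \<theta> t" by (rule parts_antimono) simp
  have "int (parts \<nu> (Suc t)) = int (parts \<theta> (Suc t)) + 1"
    using assms(1)[unfolded strip_def, rule_format, of "Suc t"] assms(3) by auto
  then have "int (parts \<theta> t) - int (parts \<theta> (Suc t)) = int (parts \<nu> t) - int (parts \<nu> (Suc t)) + 1"
    using assms(2) by simp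
  then show ?thesis unfolding one_minus_q_powi_nat[OF le] by simp
qed

lemma paths_bounded:
  assumes "f \<in> paths T S (\<lambda>_. (0, 0))" "\<And>t. f t = (parts \<mu> (2 * t), parts \<mu> (2 * t + 1))"
  shows "bounded_by (2 * T) \<mu>"
  unfolding bounded_by_fold2_iff[symmetric]
  unfolding bounded_by_def parts_fold2
proof (intro allI impI)
  fix t assume "t \<ge> T"
  then have "f t = (0, 0)" using assms(1) by (simp add: paths_def)
  then show "parts \<mu> (2 * t) + parts \<mu> (2 * t + 1) = 0" using assms(2)[of t] by simp
qed

lemma sum_fold_down:
  assumes T: "bounded_by T \<nu>"
  shows "(\<Sum>\<mu> | strip \<nu> (fold2 \<mu>) \<and> bounded_by (2 * T) \<mu>.
      kern empty_ptn \<mu> * down (fold2 \<mu>) \<nu> * X ^ (psz \<mu> - psz \<nu>))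
    = pairL X (parts \<nu>) T False 0"
proof -
  have set: "{\<mu>. strip \<nu> (fold2 \<mu>) \<and> bounded_by (2 * T) \<mu>}
      = {\<mu>. bounded_by (2 * T) \<mu> \<and> (\<forall>t<T. (parts \<mu> (2 * t), parts \<mu> (2 * t + 1)) \<in> pL t)}"
  proof (rule Collect_cong)
    fix \<mu>
    have z: "parts (fold2 \<mu>) t = parts \<nu> t" if "bounded_by (2 * T) \<mu>" "\<not> t < T" for t
      using that bounded_byD[OF T, of t] by (simp add: parts_fold2 bounded_by_def)
    have "(parts \<mu> (2 * t), parts \<mu> (2 * t + 1)) \<in> pL t
        \<longleftrightarrow> parts (fold2 \<mu>) t = parts \<nu> t \<or> parts (fold2 \<mu>) t = Suc (parts \<nu> t)" for t
      by (simp add: pL_def parts_fold2)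
    then show "strip \<nu> (fold2 \<mu>) \<and> bounded_by (2 * T) \<mu>
      \<longleftrightarrow> bounded_by (2 * T) \<mu> \<and> (\<forall>t<T. (parts \<mu> (2 * t), parts \<mu> (2 * t + 1)) \<in> pL t)"
      unfolding strip_def using z by blast
  qed
  have "(\<Sum>f\<in>paths T pL (\<lambda>_. (0, 0)). \<Prod>t<T. vL t (f t) (f (Suc t)))
    = (\<Sum>\<mu> | bounded_by (2 * T) \<mu> \<and> (\<forall>t<T. (parts \<mu> (2 * t), parts \<mu> (2 * t + 1)) \<in> pL t).
        kern empty_ptn \<mu> * down (fold2 \<mu>) \<nu> * X ^ (psz \<mu> - psz \<nu>))"
  proof (rule sum_pair_paths[OF finite_pL])
    fix f \<mu> assume f: "f \<in> paths T pL (\<lambda>_. (0, 0))" and fm: "\<And>t. f t = (parts \<mu> (2 * t), parts \<mu> (2 * t + 1))"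
    have b: "bounded_by (2 * T) \<mu>" using f fm by (rule paths_bounded)
    have s: "strip \<nu> (fold2 \<mu>)"
    proof -
      have "\<mu> \<in> {\<mu>. bounded_by (2 * T) \<mu> \<and> (\<forall>t<T. (parts \<mu> (2 * t), parts \<mu> (2 * t + 1)) \<in> pL t)}"
        using b f unfolding mem_Collect_eq fm[symmetric] by (simp add: paths_def)
      then show ?thesis unfolding set[symmetric] by simp
    qed
    define \<theta> where "\<theta> = fold2 \<mu>"
    have bf: "bounded_by T \<theta>" using b by (simp add: bounded_by_fold2_iff \<theta>_def)
    have bx: "box t (parts \<mu> (2 * t), parts \<mu> (2 * t + 1)) \<longleftrightarrow> parts \<theta> t \<noteq> parts \<nu> t" for t
      by (simp add: box_def \<theta>_def parts_fold2)
    show "(\<Prod>t<T. vL t (f t) (f (Suc t))) = kern empty_ptn \<mu> * down (fold2 \<mu>) \<nu> * X ^ (psz \<mu> - psz \<nu>)"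
      unfolding kern_empty_pairs[OF b] psz_fold2[of \<mu>, symmetric] \<theta>_def[symmetric] down_prod[OF bf T]
        strip_power[OF s[folded \<theta>_def] bf T] prod.distrib[symmetric] fm vL_def bx fst_conv boxL_def Let_def
    proof (rule prod.cong)
      fix t
      have k: "int (parts \<nu> t) + of_bool (parts \<theta> t \<noteq> parts \<nu> t) - int (parts \<mu> (2 * t)) = int (parts \<mu> (2 * t + 1))"
      proof -
        have "int (parts \<nu> t) + of_bool (parts \<theta> t \<noteq> parts \<nu> t)
            = int (parts \<nu> t + of_bool (parts \<theta> t \<noteq> parts \<nu> t))"
          by (simp only: of_nat_add of_nat_of_bool)
        also have "\<dots> = int (parts \<theta> t)"
          by (simp only: strip_parts[OF s[folded \<theta>_def]])
        finally have "int (parts \<nu> t) + of_bool (parts \<theta> t \<noteq> parts \<nu> t) = int (parts \<theta> t)" .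
        then show ?thesis by (simp add: \<theta>_def parts_fold2)
      qed
      show "(if parts \<theta> t \<noteq> parts \<nu> t then X * q powi - int (parts \<nu> t) else 1)
          * q powi (int (parts \<mu> (2 * t)) * int (parts \<mu> (2 * t))
            + (int (parts \<nu> t) + of_bool (parts \<theta> t \<noteq> parts \<nu> t) - int (parts \<mu> (2 * t)))
              * (int (parts \<nu> t) + of_bool (parts \<theta> t \<noteq> parts \<nu> t) - int (parts \<mu> (2 * t))))
          * qfac_inv q (int (parts \<mu> (2 * t)) - (int (parts \<nu> t) + of_bool (parts \<theta> t \<noteq> parts \<nu> t) - int (parts \<mu> (2 * t))))
          * qfac_inv q (int (parts \<nu> t) + of_bool (parts \<theta> t \<noteq> parts \<nu> t) - int (parts \<mu> (2 * t)) - int (parts \<mu> (2 * Suc t)))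
          * (if parts \<theta> t \<noteq> parts \<nu> t \<and> \<not> parts \<theta> (Suc t) \<noteq> parts \<nu> (Suc t)
             then 1 - q powi (int (parts \<nu> t) - int (parts \<nu> (Suc t)) + 1) else 1)
        = q powi (int (parts \<mu> (2 * t)) * int (parts \<mu> (2 * t))
            + int (parts \<mu> (2 * t + 1)) * int (parts \<mu> (2 * t + 1)))
          * qfac_inv q (int (parts \<mu> (2 * t)) - int (parts \<mu> (2 * t + 1)))
          * qfac_inv q (int (parts \<mu> (2 * t + 1)) - int (parts \<mu> (2 * Suc t)))
          * (if parts \<theta> t = parts \<nu> t then 1
             else q powi - int (parts \<nu> t)
               * (if parts \<theta> (Suc t) = parts \<nu> (Suc t)
                  then 1 - q ^ (parts \<theta> t - parts \<theta> (Suc t)) else 1))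
          * (if parts \<theta> t = parts \<nu> t then 1 else X)"
        unfolding k
        using strip_fold_step[OF s[folded \<theta>_def], of t]
        by (cases "parts \<theta> t = parts \<nu> t"; cases "parts \<theta> (Suc t) = parts \<nu> (Suc t)")
          (simp_all only: not_True_eq_False not_False_eq_True simp_thms if_True if_False mult_ac mult_1_right mult_1)
    qed simp
  next
    fix f t assume f: "f \<in> paths T pL (\<lambda>_. (0, 0))" and t: "t < T"
      and bad: "fst (f t) < snd (f t) \<or> snd (f t) < fst (f (Suc t))"
    have "f t \<in> pL t" using f t by (simp add: paths_def)
    then have "int (parts \<nu> t) + of_bool (box t (f t)) - int (fst (f t)) = int (snd (f t))"
      by (auto simp: pL_def box_def)
    then have "vL t (f t) (f (Suc t)) = 0"
      using bad unfolding vL_def boxL_def Let_def by (auto simp: qfac_inv_def)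
    then show "(\<Prod>t<T. vL t (f t) (f (Suc t))) = 0" using t by (auto intro!: prod_zero)
  qed
  moreover have "box T (0, 0) = False" using bounded_byD[OF T, of T] by (simp add: box_def)
  ultimately show ?thesis
    unfolding set by (simp add: transfer_eq_sum finite_pL transfer_vL)
qed

lemma sum_fold_up:
  assumes T: "bounded_by T \<nu>"
  shows "(\<Sum>\<mu> | strip (fold2 \<mu>) \<nu>. kern empty_ptn \<mu> * up (fold2 \<mu>) \<nu> * X ^ (psz \<nu> - psz \<mu>))
    = pairR X (parts \<nu>) T False 0"
proof -
  have set: "{\<mu>. strip (fold2 \<mu>) \<nu>}
      = {\<mu>. bounded_by (2 * T) \<mu> \<and> (\<forall>t<T. (parts \<mu> (2 * t), parts \<mu> (2 * t + 1)) \<in> pR t)}"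
  proof (rule Collect_cong)
    fix \<mu>
    have z: "parts \<nu> t = parts (fold2 \<mu>) t" if "bounded_by (2 * T) \<mu>" "\<not> t < T" for t
      using that bounded_byD[OF T, of t] by (simp add: parts_fold2 bounded_by_def)
    have b: "bounded_by (2 * T) \<mu>" if "strip (fold2 \<mu>) \<nu>"
      using strip_bounded[OF that T] by (simp add: bounded_by_fold2_iff)
    have "(parts \<mu> (2 * t), parts \<mu> (2 * t + 1)) \<in> pR t
        \<longleftrightarrow> parts \<nu> t = parts (fold2 \<mu>) t \<or> parts \<nu> t = Suc (parts (fold2 \<mu>) t)" for t
      by (auto simp: pR_def parts_fold2)
    then show "strip (fold2 \<mu>) \<nu>
      \<longleftrightarrow> bounded_by (2 * T) \<mu> \<and> (\<forall>t<T. (parts \<mu> (2 * t), parts \<mu> (2 * t + 1)) \<in> pR t)"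
      using z b unfolding strip_def by blast
  qed
  have "(\<Sum>f\<in>paths T pR (\<lambda>_. (0, 0)). \<Prod>t<T. vR t (f t) (f (Suc t)))
    = (\<Sum>\<mu> | bounded_by (2 * T) \<mu> \<and> (\<forall>t<T. (parts \<mu> (2 * t), parts \<mu> (2 * t + 1)) \<in> pR t).
        kern empty_ptn \<mu> * up (fold2 \<mu>) \<nu> * X ^ (psz \<nu> - psz \<mu>))"
  proof (rule sum_pair_paths[OF finite_pR])
    fix f \<mu> assume f: "f \<in> paths T pR (\<lambda>_. (0, 0))" and fm: "\<And>t. f t = (parts \<mu> (2 * t), parts \<mu> (2 * t + 1))"
    have b: "bounded_by (2 * T) \<mu>" using f fm by (rule paths_bounded)
    define \<theta> where "\<theta> = fold2 \<mu>"
    have s: "strip \<theta> \<nu>"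
    proof -
      have "\<mu> \<in> {\<mu>. bounded_by (2 * T) \<mu> \<and> (\<forall>t<T. (parts \<mu> (2 * t), parts \<mu> (2 * t + 1)) \<in> pR t)}"
        using b f unfolding mem_Collect_eq fm[symmetric] by (simp add: paths_def)
      then show ?thesis unfolding set[symmetric] \<theta>_def by simp
    qed
    have bf: "bounded_by T \<theta>" using b by (simp add: bounded_by_fold2_iff \<theta>_def)
    have bx: "box t (parts \<mu> (2 * t), parts \<mu> (2 * t + 1)) \<longleftrightarrow> parts \<nu> t \<noteq> parts \<theta> t" for t
      by (auto simp: box_def \<theta>_def parts_fold2)
    show "(\<Prod>t<T. vR t (f t) (f (Suc t))) = kern empty_ptn \<mu> * up (fold2 \<mu>) \<nu> * X ^ (psz \<nu> - psz \<mu>)"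
      unfolding kern_empty_pairs[OF b] psz_fold2[of \<mu>, symmetric] \<theta>_def[symmetric] up_prod[OF bf T]
        strip_power[OF s T bf] prod.distrib[symmetric] fm vR_def bx fst_conv boxR_def Let_def
    proof (rule prod.cong)
      fix t
      have i: "int (parts \<nu> t) = int (parts \<theta> t) + of_bool (parts \<nu> t \<noteq> parts \<theta> t)"
      proof -
        have "int (parts \<theta> t) + of_bool (parts \<nu> t \<noteq> parts \<theta> t)
            = int (parts \<theta> t + of_bool (parts \<nu> t \<noteq> parts \<theta> t))"
          by (simp only: of_nat_add of_nat_of_bool)
        also have "\<dots> = int (parts \<nu> t)"
          by (simp only: strip_parts[OF s])
        finally show ?thesis by (rule sym)
      qed
      then have k: "int (parts \<nu> t) - of_bool (parts \<nu> t \<noteq> parts \<theta> t) - int (parts \<mu> (2 * t)) = int (parts \<mu> (2 * t + 1))"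
        by (simp add: \<theta>_def parts_fold2)
      have qs: "q ^ Suc (parts \<theta> t) = q powi (int (parts \<nu> t))" if "parts \<nu> t \<noteq> parts \<theta> t"
      proof -
        have "int (parts \<nu> t) = int (Suc (parts \<theta> t))" using i that by simp
        then show ?thesis by (simp only: power_int_of_nat)
      qed
      show "(if parts \<nu> t \<noteq> parts \<theta> t then X * q powi int (parts \<nu> t) else 1)
          * q powi (int (parts \<mu> (2 * t)) * int (parts \<mu> (2 * t))
            + (int (parts \<nu> t) - of_bool (parts \<nu> t \<noteq> parts \<theta> t) - int (parts \<mu> (2 * t)))
              * (int (parts \<nu> t) - of_bool (parts \<nu> t \<noteq> parts \<theta> t) - int (parts \<mu> (2 * t))))
          * qfac_inv q (int (parts \<mu> (2 * t)) - (int (parts \<nu> t) - of_bool (parts \<nu> t \<noteq> parts \<theta> t) - int (parts \<mu> (2 * t))))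
          * qfac_inv q (int (parts \<nu> t) - of_bool (parts \<nu> t \<noteq> parts \<theta> t) - int (parts \<mu> (2 * t)) - int (parts \<mu> (2 * Suc t)))
          * (if \<not> parts \<nu> t \<noteq> parts \<theta> t \<and> parts \<nu> (Suc t) \<noteq> parts \<theta> (Suc t)
             then 1 - q powi (int (parts \<nu> t) - int (parts \<nu> (Suc t)) + 1) else 1)
        = q powi (int (parts \<mu> (2 * t)) * int (parts \<mu> (2 * t))
            + int (parts \<mu> (2 * t + 1)) * int (parts \<mu> (2 * t + 1)))
          * qfac_inv q (int (parts \<mu> (2 * t)) - int (parts \<mu> (2 * t + 1)))
          * qfac_inv q (int (parts \<mu> (2 * t + 1)) - int (parts \<mu> (2 * Suc t)))
          * (if parts \<nu> t = parts \<theta> t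
             then (if parts \<nu> (Suc t) = parts \<theta> (Suc t) then 1 else 1 - q ^ (parts \<theta> t - parts \<theta> (Suc t)))
             else q ^ Suc (parts \<theta> t))
          * (if parts \<nu> t = parts \<theta> t then 1 else X)"
        unfolding k
        using strip_fold_step'[OF s, of t, OF sym not_sym] qs
        by (cases "parts \<nu> t = parts \<theta> t"; cases "parts \<nu> (Suc t) = parts \<theta> (Suc t)")
          (simp_all only: not_True_eq_False not_False_eq_True simp_thms if_True if_False mult_ac mult_1_right mult_1)
    qed simp
  next
    fix f t assume f: "f \<in> paths T pR (\<lambda>_. (0, 0))" and t: "t < T"
      and bad: "fst (f t) < snd (f t) \<or> snd (f t) < fst (f (Suc t))"
    have "f t \<in> pR t" using f t by (simp add: paths_def)
    then have "int (parts \<nu> t) - of_bool (box t (f t)) - int (fst (f t)) = int (snd (f t))"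
      by (auto simp: pR_def box_def)
    then have "vR t (f t) (f (Suc t)) = 0"
      using bad unfolding vR_def boxR_def Let_def by (auto simp: qfac_inv_def)
    then show "(\<Prod>t<T. vR t (f t) (f (Suc t))) = 0" using t by (auto intro!: prod_zero)
  qed
  moreover have "box T (0, 0) = False" using bounded_byD[OF T, of T] by (simp add: box_def)
  ultimately show ?thesis
    unfolding set by (simp add: transfer_eq_sum finite_pR transfer_vR)
qed

text \<open>In contrast to \<open>kern_exchange\<close> nothing has to be subtracted: behind the
  support of \<nu> only one further box fits. A box in an empty row is the pair (1, 0), and a second
  pair (1, 0) after it would violate the order of the parts.\<close>

lemma fold_exchange:
  assumes T: "bounded_by T \<nu>" and X: "1 + q * X \<noteq> 0"
  shows "(\<Sum>\<mu> | strip \<nu> (fold2 \<mu>) \<and> bounded_by (2 * Suc T) \<mu>.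
      kern empty_ptn \<mu> * down (fold2 \<mu>) \<nu> * X ^ (psz \<mu> - psz \<nu>))
    = (1 + q * X) * (\<Sum>\<mu> | strip (fold2 \<mu>) \<nu>. kern empty_ptn \<mu> * up (fold2 \<mu>) \<nu> * X ^ (psz \<nu> - psz \<mu>))"
proof -
  have z: "parts \<nu> T = 0" "parts \<nu> (Suc T) = 0" using bounded_byD[OF T] by simp_all
  have J1: "qfac_inv q 1 * (1 - q) = 1"
    using qfac_inv_plus_1[of 0] by simp
  \<comment> \<open>In the additional row T the only surviving pairs are (0, 0) and (1, 0). The
    resulting expression is the first invariant at a = 0, where \<open>parts \<nu> T = 0\<close>
    makes the power of q equal to 1.\<close>
  have "{0..1 :: int} = {0, 1}" by auto
  then have "pairL X (parts \<nu>) (Suc T) False 0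
      = pairL X (parts \<nu>) T False 0 + X * q * (qfac_inv q 1 * (1 - q)) * pairL X (parts \<nu>) T True 1"
    by (simp add: z sum_UNIV_bool boxL_def Let_def) (simp add: qfac_inv_def)
  also have "\<dots> = (1 + q * X) * pairR X (parts \<nu>) T False 0"
    using pair_invariant(1)[OF X, of 0 "parts \<nu>" T] unfolding J1 by (simp add: z mult_ac)
  finally show ?thesis
    unfolding sum_fold_up[OF T] sum_fold_down[OF bounded_by_mono[OF T le_SucI[OF order_refl]]] .
qed

end

lemma fold_exchange_graded:
  "(\<Sum>\<mu> | strip \<nu> (fold2 \<mu>) \<and> psz \<mu> = psz \<nu> + i. kern empty_ptn \<mu> * down (fold2 \<mu>) \<nu>)
   = (\<Sum>\<mu> | strip (fold2 \<mu>) \<nu> \<and> psz \<nu> = psz \<mu> + i. kern empty_ptn \<mu> * up (fold2 \<mu>) \<nu>)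
     + (if i = 0 then 0
        else q * (\<Sum>\<mu> | strip (fold2 \<mu>) \<nu> \<and> psz \<nu> = psz \<mu> + (i - 1). kern empty_ptn \<mu> * up (fold2 \<mu>) \<nu>))"
proof -
  define T where "T = psz \<nu> + i"
  have T: "bounded_by T \<nu>" by (auto simp: T_def intro: bounded_by_size)
  define A C where "A = {\<mu>. strip \<nu> (fold2 \<mu>) \<and> bounded_by (2 * Suc T) \<mu>}"
    and "C = {\<mu>. strip (fold2 \<mu>) \<nu>}"
  have "psz \<mu> \<le> psz \<nu> + Suc T" if "\<mu> \<in> A" for \<mu>
  proof -
    have s: "strip \<nu> (fold2 \<mu>)" "bounded_by (Suc T) (fold2 \<mu>)"
      using that unfolding bounded_by_fold2_iff by (simp_all add: A_def)
    have "(\<Sum>t<Suc T. of_bool (parts (fold2 \<mu>) t \<noteq> parts \<nu> t)) \<le> (\<Sum>t<Suc T. 1 :: nat)"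
      by (intro sum_mono) simp
    then show ?thesis
      using strip_psz[OF s strip_bounded[OF s]] by (simp add: psz_fold2)
  qed
  then have "A \<subseteq> {\<mu>. psz \<mu> \<le> psz \<nu> + Suc T}" by blast
  moreover have "C \<subseteq> {\<mu>. psz \<mu> \<le> psz \<nu>}"
    using strip_psz_le[of "fold2 _" \<nu>] by (auto simp: C_def psz_fold2)
  ultimately have fin: "finite A" "finite {}" "finite C"
    by (auto intro: finite_subset[OF _ finite_psz_le])
  have d: "psz \<mu> - psz \<nu> = j \<longleftrightarrow> psz \<mu> = psz \<nu> + j" if "strip \<nu> (fold2 \<mu>)" for \<mu> j
    using strip_psz_le[OF that] by (auto simp: psz_fold2)
  have d': "psz \<nu> - psz \<mu> = j \<longleftrightarrow> psz \<nu> = psz \<mu> + j" if "strip (fold2 \<mu>) \<nu>" for \<mu> j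
    using strip_psz_le[OF that] by (auto simp: psz_fold2)
  have bb: "bounded_by (2 * Suc T) \<mu>" if "psz \<mu> = psz \<nu> + i" for \<mu>
    using that by (intro bounded_by_size) (simp add: T_def)
  have sets: "{\<mu>. \<mu> \<in> A \<and> psz \<mu> - psz \<nu> = i} = {\<mu>. strip \<nu> (fold2 \<mu>) \<and> psz \<mu> = psz \<nu> + i}"
    "{\<mu>. \<mu> \<in> C \<and> psz \<nu> - psz \<mu> = j} = {\<mu>. strip (fold2 \<mu>) \<nu> \<and> psz \<nu> = psz \<mu> + j}" for j
    using bb d d' unfolding A_def C_def by blast+
  have "{X. 1 + q * X = 0} \<subseteq> {- 1 / q}"
    using q_nz by (auto simp: field_simps add_eq_0_iff)
  then have E: "finite {X. 1 + q * X = 0}" by (rule finite_subset) simp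
  have "(\<Sum>\<mu> | \<mu> \<in> A \<and> psz \<mu> - psz \<nu> = i. kern empty_ptn \<mu> * down (fold2 \<mu>) \<nu>)
      + (if i = 0 then 0 else 0 * (\<Sum>\<mu> | \<mu> \<in> {} \<and> psz \<mu> - psz \<nu> = i - 1. kern empty_ptn \<mu> * down (fold2 \<mu>) \<nu>))
    = (\<Sum>\<mu> | \<mu> \<in> C \<and> psz \<nu> - psz \<mu> = i. kern empty_ptn \<mu> * up (fold2 \<mu>) \<nu>)
      + (if i = 0 then 0 else q * (\<Sum>\<mu> | \<mu> \<in> C \<and> psz \<nu> - psz \<mu> = i - 1. kern empty_ptn \<mu> * up (fold2 \<mu>) \<nu>))"
    using fold_exchange[OF T] by (intro coeffs_eq_of_values_eq[OF fin _ E]) (simp add: A_def C_def)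
  then show ?thesis unfolding sets by (cases "i = 0") simp_all
qed

end


section \<open>The operators as matrices indexed by partitions\<close>

context generic_q
begin

text \<open>The degree counts the boxes of the new partition for A and C, and the boxes removed or
  added for D and U. Splitting by degree is what keeps the rows of A, C and U finite.\<close>

definition Aser :: "(ptn, 'a) rfm fps" where
  "Aser = Abs_fps (\<lambda>n. Abs_rfm (\<lambda>\<mu> \<theta>. if psz \<theta> = n then kern \<mu> \<theta> else 0))"

definition Dser :: "(ptn, 'a) rfm fps" where
  "Dser = Abs_fps (\<lambda>i. Abs_rfm (\<lambda>\<theta> \<nu>. if strip \<nu> \<theta> \<and> psz \<theta> = psz \<nu> + i then down \<theta> \<nu> else 0))"

definition User :: "(ptn, 'a) rfm fps" where
  "User = Abs_fps (\<lambda>m. Abs_rfm (\<lambda>\<rho> \<nu>. if strip \<rho> \<nu> \<and> psz \<nu> = psz \<rho> + m then up \<rho> \<nu> else 0))"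

text \<open>C is a functional. As a matrix with all rows equal it lives in the same ring as the
  other operators, so that the exchange lemmas apply to it.\<close>

definition Cser :: "(ptn, 'a) rfm fps" where
  "Cser = Abs_fps (\<lambda>n. Abs_rfm (\<lambda>_ \<theta>. \<Sum>\<mu> | psz \<mu> = n \<and> fold2 \<mu> = \<theta>. kern empty_ptn \<mu>))"

lemma entry_Aser: "entry (Aser $ n) \<mu> \<theta> = (if psz \<theta> = n then kern \<mu> \<theta> else 0)"
proof -
  have "finite {\<theta>. (if psz \<theta> = n then kern \<mu> \<theta> else 0) \<noteq> 0}" for \<mu>
    by (rule finite_subset[OF _ finite_psz_eq[of n]]) auto
  then show ?thesis by (simp add: Aser_def entry_Abs_rfm)
qed

lemma entry_Dser: "entry (Dser $ i) \<theta> \<nu> = (if strip \<nu> \<theta> \<and> psz \<theta> = psz \<nu> + i then down \<theta> \<nu> else 0)"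
proof -
  have "finite {\<nu>. (if strip \<nu> \<theta> \<and> psz \<theta> = psz \<nu> + i then down \<theta> \<nu> else 0) \<noteq> 0}" for \<theta>
    by (rule finite_subset[OF _ finite_strip_below[of \<theta> "\<lambda>_. True"]]) auto
  then show ?thesis by (simp add: Dser_def entry_Abs_rfm)
qed

lemma entry_User: "entry (User $ m) \<rho> \<nu> = (if strip \<rho> \<nu> \<and> psz \<nu> = psz \<rho> + m then up \<rho> \<nu> else 0)"
proof -
  have "finite {\<nu>. (if strip \<rho> \<nu> \<and> psz \<nu> = psz \<rho> + m then up \<rho> \<nu> else 0) \<noteq> 0}" for \<rho>
    by (rule finite_subset[OF _ finite_psz_eq[of "psz \<rho> + m"]]) auto
  then show ?thesis by (simp add: User_def entry_Abs_rfm)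
qed

lemma entry_Cser: "entry (Cser $ n) (\<rho> :: ptn) \<theta> = (\<Sum>\<mu> | psz \<mu> = n \<and> fold2 \<mu> = \<theta>. kern empty_ptn \<mu>)"
proof -
  have "(\<Sum>\<mu> | psz \<mu> = n \<and> fold2 \<mu> = \<theta>. kern empty_ptn \<mu>) = 0" if "psz \<theta> \<noteq> n" for n \<theta>
    using that by (intro sum.neutral) (auto simp: psz_fold2)
  then have "finite {\<theta>. (\<Sum>\<mu> | psz \<mu> = n \<and> fold2 \<mu> = \<theta>. kern empty_ptn \<mu>) \<noteq> 0}"
    by (intro finite_subset[OF _ finite_psz_eq[of n]]) auto
  then show ?thesis by (simp add: Cser_def entry_Abs_rfm)
qed

lemma entry_Cser_mult:
  "entry (Cser $ n * M) \<rho> \<nu> = (\<Sum>\<mu> | psz \<mu> = n. kern empty_ptn \<mu> * entry M (fold2 \<mu>) \<nu>)"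
proof -
  have "entry (Cser $ n * M) \<rho> \<nu>
      = (\<Sum>\<theta> | psz \<theta> = n. (\<Sum>\<mu> | psz \<mu> = n \<and> fold2 \<mu> = \<theta>. kern empty_ptn \<mu>) * entry M \<theta> \<nu>)"
    unfolding entry_Cser[of n \<rho>, symmetric]
    by (intro entry_mult_superset finite_psz_eq)
      (auto simp: entry_Cser psz_fold2 elim!: sum.not_neutral_contains_not_neutral)
  also have "\<dots> = (\<Sum>\<theta> | psz \<theta> = n. \<Sum>\<mu> | \<mu> \<in> {\<mu>. psz \<mu> = n} \<and> fold2 \<mu> = \<theta>.
      kern empty_ptn \<mu> * entry M (fold2 \<mu>) \<nu>)"
    by (auto simp: sum_distrib_right intro!: sum.cong)
  also have "\<dots> = (\<Sum>\<mu> | psz \<mu> = n. kern empty_ptn \<mu> * entry M (fold2 \<mu>) \<nu>)"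
    by (rule sum.group) (auto simp: finite_psz_eq psz_fold2)
  finally show ?thesis .
qed

lemma entry_Aser_mult: "entry (Aser $ n * M) \<mu> \<nu> = (\<Sum>\<theta> | psz \<theta> = n. kern \<mu> \<theta> * entry M \<theta> \<nu>)"
  by (subst entry_mult_superset[OF finite_psz_eq[of n]]) (auto simp: entry_Aser split: if_splits)

lemma entry_Dser_mult:
  "entry (Dser $ i * M) \<theta> \<nu> = (\<Sum>\<kappa> | strip \<kappa> \<theta> \<and> psz \<theta> = psz \<kappa> + i. down \<theta> \<kappa> * entry M \<kappa> \<nu>)"
  by (subst entry_mult_superset[OF finite_strip_below[of \<theta> "\<lambda>\<kappa>. psz \<theta> = psz \<kappa> + i"]])
    (auto simp: entry_Dser split: if_splits)

lemma entry_User_mult: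
  "entry (User $ m * M) \<rho> \<sigma> = (\<Sum>\<nu> | strip \<rho> \<nu> \<and> psz \<nu> = psz \<rho> + m. up \<rho> \<nu> * entry M \<nu> \<sigma>)"
proof -
  have "finite {\<nu>. strip \<rho> \<nu> \<and> psz \<nu> = psz \<rho> + m}"
    by (rule finite_subset[OF _ finite_psz_eq[of "psz \<rho> + m"]]) auto
  then show ?thesis
    by (subst entry_mult_superset[where S = "{\<nu>. strip \<rho> \<nu> \<and> psz \<nu> = psz \<rho> + m}"])
      (auto simp: entry_User split: if_splits)
qed

lemma entry_AD: "entry (Aser $ n * Dser $ i) \<mu> \<nu>
  = (if n = psz \<nu> + i then \<Sum>\<theta> | strip \<nu> \<theta> \<and> psz \<theta> = psz \<nu> + i. kern \<mu> \<theta> * down \<theta> \<nu> else 0)"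
  unfolding entry_Aser_mult entry_Dser
  by (auto split: if_splits intro!: sum.mono_neutral_cong_right sum.neutral finite_psz_eq)

lemma entry_DA: "entry (Dser $ i * Aser $ m) \<mu> \<nu>
  = (if psz \<nu> = m then \<Sum>\<kappa> | strip \<kappa> \<mu> \<and> psz \<mu> = psz \<kappa> + i. down \<mu> \<kappa> * kern \<kappa> \<nu> else 0)"
  unfolding entry_Dser_mult entry_Aser by simp

lemma entry_UD: "entry (User $ m * Dser $ i) \<rho> \<sigma> = (if psz \<rho> + m = psz \<sigma> + i
    then \<Sum>\<nu> | strip \<rho> \<nu> \<and> strip \<sigma> \<nu> \<and> psz \<nu> = psz \<rho> + m. up \<rho> \<nu> * down \<nu> \<sigma> else 0)"
proof -
  have "finite {\<nu>. strip \<rho> \<nu> \<and> psz \<nu> = psz \<rho> + m}"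
    by (rule finite_subset[OF _ finite_psz_eq[of "psz \<rho> + m"]]) auto
  then show ?thesis
    unfolding entry_User_mult entry_Dser
    by (auto split: if_splits intro!: sum.mono_neutral_cong_right sum.neutral)
qed

lemma entry_DU: "entry (Dser $ i * User $ m) \<rho> \<sigma> = (if psz \<rho> + m = psz \<sigma> + i
    then \<Sum>\<tau> | strip \<tau> \<rho> \<and> strip \<tau> \<sigma> \<and> psz \<sigma> = psz \<tau> + m. down \<rho> \<tau> * up \<tau> \<sigma> else 0)"
proof -
  have "finite {\<kappa>. strip \<kappa> \<rho> \<and> psz \<rho> = psz \<kappa> + i}" by (rule finite_strip_below)
  then show ?thesis
    unfolding entry_Dser_mult entry_User
    by (auto split: if_splits intro!: sum.mono_neutral_cong_right sum.neutral)
qed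

lemma entry_CD: "entry (Cser $ n * Dser $ i) \<rho> \<nu> = (if n = psz \<nu> + i
    then \<Sum>\<mu> | strip \<nu> (fold2 \<mu>) \<and> psz \<mu> = psz \<nu> + i. kern empty_ptn \<mu> * down (fold2 \<mu>) \<nu> else 0)"
  unfolding entry_Cser_mult entry_Dser
  by (auto simp: psz_fold2 split: if_splits intro!: sum.mono_neutral_cong_right sum.neutral finite_psz_eq)

lemma entry_CU: "entry (Cser $ n * User $ m) \<rho> \<nu> = (if psz \<nu> = n + m
    then \<Sum>\<mu> | strip (fold2 \<mu>) \<nu> \<and> psz \<nu> = psz \<mu> + m. kern empty_ptn \<mu> * up (fold2 \<mu>) \<nu> else 0)"
  unfolding entry_Cser_mult entry_User
  by (auto simp: psz_fold2 split: if_splits intro!: sum.mono_neutral_cong_right sum.neutral finite_psz_eq)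

lemma strip_refl: "strip \<mu> \<mu>"
  by (simp add: strip_def)

lemma strip_same_size:
  assumes "strip \<nu> \<theta>" "psz \<theta> = psz \<nu>"
  shows "\<theta> = \<nu>"
proof -
  define T where "T = psz \<theta>"
  have b: "bounded_by T \<theta>" "bounded_by T \<nu>" unfolding T_def assms(2)
    by (rule bounded_by_size, simp add: assms(2), rule bounded_by_psz)
  have z: "parts \<theta> t = parts \<nu> t" if "t < T" for t
    using strip_psz[OF assms(1) b] assms(2) that by auto
  show ?thesis
  proof (rule ptn_eqI)
    fix t
    show "parts \<theta> t = parts \<nu> t"
      using z[of t] bounded_byD[OF b(1), of t] bounded_byD[OF b(2), of t] by (cases "t < T") auto
  qed
qed

lemma down_refl [simp]: "down \<mu> \<mu> = 1" and up_refl [simp]: "up \<mu> \<mu> = 1"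
  by (simp_all add: down_def up_def)

lemma Dser_0: "Dser $ 0 = 1" and User_0: "User $ 0 = 1"
  by (rule rfm_eqI; auto simp: entry_Dser entry_User entry_1 strip_refl dest: strip_same_size)+

section \<open>The commutation relations of the infinite products\<close>

sublocale Q: q_ring "scalar_rfm q :: (ptn, 'a) rfm" "\<lambda>n. scalar_rfm (1 / (1 - q ^ n))"
proof
  fix n :: nat
  show "central (scalar_rfm q :: (ptn, 'a) rfm)" "central (scalar_rfm (1 / (1 - q ^ n)) :: (ptn, 'a) rfm)"
    by (simp_all add: central_def scalar_rfm_commute)
  assume "n > 0"
  then have "1 / (1 - q ^ n) * (1 - q ^ n) = 1" using q_power[of n] by simp
  then show "scalar_rfm (1 / (1 - q ^ n)) * (1 - scalar_rfm q ^ n) = (1 :: (ptn, 'a) rfm)"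
    by (metis scalar_rfm_power scalar_rfm_simps(2,4,5))
qed

fun h :: "nat \<Rightarrow> 'a" where
  "h 0 = 1"
| "h (Suc n) = q * h n / (1 - q ^ Suc n)"

declare h.simps(2) [simp del]

lemma hcoeff_scalar: "Q.hcoeff n = scalar_rfm (h n)"
  by (induction n)
    (simp_all add: Q.hcoeff.simps h.simps scalar_rfm_simps(2) scalar_rfm_simps(5)[symmetric])

abbreviation Am where "Am n \<equiv> Aser $ n"
abbreviation Cm where "Cm n \<equiv> Cser $ n"
abbreviation Dm where "Dm n \<equiv> Q.lsol Dser $ n"
abbreviation Um where "Um n \<equiv> Q.rsol User $ n"

text \<open>Coefficient form of \<open>A_w D_x = H(w x) D_(wx) A_w\<close>, obtained from the
  single-strip relation \<open>kern_exchange_graded\<close>. Likewise \<open>Um_Dm\<close> and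
  \<open>Cm_Dm\<close> below for the other two relations.\<close>

lemma Am_Dm: "Am n * Dm i = (if i \<le> n then \<Sum>j\<le>i. scalar_rfm (h j) * (Dm (i - j) * Am (n - i)) else 0)"
proof (rule Q.exchange_kernel[OF _ Dser_0, unfolded hcoeff_scalar])
  fix n i :: nat
  show "Aser $ n * Dser $ i - scalar_rfm q * Q.prv (\<lambda>n i. Aser $ n * Dser $ i) n i
    = (if i \<le> n then Dser $ i * Aser $ (n - i) else 0)"
  proof (rule rfm_eqI)
    fix \<mu> \<nu> :: ptn
    have "entry (Q.prv (\<lambda>n i. Aser $ n * Dser $ i) n i) \<mu> \<nu> = (if i = 0 \<or> n \<noteq> psz \<nu> + i then 0
      else (\<Sum>\<theta> | strip \<nu> \<theta> \<and> psz \<theta> = psz \<nu> + (i - 1). kern \<mu> \<theta> * down \<theta> \<nu>))"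
      unfolding Q.prv_def by (auto simp: entry_AD)
    then show "entry (Aser $ n * Dser $ i - scalar_rfm q * Q.prv (\<lambda>n i. Aser $ n * Dser $ i) n i) \<mu> \<nu>
      = entry (if i \<le> n then Dser $ i * Aser $ (n - i) else 0) \<mu> \<nu>"
      using kern_exchange_graded[where \<nu> = \<nu> and i = i and \<mu> = \<mu>] by (auto simp: entry_AD entry_DA)
  qed
qed

text \<open>One added strip against the whole product D. This intermediate relation serves twice: to
  build U for \<open>Um_Dm\<close>, and for the cancellation in \<open>Cm_Dm\<close>.\<close>

lemma User_Dm: "User $ m * Dm i - scalar_rfm q * Q.prv (\<lambda>m i. User $ m * Dm i) m i = Dm i * User $ m"
proof (rule Q.exchange_left[OF _ Dser_0])
  fix m i :: nat
  show "User $ m * Dser $ i - scalar_rfm q * Q.prv (\<lambda>m i. User $ m * Dser $ i) m i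
      = Dser $ i * User $ m - scalar_rfm q * (scalar_rfm q * Q.prv (\<lambda>m i. Dser $ i * User $ m) m i)"
  proof (rule rfm_eqI)
    fix \<rho> \<sigma> :: ptn
    \<comment> \<open>For i = 0 the term \<open>prv\<close> is zero by definition. The formula
      covers this case too: the condition on sizes then asks for a partition containing \<sigma>
      with fewer boxes than \<sigma>.\<close>
    have L: "entry (Q.prv (\<lambda>m i. User $ m * Dser $ i) m i) \<rho> \<sigma> = (if m = 0 \<or> psz \<rho> + m \<noteq> psz \<sigma> + i then 0
      else (\<Sum>\<nu> | strip \<rho> \<nu> \<and> strip \<sigma> \<nu> \<and> psz \<nu> = psz \<rho> + (m - 1). up \<rho> \<nu> * down \<nu> \<sigma>))"
      unfolding Q.prv_def
      by (auto simp: entry_UD dest!: strip_psz_le intro!: sum.neutral)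
    have R: "entry (Q.prv (\<lambda>m i. Dser $ i * User $ m) m i) \<rho> \<sigma> = (if m = 0 \<or> psz \<rho> + m \<noteq> psz \<sigma> + i then 0
      else (\<Sum>\<tau> | strip \<tau> \<rho> \<and> strip \<tau> \<sigma> \<and> psz \<sigma> = psz \<tau> + (m - 1). down \<rho> \<tau> * up \<tau> \<sigma>))"
      unfolding Q.prv_def
      by (auto simp: entry_DU dest!: strip_psz_le intro!: sum.neutral)
    show "entry (User $ m * Dser $ i - scalar_rfm q * Q.prv (\<lambda>m i. User $ m * Dser $ i) m i) \<rho> \<sigma>
      = entry (Dser $ i * User $ m
          - scalar_rfm q * (scalar_rfm q * Q.prv (\<lambda>m i. Dser $ i * User $ m) m i)) \<rho> \<sigma>"
    proof (cases "psz \<rho> + m = psz \<sigma> + i")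
      case True
      then show ?thesis
        using strips_exchange_graded[OF True]
        unfolding entry_diff entry_scalar_mult L R entry_UD entry_DU power2_eq_square mult.assoc
        by (cases "m = 0") simp_all
    next
      case False
      then show ?thesis by (simp add: L R entry_UD entry_DU)
    qed
  qed
qed

lemma Um_Dm: "Um m * Dm i = (\<Sum>j\<le>min m i. scalar_rfm (h j) * (Dm (i - j) * Um (m - j)))"
  by (rule Q.exchange_right[OF User_Dm User_0, unfolded hcoeff_scalar])

lemma Cm_Dm: "Cm n * Dm i
  = (\<Sum>j\<le>i. if 2 * i - j \<le> n then scalar_rfm (h j) * (Cm (n - (2 * i - j)) * Um (i - j)) else 0)"
proof (rule Q.exchange_double[OF User_Dm _ Dser_0 User_0, unfolded hcoeff_scalar])
  fix n i :: nat
  show "Cser $ n * Dser $ i = (if 2 * i \<le> n then Cser $ (n - 2 * i) * User $ i else 0)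
      + (if i > 0 \<and> 2 * i - 1 \<le> n
         then scalar_rfm q * (Cser $ (n - (2 * i - 1)) * User $ (i - 1)) else 0)"
  proof (rule rfm_eqI)
    fix \<rho> \<nu> :: ptn
    show "entry (Cser $ n * Dser $ i) \<rho> \<nu>
      = entry ((if 2 * i \<le> n then Cser $ (n - 2 * i) * User $ i else 0)
      + (if i > 0 \<and> 2 * i - 1 \<le> n
         then scalar_rfm q * (Cser $ (n - (2 * i - 1)) * User $ (i - 1)) else 0)) \<rho> \<nu>"
    proof (cases "n = psz \<nu> + i")
      case True
      \<comment> \<open>If \<open>2 * i > n\<close>, then \<open>i > psz \<nu>\<close>, and the sum
        on the right is empty.\<close>
      have "entry (if 2 * i \<le> n then Cser $ (n - 2 * i) * User $ i else 0) \<rho> \<nu>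
        = (\<Sum>\<mu> | strip (fold2 \<mu>) \<nu> \<and> psz \<nu> = psz \<mu> + i. kern empty_ptn \<mu> * up (fold2 \<mu>) \<nu>)"
        using True by (auto simp: entry_CU intro!: sum.neutral[symmetric])
      moreover have "entry (if i > 0 \<and> 2 * i - 1 \<le> n
         then scalar_rfm q * (Cser $ (n - (2 * i - 1)) * User $ (i - 1)) else 0) \<rho> \<nu>
        = (if i = 0 then 0 else q *
          (\<Sum>\<mu> | strip (fold2 \<mu>) \<nu> \<and> psz \<nu> = psz \<mu> + (i - 1). kern empty_ptn \<mu> * up (fold2 \<mu>) \<nu>))"
        using True by (auto simp: entry_CU intro!: sum.neutral)
      ultimately show ?thesis
        using True fold_exchange_graded[of \<nu> i] by (simp add: entry_CD)
    next
      case False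
      then show ?thesis by (auto simp: entry_CD entry_CU)
    qed
  qed
qed

lemma Dm_rec: "Dm n = (\<Sum>k\<le>n. scalar_rfm (q ^ (n - k)) * (Dser $ k * Dm (n - k)))"
proof -
  have "Dm n = (Dser * fps_scale (scalar_rfm q) (Q.lsol Dser)) $ n"
    by (subst Q.lsol[OF Dser_0]) (rule refl)
  also have "\<dots> = (\<Sum>k\<le>n. Dser $ k * (scalar_rfm q ^ (n - k) * Dm (n - k)))"
    by (simp add: fps_mult_nth atLeast0AtMost)
  finally show ?thesis
    unfolding scalar_rfm_power[symmetric] mult.assoc[symmetric]
    by (simp only: scalar_rfm_commute)
qed

lemma Um_rec: "Um n = (\<Sum>k\<le>n. scalar_rfm (q ^ k) * (Um k * User $ (n - k)))"
proof -
  have "Um n = (fps_scale (scalar_rfm q) (Q.rsol User) * User) $ n"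
    by (subst Q.rsol[OF User_0]) (rule refl)
  also have "\<dots> = (\<Sum>k\<le>n. scalar_rfm q ^ k * (Um k * User $ (n - k)))"
    by (simp add: fps_mult_nth atLeast0AtMost mult.assoc)
  finally show ?thesis unfolding scalar_rfm_power .
qed

lemma Dm_0 [simp]: "Dm 0 = 1" and Um_0 [simp]: "Um 0 = 1"
  by simp_all

text \<open>Off the grading only the term k = 0 of the recursion survives, which says that the entry
  equals \<open>q ^ n\<close> times itself. The same argument proves \<open>Um_size\<close>.\<close>

lemma Dm_size: "entry (Dm n) \<mu> \<nu> \<noteq> 0 \<Longrightarrow> psz \<mu> = psz \<nu> + n"
proof (induction n arbitrary: \<mu> \<nu> rule: less_induct)
  case (less n)
  show ?case
  proof (rule ccontr)
    assume ne: "psz \<mu> \<noteq> psz \<nu> + n"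
    then have "n \<noteq> 0" using less.prems by (cases "n = 0") (auto simp: entry_1 split: if_splits)
    have "entry (Dser $ k * Dm (n - k)) \<mu> \<nu> = 0" if "k \<in> {..n} - {0}" for k
      unfolding entry_Dser_mult
    proof (intro sum.neutral ballI)
      fix \<kappa> assume "\<kappa> \<in> {\<kappa>. strip \<kappa> \<mu> \<and> psz \<mu> = psz \<kappa> + k}"
      then have "psz \<kappa> \<noteq> psz \<nu> + (n - k)" using ne that by auto
      then have "entry (Dm (n - k)) \<kappa> \<nu> = 0" using less.IH[of "n - k" \<kappa> \<nu>] that by auto
      then show "down \<mu> \<kappa> * entry (Dm (n - k)) \<kappa> \<nu> = 0" by simp
    qed
    then have "entry (Dm n) \<mu> \<nu> = (\<Sum>k\<in>{0}. q ^ (n - k) * entry (Dser $ k * Dm (n - k)) \<mu> \<nu>)"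
      unfolding Dm_rec[of n] entry_sum entry_scalar_mult
      by (intro sum.mono_neutral_right) auto
    then have "(1 - q ^ n) * entry (Dm n) \<mu> \<nu> = 0" by (simp add: Dser_0 algebra_simps)
    then show False using less.prems q_power[of n] \<open>n \<noteq> 0\<close> by simp
  qed
qed

lemma Um_size: "entry (Um n) \<rho> \<nu> \<noteq> 0 \<Longrightarrow> psz \<nu> = psz \<rho> + n"
proof (induction n arbitrary: \<rho> \<nu> rule: less_induct)
  case (less n)
  show ?case
  proof (rule ccontr)
    assume ne: "psz \<nu> \<noteq> psz \<rho> + n"
    then have "n \<noteq> 0" using less.prems by (cases "n = 0") (auto simp: entry_1 split: if_splits)
    have "entry (Um k * User $ (n - k)) \<rho> \<nu> = 0" if "k \<in> {..n} - {n}" for k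
      unfolding entry_mult
    proof (intro sum.neutral ballI)
      fix \<kappa> assume "\<kappa> \<in> {\<kappa>. entry (Um k) \<rho> \<kappa> \<noteq> 0}"
      then have "psz \<kappa> = psz \<rho> + k" using less.IH[of k \<rho> \<kappa>] that by auto
      then show "entry (Um k) \<rho> \<kappa> * entry (User $ (n - k)) \<kappa> \<nu> = 0"
        using ne that by (auto simp: entry_User)
    qed
    then have "entry (Um n) \<rho> \<nu> = (\<Sum>k\<in>{n}. q ^ k * entry (Um k * User $ (n - k)) \<rho> \<nu>)"
      by (subst Um_rec, unfold entry_sum entry_scalar_mult, intro sum.mono_neutral_right) auto
    then have "(1 - q ^ n) * entry (Um n) \<rho> \<nu> = 0" by (simp add: User_0 algebra_simps)
    then show False using less.prems q_power[of n] \<open>n \<noteq> 0\<close> by simp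
  qed
qed

lemma psz_empty [simp]: "psz empty_ptn = 0"
  by simp

text \<open>Let e be the values of \<open>D_1 delta\<close>. The recursion for D gives
  \<open>e \<mu>\<close> as the sum of
  \<open>q ^ psz \<kappa> * down \<mu> \<kappa> * e \<kappa>\<close> over all \<kappa>. By induction
  every term but the one at \<mu> has e = 1, and \<open>down_total\<close> leaves
  \<open>(1 - q ^ n) * (e \<mu> - 1) = 0\<close>.\<close>

lemma Dm_empty: "entry (Dm n) \<mu> empty_ptn = (if psz \<mu> = n then 1 else 0)"
proof (induction n arbitrary: \<mu> rule: less_induct)
  case (less n)
  show ?case
  proof (cases "psz \<mu> = n \<and> n \<noteq> 0")
    case False
    show ?thesis
    proof (cases "n = 0")
      case True
      then show ?thesis by (simp add: entry_1)
    next
      case n: False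
      then have "entry (Dm n) \<mu> empty_ptn = 0"
        using False Dm_size[of n \<mu> empty_ptn] unfolding psz_empty add_0_left by blast
      then show ?thesis using False n by simp
    qed
  next
    case True
    define e where "e = (\<lambda>\<kappa>. entry (Dm (psz \<kappa>)) \<kappa> empty_ptn)"
    have fin: "finite {\<kappa>. strip \<kappa> \<mu>}" using finite_strip_below[of \<mu> "\<lambda>_. True"] by simp
    have e: "e \<kappa> = 1" if "strip \<kappa> \<mu>" "\<kappa> \<noteq> \<mu>" for \<kappa>
    proof -
      have "psz \<kappa> < n" using strip_psz_le[OF that(1)] strip_same_size[OF that(1)] that True by fastforce
      then show ?thesis using less.IH[of "psz \<kappa>" \<kappa>] by (simp add: e_def)
    qed
    have "e \<mu> = entry (Dm n) \<mu> empty_ptn" using True by (simp only: e_def)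
    also have "\<dots> = (\<Sum>k\<le>n. \<Sum>\<kappa> | \<kappa> \<in> {\<kappa>. strip \<kappa> \<mu>} \<and> n - psz \<kappa> = k. q ^ psz \<kappa> * (down \<mu> \<kappa> * e \<kappa>))"
      unfolding Dm_rec[of n] entry_sum entry_scalar_mult entry_Dser_mult sum_distrib_left
    proof (intro sum.cong refl)
      fix k assume k: "k \<in> {..n}"
      show "{\<kappa>. strip \<kappa> \<mu> \<and> psz \<mu> = psz \<kappa> + k} = {\<kappa>. \<kappa> \<in> {\<kappa>. strip \<kappa> \<mu>} \<and> n - psz \<kappa> = k}"
        using True k by (auto dest: strip_psz_le)
      fix \<kappa> assume "\<kappa> \<in> {\<kappa>. \<kappa> \<in> {\<kappa>. strip \<kappa> \<mu>} \<and> n - psz \<kappa> = k}"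
      then have "strip \<kappa> \<mu>" and "n - psz \<kappa> = k" by simp_all
      then have "n - k = psz \<kappa>" using strip_psz_le[of \<kappa> \<mu>] True by linarith
      then show "q ^ (n - k) * (down \<mu> \<kappa> * entry (Dm (n - k)) \<kappa> empty_ptn)
        = q ^ psz \<kappa> * (down \<mu> \<kappa> * e \<kappa>)"
        by (simp only: e_def)
    qed
    also have "\<dots> = (\<Sum>\<kappa> | strip \<kappa> \<mu>. q ^ psz \<kappa> * (down \<mu> \<kappa> * e \<kappa>))"
      by (rule sum.group[OF fin]) auto
    also have "\<dots> = q ^ n * e \<mu> + (\<Sum>\<kappa>\<in>{\<kappa>. strip \<kappa> \<mu>} - {\<mu>}. q ^ psz \<kappa> * down \<mu> \<kappa>)"
      using True e by (subst sum.remove[OF fin, of \<mu>]) (auto simp: strip_refl)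
    also have "(\<Sum>\<kappa>\<in>{\<kappa>. strip \<kappa> \<mu>} - {\<mu>}. q ^ psz \<kappa> * down \<mu> \<kappa>) = 1 - q ^ n"
      using down_total[of \<mu>] True
      by (subst (asm) sum.remove[OF fin, of \<mu>]) (auto simp: strip_refl eq_diff_eq add.commute)
    finally have "(1 - q ^ n) * (e \<mu> - 1) = 0" by (simp add: algebra_simps)
    then show ?thesis using True q_power[of n] by (simp add: e_def)
  qed
qed

lemma Am_empty: "entry (Am n) \<mu> empty_ptn = (if n = 0 then 1 else 0)"
  by (auto simp: entry_Aser kern_def)

lemma Cm_empty: "entry (Cm n) \<rho> empty_ptn = (if n = 0 then 1 else 0)"
proof -
  have "{\<mu>. psz \<mu> = n \<and> fold2 \<mu> = empty_ptn} = (if n = 0 then {empty_ptn} else {})"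
    by (auto simp flip: psz_eq_0_iff simp: psz_fold2)
  then show ?thesis by (simp add: entry_Cser kern_def)
qed

lemma Um_empty: "entry (Um n) \<rho> empty_ptn = (if n = 0 \<and> \<rho> = empty_ptn then 1 else 0)"
  using Um_size[of n \<rho> empty_ptn] by (auto simp: entry_1)

end


section \<open>Congruence of series up to a given degree\<close>

text \<open>The degree is the total degree in the variables; powers of q are not restricted.
  Truncation at N makes all operator sums finite, and limits are taken only at the end.\<close>

definition eqmod :: "nat \<Rightarrow> ('v, 'a) mfps \<Rightarrow> ('v, 'a) mfps \<Rightarrow> bool" where
  "eqmod N f g \<longleftrightarrow> (\<forall>n. mdegree n < N \<longrightarrow> mcoeff f n = mcoeff g n)"

lemma eqmod_refl [simp]: "eqmod N f f"
  and eqmod_trans [trans]: "eqmod N f g \<Longrightarrow> eqmod N g k \<Longrightarrow> eqmod N f k"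
  by (simp_all add: eqmod_def)

lemma eqmod_sum:
  fixes f :: "'i \<Rightarrow> ('v, 'a::comm_ring_1) mfps"
  shows "(\<And>i. i \<in> A \<Longrightarrow> eqmod N (f i) (g i)) \<Longrightarrow> eqmod N (sum f A) (sum g A)"
  by (simp add: eqmod_def)

lemma eqmod_mult:
  fixes f :: "('v, 'a::comm_ring_1) mfps"
  assumes "eqmod N f f'" "eqmod N g g'"
  shows "eqmod N (f * g) (f' * g')"
  unfolding eqmod_def mcoeff_mult
proof (intro allI impI sum.cong refl)
  fix n :: "'v \<Rightarrow>\<^sub>0 nat" and p assume n: "mdegree n < N" and p: "p \<in> splits n"
  have "mdegree (fst p) + mdegree (snd p) = mdegree n"
    using p mdegree_add[of "fst p" "snd p"] by (auto simp: splits_def)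
  then show "(case p of (a, b) \<Rightarrow> mcoeff f a * mcoeff g b) = (case p of (a, b) \<Rightarrow> mcoeff f' a * mcoeff g' b)"
    using assms n by (simp add: eqmod_def case_prod_unfold)
qed

lemma eqmod_mult_left: "eqmod N g g' \<Longrightarrow> eqmod N (f * g) (f * g' :: ('v, 'a::comm_ring_1) mfps)"
  by (rule eqmod_mult) simp

lemma eqmod_mult_0: "eqmod N g 0 \<Longrightarrow> eqmod N (f * g) (0 :: ('v, 'a::comm_ring_1) mfps)"
  using eqmod_mult_left[of N g 0 f] by simp

lemma eqmod_power_0:
  fixes w :: "('v, 'a::comm_ring_1) mfps"
  shows "mcoeff w 0 = 0 \<Longrightarrow> N \<le> n \<Longrightarrow> eqmod N (w ^ n) 0"
  by (simp add: eqmod_def mcoeff_power_eq_0)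

text \<open>Reindexing the operator sums never maps one truncation region exactly onto the other;
  the discrepancy consists of terms of high degree or of zeros.\<close>

lemma eqmod_sum_sets:
  fixes T :: "'i \<Rightarrow> ('v, 'a::comm_ring_1) mfps"
  assumes "finite A" "finite B"
    and "\<And>t. t \<in> A \<Longrightarrow> t \<notin> B \<Longrightarrow> eqmod N (T t) 0" and "\<And>t. t \<in> B \<Longrightarrow> t \<notin> A \<Longrightarrow> eqmod N (T t) 0"
  shows "eqmod N (sum T A) (sum T B)"
  unfolding eqmod_def mcoeff_sum
proof (intro allI impI)
  fix n :: "'v \<Rightarrow>\<^sub>0 nat" assume n: "mdegree n < N"
  have "(\<Sum>t\<in>A. mcoeff (T t) n) = (\<Sum>t\<in>A \<union> B. mcoeff (T t) n)"
    using assms n by (intro sum.mono_neutral_left) (auto simp: eqmod_def)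
  also have "\<dots> = (\<Sum>t\<in>B. mcoeff (T t) n)"
    using assms n by (intro sum.mono_neutral_right) (auto simp: eqmod_def)
  finally show "(\<Sum>t\<in>A. mcoeff (T t) n) = (\<Sum>t\<in>B. mcoeff (T t) n)" .
qed

lemma mcoeff_mult_0: "mcoeff (f * g) 0 = mcoeff f 0 * mcoeff (g :: ('v, 'a::comm_ring_1) mfps) 0"
proof -
  have z: "a = 0 \<and> b = 0" if "a + b = 0" for a b :: "'v \<Rightarrow>\<^sub>0 nat"
  proof -
    have "mdegree a + mdegree b = mdegree (a + b)" by (rule mdegree_add[symmetric])
    then show ?thesis unfolding that by (metis add_is_0 mdegree_eq_0_iff)
  qed
  have "splits (0 :: 'v \<Rightarrow>\<^sub>0 nat) = {(0, 0)}" by (auto simp: splits_def dest: z)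
  then show ?thesis by (simp add: mcoeff_mult)
qed

lemma act_cong: "(\<And>j. entry M i j \<noteq> 0 \<Longrightarrow> f j = g j) \<Longrightarrow> act M f i = act M g i"
  unfolding act_def by (intro sum.cong) auto

lemma act_sum_fun: "act M (\<lambda>j. \<Sum>x\<in>A. g x j) i = (\<Sum>x\<in>A. act M (g x) i)"
  unfolding act_def sum_distrib_left by (rule sum.swap)

lemma act_eqmod: "(\<And>j. eqmod N (f j) (g j)) \<Longrightarrow> eqmod N (act M f i) (act M g i)"
  unfolding act_def by (intro eqmod_sum eqmod_mult_left)

lemma act_zero: "(\<And>j. entry M i j = 0) \<Longrightarrow> act M f i = 0"
  by (simp add: act_def)


section \<open>The operators on functions of partitions\<close>

definition delta :: "ptn \<Rightarrow> ('v, 'a::comm_ring_1) mfps" where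
  "delta \<mu> = (if \<mu> = empty_ptn then 1 else 0)"

lemma act_delta: "act M delta \<mu> = mconst (entry M \<mu> empty_ptn)"
  unfolding act_def delta_def
  by (auto simp: mconst_simps if_distrib cong: if_cong)

context generic_q
begin

definition Aop :: "nat \<Rightarrow> ('v, 'a) mfps \<Rightarrow> (ptn \<Rightarrow> ('v, 'a) mfps) \<Rightarrow> ptn \<Rightarrow> ('v, 'a) mfps" where
  "Aop N w f \<mu> = (\<Sum>n<N. w ^ n * act (Am n) f \<mu>)"

text \<open>Not truncated by degree, since x may be 1. The bound \<open>psz \<mu>\<close> loses
  nothing, because more boxes than this cannot be removed from \<mu>.\<close>

definition Dop :: "('v, 'a) mfps \<Rightarrow> (ptn \<Rightarrow> ('v, 'a) mfps) \<Rightarrow> ptn \<Rightarrow> ('v, 'a) mfps" where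
  "Dop x f \<mu> = (\<Sum>i\<le>psz \<mu>. x ^ i * act (Dm i) f \<mu>)"

definition Uop :: "nat \<Rightarrow> ('v, 'a) mfps \<Rightarrow> (ptn \<Rightarrow> ('v, 'a) mfps) \<Rightarrow> ptn \<Rightarrow> ('v, 'a) mfps" where
  "Uop N z f \<mu> = (\<Sum>m<N. z ^ m * act (Um m) f \<mu>)"

definition Cop :: "nat \<Rightarrow> ('v, 'a) mfps \<Rightarrow> (ptn \<Rightarrow> ('v, 'a) mfps) \<Rightarrow> ptn \<Rightarrow> ('v, 'a) mfps" where
  "Cop N w f \<mu> = (\<Sum>n<N. w ^ n * act (Cm n) f \<mu>)"

definition H :: "nat \<Rightarrow> ('v, 'a) mfps \<Rightarrow> ('v, 'a) mfps" where
  "H N z = (\<Sum>j<N. mconst (h j) * z ^ j)"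

lemma act_Dm_eq_0: "psz \<mu> < i \<Longrightarrow> act (Dm i * M) f \<mu> = 0" "psz \<mu> < i \<Longrightarrow> act (Dm i) f \<mu> = 0"
proof -
  have z: "act (Dm i) g \<mu> = 0" if "psz \<mu> < i" for g :: "ptn \<Rightarrow> ('v, 'a) mfps"
    using that Dm_size[of i \<mu>] by (intro act_zero) force
  then show "psz \<mu> < i \<Longrightarrow> act (Dm i * M) f \<mu> = 0" "psz \<mu> < i \<Longrightarrow> act (Dm i) f \<mu> = 0"
    unfolding act_mult by blast+
qed

lemma Dop_superset:
  assumes "psz \<mu> \<le> K"
  shows "Dop x f \<mu> = (\<Sum>i\<le>K. x ^ i * act (Dm i) f \<mu>)"
  unfolding Dop_def using assms
  by (intro sum.mono_neutral_left) (auto simp: act_Dm_eq_0)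

lemma act_Dop:
  assumes "\<And>\<theta>. entry M \<mu> \<theta> \<noteq> 0 \<Longrightarrow> psz \<theta> \<le> K"
  shows "act M (Dop x f) \<mu> = (\<Sum>i\<le>K. x ^ i * act (M * Dm i) f \<mu>)"
proof -
  have "act M (Dop x f) \<mu> = act M (\<lambda>\<theta>. \<Sum>i\<le>K. x ^ i * act (Dm i) f \<theta>) \<mu>"
    using assms Dop_superset by (intro act_cong) blast
  also have "\<dots> = (\<Sum>i\<le>K. x ^ i * act (M * Dm i) f \<mu>)"
    unfolding act_sum_fun by (simp add: act_cmult act_mult)
  finally show ?thesis .
qed

lemma Cm_size: "entry (Cm n) \<rho> \<theta> \<noteq> 0 \<Longrightarrow> psz \<theta> = n"
  by (auto simp: entry_Cser psz_fold2 elim!: sum.not_neutral_contains_not_neutral)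

text \<open>The indices j, k, m belong to H, D and A on the right-hand side. Every term carries
  \<open>w ^ (j + k + m)\<close>, so only w has to be free of a constant term; x is
  arbitrary.\<close>

lemma Aop_Dop:
  assumes w: "mcoeff w 0 = 0"
  shows "eqmod N (Aop N w (Dop x f) \<mu>) (H N (w * x) * Dop (w * x) (Aop N w f) \<mu>)"
proof -
  define T where "T = (\<lambda>(j, k, m). mconst (h j) * (x ^ (j + k) * act (Dm k * Am m) f \<mu>) * w ^ (j + k + m))"
  have T0: "eqmod N (T (j, k, m)) 0" if "j + k + m \<ge> N" for j k m
    unfolding T_def prod.case by (intro eqmod_mult_0 eqmod_power_0 w that)
  have act: "act (Am n) (Dop x f) \<mu>
      = (\<Sum>i\<le>n. \<Sum>j\<le>i. x ^ i * (mconst (h j) * act (Dm (i - j) * Am (n - i)) f \<mu>))" for n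
    by (subst act_Dop[where K = n])
      (auto simp: entry_Aser Am_Dm act_sum sum_distrib_left split: if_splits)
  have "Aop N w (Dop x f) \<mu> = (\<Sum>n<N. \<Sum>i\<le>n. \<Sum>j\<le>i. T (j, i - j, n - i))"
    unfolding Aop_def act T_def prod.case sum_distrib_left
    by (intro sum.cong refl) (simp add: ac_simps)
  also have "\<dots> = (\<Sum>(n, i, j)\<in>(SIGMA n:{..<N}. SIGMA i:{..n}. {..i}). T (j, i - j, n - i))"
    by (simp add: sum.Sigma)
  also have "\<dots> = sum T {(j, k, m). j + k + m < N}"
    by (rule sum.reindex_bij_witness[of _ "\<lambda>(j, k, m). (j + k + m, j + k, j)" "\<lambda>(n, i, j). (j, i - j, n - i)"]) auto
  also have "eqmod N \<dots> (sum T ({..<N} \<times> {..psz \<mu>} \<times> {..<N}))"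
  proof (rule eqmod_sum_sets)
    show "finite {(j, k, m). j + k + m < N}"
      by (rule finite_subset[of _ "{..<N} \<times> {..<N} \<times> {..<N}"]) auto
    fix t assume t: "t \<in> {(j, k, m). j + k + m < N}" "t \<notin> {..<N} \<times> {..psz \<mu>} \<times> {..<N}"
    obtain j k m where "t = (j, k, m)" by (cases t)
    moreover from this have "psz \<mu> < k" using t by auto
    ultimately show "eqmod N (T t) 0" by (simp add: T_def act_Dm_eq_0)
  qed (auto intro!: T0)
  also have "sum T ({..<N} \<times> {..psz \<mu>} \<times> {..<N}) = (\<Sum>j<N. \<Sum>k\<le>psz \<mu>. \<Sum>m<N. T (j, k, m))"
    by (simp only: sum.cartesian_product')
  also have "\<dots> = H N (w * x) * Dop (w * x) (Aop N w f) \<mu>"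
    unfolding H_def sum_distrib_right
    unfolding Dop_def Aop_def act_sum_fun act_cmult act_mult[symmetric] sum_distrib_left T_def prod.case
    by (intro sum.cong refl) (simp add: power_add power_mult_distrib ac_simps)
  finally show ?thesis .
qed

lemma Uop_Dop:
  assumes z: "mcoeff z 0 = 0"
  shows "eqmod N (Uop N z (Dop x f) \<mu>) (H N (z * x) * Dop x (Uop N z f) \<mu>)"
proof -
  \<comment> \<open>U enlarges the partition by fewer than N boxes before D acts, so this K bounds
    every size that D can meet.\<close>
  define K where "K = psz \<mu> + N"
  define T where "T = (\<lambda>(j, k, p). mconst (h j) * (x ^ (j + k) * act (Dm k * Um p) f \<mu>) * z ^ (j + p))"
  have act: "act (Um m) (Dop x f) \<mu>
      = (\<Sum>i\<le>K. \<Sum>j\<le>min m i. x ^ i * (mconst (h j) * act (Dm (i - j) * Um (m - j)) f \<mu>))" if "m < N" for m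
    using that
    by (subst act_Dop[where K = K])
      (auto simp: K_def dest!: Um_size simp: Um_Dm act_sum sum_distrib_left)
  have "Uop N z (Dop x f) \<mu> = (\<Sum>m<N. z ^ m *
      (\<Sum>i\<le>K. \<Sum>j\<le>min m i. x ^ i * (mconst (h j) * act (Dm (i - j) * Um (m - j)) f \<mu>)))"
    unfolding Uop_def by (intro sum.cong refl) (simp only: act lessThan_iff)
  also have "\<dots> = (\<Sum>m<N. \<Sum>i\<le>K. \<Sum>j\<le>min m i. T (j, i - j, m - j))"
    unfolding T_def prod.case sum_distrib_left
    by (intro sum.cong refl) (simp add: ac_simps)
  also have "\<dots> = (\<Sum>(m, i, j)\<in>(SIGMA m:{..<N}. SIGMA i:{..K}. {..min m i}). T (j, i - j, m - j))"
    by (simp add: sum.Sigma)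
  also have "\<dots> = sum T {(j, k, p). j + p < N \<and> j + k \<le> K}"
    by (rule sum.reindex_bij_witness[of _ "\<lambda>(j, k, p). (j + p, j + k, j)" "\<lambda>(m, i, j). (j, i - j, m - j)"]) auto
  also have "eqmod N \<dots> (sum T ({..<N} \<times> {..psz \<mu>} \<times> {..<N}))"
  proof (rule eqmod_sum_sets)
    show "finite {(j, k, p). j + p < N \<and> j + k \<le> K}"
      by (rule finite_subset[of _ "{..<N} \<times> {..K} \<times> {..<N}"]) auto
    fix t assume t: "t \<in> {(j, k, p). j + p < N \<and> j + k \<le> K}" "t \<notin> {..<N} \<times> {..psz \<mu>} \<times> {..<N}"
    obtain j k p where "t = (j, k, p)" by (cases t)
    moreover from this have "psz \<mu> < k" using t by auto
    ultimately show "eqmod N (T t) 0" by (simp add: T_def act_Dm_eq_0)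
  next
    fix t assume "t \<in> {..<N} \<times> {..psz \<mu>} \<times> {..<N}" "t \<notin> {(j, k, p). j + p < N \<and> j + k \<le> K}"
    then show "eqmod N (T t) 0"
      by (auto simp: T_def K_def intro!: eqmod_mult_0 eqmod_power_0 z)
  qed auto
  also have "sum T ({..<N} \<times> {..psz \<mu>} \<times> {..<N}) = (\<Sum>j<N. \<Sum>k\<le>psz \<mu>. \<Sum>p<N. T (j, k, p))"
    by (simp only: sum.cartesian_product')
  also have "\<dots> = H N (z * x) * Dop x (Uop N z f) \<mu>"
    unfolding H_def sum_distrib_right
    unfolding Dop_def Uop_def act_sum_fun act_cmult act_mult[symmetric] sum_distrib_left T_def prod.case
    by (intro sum.cong refl) (simp add: power_add power_mult_distrib ac_simps)
  finally show ?thesis .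
qed

lemma Cop_Dop:
  assumes w: "mcoeff w 0 = 0"
  shows "eqmod N (Cop N w (Dop x f) \<mu>) (H N (w * x) * Cop N w (Uop N (w\<^sup>2 * x) f) \<mu>)"
proof -
  define T where "T = (\<lambda>(j, k, p). mconst (h j) * (x ^ (j + k) * act (Cm p * Um k) f \<mu>) * (w ^ (j + p) * (w\<^sup>2) ^ k))"
  have act: "act (Cm n) (Dop x f) \<mu>
      = (\<Sum>i\<le>n. \<Sum>j | j \<le> i \<and> 2 * i - j \<le> n.
          x ^ i * (mconst (h j) * act (Cm (n - (2 * i - j)) * Um (i - j)) f \<mu>))" for n
  proof (subst act_Dop[where K = n])
    have "act (Cm n * Dm i) f \<mu> = (\<Sum>j | j \<le> i \<and> 2 * i - j \<le> n.
          mconst (h j) * act (Cm (n - (2 * i - j)) * Um (i - j)) f \<mu>)" for i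
      unfolding Cm_Dm act_sum by (intro sum.mono_neutral_cong_right) auto
    then show "(\<Sum>i\<le>n. x ^ i * act (Cm n * Dm i) f \<mu>) = (\<Sum>i\<le>n. \<Sum>j | j \<le> i \<and> 2 * i - j \<le> n.
          x ^ i * (mconst (h j) * act (Cm (n - (2 * i - j)) * Um (i - j)) f \<mu>))"
      by (simp add: sum_distrib_left)
  qed (auto dest: Cm_size)
  have "Cop N w (Dop x f) \<mu>
    = (\<Sum>n<N. \<Sum>i\<le>n. \<Sum>j | j \<le> i \<and> 2 * i - j \<le> n. T (j, i - j, n - (2 * i - j)))"
    unfolding Cop_def act T_def prod.case sum_distrib_left
  proof (intro sum.cong refl)
    fix n i j :: nat assume "j \<in> {j. j \<le> i \<and> 2 * i - j \<le> n}"
    \<comment> \<open>The exponent n splits into j for H, the remaining size for C, and twice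
      \<open>i - j\<close>, as the argument of U contains the square of w.\<close>
    then have e: "j + (i - j) = i" and n: "n = j + (n - (2 * i - j)) + 2 * (i - j)" by auto
    have w: "w ^ n = w ^ (j + (n - (2 * i - j))) * (w\<^sup>2) ^ (i - j)"
      by (subst n) (simp only: power_add power_mult)
    show "w ^ n * (x ^ i * (mconst (h j) * act (Cm (n - (2 * i - j)) * Um (i - j)) f \<mu>))
      = mconst (h j) * (x ^ (j + (i - j)) * act (Cm (n - (2 * i - j)) * Um (i - j)) f \<mu>)
        * (w ^ (j + (n - (2 * i - j))) * (w\<^sup>2) ^ (i - j))"
      unfolding e w by (simp only: mult_ac)
  qed
  also have "\<dots> = (\<Sum>(n, i, j)\<in>(SIGMA n:{..<N}. SIGMA i:{..n}. {j. j \<le> i \<and> 2 * i - j \<le> n}).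
      T (j, i - j, n - (2 * i - j)))"
    by (auto simp: sum.Sigma intro!: sum.cong)
  also have "\<dots> = sum T {(j, k, p). j + 2 * k + p < N}"
    by (rule sum.reindex_bij_witness[of _ "\<lambda>(j, k, p). (j + 2 * k + p, j + k, j)"
          "\<lambda>(n, i, j). (j, i - j, n - (2 * i - j))"]) auto
  also have "eqmod N \<dots> (sum T ({..<N} \<times> {..<N} \<times> {..<N}))"
  proof (rule eqmod_sum_sets)
    show "finite {(j, k, p). j + 2 * k + p < N}"
      by (rule finite_subset[of _ "{..<N} \<times> {..<N} \<times> {..<N}"]) auto
    fix t assume "t \<in> {..<N} \<times> {..<N} \<times> {..<N}" "t \<notin> {(j, k, p). j + 2 * k + p < N}"
    then show "eqmod N (T t) 0"
      by (auto simp: T_def power_mult[symmetric] power_add[symmetric] intro!: eqmod_mult_0 eqmod_power_0 w)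
  qed auto
  also have "sum T ({..<N} \<times> {..<N} \<times> {..<N}) = (\<Sum>j<N. \<Sum>p<N. \<Sum>k<N. T (j, k, p))"
    by (simp only: sum.cartesian_product') (intro sum.cong refl sum.swap)
  also have "\<dots> = H N (w * x) * Cop N w (Uop N (w\<^sup>2 * x) f) \<mu>"
    unfolding H_def sum_distrib_right
    unfolding Cop_def Uop_def act_sum_fun act_cmult act_mult[symmetric] sum_distrib_left T_def prod.case
    by (intro sum.cong refl) (simp add: power_add power_mult_distrib power_mult mult_ac)
  finally show ?thesis .
qed

lemma op_eqmod:
  assumes "\<And>\<mu>. eqmod N (f \<mu>) (g \<mu>)"
  shows Aop_eqmod: "eqmod N (Aop M w f \<mu>) (Aop M w g \<mu>)" and Dop_eqmod: "eqmod N (Dop w f \<mu>) (Dop w g \<mu>)"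
    and Uop_eqmod: "eqmod N (Uop M w f \<mu>) (Uop M w g \<mu>)" and Cop_eqmod: "eqmod N (Cop M w f \<mu>) (Cop M w g \<mu>)"
  unfolding Aop_def Dop_def Uop_def Cop_def
  by (intro eqmod_sum eqmod_mult_left act_eqmod assms)+

lemma op_cmult:
  "Aop M w (\<lambda>\<mu>. a * f \<mu>) \<mu> = a * Aop M w f \<mu>" "Dop w (\<lambda>\<mu>. a * f \<mu>) \<mu> = a * Dop w f \<mu>"
  "Uop M w (\<lambda>\<mu>. a * f \<mu>) \<mu> = a * Uop M w f \<mu>" "Cop M w (\<lambda>\<mu>. a * f \<mu>) \<mu> = a * Cop M w f \<mu>"
  unfolding Aop_def Dop_def Uop_def Cop_def act_cmult sum_distrib_left
  by (simp_all add: mult.left_commute)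

lemma op_delta:
  "N > 0 \<Longrightarrow> Aop N w delta \<mu> = 1" "N > 0 \<Longrightarrow> Uop N w delta \<mu> = delta \<mu>"
  "N > 0 \<Longrightarrow> Cop N w delta \<mu> = 1" "Dop 1 delta \<mu> = 1"
proof -
  have S: "(\<Sum>n<N. w ^ n * (if n = 0 then a else 0)) = a" if "N > 0" for a and w :: "('v, 'a) mfps"
    using that by (simp add: if_distrib cong: if_cong)
  show "N > 0 \<Longrightarrow> Aop N w delta \<mu> = 1" "N > 0 \<Longrightarrow> Cop N w delta \<mu> = 1"
    "N > 0 \<Longrightarrow> Uop N w delta \<mu> = delta \<mu>"
    using S[of 1 w] S[of "delta \<mu>" w]
    unfolding Aop_def Uop_def Cop_def act_delta Am_empty Cm_empty Um_empty delta_def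
    by (simp_all add: if_distrib mconst_simps cong: if_cong)
  show "Dop 1 delta \<mu> = 1"
    unfolding Dop_def act_delta Dm_empty by (simp add: if_distrib mconst_simps cong: if_cong)
qed

section \<open>Moving A, U and C through products of D applied to delta\<close>

fun E :: "('v, 'a) mfps list \<Rightarrow> ptn \<Rightarrow> ('v, 'a) mfps" where
  "E [] = delta"
| "E (x # xs) = Dop x (E xs)"

text \<open>A crosses every D, rescaling its argument by w, and finally meets delta. There
  \<open>A_w delta = 1 = D_1 delta\<close> creates the new last argument 1.\<close>

lemma Aop_E:
  assumes "mcoeff w 0 = 0" "N > 0"
  shows "eqmod N (Aop N w (E xs) \<mu>) ((\<Prod>x\<leftarrow>xs. H N (w * x)) * E (map ((*) w) xs @ [1]) \<mu>)"
proof (induction xs arbitrary: \<mu>)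
  case Nil
  show ?case using assms(2) by (simp add: op_delta)
next
  case (Cons x xs)
  have "eqmod N (Aop N w (E (x # xs)) \<mu>) (H N (w * x) * Dop (w * x) (Aop N w (E xs)) \<mu>)"
    unfolding E.simps by (rule Aop_Dop[OF assms(1)])
  also have "eqmod N \<dots> (H N (w * x)
      * Dop (w * x) (\<lambda>\<mu>. (\<Prod>x\<leftarrow>xs. H N (w * x)) * E (map ((*) w) xs @ [1]) \<mu>) \<mu>)"
    by (intro eqmod_mult_left Dop_eqmod Cons.IH)
  finally show ?case by (simp add: op_cmult mult.assoc)
qed

lemma Uop_E:
  assumes "mcoeff z 0 = 0" "N > 0"
  shows "eqmod N (Uop N z (E xs) \<mu>) ((\<Prod>x\<leftarrow>xs. H N (z * x)) * E xs \<mu>)"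
proof (induction xs arbitrary: \<mu>)
  case Nil
  show ?case using assms(2) by (simp add: op_delta)
next
  case (Cons x xs)
  have "eqmod N (Uop N z (E (x # xs)) \<mu>) (H N (z * x) * Dop x (Uop N z (E xs)) \<mu>)"
    unfolding E.simps by (rule Uop_Dop[OF assms(1)])
  also have "eqmod N \<dots> (H N (z * x) * Dop x (\<lambda>\<mu>. (\<Prod>x\<leftarrow>xs. H N (z * x)) * E xs \<mu>) \<mu>)"
    by (intro eqmod_mult_left Dop_eqmod Cons.IH)
  finally show ?case by (simp add: op_cmult mult.assoc)
qed

text \<open>Removing the first \<open>D_x\<close> by C yields \<open>H(w x)\<close> and an operator
  U with argument \<open>w^2 x\<close>. This crosses each later \<open>D_y\<close> with the factor
  \<open>H(w^2 x y)\<close> and disappears at delta.\<close>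

fun pair_prod :: "nat \<Rightarrow> ('v, 'a) mfps \<Rightarrow> ('v, 'a) mfps list \<Rightarrow> ('v, 'a) mfps" where
  "pair_prod N w [] = 1"
| "pair_prod N w (x # xs) = H N (w * x) * (\<Prod>y\<leftarrow>xs. H N (w\<^sup>2 * x * y)) * pair_prod N w xs"

lemma Cop_E:
  assumes "mcoeff w 0 = 0" "N > 0"
  shows "eqmod N (Cop N w (E xs) \<mu>) (pair_prod N w xs)"
proof (induction xs arbitrary: \<mu>)
  case Nil
  show ?case using assms(2) by (simp add: op_delta)
next
  case (Cons x xs)
  have z: "mcoeff (w\<^sup>2 * x) 0 = 0" by (simp add: power2_eq_square mcoeff_mult_0 assms(1))
  have "eqmod N (Cop N w (E (x # xs)) \<mu>) (H N (w * x) * Cop N w (Uop N (w\<^sup>2 * x) (E xs)) \<mu>)"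
    unfolding E.simps by (rule Cop_Dop[OF assms(1)])
  also have "eqmod N \<dots> (H N (w * x) * Cop N w (\<lambda>\<mu>. (\<Prod>y\<leftarrow>xs. H N (w\<^sup>2 * x * y)) * E xs \<mu>) \<mu>)"
    by (intro eqmod_mult_left Cop_eqmod Uop_E z assms)
  also have "\<dots> = H N (w * x) * (\<Prod>y\<leftarrow>xs. H N (w\<^sup>2 * x * y)) * Cop N w (E xs) \<mu>"
    by (simp add: op_cmult mult.assoc)
  also have "eqmod N \<dots> (pair_prod N w (x # xs))"
    unfolding pair_prod.simps by (intro eqmod_mult_left Cons.IH)
  finally show ?case .
qed

end


section \<open>Iterating the operators\<close>

lemma sum_PiE_Suc:
  "(\<Sum>R\<in>{1..Suc k} \<rightarrow>\<^sub>E B. g R) = (\<Sum>\<theta>\<in>B. \<Sum>R\<in>{1..k} \<rightarrow>\<^sub>E B. g (R(Suc k := \<theta>)))"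
proof -
  have "{1..Suc k} = insert (Suc k) {1..k}" by auto
  then have "{1..Suc k} \<rightarrow>\<^sub>E B = (\<lambda>(\<theta>, R). R(Suc k := \<theta>)) ` (B \<times> ({1..k} \<rightarrow>\<^sub>E B))"
    by (simp add: PiE_insert_eq)
  moreover have "inj_on (\<lambda>(\<theta>, R). R(Suc k := \<theta>)) (B \<times> ({1..k} \<rightarrow>\<^sub>E B))"
    by (rule inj_combinator) simp
  ultimately show ?thesis
    by (simp add: sum.reindex sum.cartesian_product case_prod_unfold)
qed

context generic_q
begin

lemma Aop_sum: "Aop N w f \<mu> = (\<Sum>\<theta> | psz \<theta> < N. mconst (kern \<mu> \<theta>) * w ^ psz \<theta> * f \<theta>)"
proof -
  have fin: "finite {\<theta>. psz \<theta> < N}" by (rule finite_subset[OF _ finite_psz_le[of N]]) auto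
  have "act (Am n) f \<mu> = (\<Sum>\<theta> | psz \<theta> = n. mconst (kern \<mu> \<theta>) * f \<theta>)" for n
    by (subst act_superset[OF finite_psz_eq[of n]]) (auto simp: entry_Aser split: if_splits)
  then have "Aop N w f \<mu> = (\<Sum>n<N. \<Sum>\<theta> | \<theta> \<in> {\<theta>. psz \<theta> < N} \<and> psz \<theta> = n.
      mconst (kern \<mu> \<theta>) * w ^ psz \<theta> * f \<theta>)"
    unfolding Aop_def by (auto simp: sum_distrib_left ac_simps intro!: sum.cong)
  also have "\<dots> = (\<Sum>\<theta> | psz \<theta> < N. mconst (kern \<mu> \<theta>) * w ^ psz \<theta> * f \<theta>)"
    using fin by (intro sum.group) auto
  finally show ?thesis .
qed

lemma Cop_sum:
  "Cop N w f \<rho> = (\<Sum>\<mu> | psz \<mu> < N. mconst (kern empty_ptn \<mu>) * w ^ psz \<mu> * f (fold2 \<mu>))"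
proof -
  have fin: "finite {\<theta>. psz \<theta> < N}" by (rule finite_subset[OF _ finite_psz_le[of N]]) auto
  have "act (Cm n) f \<rho> = (\<Sum>\<mu> | psz \<mu> = n. mconst (kern empty_ptn \<mu>) * f (fold2 \<mu>))" for n
  proof -
    have "act (Cm n) f \<rho> = (\<Sum>\<theta> | psz \<theta> = n. \<Sum>\<mu> | \<mu> \<in> {\<mu>. psz \<mu> = n} \<and> fold2 \<mu> = \<theta>.
        mconst (kern empty_ptn \<mu>) * f (fold2 \<mu>))"
    proof (subst act_superset[OF finite_psz_eq[of n]])
      show "\<theta> \<in> {\<theta>. psz \<theta> = n}" if "entry (Cm n) \<rho> \<theta> \<noteq> 0" for \<theta>
        using Cm_size[OF that] by simp
      show "(\<Sum>\<theta> | psz \<theta> = n. mconst (entry (Cm n) \<rho> \<theta>) * f \<theta>)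
        = (\<Sum>\<theta> | psz \<theta> = n. \<Sum>\<mu> | \<mu> \<in> {\<mu>. psz \<mu> = n} \<and> fold2 \<mu> = \<theta>.
            mconst (kern empty_ptn \<mu>) * f (fold2 \<mu>))"
        unfolding entry_Cser mconst_sum sum_distrib_right by (intro sum.cong refl) auto
    qed
    also have "\<dots> = (\<Sum>\<mu> | psz \<mu> = n. mconst (kern empty_ptn \<mu>) * f (fold2 \<mu>))"
      by (rule sum.group) (auto simp: finite_psz_eq psz_fold2)
    finally show ?thesis .
  qed
  then have "Cop N w f \<rho> = (\<Sum>n<N. \<Sum>\<mu> | \<mu> \<in> {\<mu>. psz \<mu> < N} \<and> psz \<mu> = n.
      mconst (kern empty_ptn \<mu>) * w ^ psz \<mu> * f (fold2 \<mu>))"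
    unfolding Cop_def by (auto simp: sum_distrib_left ac_simps intro!: sum.cong)
  also have "\<dots> = (\<Sum>\<mu> | psz \<mu> < N. mconst (kern empty_ptn \<mu>) * w ^ psz \<mu> * f (fold2 \<mu>))"
    using fin by (intro sum.group) auto
  finally show ?thesis .
qed

text \<open>\<open>r_1\<close> is summed innermost, against the constant function 1, since it has no
  predecessor in the chain. The free argument is the neighbouring partition that follows, which the
  next operator sums over.\<close>

fun iter :: "nat \<Rightarrow> (nat \<Rightarrow> ('v, 'a) mfps) \<Rightarrow> nat \<Rightarrow> ptn \<Rightarrow> ('v, 'a) mfps" where
  "iter N y 0 = (\<lambda>_. 1)"
| "iter N y (Suc k) = Aop N (y (Suc k)) (iter N y k)"

lemma iter_sum:
  "iter N y k \<sigma> = (\<Sum>R\<in>{1..k} \<rightarrow>\<^sub>E {\<mu>. psz \<mu> < N}.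
     \<Prod>i=1..k. mconst (kern (if i = k then \<sigma> else R (Suc i)) (R i)) * y i ^ psz (R i))"
proof (induction k arbitrary: \<sigma>)
  case (Suc k)
  show ?case
    unfolding iter.simps Aop_sum sum_PiE_Suc Suc.IH sum_distrib_left
    by (intro sum.cong refl) (auto simp: ac_simps intro!: prod.cong)
qed simp

lemma Cop_iter_sum:
  "Cop N w (iter N y p) \<rho> = (\<Sum>R\<in>{1..Suc p} \<rightarrow>\<^sub>E {\<mu>. psz \<mu> < N}.
     mconst (kern empty_ptn (R (Suc p))) * w ^ psz (R (Suc p))
     * (\<Prod>i=1..p. mconst (kern (if i = p then fold2 (R (Suc p)) else R (Suc i)) (R i)) * y i ^ psz (R i)))"
  unfolding Cop_sum sum_PiE_Suc iter_sum sum_distrib_left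
  by (intro sum.cong refl) (auto intro!: arg_cong2[where f = "(*)"] prod.cong)

text \<open>Each new operator multiplies all arguments by the next variable and appends 1, so after
  k steps the arguments are the products of \<open>y i, ..., y k\<close>, the last one being the
  empty product. The factors of H released on the way belong to the roots that end before
  \<open>k + 1\<close>.\<close>

lemma iter_E:
  assumes N: "N > 0" and y: "\<And>i. mcoeff (y i) 0 = 0"
  shows "eqmod N (iter N y k \<mu>) ((\<Prod>j=1..k. \<Prod>i=1..j. H N (\<Prod>t=i..j. y t))
    * E (map (\<lambda>i. \<Prod>t=i..k. y t) [1..<Suc (Suc k)]) \<mu>)"
proof (induction k arbitrary: \<mu>)
  case 0
  show ?case by (simp add: op_delta)
next
  case (Suc k)
  define P where "P = (\<Prod>j=1..k. \<Prod>i=1..j. H N (\<Prod>t=i..j. y t))"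
  define xs where "xs = map (\<lambda>i. \<Prod>t=i..k. y t) [1..<Suc (Suc k)]"
  have m: "map ((*) (y (Suc k))) xs = map (\<lambda>i. \<Prod>t=i..Suc k. y t) [1..<Suc (Suc k)]"
    unfolding xs_def map_map by (intro map_cong refl) (auto simp: mult.commute)
  have "eqmod N (iter N y (Suc k) \<mu>) (Aop N (y (Suc k)) (\<lambda>\<mu>. P * E xs \<mu>) \<mu>)"
    unfolding iter.simps P_def xs_def by (intro Aop_eqmod Suc.IH)
  also have "\<dots> = P * Aop N (y (Suc k)) (E xs) \<mu>" by (rule op_cmult)
  also have "eqmod N \<dots> (P * ((\<Prod>x\<leftarrow>xs. H N (y (Suc k) * x)) * E (map ((*) (y (Suc k))) xs @ [1]) \<mu>))"
    by (intro eqmod_mult_left Aop_E y N)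
  also have "(\<Prod>x\<leftarrow>xs. H N (y (Suc k) * x)) = prod_list (map (H N) (map ((*) (y (Suc k))) xs))"
    by (simp add: comp_def)
  also have "\<dots> = (\<Prod>i=1..Suc k. H N (\<Prod>t=i..Suc k. y t))"
  proof -
    have "set [1..<Suc (Suc k)] = {1..Suc k}" by auto
    then show ?thesis
      unfolding m map_map
      using prod.distinct_set_conv_list[of "[1..<Suc (Suc k)]" "\<lambda>i. H N (\<Prod>t=i..Suc k. y t)"]
      by (simp add: comp_def del: upt_Suc)
  qed
  also have "map ((*) (y (Suc k))) xs @ [1] = map (\<lambda>i. \<Prod>t=i..Suc k. y t) [1..<Suc (Suc (Suc k))]"
    unfolding m by simp
  also have "P * ((\<Prod>i=1..Suc k. H N (\<Prod>t=i..Suc k. y t)) * E \<dots> \<mu>)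
    = (\<Prod>j=1..Suc k. \<Prod>i=1..j. H N (\<Prod>t=i..j. y t)) * E \<dots> \<mu>"
    unfolding P_def by (subst (2) prod.nat_ivl_Suc') (simp_all del: upt_Suc add: ac_simps)
  finally show ?case .
qed

lemma pair_prod_upt:
  "pair_prod N w (map f [a..<b])
    = (\<Prod>i\<in>{a..<b}. H N (w * f i)) * (\<Prod>i\<in>{a..<b}. \<Prod>j\<in>{Suc i..<b}. H N (w\<^sup>2 * f i * f j))"
proof (induction "b - a" arbitrary: a)
  case (Suc n)
  then have ab: "a < b" and IH: "pair_prod N w (map f [Suc a..<b])
    = (\<Prod>i\<in>{Suc a..<b}. H N (w * f i)) * (\<Prod>i\<in>{Suc a..<b}. \<Prod>j\<in>{Suc i..<b}. H N (w\<^sup>2 * f i * f j))"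
    by simp_all
  have "(\<Prod>y\<leftarrow>map f [Suc a..<b]. H N (w\<^sup>2 * f a * y)) = (\<Prod>j\<in>{Suc a..<b}. H N (w\<^sup>2 * f a * f j))"
    using prod.distinct_set_conv_list[of "[Suc a..<b]" "\<lambda>j. H N (w\<^sup>2 * f a * f j)"] by (simp add: comp_def)
  then show ?case
    unfolding upt_conv_Cons[OF ab] list.map pair_prod.simps IH
      prod.atLeast_Suc_lessThan[OF ab, of "\<lambda>i. H N (w * f i)"]
      prod.atLeast_Suc_lessThan[OF ab, of "\<lambda>i. \<Prod>j\<in>{Suc i..<b}. H N (w\<^sup>2 * f i * f j)"]
    by (simp only: ac_simps)
qed simp

text \<open>With \<open>f i\<close> the product of \<open>y i, ..., y (l - 1)\<close>, the final
  step adds \<open>H(y l * f i)\<close>, the roots that end at l, and for i < j the factors with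
  argument \<open>(y l)^2 * f i * f j\<close>. In the latter the variables from j on occur twice.
  The case j = l is included through the empty product \<open>f l = 1\<close>.\<close>

lemma Cop_iter:
  assumes N: "N > 0" and y: "\<And>i. mcoeff (y i) 0 = 0" and l: "l = Suc p"
  shows "eqmod N (Cop N (y l) (iter N y p) \<rho>)
    ((\<Prod>i=1..l. \<Prod>j=i..l. H N (\<Prod>k=i..j. y k))
     * (\<Prod>i=1..l. \<Prod>j=i+1..l. H N ((\<Prod>k=i..j-1. y k) * (\<Prod>k=j..l. (y k)\<^sup>2))))"
proof -
  define P where "P = (\<Prod>j=1..p. \<Prod>i=1..j. H N (\<Prod>t=i..j. y t))"
  define f where "f = (\<lambda>i. \<Prod>t=i..p. y t)"
  have "eqmod N (Cop N (y l) (iter N y p) \<rho>) (Cop N (y l) (\<lambda>\<mu>. P * E (map f [1..<Suc (Suc p)]) \<mu>) \<rho>)"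
    unfolding P_def f_def by (intro Cop_eqmod iter_E N y)
  also have "\<dots> = P * Cop N (y l) (E (map f [1..<Suc (Suc p)])) \<rho>" by (rule op_cmult)
  also have "eqmod N \<dots> (P * pair_prod N (y l) (map f [1..<Suc (Suc p)]))"
    by (intro eqmod_mult_left Cop_E y N)
  also have "\<dots> = P * (\<Prod>i=1..l. H N (y l * f i))
     * (\<Prod>i=1..l. \<Prod>j=i+1..l. H N ((y l)\<^sup>2 * f i * f j))"
    unfolding pair_prod_upt l atLeastLessThanSuc_atLeastAtMost by (simp add: mult.assoc)
  also have "(\<Prod>i=1..l. H N (y l * f i)) = (\<Prod>i=1..l. H N (\<Prod>t=i..l. y t))"
    by (intro prod.cong refl) (auto simp: l f_def mult.commute)
  also have "P * \<dots> = (\<Prod>j=1..l. \<Prod>i=1..j. H N (\<Prod>t=i..j. y t))"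
    unfolding P_def l by (subst (2) prod.nat_ivl_Suc') simp_all
  also have "\<dots> = (\<Prod>i=1..l. \<Prod>j=i..l. H N (\<Prod>t=i..j. y t))"
    unfolding prod.Sigma[OF finite_atLeastAtMost ballI[OF finite_atLeastAtMost]]
    by (rule prod.reindex_bij_witness[of _ prod.swap prod.swap]) auto
  also have "(\<Prod>i=1..l. \<Prod>j=i+1..l. H N ((y l)\<^sup>2 * f i * f j))
    = (\<Prod>i=1..l. \<Prod>j=i+1..l. H N ((\<Prod>k=i..j-1. y k) * (\<Prod>k=j..l. (y k)\<^sup>2)))"
  proof (intro prod.cong refl arg_cong[of _ _ "H N"])
    fix i j assume ij: "i \<in> {1..l}" "j \<in> {i+1..l}"
    have "{i..p} = {i..j-1} \<union> {j..p}" "{i..j-1} \<inter> {j..p} = {}" using ij l by auto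
    then have "f i = (\<Prod>k=i..j-1. y k) * f j" unfolding f_def by (simp add: prod.union_disjoint)
    moreover have "(\<Prod>k=j..l. (y k)\<^sup>2) = (y l)\<^sup>2 * (f j)\<^sup>2"
      using ij by (simp add: l f_def prod_power_distrib mult.commute)
    ultimately show "(y l)\<^sup>2 * f i * f j = (\<Prod>k=i..j-1. y k) * (\<Prod>k=j..l. (y k)\<^sup>2)"
      by (simp add: power2_eq_square ac_simps)
  qed
  finally show ?thesis .
qed

end


section \<open>The sum side\<close>

lemma mconst_prod: "mconst (prod f A) = (\<Prod>x\<in>A. mconst (f x) :: ('v, 'a::comm_ring_1) mfps)"
  by (induction A rule: infinite_finite_induct) (simp_all add: mconst_simps mconst_mult)

lemma Sum_any_lessThan:
  fixes f :: "nat \<Rightarrow> 'b::comm_monoid_add"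
  assumes "\<And>t. t \<ge> T \<Longrightarrow> f t = 0"
  shows "Sum_any f = (\<Sum>t<T. f t)"
proof (intro Sum_any.expand_superset subsetI)
  fix t assume "t \<in> {t. f t \<noteq> 0}"
  then show "t \<in> {..<T}" using assms[of t] by (cases "t < T") auto
qed simp

definition sq :: "ptn \<Rightarrow> int" where
  "sq \<mu> = Sum_any (\<lambda>t. (int (parts \<mu> t))\<^sup>2)"

definition dot :: "ptn \<Rightarrow> ptn \<Rightarrow> int" where
  "dot \<mu> \<theta> = Sum_any (\<lambda>t. int (parts \<mu> t) * int (parts \<theta> t))"

definition qfac_prod :: "'a::field \<Rightarrow> ptn \<Rightarrow> 'a" where
  "qfac_prod q \<mu> = Prod_any (\<lambda>t. qfac q (parts \<mu> t - parts \<mu> (Suc t)))"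

text \<open>Each mixed term of the exponent is assigned to the earlier of the two partitions that it
  couples, matching the kernel that sums over that partition. For the last coupling the partner is
  the folded partition.\<close>

lemma qexponent_parts:
  assumes l: "l = Suc p" "p \<ge> 1"
  shows "qexponent l (\<lambda>i. parts (R i)) = sq (R l)
    + (\<Sum>i=1..p. sq (R i) - dot (if i = p then fold2 (R l) else R (Suc i)) (R i))"
proof -
  obtain p' where p: "p = Suc p'" using l by (cases p) auto
  have "(\<Sum>i=2..l-1. Sum_any (\<lambda>t. int (parts (R (i - 1)) t) * int (parts (R i) t)))
    = (\<Sum>i=1..p'. dot (R (Suc i)) (R i))"
  proof -
    have "{2..l-1} = {Suc 1..Suc p'}" using l p by auto
    then show ?thesis
      unfolding dot_def by (simp only: sum.shift_bounds_cl_Suc_ivl) (simp add: mult.commute)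
  qed
  moreover have "Sum_any (\<lambda>t. int (parts (R (l - 1)) t) * (int (parts (R l) (2 * t)) + int (parts (R l) (2 * t + 1))))
    = dot (fold2 (R l)) (R p)"
    unfolding dot_def by (simp add: l parts_fold2 mult.commute)
  moreover have "(\<Sum>i=1..p. dot (if i = p then fold2 (R l) else R (Suc i)) (R i))
    = (\<Sum>i=1..p'. dot (R (Suc i)) (R i)) + dot (fold2 (R l)) (R p)"
    by (simp add: p)
  moreover have "(\<Sum>i=1..l. Sum_any (\<lambda>t. (int (parts (R i) t))\<^sup>2)) = sq (R l) + (\<Sum>i=1..p. sq (R i))"
    unfolding sq_def by (simp add: l)
  ultimately show ?thesis
    unfolding qexponent_def by (simp add: sum_subtractf)
qed

context generic_q
begin

lemma powi_sum: "q powi (\<Sum>t\<in>A. f t) = (\<Prod>t\<in>A. q powi f t)"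
  by (induction A rule: infinite_finite_induct) (simp_all add: powi_add[symmetric])

lemma kern_eq: "kern \<mu> \<theta> = q powi (sq \<theta> - dot \<mu> \<theta>) / qfac_prod q \<theta>"
proof -
  define T where "T = psz \<theta>"
  have b: "bounded_by T \<theta>" by (simp add: T_def bounded_by_psz)
  have "sq \<theta> - dot \<mu> \<theta> = (\<Sum>t<T. int (parts \<theta> t) * (int (parts \<theta> t) - int (parts \<mu> t)))"
    unfolding sq_def dot_def
    by (subst (1 2) Sum_any_lessThan[where T = T])
      (simp_all add: bounded_byD[OF b] sum_subtractf[symmetric] power2_eq_square algebra_simps)
  then have e: "q powi (sq \<theta> - dot \<mu> \<theta>)
    = (\<Prod>t<T. q powi (int (parts \<theta> t) * (int (parts \<theta> t) - int (parts \<mu> t))))"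
    by (simp only: powi_sum)
  have f: "qfac_prod q \<theta> = (\<Prod>t<T. qfac q (parts \<theta> t - parts \<theta> (Suc t)))"
    unfolding qfac_prod_def by (rule Prod_any_lessThan) (simp add: bounded_byD[OF b])
  have g: "qfac_inv q (int (parts \<theta> t) - int (parts \<theta> (Suc t))) = 1 / qfac q (parts \<theta> t - parts \<theta> (Suc t))" for t
    using parts_antimono[of t "Suc t" \<theta>] by (simp add: qfac_inv_def flip: of_nat_diff)
  show ?thesis
    unfolding kern_prod[OF b] e f g by (simp add: prod.distrib prod_dividef)
qed

text \<open>A single kernel value may have a negative exponent. Only the total exponent is
  nonnegative, by \<open>qexponent_nonneg\<close>, so that \<open>nat\<close> changes
  nothing.\<close>

lemma kern_chain:
  assumes l: "l = Suc p" "p \<ge> 1"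
  shows "kern empty_ptn (R l) * (\<Prod>i=1..p. kern (if i = p then fold2 (R l) else R (Suc i)) (R i))
    = q ^ nat (qexponent l (\<lambda>i. parts (R i))) / (\<Prod>i=1..l. qfac_prod q (R i))"
proof -
  define d where "d = (\<lambda>i. dot (if i = p then fold2 (R l) else R (Suc i)) (R i))"
  have "qexponent l (\<lambda>i. parts (R i)) \<ge> 0"
    using l parts by (intro qexponent_nonneg) auto
  then have "q ^ nat (qexponent l (\<lambda>i. parts (R i))) = q powi qexponent l (\<lambda>i. parts (R i))"
    by (simp add: power_int_def)
  also have "\<dots> = q powi sq (R l) * (\<Prod>i=1..p. q powi (sq (R i) - d i))"
    unfolding qexponent_parts[OF l] powi_add[symmetric] powi_sum d_def ..
  finally have e: "q ^ nat (qexponent l (\<lambda>i. parts (R i)))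
    = q powi sq (R l) * (\<Prod>i=1..p. q powi (sq (R i) - d i))" .
  have "dot empty_ptn (R l) = 0" by (simp add: dot_def)
  moreover have "(\<Prod>i=1..l. qfac_prod q (R i)) = qfac_prod q (R l) * (\<Prod>i=1..p. qfac_prod q (R i))"
    by (simp add: l mult.commute)
  ultimately show ?thesis
    unfolding e kern_eq by (simp add: prod_dividef d_def)
qed

end

section \<open>Passage between power series and Laurent series in q\<close>

interpretation L: generic_q "fls_X :: rat fls"
proof
  fix n :: nat assume "n > 0"
  then have "fls_nth (fls_X ^ n :: rat fls) 0 \<noteq> fls_nth 1 0" by simp
  then show "(fls_X :: rat fls) ^ n \<noteq> 1" by metis
qed simp

text \<open>An injective ring homomorphism: congruences proved over Laurent series in q descend to
  power series by \<open>eqmod_emb\<close>.\<close>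

definition emb :: "('v, rat fps) mfps \<Rightarrow> ('v, rat fls) mfps" where
  "emb f = Abs_mfps (\<lambda>n. fps_to_fls (mcoeff f n))"

lemma mcoeff_emb: "mcoeff (emb f) n = fps_to_fls (mcoeff f n)"
  by (simp add: emb_def)

lemma fps_to_fls_sum: "fps_to_fls (sum f A) = (\<Sum>k\<in>A. fps_to_fls (f k :: rat fps))"
  by (induction A rule: infinite_finite_induct) simp_all

lemma fps_to_fls_prod: "fps_to_fls (prod f A) = (\<Prod>k\<in>A. fps_to_fls (f k :: rat fps))"
  by (induction A rule: infinite_finite_induct) (simp_all add: fls_times_fps_to_fls)

lemma qpoch_to_fls: "fps_to_fls (qpoch n) = qfac fls_X n"
  by (simp add: qpoch_def qfac_def fps_to_fls_prod fps_to_fls_power)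

lemma emb_1 [simp]: "emb 1 = 1" and emb_0 [simp]: "emb 0 = 0"
  by (rule mfps_eqI, simp add: mcoeff_emb mcoeff_1)+

lemma emb_add: "emb (f + g) = emb f + emb g"
  by (rule mfps_eqI) (simp add: mcoeff_emb)

lemma emb_mult: "emb (f * g) = emb f * emb g"
  by (rule mfps_eqI)
    (simp add: mcoeff_emb mcoeff_mult fps_to_fls_sum fls_times_fps_to_fls case_prod_unfold)

lemma emb_sum: "emb (sum f A) = (\<Sum>x\<in>A. emb (f x))"
  by (induction A rule: infinite_finite_induct) (simp_all add: emb_add)

lemma emb_prod: "emb (prod f A) = (\<Prod>x\<in>A. emb (f x))"
  by (induction A rule: infinite_finite_induct) (simp_all add: emb_mult)

lemma emb_power: "emb (f ^ n) = emb f ^ n"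
  by (induction n) (simp_all add: emb_mult)

lemma emb_mconst: "emb (mconst c) = mconst (fps_to_fls c)"
  by (rule mfps_eqI) (simp add: mcoeff_emb mcoeff_mconst)

lemma emb_mvar: "emb (mvar v) = mvar v"
  by (rule mfps_eqI) (simp add: mcoeff_emb mvar_def)

lemma eqmod_emb: "eqmod N (emb f) (emb g) \<longleftrightarrow> eqmod N f g"
  by (simp add: eqmod_def mcoeff_emb)

lemma mcoeff_mvar_0 [simp]: "mcoeff (mvar v) 0 = 0"
proof -
  have "Poly_Mapping.single v (1 :: nat) \<noteq> 0" by (metis lookup_single_eq lookup_zero one_neq_zero)
  then show ?thesis by (simp add: mvar_def)
qed

fun hcoeff_fps :: "nat \<Rightarrow> rat fps" where
  "hcoeff_fps 0 = 1"
| "hcoeff_fps (Suc n) = fps_X * hcoeff_fps n * inverse (1 - fps_X ^ Suc n)"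

declare hcoeff_fps.simps(2) [simp del]

lemma hcoeff_fps_Suc: "hcoeff_fps (Suc n) = fps_X ^ Suc n * hcoeff_fps (Suc n) + fps_X * hcoeff_fps n"
proof -
  have "inverse (1 - fps_X ^ Suc n) * (1 - fps_X ^ Suc n) = (1 :: rat fps)"
    by (rule inverse_mult_eq_1) simp
  then have "hcoeff_fps (Suc n) * (1 - fps_X ^ Suc n) = fps_X * hcoeff_fps n"
    unfolding hcoeff_fps.simps mult.assoc by simp
  then show ?thesis by (simp add: algebra_simps del: power_Suc)
qed

lemma hcoeff_fps_to_fls: "fps_to_fls (hcoeff_fps n) = L.h n"
proof (induction n)
  case (Suc n)
  have nz: "1 - fls_X ^ Suc n \<noteq> (0 :: rat fls)" using L.q_power[of "Suc n"] by auto
  have "fps_to_fls (hcoeff_fps (Suc n)) = fps_to_fls (fps_X ^ Suc n * hcoeff_fps (Suc n) + fps_X * hcoeff_fps n)"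
    by (rule arg_cong[OF hcoeff_fps_Suc])
  then have "fps_to_fls (hcoeff_fps (Suc n)) * (1 - fls_X ^ Suc n) = fls_X * L.h n"
    by (simp add: fls_times_fps_to_fls fps_to_fls_power Suc.IH algebra_simps del: power_Suc)
  then show ?case using nz by (simp add: L.h.simps(2) eq_divide_eq del: power_Suc)
qed simp

definition hseries :: "nat \<Rightarrow> ('v, rat fps) mfps \<Rightarrow> ('v, rat fps) mfps" where
  "hseries N z = (\<Sum>j<N. mconst (hcoeff_fps j) * z ^ j)"

lemma emb_hseries: "emb (hseries N z) = L.H N (emb z)"
  by (simp add: hseries_def L.H_def emb_sum emb_mult emb_mconst emb_power hcoeff_fps_to_fls)

lemma fps_prod_nth_0: "prod f A $ 0 = (\<Prod>x\<in>A. f x $ 0 :: 'b::comm_ring_1)"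
  by (induction A rule: infinite_finite_induct) simp_all

text \<open>Tuples are extensional functions on \<open>{1..l}\<close>; their values elsewhere must
  not matter when they are exchanged for families of type \<open>ptn\<close>.\<close>

lemma sum_side_term_cong:
  assumes "\<And>i. i \<in> {1..l} \<Longrightarrow> R i = R' i" and "l \<ge> 2"
  shows "sum_side_term l R = sum_side_term l R'"
proof -
  have eq: "R l = R' l" "R (l - 1) = R' (l - 1)"
    using assms(2) by (auto intro: assms(1))
  have "(\<Sum>i=1..l. Sum_any (\<lambda>t. (int (R i t))\<^sup>2)) = (\<Sum>i=1..l. Sum_any (\<lambda>t. (int (R' i t))\<^sup>2))"
    by (intro sum.cong refl) (simp add: assms(1))
  moreover have "(\<Sum>i=2..l-1. Sum_any (\<lambda>t. int (R (i - 1) t) * int (R i t)))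
    = (\<Sum>i=2..l-1. Sum_any (\<lambda>t. int (R' (i - 1) t) * int (R' i t)))"
  proof (intro sum.cong refl)
    fix i assume "i \<in> {2..l-1}"
    then have "R i = R' i" "R (i - 1) = R' (i - 1)" by (auto intro!: assms(1))
    then show "Sum_any (\<lambda>t. int (R (i - 1) t) * int (R i t)) = Sum_any (\<lambda>t. int (R' (i - 1) t) * int (R' i t))"
      by (simp only:)
  qed
  ultimately have "qexponent l R = qexponent l R'"
    unfolding qexponent_def eq by (simp only:)
  moreover have "(\<Prod>i=1..l. Prod_any (\<lambda>t. qpoch (R i t - R i (Suc t))))
    = (\<Prod>i=1..l. Prod_any (\<lambda>t. qpoch (R' i t - R' i (Suc t))))"
    by (intro prod.cong refl) (simp add: assms)
  moreover have "(\<Prod>i=1..l. mvar i ^ psize (R i)) = (\<Prod>i=1..l. mvar i ^ psize (R' i) :: (nat, rat fps) mfps)"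
    by (intro prod.cong refl) (simp add: assms)
  ultimately show ?thesis by (simp add: sum_side_term_def)
qed

lemma emb_sum_side_term:
  assumes l: "l = Suc p" "p \<ge> 1"
  shows "emb (sum_side_term l (\<lambda>i. parts (R i)))
    = mconst (L.kern empty_ptn (R l)) * mvar l ^ psz (R l)
      * (\<Prod>i=1..p. mconst (L.kern (if i = p then fold2 (R l) else R (Suc i)) (R i)) * mvar i ^ psz (R i))"
proof -
  define Q where "Q = (\<Prod>i=1..l. Prod_any (\<lambda>t. qpoch (parts (R i) t - parts (R i) (Suc t))))"
  have Q: "fps_to_fls (Prod_any (\<lambda>t. qpoch (parts \<mu> t - parts \<mu> (Suc t)))) = qfac_prod fls_X \<mu>"
    and Q0: "Prod_any (\<lambda>t. qpoch (parts \<mu> t - parts \<mu> (Suc t))) $ 0 = 1" for \<mu>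
  proof -
    have q0: "qpoch n $ 0 = 1" for n by (simp add: qpoch_def fps_prod_nth_0)
    have z: "parts \<mu> t = 0" if "t \<ge> psz \<mu>" for t using that bounded_byD[OF bounded_by_psz] by blast
    have 1: "Prod_any (\<lambda>t. qpoch (parts \<mu> t - parts \<mu> (Suc t)))
      = (\<Prod>t<psz \<mu>. qpoch (parts \<mu> t - parts \<mu> (Suc t)))"
      by (rule Prod_any_lessThan) (simp add: z qpoch_def)
    show "fps_to_fls (Prod_any (\<lambda>t. qpoch (parts \<mu> t - parts \<mu> (Suc t)))) = qfac_prod fls_X \<mu>"
      unfolding 1 qfac_prod_def fps_to_fls_prod qpoch_to_fls by (rule Prod_any_lessThan[symmetric]) (simp add: z)
    show "Prod_any (\<lambda>t. qpoch (parts \<mu> t - parts \<mu> (Suc t))) $ 0 = 1"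
      unfolding 1 by (simp add: fps_prod_nth_0 q0)
  qed
  have "fps_to_fls Q = (\<Prod>i=1..l. qfac_prod fls_X (R i))"
    unfolding Q_def fps_to_fls_prod Q ..
  moreover have "Q $ 0 = 1" unfolding Q_def by (simp add: fps_prod_nth_0 Q0)
  then have "inverse Q * Q = 1" "Q \<noteq> 0" by (auto intro: inverse_mult_eq_1)
  then have "fps_to_fls (inverse Q) * fps_to_fls Q = 1" by (metis fls_times_fps_to_fls fps_one_to_fls)
  then have "fps_to_fls (inverse Q) = 1 / fps_to_fls Q" using \<open>Q \<noteq> 0\<close> by (simp add: eq_divide_eq)
  moreover have "fps_X ^ nat (qexponent l (\<lambda>i. parts (R i))) / Q
      = fps_X ^ nat (qexponent l (\<lambda>i. parts (R i))) * inverse Q"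
    using \<open>Q $ 0 = 1\<close> by (intro fps_divide_unit) simp
  ultimately have "fps_to_fls (fps_X ^ nat (qexponent l (\<lambda>i. parts (R i))) / Q)
    = L.kern empty_ptn (R l) * (\<Prod>i=1..p. L.kern (if i = p then fold2 (R l) else R (Suc i)) (R i))"
    unfolding L.kern_chain[OF l] by (simp add: fls_times_fps_to_fls fps_to_fls_power)
  moreover have "emb (\<Prod>i=1..l. mvar i ^ psize (parts (R i))) = mvar l ^ psz (R l) * (\<Prod>i=1..p. mvar i ^ psz (R i))"
    unfolding emb_prod emb_power emb_mvar psz_def by (simp add: l mult.commute)
  ultimately show ?thesis
    unfolding sum_side_term_def Q_def[symmetric] emb_mult emb_mconst
    by (simp add: mconst_mult prod.distrib mconst_prod ac_simps)
qed


section \<open>Truncations of the sum and their common limit\<close>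

definition product_series :: "nat \<Rightarrow> nat \<Rightarrow> (nat, rat fps) mfps" where
  "product_series N l = (\<Prod>i=1..l. \<Prod>j=i..l. hseries N (\<Prod>k=i..j. mvar k))
     * (\<Prod>i=1..l. \<Prod>j=i+1..l. hseries N ((\<Prod>k=i..j-1. mvar k) * (\<Prod>k=j..l. (mvar k)\<^sup>2)))"

lemma sum_side_eqmod:
  assumes N: "N > 0" and l: "l \<ge> 2"
  shows "eqmod N (\<Sum>R\<in>{1..l} \<rightarrow>\<^sub>E {r \<in> partitions. psize r < N}. sum_side_term l R) (product_series N l)"
proof -
  obtain p where p: "l = Suc p" "p \<ge> 1" using l by (cases l) auto
  define B where "B = {\<mu>. psz \<mu> < N}"
  have "(\<Sum>R\<in>{1..l} \<rightarrow>\<^sub>E {r \<in> partitions. psize r < N}. sum_side_term l R)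
    = (\<Sum>R\<in>{1..l} \<rightarrow>\<^sub>E B. sum_side_term l (\<lambda>i. parts (R i)))"
  proof (rule sum.reindex_bij_witness[of _ "\<lambda>R. \<lambda>i\<in>{1..l}. parts (R i)" "\<lambda>R. \<lambda>i\<in>{1..l}. Abs_ptn (R i)"])
    fix R assume R: "R \<in> {1..l} \<rightarrow>\<^sub>E {r \<in> partitions. psize r < N}"
    have inv: "parts (Abs_ptn (R i)) = R i" if "i \<in> {1..l}" for i
      using PiE_mem[OF R that] by (simp add: Abs_ptn_inverse)
    show "(\<lambda>i\<in>{1..l}. parts ((\<lambda>i\<in>{1..l}. Abs_ptn (R i)) i)) = R"
      using R inv by (intro ext) (auto simp: restrict_def PiE_def extensional_def)
    show "(\<lambda>i\<in>{1..l}. Abs_ptn (R i)) \<in> {1..l} \<rightarrow>\<^sub>E B"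
      using R inv by (auto simp: B_def psz_def PiE_iff)
    show "sum_side_term l (\<lambda>i. parts ((\<lambda>i\<in>{1..l}. Abs_ptn (R i)) i)) = sum_side_term l R"
      using inv by (intro sum_side_term_cong l) simp
  next
    fix R assume R: "R \<in> {1..l} \<rightarrow>\<^sub>E B"
    show "(\<lambda>i\<in>{1..l}. Abs_ptn ((\<lambda>i\<in>{1..l}. parts (R i)) i)) = R"
      using R by (intro ext) (auto simp: restrict_def PiE_def extensional_def parts_inverse)
    show "(\<lambda>i\<in>{1..l}. parts (R i)) \<in> {1..l} \<rightarrow>\<^sub>E {r \<in> partitions. psize r < N}"
      using R parts by (auto simp: B_def psz_def PiE_iff)
  qed
  then have "emb (\<Sum>R\<in>{1..l} \<rightarrow>\<^sub>E {r \<in> partitions. psize r < N}. sum_side_term l R)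
    = emb (\<Sum>R\<in>{1..l} \<rightarrow>\<^sub>E B. sum_side_term l (\<lambda>i. parts (R i)))" by (rule arg_cong)
  also have "\<dots> = L.Cop N (mvar l) (L.iter N mvar p) empty_ptn"
    unfolding emb_sum L.Cop_iter_sum p(1)[symmetric] B_def emb_sum_side_term[OF p] ..
  finally have "emb (\<Sum>R\<in>{1..l} \<rightarrow>\<^sub>E {r \<in> partitions. psize r < N}. sum_side_term l R)
    = L.Cop N (mvar l) (L.iter N mvar p) empty_ptn" .
  moreover have "eqmod N (L.Cop N (mvar l) (L.iter N mvar p) empty_ptn) (emb (product_series N l))"
    unfolding product_series_def emb_mult emb_prod emb_hseries emb_power emb_mvar
    by (rule L.Cop_iter[OF N _ p(1)]) simp
  ultimately show ?thesis by (simp only: eqmod_emb[symmetric])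
qed

text \<open>The common value of both sides. The coefficient at n is read off from the first
  truncation that sees its degree; higher ones agree by
  \<open>product_series_limit_series\<close>.\<close>

definition limit_series :: "nat \<Rightarrow> (nat, rat fps) mfps" where
  "limit_series l = Abs_mfps (\<lambda>n. mcoeff (product_series (Suc (mdegree n)) l) n)"

lemma finite_psize_less: "finite {r \<in> partitions. psize r < N}"
proof -
  have "{r \<in> partitions. psize r < N} \<subseteq> parts ` {\<mu>. psz \<mu> \<le> N}"
  proof
    fix r assume "r \<in> {r \<in> partitions. psize r < N}"
    then have "r = parts (Abs_ptn r)" "psz (Abs_ptn r) \<le> N"
      by (auto simp: Abs_ptn_inverse psz_def)
    then show "r \<in> parts ` {\<mu>. psz \<mu> \<le> N}" by blast
  qed
  then show ?thesis by (rule finite_subset) (intro finite_imageI finite_psz_le)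
qed

text \<open>A tuple outside the box has some \<open>psize (R i) \<ge> N\<close>, so its monomial has
  degree at least N and is invisible to the congruence.\<close>

lemma sum_side_superset:
  assumes N: "N > 0" and l: "l \<ge> 2"
    and F: "finite F" "{1..l} \<rightarrow>\<^sub>E {r \<in> partitions. psize r < N} \<subseteq> F" "F \<subseteq> {1..l} \<rightarrow>\<^sub>E partitions"
  shows "eqmod N (sum (sum_side_term l) F) (product_series N l)"
proof -
  have "eqmod N (sum (sum_side_term l) F) (\<Sum>R\<in>{1..l} \<rightarrow>\<^sub>E {r \<in> partitions. psize r < N}. sum_side_term l R)"
  proof (rule eqmod_sum_sets)
    fix R assume R: "R \<in> F" "R \<notin> {1..l} \<rightarrow>\<^sub>E {r \<in> partitions. psize r < N}"
    then have "R \<in> {1..l} \<rightarrow>\<^sub>E partitions" using F by blast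
    then obtain i where i: "i \<in> {1..l}" "\<not> psize (R i) < N" using R(2) by (auto simp: PiE_iff)
    have "eqmod N (mvar i ^ psize (R i) :: (nat, rat fps) mfps) 0"
      using i by (intro eqmod_power_0) auto
    then have "eqmod N ((\<Prod>j\<in>{1..l} - {i}. mvar j ^ psize (R j)) * mvar i ^ psize (R i) :: (nat, rat fps) mfps) 0"
      by (rule eqmod_mult_0)
    then have "eqmod N (\<Prod>j=1..l. mvar j ^ psize (R j) :: (nat, rat fps) mfps) 0"
      using i by (subst prod.remove[of _ i]) (simp_all add: mult.commute)
    then show "eqmod N (sum_side_term l R) 0" unfolding sum_side_term_def by (rule eqmod_mult_0)
  qed (use F in \<open>auto intro: finite_subset\<close>)
  then show ?thesis using sum_side_eqmod[OF N l] by (rule eqmod_trans)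
qed

text \<open>Different truncations of the product are compared through the sum side: one finite set F
  of tuples is congruent to both, each to its own degree.\<close>

lemma product_series_limit_series:
  assumes l: "l \<ge> 2"
  shows "eqmod N (product_series N l) (limit_series l)"
  unfolding eqmod_def limit_series_def mcoeff_Abs_mfps
proof (intro allI impI)
  fix n :: "nat \<Rightarrow>\<^sub>0 nat" assume n: "mdegree n < N"
  define F where "F = {1..l} \<rightarrow>\<^sub>E {r \<in> partitions. psize r < N}"
  have F: "finite F" "F \<subseteq> {1..l} \<rightarrow>\<^sub>E partitions"
    unfolding F_def by (auto intro!: finite_PiE finite_psize_less PiE_mono)
  have "{1..l} \<rightarrow>\<^sub>E {r \<in> partitions. psize r < Suc (mdegree n)} \<subseteq> F"
    unfolding F_def using n by (intro PiE_mono) auto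
  then have "eqmod (Suc (mdegree n)) (sum (sum_side_term l) F) (product_series (Suc (mdegree n)) l)"
    by (intro sum_side_superset l F) simp_all
  moreover have "eqmod N (sum (sum_side_term l) F) (product_series N l)"
    using n F by (intro sum_side_superset l) (auto simp: F_def)
  ultimately show "mcoeff (product_series N l) n = mcoeff (product_series (Suc (mdegree n)) l) n"
    using n by (simp add: eqmod_def)
qed

lemma has_sum_sum_side:
  assumes l: "l \<ge> 2"
  shows "(sum_side_term l has_sum limit_series l) ({1..l} \<rightarrow>\<^sub>E partitions)"
  unfolding has_sum_def tendsto_mfps_iff
proof (intro allI tendsto_eventually)
  fix n :: "nat \<Rightarrow>\<^sub>0 nat"
  define N where "N = Suc (mdegree n)"
  define F where "F = {1..l} \<rightarrow>\<^sub>E {r \<in> partitions. psize r < N}"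
  have F: "finite F" "F \<subseteq> {1..l} \<rightarrow>\<^sub>E partitions"
    unfolding F_def by (auto intro!: finite_PiE finite_psize_less PiE_mono)
  have "mcoeff (sum (sum_side_term l) G) n = mcoeff (limit_series l) n"
    if "finite G" "F \<subseteq> G" "G \<subseteq> {1..l} \<rightarrow>\<^sub>E partitions" for G
  proof -
    have "eqmod N (sum (sum_side_term l) G) (product_series N l)"
      using that by (intro sum_side_superset l) (auto simp: F_def N_def)
    then have "eqmod N (sum (sum_side_term l) G) (limit_series l)"
      using product_series_limit_series[OF l] by (rule eqmod_trans)
    then show ?thesis by (simp add: eqmod_def N_def)
  qed
  then show "\<forall>\<^sub>F G in finite_subsets_at_top ({1..l} \<rightarrow>\<^sub>E partitions).
      mcoeff (sum (sum_side_term l) G) n = mcoeff (limit_series l) n"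
    unfolding eventually_finite_subsets_at_top using F by (intro exI[of _ F]) simp
qed


section \<open>The product side\<close>

lemma eqmod_prod:
  fixes f :: "'i \<Rightarrow> ('v, 'a::comm_ring_1) mfps"
  shows "(\<And>x. x \<in> A \<Longrightarrow> eqmod N (f x) (g x)) \<Longrightarrow> eqmod N (prod f A) (prod g A)"
  by (induction A rule: infinite_finite_induct) (auto intro: eqmod_mult)

abbreviation qX :: "nat \<Rightarrow> ('v, rat fps) mfps" where
  "qX m \<equiv> mconst (fps_X ^ m)"

lemma q_shift_step:
  fixes x z F G c p h r :: "'r::comm_ring_1"
  assumes "(1 - x * z) * F = G - c * p" "h = r * h + c"
  shows "(1 - x * z) * (F + h * p) = G + h * (r * p) - x * h * (z * p)"
proof -
  have "(r * h + c) * p = h * (r * p) + c * p" by (simp add: algebra_simps)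
  then have hp: "h * p = h * (r * p) + c * p" by (simp only: assms(2)[symmetric])
  have "(1 - x * z) * (F + h * p) = (1 - x * z) * F + h * p - x * h * (z * p)"
    by (simp add: algebra_simps)
  then show ?thesis unfolding assms(1) by (simp add: hp)
qed

text \<open>The truncated form of \<open>(1 - q z) H(z) = H(q z)\<close>. The error is a single term
  of degree n + 1 in z, negligible for the congruence at \<open>Suc n\<close>.\<close>

lemma hseries_q_shift:
  fixes z :: "('v, rat fps) mfps"
  shows "(1 - qX 1 * z) * hseries (Suc n) z = hseries (Suc n) (qX 1 * z) - mconst (fps_X * hcoeff_fps n) * z ^ Suc n"
proof (induction n)
  case 0
  show ?case by (simp add: hseries_def mconst_simps algebra_simps)
next
  case (Suc n)
  have e: "mconst (hcoeff_fps (Suc n)) = qX (Suc n) * mconst (hcoeff_fps (Suc n)) + mconst (fps_X * hcoeff_fps n)"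
    by (metis hcoeff_fps_Suc mconst_mult mconst_simps(3))
  have "(1 - qX 1 * z) * (hseries (Suc n) z + mconst (hcoeff_fps (Suc n)) * z ^ Suc n)
    = hseries (Suc n) (qX 1 * z) + mconst (hcoeff_fps (Suc n)) * (qX (Suc n) * z ^ Suc n)
      - qX 1 * mconst (hcoeff_fps (Suc n)) * (z * z ^ Suc n)"
    by (rule q_shift_step[OF Suc.IH e])
  moreover have "(qX 1 * z) ^ Suc n = qX (Suc n) * z ^ Suc n"
    by (simp only: power_mult_distrib mconst_power power_one_right)
  moreover have "mconst (fps_X * hcoeff_fps (Suc n)) = (qX 1 * mconst (hcoeff_fps (Suc n)) :: ('v, rat fps) mfps)"
    by (simp only: mconst_mult power_one_right)
  moreover have "hseries (Suc (Suc n)) u = hseries (Suc n) u + mconst (hcoeff_fps (Suc n)) * u ^ Suc n"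
    for u :: "('v, rat fps) mfps" by (simp add: hseries_def)
  ultimately show ?case by (simp only: power_Suc[of z "Suc n"])
qed

lemma hseries_geom_step:
  assumes z: "mcoeff z 0 = 0" and N: "N > 0"
  shows "eqmod N (geom (qX 1 * z) * hseries N (qX 1 * z)) (hseries N z)"
proof -
  obtain n where n: "N = Suc n" using N by (cases N) auto
  have z': "mcoeff (qX 1 * z) 0 = 0" using z by simp
  have "eqmod N (z ^ N) 0" using z by (rule eqmod_power_0) simp
  then have e: "eqmod N (mconst (fps_X * hcoeff_fps n) * z ^ N) 0" by (rule eqmod_mult_0)
  have "eqmod N (hseries N (qX 1 * z)) ((1 - qX 1 * z) * hseries N z)"
    unfolding n hseries_q_shift using e[unfolded n] by (simp add: eqmod_def)
  then have "eqmod N (geom (qX 1 * z) * hseries N (qX 1 * z)) (geom (qX 1 * z) * ((1 - qX 1 * z) * hseries N z))"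
    by (rule eqmod_mult_left)
  also have "\<dots> = (1 - qX 1 * z) * geom (qX 1 * z) * hseries N z" by (simp only: ac_simps)
  also have "\<dots> = hseries N z" unfolding geom_inverse[OF z'] by simp
  finally show ?thesis .
qed

text \<open>Splitting off the first M factors of \<open>H(z)\<close> leaves \<open>H(q^M z)\<close>,
  which is the tail of the product.\<close>

lemma hseries_geom:
  assumes z: "mcoeff z 0 = 0" and N: "N > 0"
  shows "eqmod N ((\<Prod>m<M. geom (qX (Suc m) * z)) * hseries N (qX M * z)) (hseries N z)"
proof (induction M)
  case 0
  show ?case by (simp add: mconst_simps)
next
  case (Suc M)
  have e: "qX (Suc M) * z = qX 1 * (qX M * z)"
    by (simp add: mconst_mult mult.assoc)
  have "eqmod N (geom (qX (Suc M) * z) * hseries N (qX (Suc M) * z)) (hseries N (qX M * z))"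
    unfolding e using N z by (intro hseries_geom_step) simp_all
  then have "eqmod N ((\<Prod>m<M. geom (qX (Suc m) * z)) * (geom (qX (Suc M) * z) * hseries N (qX (Suc M) * z)))
      ((\<Prod>m<M. geom (qX (Suc m) * z)) * hseries N (qX M * z))"
    by (rule eqmod_mult_left)
  also note Suc.IH
  finally show ?case by (simp add: mult.assoc)
qed

section \<open>The tail of the product in the q-adic topology\<close>

definition near_1 :: "nat \<Rightarrow> ('v, rat fps) mfps \<Rightarrow> bool" where
  "near_1 M f \<longleftrightarrow> (\<exists>g. f = 1 + qX M * g)"

lemma near_1_mult: "near_1 M f \<Longrightarrow> near_1 M g \<Longrightarrow> near_1 M (f * g)"
proof -
  assume "near_1 M f" "near_1 M g"
  then obtain u v where "f = 1 + qX M * u" "g = 1 + qX M * v" by (auto simp: near_1_def)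
  then have "f * g = 1 + qX M * (u + v + qX M * u * v)" by (simp add: algebra_simps)
  then show ?thesis unfolding near_1_def by blast
qed

lemma near_1_1: "near_1 M 1"
  unfolding near_1_def by (rule exI[of _ 0]) simp

lemma near_1_prod: "(\<And>x. x \<in> A \<Longrightarrow> near_1 M (f x)) \<Longrightarrow> near_1 M (prod f A)"
  by (induction A rule: infinite_finite_induct) (auto intro: near_1_mult near_1_1)

lemma near_1_hseries: "N > 0 \<Longrightarrow> near_1 M (hseries N (qX M * z))"
proof (induction N rule: nat_induct_non_zero)
  case 1
  show ?case by (simp add: hseries_def near_1_1 mconst_simps)
next
  case (Suc N)
  then obtain g where "hseries N (qX M * z) = 1 + qX M * g" by (auto simp: near_1_def)
  moreover have "(qX M * z) ^ N = qX M * (z * (qX M * z) ^ (N - 1))"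
    using Suc.hyps by (cases N) (simp_all add: mult.assoc)
  moreover have "hseries (Suc N) (qX M * z) = hseries N (qX M * z) + mconst (hcoeff_fps N) * (qX M * z) ^ N"
    by (simp add: hseries_def)
  ultimately have "hseries (Suc N) (qX M * z) = 1 + qX M * (g + mconst (hcoeff_fps N) * (z * (qX M * z) ^ (N - 1)))"
    by (simp add: algebra_simps)
  then show ?case unfolding near_1_def by blast
qed

text \<open>T collects the tails of all the series H. Two limits are thereby kept apart: N bounds
  the degree in the variables, M the accuracy in q.\<close>

lemma product_side_eqmod:
  assumes l: "l \<ge> 2" and N: "N > 0"
  shows "\<exists>T. near_1 M T \<and> eqmod N ((\<Prod>m<M. product_side_factor l (Suc m)) * T) (product_series N l)"
proof -
  define z1 z2 where "z1 = (\<lambda>i j. \<Prod>k=i..j. mvar k :: (nat, rat fps) mfps)"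
    and "z2 = (\<lambda>i j. (\<Prod>k=i..j-1. mvar k) * (\<Prod>k=j..l. (mvar k)\<^sup>2) :: (nat, rat fps) mfps)"
  define T where "T = (\<Prod>i=1..l. \<Prod>j=i..l. hseries N (qX M * z1 i j)) * (\<Prod>i=1..l. \<Prod>j=i+1..l. hseries N (qX M * z2 i j))"
  have prod_0: "mcoeff (prod f A) 0 = (\<Prod>x\<in>A. mcoeff (f x) 0)" for f :: "nat \<Rightarrow> (nat, rat fps) mfps" and A
    by (induction A rule: infinite_finite_induct) (simp_all add: mcoeff_mult_0 mcoeff_1)
  have z1: "mcoeff (z1 i j) 0 = 0" if "i \<le> j" for i j
    unfolding z1_def prod_0 using that by (intro prod_zero) auto
  have z2: "mcoeff (z2 i j) 0 = 0" if "j \<le> l" for i j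
  proof -
    have "(\<Prod>k=j..l. mcoeff ((mvar k :: (nat, rat fps) mfps)\<^sup>2) 0) = 0"
      using that by (intro prod_zero) (auto simp: power2_eq_square mcoeff_mult_0)
    then show ?thesis unfolding z2_def mcoeff_mult_0 prod_0 by simp
  qed
  have "near_1 M T"
    unfolding T_def by (intro near_1_mult near_1_prod near_1_hseries N)
  moreover have "(\<Prod>m<M. product_side_factor l (Suc m)) * T
    = (\<Prod>i=1..l. \<Prod>j=i..l. (\<Prod>m<M. geom (qX (Suc m) * z1 i j)) * hseries N (qX M * z1 i j))
      * (\<Prod>i=1..l. \<Prod>j=i+1..l. (\<Prod>m<M. geom (qX (Suc m) * z2 i j)) * hseries N (qX M * z2 i j))"
  proof -
    have swap: "(\<Prod>m<M. \<Prod>i=1..l. \<Prod>j\<in>J i. g m i j) = (\<Prod>i=1..l. \<Prod>j\<in>J i. \<Prod>m<M. g m i j)"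
      for g :: "nat \<Rightarrow> nat \<Rightarrow> nat \<Rightarrow> (nat, rat fps) mfps" and J :: "nat \<Rightarrow> nat set"
      by (subst prod.swap) (rule prod.cong[OF refl], rule prod.swap)
    have "product_side_factor l (Suc m) = (\<Prod>i=1..l. \<Prod>j=i..l. geom (qX (Suc m) * z1 i j))
      * (\<Prod>i=1..l. \<Prod>j=i+1..l. geom (qX (Suc m) * z2 i j))" for m
      unfolding product_side_factor_def z1_def z2_def mult.assoc ..
    then show ?thesis
      unfolding T_def by (simp only: prod.distrib swap ac_simps)
  qed
  moreover have "product_series N l = (\<Prod>i=1..l. \<Prod>j=i..l. hseries N (z1 i j)) * (\<Prod>i=1..l. \<Prod>j=i+1..l. hseries N (z2 i j))"
    unfolding product_series_def z1_def z2_def ..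
  moreover have "eqmod N
      ((\<Prod>i=1..l. \<Prod>j=i..l. (\<Prod>m<M. geom (qX (Suc m) * z1 i j)) * hseries N (qX M * z1 i j))
      * (\<Prod>i=1..l. \<Prod>j=i+1..l. (\<Prod>m<M. geom (qX (Suc m) * z2 i j)) * hseries N (qX M * z2 i j)))
      ((\<Prod>i=1..l. \<Prod>j=i..l. hseries N (z1 i j)) * (\<Prod>i=1..l. \<Prod>j=i+1..l. hseries N (z2 i j)))"
    by (intro eqmod_mult eqmod_prod hseries_geom N z1 z2) simp_all
  ultimately show ?thesis by metis
qed

lemma product_side_tendsto:
  assumes l: "l \<ge> 2"
  shows "(\<lambda>M. \<Prod>m<M. product_side_factor l (Suc m)) \<longlonglongrightarrow> limit_series l"
  unfolding tendsto_mfps_iff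
proof (intro allI tendsto_fpsI)
  fix n :: "nat \<Rightarrow>\<^sub>0 nat" and k :: nat
  have "fps_nth (mcoeff (\<Prod>m<M. product_side_factor l (Suc m)) n) k = fps_nth (mcoeff (limit_series l) n) k"
    if "k < M" for M
  proof -
    define P where "P = (\<Prod>m<M. product_side_factor l (Suc m))"
    define N where "N = Suc (mdegree n)"
    obtain T where T: "near_1 M T" "eqmod N (P * T) (product_series N l)"
      unfolding P_def using product_side_eqmod[OF l, of N M] by (auto simp: N_def)
    then obtain g where g: "T = 1 + qX M * g" by (auto simp: near_1_def)
    have "eqmod N (P * T) (limit_series l)" using T(2) product_series_limit_series[OF l] by (rule eqmod_trans)
    then have "mcoeff (limit_series l) n = mcoeff (P + qX M * (P * g)) n"
      unfolding g by (simp add: eqmod_def N_def algebra_simps)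
    \<comment> \<open>The tail changes the partial product by a multiple of \<open>q^M\<close>,
      which cannot affect the coefficient of \<open>q^k\<close> for k < M.\<close>
    then show ?thesis using that by (simp add: P_def[symmetric] fps_X_power_mult_nth)
  qed
  then show "\<forall>\<^sub>F M in sequentially. fps_nth (mcoeff (\<Prod>m<M. product_side_factor l (Suc m)) n) k
      = fps_nth (mcoeff (limit_series l) n) k"
    by (rule eventually_mono[OF eventually_gt_at_top[of k]])
qed

text \<open>\<open>has_prod\<close> demands a nonzero limit of the partial products; the constant
  term settles this.\<close>

lemma limit_series_nz: "limit_series l \<noteq> 0"
proof -
  have "hseries (Suc 0) z = 1" for z :: "(nat, rat fps) mfps" by (simp add: hseries_def mconst_simps)
  then have "mcoeff (limit_series l) 0 = 1"
    by (simp add: limit_series_def product_series_def mdegree_eq_0_iff[THEN iffD2] mcoeff_1)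
  then show ?thesis by auto
qed

theorem theorem1:
  fixes l :: nat
  assumes "l \<ge> 2"
  shows "sum_side_term l summable_on ({1..l} \<rightarrow>\<^sub>E partitions)
       \<and> (\<lambda>m. product_side_factor l (Suc m)) has_prod
           (\<Sum>\<^sub>\<infinity>R\<in>{1..l} \<rightarrow>\<^sub>E partitions. sum_side_term l R)"
proof
  note sum = has_sum_sum_side[OF assms]
  then show "sum_side_term l summable_on ({1..l} \<rightarrow>\<^sub>E partitions)"
    unfolding summable_on_def by blast
  \<comment> \<open>The shape of \<open>raw_has_prod\<close> with offset 0, whose partial products
    include the index M; hence the shift by one of the limit.\<close>
  have "(\<lambda>M. \<Prod>m\<le>M. product_side_factor l (Suc (m + 0))) \<longlonglongrightarrow> limit_series l"
    using LIMSEQ_Suc[OF product_side_tendsto[OF assms]] by (simp add: lessThan_Suc_atMost)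
  then show "(\<lambda>m. product_side_factor l (Suc m)) has_prod
      (\<Sum>\<^sub>\<infinity>R\<in>{1..l} \<rightarrow>\<^sub>E partitions. sum_side_term l R)"
    unfolding infsumI[OF sum] has_prod_def raw_has_prod_def using limit_series_nz by blast
qed


end
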